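(* Let $(\mathcal{M},g)$ be a four-dimensional Lorentzian spacetime on which the algebraic types of the curvature tensors are constant (in the sense of the context). Assume the spacetime is Einstein, i.e. $R_{\mu\nu}=\lambda g_{\mu\nu}$. If it is $\mathrm{VSI}^W_{2}$, then it is Kundt.
   Context: Spacetime: a 4-dimensional smooth manifold $\mathcal{M}$ with a Lorentzian metric $g$ of signature $(-,+,+,+)$. All statements are local. Standing assumption: one works on an open neighborhood on which the Riemann, Weyl (Petrov) and Ricci (Segre) types, and the algebraic types of the covariant derivatives of the Riemann tensor up to order $4$, do not change. $\mathrm{VSI}^W_2$: all scalar polynomial invariants constructed from the Weyl tensor $C$ and its covariant derivatives $\nabla C$, $\nabla^{(2)}C$ of order up to $2$ vanish. Kundt: the spacetime admits a null vector field $\ell$ that is geodesic, expansion-free, shear-free and twist-free, i.e. $\ell^{\beta}\ell_{\alpha;\beta}=0$, $\ell_{\alpha}{}^{;\alpha}=0$, $\ell^{(\alpha;\beta)}\ell_{\alpha;\beta}=0$, $\ell^{[\alpha;\beta]}\ell_{\alpha;\beta}=0$. *)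

theory Defs
  imports "HOL-Analysis.Analysis" "HOL-Combinatorics.Permutations"
begin

section \<open>Smooth functions on open subsets of coordinate space\<close>

definition partial :: "4 \<Rightarrow> (real^4 \<Rightarrow> real) \<Rightarrow> real^4 \<Rightarrow> real" where
  "partial a f x = frechet_derivative f (at x) (axis a 1)"

(* Only meaningful for open S, where it is the usual class C^k. *)
primrec Ck_on :: "nat \<Rightarrow> (real^4) set \<Rightarrow> (real^4 \<Rightarrow> real) \<Rightarrow> bool" where
  "Ck_on 0 S f \<longleftrightarrow> continuous_on S f"
| "Ck_on (Suc k) S f \<longleftrightarrow> f differentiable_on S \<and> (\<forall>a. Ck_on k S (partial a f))"

definition smooth_on :: "(real^4) set \<Rightarrow> (real^4 \<Rightarrow> real) \<Rightarrow> bool" where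
  "smooth_on S f \<longleftrightarrow> (\<forall>k. Ck_on k S f)"

section \<open>Four-dimensional Lorentzian manifolds\<close>

type_synonym 'm chart = "'m set \<times> ('m \<Rightarrow> real^4)"

definition is_chart :: "'m::topological_space chart \<Rightarrow> bool" where
  "is_chart c \<longleftrightarrow> open (fst c) \<and> open (snd c ` fst c) \<and>
     (\<exists>\<psi>. homeomorphism (fst c) (snd c ` fst c) (snd c) \<psi>)"

definition transition :: "'m chart \<Rightarrow> 'm chart \<Rightarrow> real^4 \<Rightarrow> real^4" where
  "transition c d x = snd d (inv_into (fst c) (snd c) x)"

definition smooth_atlas :: "'m::topological_space chart set \<Rightarrow> bool" where
  "smooth_atlas A \<longleftrightarrow> (\<forall>c\<in>A. is_chart c) \<and> (\<Union>c\<in>A. fst c) = UNIV \<and>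
     (\<forall>c\<in>A. \<forall>d\<in>A. \<forall>i. smooth_on (snd c ` (fst c \<inter> fst d)) (\<lambda>x. transition c d x $ i))"

definition lorentz_form :: "real^4^4 \<Rightarrow> bool" where
  "lorentz_form G \<longleftrightarrow> (\<exists>E::real^4^4. invertible E \<and>
     transpose E ** G ** E = (\<chi> i j. if i \<noteq> j then 0 else if i = 0 then - 1 else 1))"

(* A metric is given by its coordinate components g c in each chart c. *)
definition lorentzian_metric ::
  "'m::topological_space chart set \<Rightarrow> ('m chart \<Rightarrow> real^4 \<Rightarrow> real^4^4) \<Rightarrow> bool" where
  "lorentzian_metric A g \<longleftrightarrow>
     (\<forall>c\<in>A. (\<forall>i j. smooth_on (snd c ` fst c) (\<lambda>x. g c x $ i $ j)) \<and>
            (\<forall>x\<in>snd c ` fst c. lorentz_form (g c x))) \<and>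
     (\<forall>c\<in>A. \<forall>d\<in>A. \<forall>x\<in>snd c ` (fst c \<inter> fst d). \<forall>a b.
        g c x $ a $ b =
          (\<Sum>i\<in>UNIV. \<Sum>j\<in>UNIV.
             partial a (\<lambda>z. transition c d z $ i) x * partial b (\<lambda>z. transition c d z $ j) x *
             g d (transition c d x) $ i $ j))"

section \<open>Tensor calculus in a chart\<close>

(* A covariant tensor of rank r at a point is represented by its components, a function of
   index lists; only its values on lists of length r are meaningful.  Indices are of type 4,
   whose elements are 0, 1, 2, 3. *)

type_synonym tensor = "4 list \<Rightarrow> real"
type_synonym tensor_field = "real^4 \<Rightarrow> tensor"
type_synonym metric_field = "real^4 \<Rightarrow> real^4^4"

definition christoffel :: "metric_field \<Rightarrow> real^4 \<Rightarrow> 4 \<Rightarrow> 4 \<Rightarrow> 4 \<Rightarrow> real" where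
  "christoffel g x d a b = (\<Sum>e\<in>UNIV. matrix_inv (g x) $ d $ e *
     (partial a (\<lambda>y. g y $ e $ b) x + partial b (\<lambda>y. g y $ e $ a) x
        - partial e (\<lambda>y. g y $ a $ b) x)) / 2"

(* The differentiation index comes first: T_{I;c} = nabla g T x (c # I). *)
fun nabla :: "metric_field \<Rightarrow> tensor_field \<Rightarrow> tensor_field" where
  "nabla g T x [] = 0"
| "nabla g T x (c # I) = partial c (\<lambda>y. T y I) x
     - (\<Sum>k<length I. \<Sum>d\<in>UNIV. christoffel g x d c (I ! k) * T x (I[k := d]))"

(* R^a_{bcd} *)
definition riemann_up :: "metric_field \<Rightarrow> real^4 \<Rightarrow> 4 \<Rightarrow> 4 \<Rightarrow> 4 \<Rightarrow> 4 \<Rightarrow> real" where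
  "riemann_up g x a b c d =
     partial c (\<lambda>y. christoffel g y a d b) x - partial d (\<lambda>y. christoffel g y a c b) x
     + (\<Sum>e\<in>UNIV. christoffel g x a c e * christoffel g x e d b
                 - christoffel g x a d e * christoffel g x e c b)"

definition riemann :: "metric_field \<Rightarrow> tensor_field" where
  "riemann g x I = (\<Sum>e\<in>UNIV. g x $ (I!0) $ e * riemann_up g x e (I!1) (I!2) (I!3))"

definition ricci :: "metric_field \<Rightarrow> real^4 \<Rightarrow> real^4^4" where
  "ricci g x = (\<chi> b d. \<Sum>a\<in>UNIV. riemann_up g x a b a d)"

definition scalar_curvature :: "metric_field \<Rightarrow> real^4 \<Rightarrow> real" where
  "scalar_curvature g x = (\<Sum>a\<in>UNIV. \<Sum>b\<in>UNIV. matrix_inv (g x) $ a $ b * ricci g x $ a $ b)"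

definition weyl :: "metric_field \<Rightarrow> tensor_field" where
  "weyl g x I = (let a = I!0; b = I!1; c = I!2; d = I!3; G = g x; R = ricci g x in
     riemann g x I
     - (G$a$c * R$b$d - G$a$d * R$b$c - G$b$c * R$a$d + G$b$d * R$a$c) / 2
     + scalar_curvature g x / 6 * (G$a$c * G$b$d - G$a$d * G$b$c))"

section \<open>Scalar polynomial invariants\<close>

fun tensor_product :: "(nat \<times> tensor) list \<Rightarrow> tensor" where
  "tensor_product [] I = 1"
| "tensor_product ((r, T) # Ts) I = T (take r I) * tensor_product Ts (drop r I)"

(* H_{ab} H_{cd} H_{ef} ... for the index list [a, b, c, d, e, f, ...] of even length *)
fun pair_product :: "real^4^4 \<Rightarrow> tensor" where
  "pair_product H (a # b # I) = H $ a $ b * pair_product H I"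
| "pair_product H _ = 1"

(* The permutation \<pi> of the slots selects which pairs are contracted with the inverse metric. *)
definition complete_contraction :: "real^4^4 \<Rightarrow> (nat \<times> tensor) list \<Rightarrow> (nat \<Rightarrow> nat) \<Rightarrow> real" where
  "complete_contraction G Ts \<pi> =
     (\<Sum>I | length I = sum_list (map fst Ts).
        tensor_product Ts I * pair_product (matrix_inv G) (permute_list \<pi> I))"

(* Scalar polynomial invariants built from a rank r tensor field T and its covariant derivatives
   of order at most m: the real linear combinations of complete contractions of products of these
   tensors.  A product has at least one factor (ks \<noteq> []), so that nonzero constants are excluded. *)
inductive_set polynomial_invariants ::
    "metric_field \<Rightarrow> tensor_field \<Rightarrow> nat \<Rightarrow> nat \<Rightarrow> (real^4 \<Rightarrow> real) set"
  for g T r m where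
  contraction: "ks \<noteq> [] \<Longrightarrow> set ks \<subseteq> {..m} \<Longrightarrow> even (\<Sum>k\<leftarrow>ks. r + k) \<Longrightarrow>
     \<pi> permutes {..<(\<Sum>k\<leftarrow>ks. r + k)} \<Longrightarrow>
     (\<lambda>x. complete_contraction (g x) (map (\<lambda>k. (r + k, (nabla g ^^ k) T x)) ks) \<pi>)
       \<in> polynomial_invariants g T r m"
| add: "f \<in> polynomial_invariants g T r m \<Longrightarrow> h \<in> polynomial_invariants g T r m \<Longrightarrow>
     (\<lambda>x. f x + h x) \<in> polynomial_invariants g T r m"
| scale: "f \<in> polynomial_invariants g T r m \<Longrightarrow>
     (\<lambda>x. s * f x) \<in> polynomial_invariants g T r m"

definition VSI_W :: "nat \<Rightarrow> 'm chart set \<Rightarrow> ('m chart \<Rightarrow> metric_field) \<Rightarrow> bool" where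
  "VSI_W m A g \<longleftrightarrow> (\<forall>c\<in>A. \<forall>f\<in>polynomial_invariants (g c) (weyl (g c)) 4 m.
     \<forall>x\<in>snd c ` fst c. f x = 0)"

section \<open>Algebraic types\<close>

definition ip :: "real^4^4 \<Rightarrow> real^4 \<Rightarrow> real^4 \<Rightarrow> real" where
  "ip G u v = u \<bullet> (G *v v)"

definition null_vector :: "real^4^4 \<Rightarrow> real^4 \<Rightarrow> bool" where
  "null_vector G k \<longleftrightarrow> k \<noteq> 0 \<and> ip G k k = 0"

(* Null frame (l, n, m_2, m_3) = (e 0, e 1, e 2, e 3) *)
definition null_frame :: "real^4^4 \<Rightarrow> (4 \<Rightarrow> real^4) \<Rightarrow> bool" where
  "null_frame G e \<longleftrightarrow> (\<forall>a b. ip G (e a) (e b) =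
     (if {a, b} = {0, 1} \<or> a = b \<and> a \<in> {2, 3} then 1 else 0))"

definition frame_component :: "tensor \<Rightarrow> (4 \<Rightarrow> real^4) \<Rightarrow> 4 list \<Rightarrow> real" where
  "frame_component T e J =
     (\<Sum>I | length I = length J. T I * (\<Prod>k<length J. e (J ! k) $ (I ! k)))"

(* The exponent s in T_J \<mapsto> \<mu>^s T_J under the boost l \<mapsto> \<mu> l, n \<mapsto> n / \<mu> *)
definition boost_weight :: "4 list \<Rightarrow> int" where
  "boost_weight J = int (count_list J 0) - int (count_list J 1)"

(* Largest boost weight of a nonvanishing component in a null frame with l = k; it depends only
   on the null direction of k.  The boost order of the zero tensor is conventionally -r-1, which
   is below every boost weight. *)
definition boost_order :: "real^4^4 \<Rightarrow> nat \<Rightarrow> tensor \<Rightarrow> real^4 \<Rightarrow> int" where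
  "boost_order G r T k = Max (insert (- int r - 1)
     {boost_weight J | e J. null_frame G e \<and> e 0 = k \<and> length J = r \<and> frame_component T e J \<noteq> 0})"

definition primary_order :: "real^4^4 \<Rightarrow> nat \<Rightarrow> tensor \<Rightarrow> int" where
  "primary_order G r T = Min {boost_order G r T k | k. null_vector G k}"

(* For null vectors k and n, ip G k n \<noteq> 0 says that they span different directions. *)
definition secondary_order :: "real^4^4 \<Rightarrow> nat \<Rightarrow> tensor \<Rightarrow> int" where
  "secondary_order G r T = Min {boost_order G r T n | k n. null_vector G k \<and> null_vector G n \<and>
     ip G k n \<noteq> 0 \<and> boost_order G r T k = primary_order G r T}"

(* The (Milson-Coley-Pravda-Pravdova) alignment type *)
definition alignment_type :: "real^4^4 \<Rightarrow> nat \<Rightarrow> tensor \<Rightarrow> int \<times> int" where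
  "alignment_type G r T = (primary_order G r T, secondary_order G r T)"

datatype petrov = Petrov_I | Petrov_II | Petrov_D | Petrov_III | Petrov_N | Petrov_O

(* Classification by multiplicities of principal null directions: k spans a principal null
   direction of C \<noteq> 0 of multiplicity p > 0 iff its boost order is 2 - p (Bel-Debever criteria). *)
definition petrov_type :: "real^4^4 \<Rightarrow> tensor \<Rightarrow> petrov" where
  "petrov_type G C =
     (let order = boost_order G 4 C in
      if \<forall>I. length I = 4 \<longrightarrow> C I = 0 then Petrov_O
      else if \<exists>k. null_vector G k \<and> order k = - 2 then Petrov_N
      else if \<exists>k. null_vector G k \<and> order k = - 1 then Petrov_III
      else if \<exists>k n. null_vector G k \<and> null_vector G n \<and> ip G k n \<noteq> 0 \<and> order k = 0 \<and> order n = 0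
        then Petrov_D
      else if \<exists>k. null_vector G k \<and> order k = 0 then Petrov_II
      else Petrov_I)"

definition cmatrix :: "real^4^4 \<Rightarrow> complex^4^4" where
  "cmatrix M = (\<chi> i j. complex_of_real (M $ i $ j))"

(* Number of Jordan blocks of size k > 0 of M for the eigenvalue z *)
definition jordan_blocks :: "complex^4^4 \<Rightarrow> complex \<Rightarrow> nat \<Rightarrow> int" where
  "jordan_blocks M z k =
     (let rk = (\<lambda>j. int (rank ((((**) (M - mat z)) ^^ j) (mat 1))))
      in rk (k - 1) - 2 * rk k + rk (k + 1))"

(* The Segre type of the operator M = (R^a_b) records, for each distinct complex eigenvalue,
   whether it is real, the numbers of Jordan blocks of sizes 1, 2, 3, 4, and whether there is a
   timelike eigenvector (the entry before the comma in the Segre symbol). *)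
definition segre_type :: "real^4^4 \<Rightarrow> real^4^4 \<Rightarrow> (bool \<times> int list \<times> bool) multiset" where
  "segre_type G M = image_mset
     (\<lambda>z. (z \<in> \<real>, map (jordan_blocks (cmatrix M) z) [1, 2, 3, 4],
           \<exists>v r. z = complex_of_real r \<and> M *v v = r *s v \<and> ip G v v < 0))
     (mset_set {z. det (cmatrix M - mat z) = 0})"

definition constant_algebraic_types :: "'m chart set \<Rightarrow> ('m chart \<Rightarrow> metric_field) \<Rightarrow> bool" where
  "constant_algebraic_types A g \<longleftrightarrow>
     (\<forall>c\<in>A. \<forall>d\<in>A. \<forall>x\<in>snd c ` fst c. \<forall>y\<in>snd d ` fst d.
        petrov_type (g c x) (weyl (g c) x) = petrov_type (g d y) (weyl (g d) y) \<and>
        segre_type (g c x) (matrix_inv (g c x) ** ricci (g c) x) =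
          segre_type (g d y) (matrix_inv (g d y) ** ricci (g d) y) \<and>
        (\<forall>k\<le>4. alignment_type (g c x) (4 + k) ((nabla (g c) ^^ k) (riemann (g c)) x) =
                 alignment_type (g d y) (4 + k) ((nabla (g d) ^^ k) (riemann (g d)) y)))"

section \<open>Einstein and Kundt spacetimes\<close>

definition einstein :: "'m chart set \<Rightarrow> ('m chart \<Rightarrow> metric_field) \<Rightarrow> real \<Rightarrow> bool" where
  "einstein A g lam \<longleftrightarrow> (\<forall>c\<in>A. \<forall>x\<in>snd c ` fst c. \<forall>a b. ricci (g c) x $ a $ b = lam * g c x $ a $ b)"

(* l_{a;b} for the covector obtained from the vector field l by lowering its index *)
definition cov_low :: "metric_field \<Rightarrow> (real^4 \<Rightarrow> real^4) \<Rightarrow> real^4 \<Rightarrow> 4 \<Rightarrow> 4 \<Rightarrow> real" where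
  "cov_low g l x a b = nabla g (\<lambda>y I. (g y *v l y) $ (I ! 0)) x [b, a]"

(* l^{a;b} *)
definition cov_up :: "metric_field \<Rightarrow> (real^4 \<Rightarrow> real^4) \<Rightarrow> real^4 \<Rightarrow> 4 \<Rightarrow> 4 \<Rightarrow> real" where
  "cov_up g l x a b = (\<Sum>c\<in>UNIV. \<Sum>d\<in>UNIV.
     matrix_inv (g x) $ a $ c * matrix_inv (g x) $ b $ d * cov_low g l x c d)"

definition kundt_vector :: "metric_field \<Rightarrow> (real^4 \<Rightarrow> real^4) \<Rightarrow> real^4 \<Rightarrow> bool" where
  "kundt_vector g l x \<longleftrightarrow>
     null_vector (g x) (l x) \<and>
     (\<forall>a. (\<Sum>b\<in>UNIV. l x $ b * cov_low g l x a b) = 0) \<and>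
     (\<Sum>a\<in>UNIV. \<Sum>b\<in>UNIV. matrix_inv (g x) $ a $ b * cov_low g l x a b) = 0 \<and>
     (\<Sum>a\<in>UNIV. \<Sum>b\<in>UNIV. (cov_up g l x a b + cov_up g l x b a) / 2 * cov_low g l x a b) = 0 \<and>
     (\<Sum>a\<in>UNIV. \<Sum>b\<in>UNIV. (cov_up g l x a b - cov_up g l x b a) / 2 * cov_low g l x a b) = 0"

(* The condition is local: the null vector field is required near each point, in some chart. *)
definition kundt :: "'m chart set \<Rightarrow> ('m chart \<Rightarrow> metric_field) \<Rightarrow> bool" where
  "kundt A g \<longleftrightarrow> (\<forall>p. \<exists>c\<in>A. \<exists>V l. p \<in> fst c \<and> open V \<and> snd c p \<in> V \<and> V \<subseteq> snd c ` fst c \<and>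
     (\<forall>i. smooth_on V (\<lambda>x. l x $ i)) \<and> (\<forall>x\<in>V. kundt_vector (g c) l x))"

end

theory Submission
  imports Defs
begin

text \<open>
  Vanishing of the invariants of the Weyl tensor forces its Petrov type to be III, N or O.  For types III and N
  let \<open>l\<close> span the multiple null direction, which depends smoothly on the point.  Contracting a slot of the Weyl
  tensor \<open>C\<close> with \<open>l\<close> and differentiating expresses the leading components of \<open>\<nabla>C\<close> (and of \<open>\<nabla>\<nabla>C\<close>) by
  \<open>C\<close> and \<open>\<nabla>l\<close>; the Bianchi identity then shows that \<open>l\<close> is geodesic and shear-free, and the vanishing of a
  quartic invariant of \<open>\<nabla>C\<close> (type III) or \<open>\<nabla>\<nabla>C\<close> (type N) shows that expansion and twist vanish.  Normalising
  \<open>l\<close> by a component of \<open>C\<close> makes the geodesics affinely parametrised.  In type O the metric has constant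
  curvature, and \<open>l\<close> is constructed from solutions of an integrable linear system.
\<close>

section \<open>Smooth functions\<close>

text \<open>The invariants contain no volume form, so of the complex Weyl invariants only real parts
  are at hand; the imaginary parts of tr Q^2 and tr Q^3 are reached through Re tr Q^4 and Re tr Q^6.
  For the derivatives, the quadratic invariants vanish identically once the shear does: the
  transverse components are copies of one complex number, rotated by powers of i, and their squares
  cancel. The quartic invariant contracts the derivative indices crosswise between two products,
  which makes it a sum of squares. In type N the Bianchi identity already gives
  \<open>\<nabla>C\<close> a negative total boost order, so that all first-order invariants vanish
  automatically; hence the second derivative there. Null frames are chosen pointwise and may be
  discontinuous. Therefore only objects built from \<open>C\<close>, \<open>g\<close>, the field
  \<open>l\<close> and vectors with constant coordinates are ever differentiated; frames serve to
  evaluate at a point. In type O the curvature singles out no null direction, and one has to be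
  produced by solving differential equations.\<close>

lemma partial_eqI: "(f has_derivative D) (at x) \<Longrightarrow> partial a f x = D (axis a 1)"
  unfolding partial_def by (metis frechet_derivative_at)

lemma differentiable_partial:
  "f differentiable at x \<Longrightarrow> (f has_derivative (\<lambda>h. \<Sum>a\<in>UNIV. h $ a * partial a f x)) (at x)"
proof -
  assume "f differentiable at x"
  then have d: "(f has_derivative frechet_derivative f (at x)) (at x)"
    by (simp add: frechet_derivative_works)
  then interpret bounded_linear "frechet_derivative f (at x)" by (rule has_derivative_bounded_linear)
  have "frechet_derivative f (at x) h = (\<Sum>a\<in>UNIV. h $ a * partial a f x)" for h
  proof -
    have "frechet_derivative f (at x) h = frechet_derivative f (at x) (\<Sum>a\<in>UNIV. h $ a *\<^sub>R axis a 1)"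
      by (simp add: basis_expansion scalar_mult_eq_scaleR[symmetric])
    also have "\<dots> = (\<Sum>a\<in>UNIV. h $ a * partial a f x)"
      by (simp add: sum scaleR partial_def)
    finally show ?thesis .
  qed
  then have "frechet_derivative f (at x) = (\<lambda>h. \<Sum>a\<in>UNIV. h $ a * partial a f x)" by (rule ext)
  from d[unfolded this] show ?thesis .
qed

lemma partial_cong:
  assumes "open S" "x \<in> S" "\<And>y. y \<in> S \<Longrightarrow> f y = h y"
  shows "partial a f x = partial a h x"
proof -
  have "(f has_derivative D) (at x) \<longleftrightarrow> (h has_derivative D) (at x)" for D
    using has_derivative_transform_within_open[of f D x UNIV S h]
      has_derivative_transform_within_open[of h D x UNIV S f] assms by auto
  then show ?thesis unfolding partial_def frechet_derivative_def by simp
qed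

lemma Ck_on_cong:
  assumes "open S" "\<And>y. y \<in> S \<Longrightarrow> f y = h y"
  shows "Ck_on k S f \<longleftrightarrow> Ck_on k S h"
  using assms
proof (induction k arbitrary: f h)
  case 0 then show ?case by (auto intro: continuous_on_cong)
next
  case (Suc k)
  have "f differentiable_on S \<longleftrightarrow> h differentiable_on S"
    using Suc.prems differentiable_transform_within[of f _ S 1 h] differentiable_transform_within[of h _ S 1 f]
    unfolding differentiable_on_def by auto
  moreover have "Ck_on k S (partial a f) \<longleftrightarrow> Ck_on k S (partial a h)" for a
    using Suc.prems by (intro Suc.IH) (auto intro: partial_cong)
  ultimately show ?case by simp
qed

lemma Ck_on_subset:
  assumes "open U" "U \<subseteq> S" shows "Ck_on k S f \<Longrightarrow> Ck_on k U f"
  using assms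
  by (induction k arbitrary: f) (auto intro: continuous_on_subset differentiable_on_subset)

lemma Ck_on_Suc_imp: "Ck_on (Suc k) S f \<Longrightarrow> Ck_on k S f"
proof (induction k arbitrary: f)
  case 0 then show ?case by (auto intro: differentiable_imp_continuous_on)
next
  case (Suc k)
  have "f differentiable_on S" "\<And>a. Ck_on (Suc k) S (partial a f)" using Suc.prems by auto
  then show ?case using Suc.IH by auto
qed

lemma Ck_on_const: "Ck_on k S (\<lambda>x. c)"
proof (induction k arbitrary: c)
  case (Suc k)
  have "partial a (\<lambda>x. c) = (\<lambda>x. 0)" for a
    by (rule ext, subst partial_eqI[OF has_derivative_const]) auto
  then show ?case using Suc by simp
qed auto

lemma partial_const [simp]: "partial a (\<lambda>x. c) x = 0"
  by (subst partial_eqI[OF has_derivative_const]) auto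

lemma partial_nth: "partial a (\<lambda>x. x $ i) x = (if i = a then 1 else 0)"
proof -
  have "((\<lambda>x::real^4. x $ i) has_derivative (\<lambda>x. x $ i)) (at x)"
    by (intro bounded_linear_imp_has_derivative bounded_linear_vec_nth)
  from partial_eqI[OF this, of a] show ?thesis by (simp add: axis_def)
qed

lemma partial_add:
  assumes "f differentiable at x" "h differentiable at x"
  shows "partial a (\<lambda>x. f x + h x) x = partial a f x + partial a h x"
  using partial_eqI[OF has_derivative_add[OF assms[THEN frechet_derivative_works[THEN iffD1]]]]
  by (simp add: partial_def)

lemma partial_mult:
  assumes "f differentiable at x" "h differentiable at x"
  shows "partial a (\<lambda>x. f x * h x) x = partial a f x * h x + f x * partial a h x"
  using partial_eqI[OF has_derivative_mult[OF assms[THEN frechet_derivative_works[THEN iffD1]]]]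
  by (simp add: partial_def)

lemma partial_cmult:
  assumes "f differentiable at x"
  shows "partial a (\<lambda>x. c * f x) x = c * partial a f x"
  using partial_mult[OF differentiable_const assms, of a c] by simp

lemma partial_minus:
  assumes "f differentiable at x"
  shows "partial a (\<lambda>x. - f x) x = - partial a f x"
  using partial_cmult[OF assms, of a "-1"] by simp

lemma partial_diff:
  assumes "f differentiable at x" "h differentiable at x"
  shows "partial a (\<lambda>x. f x - h x) x = partial a f x - partial a h x"
  using partial_add[OF assms(1) differentiable_minus[OF assms(2)]] partial_minus[OF assms(2)] by simp

lemma partial_sum:
  assumes "\<And>i. i \<in> I \<Longrightarrow> f i differentiable at x"
  shows "partial a (\<lambda>x. \<Sum>i\<in>I. f i x) x = (\<Sum>i\<in>I. partial a (f i) x)"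
proof (cases "finite I")
  case True
  then show ?thesis using assms
    by (induction I) (auto simp: partial_add differentiable_sum)
qed simp

lemma partial_inverse:
  assumes "f differentiable at x" "f x \<noteq> 0"
  shows "partial a (\<lambda>x. inverse (f x)) x = - (partial a f x * (inverse (f x) * inverse (f x)))"
  using partial_eqI[OF Deriv.has_derivative_inverse[OF assms(2) assms(1)[THEN frechet_derivative_works[THEN iffD1]]]]
  by (simp add: partial_def mult_ac)

lemma partial_sqrt:
  assumes "f differentiable at x" "f x > 0"
  shows "partial a (\<lambda>x. sqrt (f x)) x = partial a f x * inverse (2 * sqrt (f x))"
  using partial_eqI[OF has_derivative_real_sqrt[OF assms(2) assms(1)[THEN frechet_derivative_works[THEN iffD1]]]]
  by (simp add: partial_def field_simps)

lemma Ck_on_nth: "Ck_on k S (\<lambda>x. x $ i)"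
proof (cases k)
  case (Suc m)
  have "partial a (\<lambda>x. x $ i) = (\<lambda>x. if i = a then 1 else 0)" for a
    by (rule ext) (rule partial_nth)
  then have "\<forall>a. Ck_on m S (partial a (\<lambda>x. x $ i))" by (simp add: Ck_on_const)
  then show ?thesis using Suc
    by (auto intro: bounded_linear_imp_differentiable_on bounded_linear_vec_nth)
qed (auto intro: continuous_intros)

lemma diff_at: "open S \<Longrightarrow> f differentiable_on S \<Longrightarrow> x \<in> S \<Longrightarrow> f differentiable at x"
  using differentiable_on_eq_differentiable_at by blast

lemma Ck_on_add:
  assumes "open S" shows "Ck_on k S f \<Longrightarrow> Ck_on k S h \<Longrightarrow> Ck_on k S (\<lambda>x. f x + h x)"
proof (induction k arbitrary: f h)
  case (Suc k)
  have "Ck_on k S (partial a (\<lambda>x. f x + h x))" for a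
  proof -
    have "Ck_on k S (partial a (\<lambda>x. f x + h x)) = Ck_on k S (\<lambda>x. partial a f x + partial a h x)"
      using Suc.prems by (intro Ck_on_cong assms partial_add) (auto intro: diff_at assms)
    then show ?thesis using Suc by auto
  qed
  then show ?case using Suc.prems by (auto intro: differentiable_on_add)
qed (auto intro: continuous_intros)

lemma Ck_on_mult:
  assumes "open S" shows "Ck_on k S f \<Longrightarrow> Ck_on k S h \<Longrightarrow> Ck_on k S (\<lambda>x. f x * h x)"
proof (induction k arbitrary: f h)
  case (Suc k)
  have "Ck_on k S (partial a (\<lambda>x. f x * h x))" for a
  proof -
    have "Ck_on k S (partial a (\<lambda>x. f x * h x)) = Ck_on k S (\<lambda>x. partial a f x * h x + f x * partial a h x)"
      using Suc.prems by (intro Ck_on_cong assms partial_mult) (auto intro: diff_at assms)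
    moreover have "Ck_on k S f" "Ck_on k S h" using Suc.prems Ck_on_Suc_imp by blast+
    ultimately show ?thesis using Suc.IH Suc.prems by (simp add: Ck_on_add[OF assms])
  qed
  then show ?case using Suc.prems by (auto intro: differentiable_on_mult)
qed (auto intro: continuous_intros)

lemma Ck_on_inverse:
  assumes "open S" "\<And>x. x \<in> S \<Longrightarrow> f x \<noteq> 0"
  shows "Ck_on k S f \<Longrightarrow> Ck_on k S (\<lambda>x. inverse (f x))"
proof (induction k)
  case 0 then show ?case using assms by (auto intro!: continuous_intros)
next
  case (Suc k)
  have inv: "Ck_on k S (\<lambda>x. inverse (f x))" using Suc Ck_on_Suc_imp by blast
  have "Ck_on k S (partial a (\<lambda>x. inverse (f x)))" for a
  proof -
    have "Ck_on k S (partial a (\<lambda>x. inverse (f x))) =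
        Ck_on k S (\<lambda>x. - 1 * (partial a f x * (inverse (f x) * inverse (f x))))"
      using Suc.prems assms
      by (intro Ck_on_cong assms(1)) (simp add: partial_inverse[OF diff_at[OF assms(1)]])
    moreover have "Ck_on k S (\<lambda>x. - 1 * (partial a f x * (inverse (f x) * inverse (f x))))"
      using Suc.prems by (intro Ck_on_mult Ck_on_const inv assms(1)) auto
    ultimately show ?thesis by simp
  qed
  then show ?case using Suc.prems assms by (auto intro!: differentiable_on_inverse)
qed

lemma Ck_on_sqrt:
  assumes "open S" "\<And>x. x \<in> S \<Longrightarrow> f x > 0"
  shows "Ck_on k S f \<Longrightarrow> Ck_on k S (\<lambda>x. sqrt (f x))"
proof (induction k)
  case 0 then show ?case by (auto intro!: continuous_intros)
next
  case (Suc k)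
  have sq: "Ck_on k S (\<lambda>x. sqrt (f x))" using Suc Ck_on_Suc_imp by blast
  have d: "f differentiable at x" if "x \<in> S" for x using Suc.prems that assms(1) diff_at by auto
  have "Ck_on k S (partial a (\<lambda>x. sqrt (f x)))" for a
  proof -
    have "Ck_on k S (partial a (\<lambda>x. sqrt (f x))) =
        Ck_on k S (\<lambda>x. partial a f x * inverse (2 * sqrt (f x)))"
      using Suc.prems by (intro Ck_on_cong assms) (auto simp: partial_sqrt assms d)
    moreover have "Ck_on k S (\<lambda>x. partial a f x * inverse (2 * sqrt (f x)))"
      using Suc.prems by (intro Ck_on_mult Ck_on_inverse Ck_on_const sq assms(1)) (use assms(2) in force)+
    ultimately show ?thesis by simp
  qed
  moreover have "(\<lambda>x. sqrt (f x)) differentiable_on S"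
    unfolding differentiable_on_def
    using has_derivative_real_sqrt[OF assms(2) d[THEN frechet_derivative_works[THEN iffD1]]]
    by (meson differentiable_at_withinI differentiable_def)
  ultimately show ?case by simp
qed

lemma smooth_on_D: "smooth_on S f \<Longrightarrow> open S \<Longrightarrow> x \<in> S \<Longrightarrow> f differentiable at x"
  unfolding smooth_on_def by (metis Ck_on.simps(2) diff_at)

lemma smooth_on_continuous: "smooth_on S f \<Longrightarrow> continuous_on S f"
  unfolding smooth_on_def by (metis Ck_on.simps(1))

lemma smooth_on_partial: "smooth_on S f \<Longrightarrow> smooth_on S (partial a f)"
  unfolding smooth_on_def by (metis Ck_on.simps(2))

lemma smooth_on_cong: "open S \<Longrightarrow> (\<And>y. y \<in> S \<Longrightarrow> f y = h y) \<Longrightarrow> smooth_on S h \<Longrightarrow> smooth_on S f"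
  unfolding smooth_on_def using Ck_on_cong by blast

lemma smooth_on_subset: "smooth_on S f \<Longrightarrow> open U \<Longrightarrow> U \<subseteq> S \<Longrightarrow> smooth_on U f"
  unfolding smooth_on_def using Ck_on_subset by blast

lemma smooth_on_const: "smooth_on S (\<lambda>x. c)" unfolding smooth_on_def by (simp add: Ck_on_const)
lemma smooth_on_nth: "smooth_on S (\<lambda>x. x $ i)" unfolding smooth_on_def by (simp add: Ck_on_nth)
lemma smooth_on_add: "open S \<Longrightarrow> smooth_on S f \<Longrightarrow> smooth_on S h \<Longrightarrow> smooth_on S (\<lambda>x. f x + h x)"
  unfolding smooth_on_def by (simp add: Ck_on_add)
lemma smooth_on_mult: "open S \<Longrightarrow> smooth_on S f \<Longrightarrow> smooth_on S h \<Longrightarrow> smooth_on S (\<lambda>x. f x * h x)"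
  unfolding smooth_on_def by (simp add: Ck_on_mult)
lemma smooth_on_minus: "open S \<Longrightarrow> smooth_on S f \<Longrightarrow> smooth_on S (\<lambda>x. - f x)"
  using smooth_on_mult[OF _ smooth_on_const, of S f "-1"] by simp
lemma smooth_on_diff: "open S \<Longrightarrow> smooth_on S f \<Longrightarrow> smooth_on S h \<Longrightarrow> smooth_on S (\<lambda>x. f x - h x)"
  using smooth_on_add[OF _ _ smooth_on_minus, of S f h] by simp
lemma smooth_on_inverse:
  "open S \<Longrightarrow> (\<And>x. x \<in> S \<Longrightarrow> f x \<noteq> 0) \<Longrightarrow> smooth_on S f \<Longrightarrow> smooth_on S (\<lambda>x. inverse (f x))"
  unfolding smooth_on_def by (simp add: Ck_on_inverse)
lemma smooth_on_divide:
  "open S \<Longrightarrow> smooth_on S f \<Longrightarrow> smooth_on S h \<Longrightarrow> (\<And>x. x \<in> S \<Longrightarrow> h x \<noteq> 0) \<Longrightarrow> smooth_on S (\<lambda>x. f x / h x)"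
  unfolding divide_inverse by (simp add: smooth_on_mult smooth_on_inverse)
lemma smooth_on_sqrt:
  "open S \<Longrightarrow> (\<And>x. x \<in> S \<Longrightarrow> f x > 0) \<Longrightarrow> smooth_on S f \<Longrightarrow> smooth_on S (\<lambda>x. sqrt (f x))"
  unfolding smooth_on_def by (simp add: Ck_on_sqrt)
lemma smooth_on_sum:
  "open S \<Longrightarrow> (\<And>i. i \<in> I \<Longrightarrow> smooth_on S (f i)) \<Longrightarrow> smooth_on S (\<lambda>x. \<Sum>i\<in>I. f i x)"
  by (induction I rule: infinite_finite_induct) (auto intro: smooth_on_const smooth_on_add)
lemma smooth_on_prod:
  "open S \<Longrightarrow> (\<And>i. i \<in> I \<Longrightarrow> smooth_on S (f i)) \<Longrightarrow> smooth_on S (\<lambda>x. \<Prod>i\<in>I. f i x)"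
  by (induction I rule: infinite_finite_induct) (auto intro: smooth_on_const smooth_on_mult)
lemma smooth_on_power: "open S \<Longrightarrow> smooth_on S f \<Longrightarrow> smooth_on S (\<lambda>x. f x ^ n)"
  by (induction n) (auto intro: smooth_on_const smooth_on_mult)
lemma smooth_on_if: "(P \<Longrightarrow> smooth_on S f) \<Longrightarrow> (\<not> P \<Longrightarrow> smooth_on S h) \<Longrightarrow> smooth_on S (\<lambda>x. if P then f x else h x)"
  by (cases P) auto

lemmas smooth_intros = smooth_on_const smooth_on_nth smooth_on_add smooth_on_mult smooth_on_minus
  smooth_on_diff smooth_on_inverse smooth_on_divide smooth_on_sqrt smooth_on_sum smooth_on_prod
  smooth_on_power smooth_on_partial smooth_on_if

lemma smooth_on_det:
  assumes "open S" "\<And>i j. smooth_on S (\<lambda>x. M x $ i $ j)"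
  shows "smooth_on S (\<lambda>x. det (M x :: real^4^4))"
  unfolding det_def by (intro smooth_intros assms)

lemma matrix_inv_mult:
  assumes "invertible (A :: real^'n^'n)"
  shows "A ** matrix_inv A = mat 1" "matrix_inv A ** A = mat 1"
  using someI_ex[OF assms[unfolded invertible_def]] unfolding matrix_inv_def by auto

text \<open>Cramer's rule writes the entries as quotients of determinants, which are polynomials in
  smooth functions.\<close>

lemma smooth_on_matrix_inv:
  fixes M :: "real^4 \<Rightarrow> real^4^4"
  assumes S: "open S" and M: "\<And>i j. smooth_on S (\<lambda>x. M x $ i $ j)"
    and inv: "\<And>x. x \<in> S \<Longrightarrow> invertible (M x)"
  shows "smooth_on S (\<lambda>x. matrix_inv (M x) $ i $ j)"
proof -
  have eq: "matrix_inv (M x) $ i $ j = det (\<chi> r c. if c = i then (if r = j then 1 else 0) else M x $ r $ c) / det (M x)"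
    if "x \<in> S" for x
  proof -
    have "M x *v (matrix_inv (M x) *v axis j 1) = axis j 1"
      using inv[OF that] by (simp add: matrix_vector_mul_assoc matrix_inv_mult)
    then have "matrix_inv (M x) *v axis j 1 =
        (\<chi> k. det (\<chi> r c. if c = k then axis j 1 $ r else M x $ r $ c) / det (M x))"
      using cramer[of "M x"] inv[OF that] invertible_det_nz by blast
    then have "(matrix_inv (M x) *v axis j 1) $ i = 
        det (\<chi> r c. if c = i then axis j 1 $ r else M x $ r $ c) / det (M x)" by simp
    then show ?thesis
      by (simp add: matrix_vector_mul_component axis_def inner_vec_def if_distrib cong: if_cong)
  qed
  show ?thesis
    apply (rule smooth_on_cong[OF S eq], assumption)
    apply (intro smooth_on_divide smooth_on_det S M)
    subgoal for r c unfolding vec_lambda_beta by (intro smooth_intros M S)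
    subgoal using inv invertible_det_nz by blast
    done
qed

section \<open>Symmetry of second partial derivatives\<close>

lemma partial_line:
  assumes "f differentiable at (x + t *\<^sub>R axis a 1)"
  shows "((\<lambda>t. f (x + t *\<^sub>R axis a 1)) has_real_derivative partial a f (x + t *\<^sub>R axis a 1)) (at t)"
proof -
  have "((\<lambda>t. f (x + t *\<^sub>R axis a 1)) has_derivative
     (\<lambda>s. frechet_derivative f (at (x + t *\<^sub>R axis a 1)) (s *\<^sub>R axis a 1))) (at t)"
    using assms
    by (intro has_derivative_compose[where f="\<lambda>t. x + t *\<^sub>R axis a 1" and g=f])
      (auto intro!: derivative_eq_intros simp: frechet_derivative_works[symmetric])
  moreover have "frechet_derivative f (at (x + t *\<^sub>R axis a 1)) (s *\<^sub>R axis a 1) = partial a f (x + t *\<^sub>R axis a 1) * s" for s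
    using linear_frechet_derivative[OF assms] by (simp add: linear_cmul partial_def)
  ultimately show ?thesis by (simp add: has_field_derivative_def)
qed

text \<open>The one-variable mean value theorem is applied twice: in direction \<open>a\<close> to
  the increment over the step \<open>k\<close>, then in direction \<open>b\<close> to the resulting
  derivative.\<close>

lemma partial_mean_value2:
  assumes "0 < h" "0 < k"
    and box: "\<And>s t. s \<in> {0..h} \<Longrightarrow> t \<in> {0..k} \<Longrightarrow> x + s *\<^sub>R axis a 1 + t *\<^sub>R axis b 1 \<in> S"
    and S: "open S" "smooth_on S f"
  obtains s t where "s \<in> {0..h}" "t \<in> {0..k}"
    "f (x + h *\<^sub>R axis a 1 + k *\<^sub>R axis b 1) - f (x + h *\<^sub>R axis a 1) - f (x + k *\<^sub>R axis b 1) + f x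
     = h * k * partial b (partial a f) (x + s *\<^sub>R axis a 1 + t *\<^sub>R axis b 1)"
proof -
  let ?F = "\<lambda>s. f ((x + k *\<^sub>R axis b 1) + s *\<^sub>R axis a 1) - f (x + s *\<^sub>R axis a 1)"
  let ?F' = "\<lambda>s. partial a f ((x + k *\<^sub>R axis b 1) + s *\<^sub>R axis a 1) - partial a f (x + s *\<^sub>R axis a 1)"
  have inS: "(x + k *\<^sub>R axis b 1) + s *\<^sub>R axis a 1 \<in> S" "x + s *\<^sub>R axis a 1 \<in> S" if "s \<in> {0..h}" for s
    using box[OF that, of k] box[OF that, of 0] \<open>0 < k\<close> by (auto simp: algebra_simps)
  have "\<And>s. 0 \<le> s \<Longrightarrow> s \<le> h \<Longrightarrow> DERIV ?F s :> ?F' s"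
    by (intro DERIV_diff partial_line smooth_on_D[OF S(2,1)] inS) auto
  from MVT2[OF \<open>0 < h\<close> this] obtain s where s: "0 < s" "s < h" "?F h - ?F 0 = (h - 0) * ?F' s" by blast
  have "\<And>t. 0 \<le> t \<Longrightarrow> t \<le> k \<Longrightarrow> DERIV (\<lambda>t. partial a f ((x + s *\<^sub>R axis a 1) + t *\<^sub>R axis b 1)) t :>
     partial b (partial a f) ((x + s *\<^sub>R axis a 1) + t *\<^sub>R axis b 1)"
    using s by (intro partial_line smooth_on_D[OF smooth_on_partial[OF S(2)] S(1)] box) auto
  from MVT2[OF \<open>0 < k\<close> this] obtain t where t: "0 < t" "t < k"
    "partial a f (x + s *\<^sub>R axis a 1 + k *\<^sub>R axis b 1) - partial a f (x + s *\<^sub>R axis a 1 + 0 *\<^sub>R axis b 1)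
     = (k - 0) * partial b (partial a f) (x + s *\<^sub>R axis a 1 + t *\<^sub>R axis b 1)" by blast
  have "?F' s = k * partial b (partial a f) (x + s *\<^sub>R axis a 1 + t *\<^sub>R axis b 1)"
    using t(3) by (simp add: algebra_simps)
  with s(3) have "?F h - ?F 0 = h * k * partial b (partial a f) (x + s *\<^sub>R axis a 1 + t *\<^sub>R axis b 1)"
    by simp
  then show ?thesis using s t by (intro that[of s t]) (auto simp: algebra_simps)
qed

text \<open>The second difference over a small square does not depend on the order of the
  directions. By \<open>partial_mean_value2\<close> it is h^2 times either mixed derivative at some
  point of the square, and continuity makes these two values close to the ones at
  \<open>x\<close>.\<close>

lemma partial_commute:
  assumes S: "open S" "smooth_on S f" and x: "x \<in> S"
  shows "partial a (partial b f) x = partial b (partial a f) x"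
proof (rule ccontr)
  assume ne: "\<not> ?thesis"
  define e where "e = \<bar>partial a (partial b f) x - partial b (partial a f) x\<bar> / 2"
  have e: "e > 0" using ne by (simp add: e_def)
  have cont: "isCont (partial i (partial j f)) x" for i j
    using S x by (intro continuous_on_interior[of S])
      (auto intro: smooth_on_continuous smooth_on_partial simp: interior_open)
  obtain d1 where d1: "d1 > 0" "\<And>y. dist y x < d1 \<Longrightarrow> dist (partial a (partial b f) y) (partial a (partial b f) x) < e"
    using cont[of a b] e unfolding continuous_at_eps_delta by (metis dist_commute)
  obtain d2 where d2: "d2 > 0" "\<And>y. dist y x < d2 \<Longrightarrow> dist (partial b (partial a f) y) (partial b (partial a f) x) < e"
    using cont[of b a] e unfolding continuous_at_eps_delta by (metis dist_commute)
  obtain d3 where d3: "d3 > 0" "ball x d3 \<subseteq> S" using S x openE by blast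
  define h where "h = min d1 (min d2 d3) / 3"
  have h: "h > 0" "2 * h < d1" "2 * h < d2" "2 * h < d3" using d1 d2 d3 by (auto simp: h_def)
  have near: "dist (x + s *\<^sub>R axis i 1 + t *\<^sub>R axis j 1) x \<le> 2 * h" if "s \<in> {0..h}" "t \<in> {0..h}" for s t i j
  proof -
    have "norm (s *\<^sub>R axis i (1::real) + t *\<^sub>R axis j 1 :: real^4) \<le> \<bar>s\<bar> + \<bar>t\<bar>"
      by (rule order_trans[OF norm_triangle_ineq]) (simp add: norm_axis_1)
    then show ?thesis using that by (simp add: dist_norm add.assoc)
  qed
  have inS: "x + s *\<^sub>R axis i 1 + t *\<^sub>R axis j 1 \<in> S" if "s \<in> {0..h}" "t \<in> {0..h}" for s t i j
    using near[OF that, of i j] d3 h by (auto simp: dist_commute subset_eq)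
  obtain s t where st: "s \<in> {0..h}" "t \<in> {0..h}"
    "f (x + h *\<^sub>R axis a 1 + h *\<^sub>R axis b 1) - f (x + h *\<^sub>R axis a 1) - f (x + h *\<^sub>R axis b 1) + f x
     = h * h * partial b (partial a f) (x + s *\<^sub>R axis a 1 + t *\<^sub>R axis b 1)"
    using partial_mean_value2[OF h(1) h(1) inS S] by metis
  obtain s' t' where st': "s' \<in> {0..h}" "t' \<in> {0..h}"
    "f (x + h *\<^sub>R axis b 1 + h *\<^sub>R axis a 1) - f (x + h *\<^sub>R axis b 1) - f (x + h *\<^sub>R axis a 1) + f x
     = h * h * partial a (partial b f) (x + s' *\<^sub>R axis b 1 + t' *\<^sub>R axis a 1)"
    using partial_mean_value2[OF h(1) h(1) inS S] by metis
  have "x + h *\<^sub>R axis b 1 + h *\<^sub>R axis a 1 = x + h *\<^sub>R axis a 1 + h *\<^sub>R axis b 1" by simp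
  then have "h * h * partial b (partial a f) (x + s *\<^sub>R axis a 1 + t *\<^sub>R axis b 1)
      = h * h * partial a (partial b f) (x + s' *\<^sub>R axis b 1 + t' *\<^sub>R axis a 1)"
    using st(3) st'(3) by (simp only:)
  then have "partial b (partial a f) (x + s *\<^sub>R axis a 1 + t *\<^sub>R axis b 1)
      = partial a (partial b f) (x + s' *\<^sub>R axis b 1 + t' *\<^sub>R axis a 1)" using h by simp
  moreover have "dist (partial b (partial a f) (x + s *\<^sub>R axis a 1 + t *\<^sub>R axis b 1)) (partial b (partial a f) x) < e"
    using near[OF st(1,2), of a b] h by (intro d2(2)) linarith
  moreover have "dist (partial a (partial b f) (x + s' *\<^sub>R axis b 1 + t' *\<^sub>R axis a 1)) (partial a (partial b f) x) < e"
    using near[OF st'(1,2), of b a] h by (intro d1(2)) linarith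
  ultimately show False using e_def unfolding dist_real_def abs_if by (simp split: if_splits)
qed

section \<open>Curvature in a chart\<close>

lemma lorentz_form_symmetric:
  assumes "lorentz_form G" shows "transpose G = G" "invertible G"
proof -
  obtain E :: "real^4^4" and D where E: "invertible E" "transpose E ** G ** E = D"
    and D: "D = (\<chi> i j. if i \<noteq> j then 0 else if i = 0 then - 1 else 1)"
    using assms unfolding lorentz_form_def by blast
  let ?F = "matrix_inv E"
  have tF: "transpose ?F ** transpose E = mat 1"
    by (simp add: matrix_inv_mult[OF E(1)] flip: matrix_transpose_mul)
  have G: "G = transpose ?F ** D ** ?F"
  proof -
    have "transpose ?F ** D ** ?F = (transpose ?F ** transpose E) ** G ** (E ** ?F)"
      unfolding E(2)[symmetric] by (simp add: matrix_mul_assoc)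
    then show ?thesis by (simp add: tF matrix_inv_mult[OF E(1)])
  qed
  have "transpose D = D" unfolding D by (auto simp: transpose_def vec_eq_iff)
  then show "transpose G = G"
    by (subst (1 2) G) (simp add: matrix_transpose_mul matrix_mul_assoc)
  have "det D = (\<Prod>i\<in>UNIV. D $ i $ i)" unfolding D by (rule det_diagonal) simp
  then have "det D \<noteq> 0" unfolding D by simp
  then have "det G \<noteq> 0" using E(2) by (auto simp: det_mul)
  then show "invertible G" by (simp add: invertible_det_nz)
qed

lemma lorentz_form_symD: "lorentz_form G \<Longrightarrow> G $ i $ j = G $ j $ i"
  using lorentz_form_symmetric(1)[of G] by (simp add: transpose_def vec_eq_iff)

lemma symmetric_matrix_inv:
  fixes G :: "real^4^4"
  assumes "transpose G = G" "invertible G" shows "matrix_inv G $ i $ j = matrix_inv G $ j $ i"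
proof -
  have "transpose (matrix_inv G) ** G = mat 1"
    using arg_cong[OF matrix_inv_mult(1)[OF assms(2)], of transpose] assms(1)
    by (simp add: matrix_transpose_mul transpose_mat)
  then have "transpose (matrix_inv G) ** (G ** matrix_inv G) = matrix_inv G"
    by (simp add: matrix_mul_assoc)
  then have "transpose (matrix_inv G) = matrix_inv G" by (simp add: matrix_inv_mult[OF assms(2)])
  then show ?thesis by (simp add: transpose_def vec_eq_iff)
qed

lemma sum_pull:
  fixes h :: "'a \<Rightarrow> 'b \<Rightarrow> real"
  shows "(\<Sum>a\<in>A. \<Sum>c\<in>C. h a c * (\<Sum>k\<in>K. q k * F k a c)) = (\<Sum>k\<in>K. q k * (\<Sum>a\<in>A. \<Sum>c\<in>C. h a c * F k a c))"
proof -
  have "(\<Sum>a\<in>A. \<Sum>c\<in>C. h a c * (\<Sum>k\<in>K. q k * F k a c)) = (\<Sum>a\<in>A. \<Sum>c\<in>C. \<Sum>k\<in>K. q k * (h a c * F k a c))"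
    by (simp add: sum_distrib_left mult_ac)
  also have "\<dots> = (\<Sum>a\<in>A. \<Sum>k\<in>K. \<Sum>c\<in>C. q k * (h a c * F k a c))"
    by (intro sum.cong refl sum.swap)
  also have "\<dots> = (\<Sum>k\<in>K. \<Sum>a\<in>A. \<Sum>c\<in>C. q k * (h a c * F k a c))"
    by (rule sum.swap)
  finally show ?thesis by (simp add: sum_distrib_left)
qed

text \<open>\<open>H\<close> is the inverse metric. Only the trace over the first and third slot is
  listed; the symmetries yield the other traces.\<close>

definition weyl_sym :: "real^4^4 \<Rightarrow> (4 \<Rightarrow> 4 \<Rightarrow> 4 \<Rightarrow> 4 \<Rightarrow> real) \<Rightarrow> bool" where
  "weyl_sym H X \<longleftrightarrow> (\<forall>a b c d. X a b c d = - X b a c d \<and> X a b c d = X c d a b \<and>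
      X a b c d + X a c d b + X a d b c = 0 \<and>
      (\<Sum>i\<in>UNIV. \<Sum>j\<in>UNIV. H $ i $ j * X i b j d) = 0)"

locale chart_metric =
  fixes S :: "(real^4) set" and g :: metric_field
  assumes openS: "open S"
    and smooth_g: "\<And>i j. smooth_on S (\<lambda>x. g x $ i $ j)"
    and lorentz: "\<And>x. x \<in> S \<Longrightarrow> lorentz_form (g x)"
begin

abbreviation "h x \<equiv> matrix_inv (g x)"
abbreviation "\<Gamma> \<equiv> christoffel g"

lemma g_sym: "x \<in> S \<Longrightarrow> g x $ i $ j = g x $ j $ i"
  using lorentz lorentz_form_symD by blast

lemma h_sym: "x \<in> S \<Longrightarrow> h x $ i $ j = h x $ j $ i"
  using lorentz lorentz_form_symmetric symmetric_matrix_inv by blast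

lemma gh: "x \<in> S \<Longrightarrow> (\<Sum>e\<in>UNIV. g x $ d $ e * h x $ e $ f) = (if d = f then 1 else 0)"
  using matrix_inv_mult(1)[OF lorentz_form_symmetric(2)[OF lorentz], of x]
  by (simp add: vec_eq_iff matrix_matrix_mult_def mat_def)

lemma hg: "x \<in> S \<Longrightarrow> (\<Sum>e\<in>UNIV. h x $ d $ e * g x $ e $ f) = (if d = f then 1 else 0)"
  using matrix_inv_mult(2)[OF lorentz_form_symmetric(2)[OF lorentz], of x]
  by (simp add: vec_eq_iff matrix_matrix_mult_def mat_def)

lemma lower_raise: "x \<in> S \<Longrightarrow> (\<Sum>d\<in>UNIV. g x $ f $ d * (\<Sum>e\<in>UNIV. h x $ d $ e * X e)) = X f"
proof -
  assume x: "x \<in> S"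
  have "(\<Sum>d\<in>UNIV. g x $ f $ d * (\<Sum>e\<in>UNIV. h x $ d $ e * X e)) =
        (\<Sum>e\<in>UNIV. (\<Sum>d\<in>UNIV. g x $ f $ d * h x $ d $ e) * X e)"
    by (simp add: sum_distrib_left sum_distrib_right mult.assoc) (rule sum.swap)
  also have "\<dots> = (\<Sum>e\<in>UNIV. if f = e then X e else 0)"
    by (intro sum.cong) (auto simp: gh[OF x])
  finally show ?thesis by simp
qed

lemma raise_lower: "x \<in> S \<Longrightarrow> (\<Sum>d\<in>UNIV. h x $ f $ d * (\<Sum>e\<in>UNIV. g x $ d $ e * X e)) = X f"
proof -
  assume x: "x \<in> S"
  have "(\<Sum>d\<in>UNIV. h x $ f $ d * (\<Sum>e\<in>UNIV. g x $ d $ e * X e)) =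
        (\<Sum>e\<in>UNIV. (\<Sum>d\<in>UNIV. h x $ f $ d * g x $ d $ e) * X e)"
    by (simp add: sum_distrib_left sum_distrib_right mult.assoc) (rule sum.swap)
  also have "\<dots> = (\<Sum>e\<in>UNIV. if f = e then X e else 0)"
    by (intro sum.cong) (auto simp: hg[OF x])
  finally show ?thesis by simp
qed

lemma smooth_h: "smooth_on S (\<lambda>x. h x $ i $ j)"
  by (intro smooth_on_matrix_inv openS smooth_g lorentz_form_symmetric lorentz)

lemma smooth_partial_g: "smooth_on S (\<lambda>x. partial a (\<lambda>y. g y $ i $ j) x)"
  using smooth_on_partial[OF smooth_g] .

lemma smooth_christoffel: "smooth_on S (\<lambda>x. \<Gamma> x d a b)"
  unfolding christoffel_def divide_inverse
  by (intro smooth_on_mult smooth_on_sum smooth_on_add smooth_on_diff smooth_on_const openS smooth_h smooth_partial_g)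

lemma smooth_partial_christoffel: "smooth_on S (\<lambda>x. partial c (\<lambda>y. \<Gamma> y d a b) x)"
  using smooth_on_partial[OF smooth_christoffel] .

lemma smooth_riemann_up: "smooth_on S (\<lambda>x. riemann_up g x a b c d)"
  unfolding riemann_up_def
  by (intro smooth_on_mult smooth_on_sum smooth_on_add smooth_on_diff openS
      smooth_christoffel smooth_partial_christoffel)

lemma smooth_riemann: "smooth_on S (\<lambda>x. riemann g x I)"
  unfolding riemann_def by (intro smooth_on_sum smooth_on_mult openS smooth_g smooth_riemann_up)

lemma smooth_ricci: "smooth_on S (\<lambda>x. ricci g x $ a $ b)"
  unfolding ricci_def by (simp, intro smooth_on_sum openS smooth_riemann_up)

lemma smooth_scalar: "smooth_on S (\<lambda>x. scalar_curvature g x)"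
  unfolding scalar_curvature_def by (intro smooth_on_sum smooth_on_mult openS smooth_h smooth_ricci)

lemma smooth_weyl: "smooth_on S (\<lambda>x. weyl g x I)"
  unfolding weyl_def Let_def divide_inverse
  by (intro smooth_on_add smooth_on_diff smooth_on_mult smooth_on_const openS smooth_g
      smooth_riemann smooth_ricci smooth_scalar)

lemma smooth_nabla:
  assumes "\<And>I. smooth_on S (\<lambda>x. T x I)" shows "smooth_on S (\<lambda>x. nabla g T x I)"
proof (cases I)
  case Nil then show ?thesis by (simp add: smooth_on_const)
next
  case (Cons c J)
  have "smooth_on S (\<lambda>x. partial c (\<lambda>y. T y J) x)" using smooth_on_partial[OF assms] .
  then show ?thesis unfolding Cons nabla.simps
    by (intro smooth_on_diff smooth_on_sum smooth_on_mult openS smooth_christoffel assms)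
qed

lemma christoffel_sym: "x \<in> S \<Longrightarrow> \<Gamma> x d a b = \<Gamma> x d b a"
proof -
  assume x: "x \<in> S"
  have "partial e (\<lambda>y. g y $ a $ b) x = partial e (\<lambda>y. g y $ b $ a) x" for e a b
    using g_sym by (intro partial_cong[OF openS x]) blast
  then show ?thesis unfolding christoffel_def by (simp add: add.commute)
qed

text \<open>Christoffel symbols of the first kind; raising \<open>f\<close> gives
  \<open>\<Gamma>\<close>.\<close>

definition cl :: "real^4 \<Rightarrow> 4 \<Rightarrow> 4 \<Rightarrow> 4 \<Rightarrow> real" where
  "cl x f a b = (partial a (\<lambda>y. g y $ f $ b) x + partial b (\<lambda>y. g y $ f $ a) x
        - partial f (\<lambda>y. g y $ a $ b) x) / 2"

lemma partial_g_sym: "x \<in> S \<Longrightarrow> partial e (\<lambda>y. g y $ a $ b) x = partial e (\<lambda>y. g y $ b $ a) x"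
  using g_sym by (intro partial_cong[OF openS]) blast+

lemma cl_sym: "x \<in> S \<Longrightarrow> cl x d a b = cl x d b a"
  unfolding cl_def using partial_g_sym[of x d a b] by simp

lemma lower_christoffel: "x \<in> S \<Longrightarrow> (\<Sum>d\<in>UNIV. g x $ f $ d * \<Gamma> x d a b) = cl x f a b"
proof -
  assume x: "x \<in> S"
  have "\<Gamma> x d a b = (\<Sum>e\<in>UNIV. h x $ d $ e * cl x e a b)" for d
    unfolding christoffel_def cl_def by (simp add: sum_divide_distrib)
  then show ?thesis using lower_raise[OF x] by simp
qed

lemma partial_g: assumes x: "x \<in> S" shows "partial c (\<lambda>y. g y $ a $ b) x = cl x a c b + cl x b c a"
  unfolding cl_def using partial_g_sym[OF x, of c a b] partial_g_sym[OF x, of a b c] partial_g_sym[OF x, of b a c]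
  by argo

lemma metric_compat: "x \<in> S \<Longrightarrow> partial c (\<lambda>y. g y $ a $ b) x =
    (\<Sum>d\<in>UNIV. \<Gamma> x d c a * g x $ d $ b) + (\<Sum>d\<in>UNIV. \<Gamma> x d c b * g x $ a $ d)"
proof -
  assume x: "x \<in> S"
  have "(\<Sum>d\<in>UNIV. \<Gamma> x d c a * g x $ d $ b) = cl x b c a"
    unfolding lower_christoffel[OF x, symmetric] using g_sym[OF x, of b] by (simp add: mult.commute)
  moreover have "(\<Sum>d\<in>UNIV. \<Gamma> x d c b * g x $ a $ d) = cl x a c b"
    unfolding lower_christoffel[OF x, symmetric] by (simp add: mult.commute)
  ultimately show ?thesis using partial_g[OF x] by simp
qed

lemmas sd = smooth_on_D[OF _ openS]

text \<open>The equation g h = 1 is differentiated and solved for the derivative of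
  \<open>h\<close>. The formula says that the inverse metric is parallel.\<close>

lemma partial_h: "x \<in> S \<Longrightarrow> partial c (\<lambda>y. h y $ a $ b) x =
    - (\<Sum>d\<in>UNIV. \<Gamma> x a c d * h x $ d $ b) - (\<Sum>d\<in>UNIV. \<Gamma> x b c d * h x $ a $ d)"
proof -
  assume x: "x \<in> S"
  have 0: "(\<Sum>d\<in>UNIV. g x $ e $ d * partial c (\<lambda>y. h y $ d $ b) x)
     = - (\<Sum>d\<in>UNIV. partial c (\<lambda>y. g y $ e $ d) x * h x $ d $ b)" for e
  proof -
    have "partial c (\<lambda>y. \<Sum>d\<in>UNIV. g y $ e $ d * h y $ d $ b) x = partial c (\<lambda>y. if e = b then 1 else 0) x"
      by (rule partial_cong[OF openS x gh])
    then have "(\<Sum>d\<in>UNIV. partial c (\<lambda>y. g y $ e $ d) x * h x $ d $ b + g x $ e $ d * partial c (\<lambda>y. h y $ d $ b) x) = 0"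
      by (subst (asm) partial_sum, intro smooth_on_D[OF _ openS x] smooth_on_mult openS smooth_g smooth_h)
        (simp add: partial_mult sd[OF smooth_g x] sd[OF smooth_h x])
    then show ?thesis by (simp add: sum.distrib)
  qed
  have 1: "(\<Sum>d\<in>UNIV. partial c (\<lambda>y. g y $ e $ d) x * h x $ d $ b)
     = (\<Sum>d\<in>UNIV. cl x e c d * h x $ d $ b) + \<Gamma> x b c e" for e
  proof -
    have "(\<Sum>d\<in>UNIV. cl x d c e * h x $ d $ b) = (\<Sum>d\<in>UNIV. h x $ b $ d * (\<Sum>f\<in>UNIV. g x $ d $ f * \<Gamma> x f c e))"
      unfolding lower_christoffel[OF x] using h_sym[OF x, of b] by (simp add: mult.commute)
    also have "\<dots> = \<Gamma> x b c e" by (rule raise_lower[OF x])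
    finally show ?thesis by (simp add: partial_g[OF x] distrib_right sum.distrib)
  qed
  have "partial c (\<lambda>y. h y $ a $ b) x = (\<Sum>e\<in>UNIV. h x $ a $ e * (\<Sum>d\<in>UNIV. g x $ e $ d * partial c (\<lambda>y. h y $ d $ b) x))"
    by (rule raise_lower[OF x, symmetric])
  also have "\<dots> = - (\<Sum>e\<in>UNIV. h x $ a $ e * (\<Sum>d\<in>UNIV. cl x e c d * h x $ d $ b)) - (\<Sum>e\<in>UNIV. h x $ a $ e * \<Gamma> x b c e)"
    unfolding 0 1 by (simp add: sum.distrib distrib_left sum_negf sum_subtractf algebra_simps)
  also have "(\<Sum>e\<in>UNIV. h x $ a $ e * (\<Sum>d\<in>UNIV. cl x e c d * h x $ d $ b)) = 
     (\<Sum>d\<in>UNIV. (\<Sum>e\<in>UNIV. h x $ a $ e * cl x e c d) * h x $ d $ b)"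
    by (simp add: sum_distrib_left sum_distrib_right mult.assoc) (rule sum.swap)
  also have "\<dots> = (\<Sum>d\<in>UNIV. \<Gamma> x a c d * h x $ d $ b)"
  proof -
    have "(\<Sum>e\<in>UNIV. h x $ a $ e * cl x e c d) = \<Gamma> x a c d" for d
      unfolding lower_christoffel[OF x, symmetric] by (rule raise_lower[OF x])
    then show ?thesis by simp
  qed
  finally show ?thesis by (simp add: mult.commute)
qed

text \<open>As the inverse metric is parallel, its derivative turns into the Christoffel corrections
  of the two contracted slots: traces commute with covariant differentiation.\<close>

lemma partial_trace:
  assumes x: "x \<in> S" and U: "\<And>i j. smooth_on S (\<lambda>y. U y i j)"
  shows "partial e (\<lambda>y. \<Sum>i\<in>UNIV. \<Sum>j\<in>UNIV. h y $ i $ j * U y i j) x =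
    (\<Sum>i\<in>UNIV. \<Sum>j\<in>UNIV. h x $ i $ j * (partial e (\<lambda>y. U y i j) x
       - (\<Sum>k\<in>UNIV. \<Gamma> x k e i * U x k j) - (\<Sum>k\<in>UNIV. \<Gamma> x k e j * U x i k)))"
proof -
  have "partial e (\<lambda>y. \<Sum>i\<in>UNIV. \<Sum>j\<in>UNIV. h y $ i $ j * U y i j) x =
    (\<Sum>i\<in>UNIV. \<Sum>j\<in>UNIV. partial e (\<lambda>y. h y $ i $ j) x * U x i j + h x $ i $ j * partial e (\<lambda>y. U y i j) x)"
    by (simp add: partial_sum partial_mult sd[OF _ x] smooth_on_sum smooth_on_mult openS smooth_h U)
  also have "\<dots> = (\<Sum>i\<in>UNIV. \<Sum>j\<in>UNIV. h x $ i $ j * partial e (\<lambda>y. U y i j) x)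
     - (\<Sum>i\<in>UNIV. \<Sum>j\<in>UNIV. (\<Sum>d\<in>UNIV. \<Gamma> x i e d * h x $ d $ j) * U x i j)
     - (\<Sum>i\<in>UNIV. \<Sum>j\<in>UNIV. (\<Sum>d\<in>UNIV. \<Gamma> x j e d * h x $ i $ d) * U x i j)"
    unfolding partial_h[OF x] by (simp add: algebra_simps sum.distrib sum_subtractf sum_negf)
  also have "(\<Sum>i\<in>UNIV. \<Sum>j\<in>UNIV. (\<Sum>d\<in>UNIV. \<Gamma> x i e d * h x $ d $ j) * U x i j) =
     (\<Sum>i\<in>UNIV. \<Sum>j\<in>UNIV. h x $ i $ j * (\<Sum>k\<in>UNIV. \<Gamma> x k e i * U x k j))"
  proof -
    have "(\<Sum>i\<in>UNIV. \<Sum>j\<in>UNIV. (\<Sum>d\<in>UNIV. \<Gamma> x i e d * h x $ d $ j) * U x i j) =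
      (\<Sum>j\<in>UNIV. \<Sum>i\<in>UNIV. \<Sum>d\<in>UNIV. \<Gamma> x i e d * h x $ d $ j * U x i j)"
      by (subst sum.swap) (simp add: sum_distrib_right)
    also have "\<dots> = (\<Sum>j\<in>UNIV. \<Sum>d\<in>UNIV. \<Sum>i\<in>UNIV. \<Gamma> x i e d * h x $ d $ j * U x i j)"
      by (intro sum.cong refl sum.swap)
    also have "\<dots> = (\<Sum>d\<in>UNIV. \<Sum>j\<in>UNIV. \<Sum>i\<in>UNIV. \<Gamma> x i e d * h x $ d $ j * U x i j)"
      by (rule sum.swap)
    finally show ?thesis by (simp add: sum_distrib_left mult_ac)
  qed
  also have "(\<Sum>i\<in>UNIV. \<Sum>j\<in>UNIV. (\<Sum>d\<in>UNIV. \<Gamma> x j e d * h x $ i $ d) * U x i j) =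
     (\<Sum>i\<in>UNIV. \<Sum>j\<in>UNIV. h x $ i $ j * (\<Sum>k\<in>UNIV. \<Gamma> x k e j * U x i k))"
  proof -
    have "(\<Sum>j\<in>UNIV. (\<Sum>d\<in>UNIV. \<Gamma> x j e d * h x $ i $ d) * U x i j) =
       (\<Sum>j\<in>UNIV. h x $ i $ j * (\<Sum>k\<in>UNIV. \<Gamma> x k e j * U x i k))" for i
      by (simp add: sum_distrib_left sum_distrib_right mult_ac) (rule sum.swap)
    then show ?thesis by simp
  qed
  finally show ?thesis by (simp add: right_diff_distrib sum_subtractf)
qed

definition pp :: "real^4 \<Rightarrow> 4 \<Rightarrow> 4 \<Rightarrow> 4 \<Rightarrow> 4 \<Rightarrow> real" where
  "pp x a b i j = partial a (partial b (\<lambda>y. g y $ i $ j)) x"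

lemma pp_sym:
  assumes x: "x \<in> S" shows "pp x a b i j = pp x b a i j" "pp x a b i j = pp x a b j i"
  unfolding pp_def
  by (rule partial_commute[OF openS smooth_g x]) (rule partial_cong[OF openS x], rule partial_g_sym)

text \<open>The part of the lowered curvature that is quadratic in the Christoffel symbols. It is
  the metric product of two vectors \<open>\<Gamma>\<close>, hence symmetric within each index pair
  and under exchange of the pairs.\<close>

definition Qc :: "real^4 \<Rightarrow> 4 \<Rightarrow> 4 \<Rightarrow> 4 \<Rightarrow> 4 \<Rightarrow> real" where
  "Qc x a b c d = (\<Sum>e\<in>UNIV. cl x e a b * \<Gamma> x e c d)"

lemma Qc_sym: assumes x: "x \<in> S"
  shows "Qc x a b c d = Qc x b a c d" "Qc x a b c d = Qc x a b d c" "Qc x a b c d = Qc x c d a b"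
proof -
  show "Qc x a b c d = Qc x b a c d" unfolding Qc_def using cl_sym[OF x, of _ a b] by simp
  show "Qc x a b c d = Qc x a b d c" unfolding Qc_def using christoffel_sym[OF x, of _ c d] by simp
  have "Qc x a b c d = (\<Sum>e\<in>UNIV. \<Sum>f\<in>UNIV. g x $ e $ f * \<Gamma> x f a b * \<Gamma> x e c d)" for a b c d
    unfolding Qc_def lower_christoffel[OF x, symmetric] by (simp add: sum_distrib_right)
  then have 1: "Qc x a b c d = (\<Sum>e\<in>UNIV. \<Sum>f\<in>UNIV. g x $ e $ f * \<Gamma> x f a b * \<Gamma> x e c d)" 
    "Qc x c d a b = (\<Sum>e\<in>UNIV. \<Sum>f\<in>UNIV. g x $ e $ f * \<Gamma> x f c d * \<Gamma> x e a b)" by auto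
  show "Qc x a b c d = Qc x c d a b" unfolding 1
    by (subst sum.swap) (intro sum.cong refl, subst g_sym[OF x], simp)
qed

text \<open>Pulling the lowering metric inside the derivative replaces derivatives of
  \<open>\<Gamma>\<close> by derivatives of \<open>cl\<close> and products. In the resulting form
  all algebraic symmetries of the curvature are linear arithmetic in \<open>pp\<close> and
  \<open>Qc\<close>.\<close>

lemma riemann_formula:
  assumes x: "x \<in> S"
  shows "riemann g x [a,b,c,d] = (pp x c b a d + pp x d a c b - pp x c a d b - pp x d b a c) / 2
     - Qc x c a d b + Qc x d a c b"
proof -
  have pcl: "partial c (\<lambda>y. cl y a d b) x = (pp x c d a b + pp x c b a d - pp x c a d b) / 2" for a b c d
    unfolding cl_def pp_def divide_inverse
    by (subst partial_mult, (intro smooth_on_D[OF _ openS x] smooth_on_add smooth_on_diff smooth_on_const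
        openS smooth_partial_g)+)
      (simp add: partial_add partial_diff sd[OF smooth_partial_g x] sd[OF _ x] smooth_on_add openS smooth_partial_g)
  have 1: "(\<Sum>e\<in>UNIV. g x $ a $ e * partial c (\<lambda>y. \<Gamma> y e d b) x) =
     partial c (\<lambda>y. cl y a d b) x - (\<Sum>e\<in>UNIV. cl x a c e * \<Gamma> x e d b) - Qc x c a d b" for a b c d
  proof -
    have "partial c (\<lambda>y. cl y a d b) x = partial c (\<lambda>y. \<Sum>e\<in>UNIV. g y $ a $ e * \<Gamma> y e d b) x"
      by (rule partial_cong[OF openS x]) (simp add: lower_christoffel)
    also have "\<dots> = (\<Sum>e\<in>UNIV. partial c (\<lambda>y. g y $ a $ e) x * \<Gamma> x e d b + g x $ a $ e * partial c (\<lambda>y. \<Gamma> y e d b) x)"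
      by (simp add: partial_sum partial_mult sd[OF _ x] smooth_on_mult openS smooth_g smooth_christoffel)
    also have "\<dots> = (\<Sum>e\<in>UNIV. cl x a c e * \<Gamma> x e d b) + Qc x c a d b + (\<Sum>e\<in>UNIV. g x $ a $ e * partial c (\<lambda>y. \<Gamma> y e d b) x)"
      unfolding Qc_def using cl_sym[OF x, of _ c a]
      by (simp add: partial_g[OF x] distrib_right sum.distrib)
    finally show ?thesis by simp
  qed
  have 2: "(\<Sum>e\<in>UNIV. g x $ a $ e * (\<Sum>f\<in>UNIV. \<Gamma> x e c f * \<Gamma> x f d b)) = (\<Sum>f\<in>UNIV. cl x a c f * \<Gamma> x f d b)" for c d
    unfolding lower_christoffel[OF x, symmetric]
    by (simp add: sum_distrib_left sum_distrib_right mult.assoc) (rule sum.swap)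
  have "riemann g x [a,b,c,d] = (\<Sum>e\<in>UNIV. g x $ a $ e * partial c (\<lambda>y. \<Gamma> y e d b) x)
     - (\<Sum>e\<in>UNIV. g x $ a $ e * partial d (\<lambda>y. \<Gamma> y e c b) x)
     + (\<Sum>e\<in>UNIV. g x $ a $ e * (\<Sum>f\<in>UNIV. \<Gamma> x e c f * \<Gamma> x f d b))
     - (\<Sum>e\<in>UNIV. g x $ a $ e * (\<Sum>f\<in>UNIV. \<Gamma> x e d f * \<Gamma> x f c b))"
    unfolding riemann_def riemann_up_def
    by (simp add: numeral_2_eq_2 numeral_3_eq_3 algebra_simps sum.distrib sum_subtractf)
  then show ?thesis unfolding 1 2 pcl using pp_sym(1)[OF x, of c d a b] by argo
qed

lemma riemann_sym:
  assumes x: "x \<in> S"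
  shows "riemann g x [a,b,c,d] = - riemann g x [b,a,c,d]"
    "riemann g x [a,b,c,d] = riemann g x [c,d,a,b]"
    "riemann g x [a,b,c,d] + riemann g x [a,c,d,b] + riemann g x [a,d,b,c] = 0"
proof -
  note p = pp_sym[OF x] and q = Qc_sym[OF x]
  show "riemann g x [a,b,c,d] = - riemann g x [b,a,c,d]" unfolding riemann_formula[OF x]
    using p(2)[of c a d b] p(2)[of d b a c] p(2)[of c b a d] p(2)[of d a c b] q(3)[of c a d b] q(3)[of d a c b]
    by argo
  show "riemann g x [a,b,c,d] = riemann g x [c,d,a,b]" unfolding riemann_formula[OF x]
    using p(1)[of c b a d] p(2)[of b c a d] p(1)[of d a c b] p(1)[of c a d b] p(2)[of a c b d] p(1)[of d b a c] p(2)[of b d a c]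
     p(2)[of a d c b]
      q(1)[of c a d b] q(2)[of a c d b] q(1)[of d a c b] q(2)[of a d c b] q(3)[of a d b c]
    by argo
  show "riemann g x [a,b,c,d] + riemann g x [a,c,d,b] + riemann g x [a,d,b,c] = 0" unfolding riemann_formula[OF x]
    using p(1)[of c b a d] p(1)[of d c a b] p(1)[of b d a c] p(2)[of c a d b] p(2)[of d a c b] p(2)[of b a d c] 
      q(2)[of c a d b] q(2)[of d a c b] q(2)[of b a d c]
    by argo
qed

end

section \<open>The second Bianchi identity, and the Weyl symmetries of covariant derivatives\<close>

context chart_metric
begin

lemma riemann_up_antisym: "riemann_up g x f b c d = - riemann_up g x f b d c"
  unfolding riemann_up_def by (simp add: sum_subtractf)

text \<open>Covariant derivative of the mixed Riemann tensor without the corrections for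
  \<open>c\<close> and \<open>d\<close>; these cancel in the cyclic sum because
  \<open>\<Gamma>\<close> is symmetric.\<close>

definition Zb :: "real^4 \<Rightarrow> 4 \<Rightarrow> 4 \<Rightarrow> 4 \<Rightarrow> 4 \<Rightarrow> 4 \<Rightarrow> real" where
  "Zb x e f b c d = partial e (\<lambda>y. riemann_up g y f b c d) x
     + (\<Sum>k\<in>UNIV. \<Gamma> x f e k * riemann_up g x k b c d) - (\<Sum>k\<in>UNIV. \<Gamma> x k e b * riemann_up g x f k c d)"

text \<open>A direct computation without normal coordinates. Every term is split into second
  derivatives of \<open>\<Gamma>\<close> (\<open>P\<close>), products of \<open>\<Gamma>\<close>
  with a first derivative (\<open>A\<close>, \<open>B\<close>) and cubic terms (\<open>T\<close>).
  The second derivatives cancel because partial derivatives commute, the others in pairs.\<close>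

lemma bianchi_up:
  assumes x: "x \<in> S"
  shows "Zb x e f b c d + Zb x c f b d e + Zb x d f b e c = 0"
proof -
  define A where "A = (\<lambda>e c d. \<Sum>k\<in>UNIV. partial e (\<lambda>y. \<Gamma> y f c k) x * \<Gamma> x k d b)"
  define B where "B = (\<lambda>e c d. \<Sum>k\<in>UNIV. \<Gamma> x f c k * partial e (\<lambda>y. \<Gamma> y k d b) x)"
  define T where "T = (\<lambda>e c d. \<Sum>k\<in>UNIV. \<Sum>m\<in>UNIV. \<Gamma> x f e k * \<Gamma> x k c m * \<Gamma> x m d b)"
  define P where "P = (\<lambda>e c d. partial e (partial c (\<lambda>y. \<Gamma> y f d b)) x)"
  have P: "P e c d = P c e d" for e c d
    unfolding P_def by (rule partial_commute[OF openS smooth_christoffel x])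
  have 1: "partial e (\<lambda>y. riemann_up g y f b c d) x = P e c d - P e d c + A e c d + B e c d - A e d c - B e d c" for e c d
  proof -
    have "partial e (\<lambda>y. \<Sum>k\<in>UNIV. \<Gamma> y f c k * \<Gamma> y k d b - \<Gamma> y f d k * \<Gamma> y k c b) x = 
      A e c d + B e c d - A e d c - B e d c"
      unfolding A_def B_def
      by (simp add: partial_sum partial_diff partial_mult sd[OF _ x] smooth_on_mult smooth_on_diff openS smooth_christoffel
           sum.distrib sum_subtractf)
    moreover have "partial e (\<lambda>y. partial c (\<lambda>z. \<Gamma> z f d b) y - partial d (\<lambda>z. \<Gamma> z f c b) y) x = P e c d - P e d c"
      unfolding P_def by (simp add: partial_diff sd[OF _ x] smooth_partial_christoffel)
    ultimately show ?thesis unfolding riemann_up_def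
      by (subst partial_add, intro smooth_on_D[OF _ openS x] smooth_on_diff openS smooth_partial_christoffel,
          intro smooth_on_D[OF _ openS x] smooth_on_diff smooth_on_sum smooth_on_mult openS smooth_christoffel) simp
  qed
  have 2: "(\<Sum>k\<in>UNIV. \<Gamma> x f e k * riemann_up g x k b c d) = B c e d - B d e c + T e c d - T e d c" for e c d
    unfolding riemann_up_def B_def T_def
    by (simp add: distrib_left right_diff_distrib sum.distrib sum_subtractf sum_distrib_left mult.assoc)
  have T': "(\<Sum>k\<in>UNIV. \<Gamma> x k e b * (\<Sum>m\<in>UNIV. \<Gamma> x f c m * \<Gamma> x m d k)) = T c d e" for e c d
    unfolding T_def by (subst sum.swap) (simp add: sum_distrib_left mult_ac)
  have 3: "(\<Sum>k\<in>UNIV. \<Gamma> x k e b * riemann_up g x f k c d) = A c d e - A d c e + T c d e - T d c e" for e c d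
    unfolding riemann_up_def A_def T'[symmetric]
    by (simp add: distrib_left right_diff_distrib sum.distrib sum_subtractf mult.commute)
  show ?thesis unfolding Zb_def 1 2 3 using P[of e c d] P[of c d e] P[of d e c] by argo
qed

lemma nabla4: "nabla g T x [e,a,b,c,d] = partial e (\<lambda>y. T y [a,b,c,d]) x
   - (\<Sum>k\<in>UNIV. \<Gamma> x k e a * T x [k,b,c,d]) - (\<Sum>k\<in>UNIV. \<Gamma> x k e b * T x [a,k,c,d])
   - (\<Sum>k\<in>UNIV. \<Gamma> x k e c * T x [a,b,k,d]) - (\<Sum>k\<in>UNIV. \<Gamma> x k e d * T x [a,b,c,k])"
  by simp

lemma nabla_append4: "nabla g T x (e # D @ [a,b,c,d]) = partial e (\<lambda>y. T y (D @ [a,b,c,d])) x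
   - (\<Sum>k<length D. \<Sum>i\<in>UNIV. \<Gamma> x i e (D ! k) * T x (D[k := i] @ [a,b,c,d]))
   - (\<Sum>k\<in>UNIV. \<Gamma> x k e a * T x (D @ [k,b,c,d])) - (\<Sum>k\<in>UNIV. \<Gamma> x k e b * T x (D @ [a,k,c,d]))
   - (\<Sum>k\<in>UNIV. \<Gamma> x k e c * T x (D @ [a,b,k,d])) - (\<Sum>k\<in>UNIV. \<Gamma> x k e d * T x (D @ [a,b,c,k]))"
proof -
  have split: "sum F {..<n + 4} = sum F {..<n} + F n + F (n+1) + F (n+2) + F (n+3)" for F :: "nat \<Rightarrow> real" and n
    by (simp add: numeral_eq_Suc)
  have "(\<Sum>k<length D. \<Sum>i\<in>UNIV. \<Gamma> x i e ((D @ [a,b,c,d]) ! k) * T x ((D @ [a,b,c,d])[k := i])) =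
      (\<Sum>k<length D. \<Sum>i\<in>UNIV. \<Gamma> x i e (D ! k) * T x (D[k := i] @ [a,b,c,d]))"
    by (intro sum.cong refl) (auto simp: nth_append list_update_append)
  then show ?thesis
    by (simp add: split[of _ "length D", simplified]) (simp add: nth_append list_update_append)
qed

text \<open>By metric compatibility the derivative of the lowering factor is exactly the correction
  for the slot \<open>a\<close> plus the one that belongs to the raised index.\<close>

lemma nabla_riemann:
  assumes x: "x \<in> S"
  shows "nabla g (riemann g) x [e,a,b,c,d] = (\<Sum>f\<in>UNIV. g x $ a $ f * (Zb x e f b c d
     - (\<Sum>k\<in>UNIV. \<Gamma> x k e c * riemann_up g x f b k d) - (\<Sum>k\<in>UNIV. \<Gamma> x k e d * riemann_up g x f b c k)))"
proof -
  have R: "riemann g y [a,b,c,d] = (\<Sum>f\<in>UNIV. g y $ a $ f * riemann_up g y f b c d)" for y a b c d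
    unfolding riemann_def by (simp add: numeral_2_eq_2 numeral_3_eq_3)
  have 1: "partial e (\<lambda>y. riemann g y [a,b,c,d]) x =
     (\<Sum>f\<in>UNIV. partial e (\<lambda>y. g y $ a $ f) x * riemann_up g x f b c d)
     + (\<Sum>f\<in>UNIV. g x $ a $ f * partial e (\<lambda>y. riemann_up g y f b c d) x)"
    unfolding R by (simp add: partial_sum partial_mult sd[OF _ x] smooth_on_mult openS smooth_g smooth_riemann_up sum.distrib)
  have 2: "(\<Sum>f\<in>UNIV. partial e (\<lambda>y. g y $ a $ f) x * riemann_up g x f b c d) =
     (\<Sum>k\<in>UNIV. \<Gamma> x k e a * riemann g x [k,b,c,d]) 
     + (\<Sum>f\<in>UNIV. g x $ a $ f * (\<Sum>k\<in>UNIV. \<Gamma> x f e k * riemann_up g x k b c d))"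
  proof -
    have "(\<Sum>f\<in>UNIV. (\<Sum>k\<in>UNIV. \<Gamma> x k e a * g x $ k $ f) * riemann_up g x f b c d) =
       (\<Sum>k\<in>UNIV. \<Gamma> x k e a * riemann g x [k,b,c,d])"
      unfolding R by (simp add: sum_distrib_left sum_distrib_right mult.assoc) (rule sum.swap)
    moreover have "(\<Sum>f\<in>UNIV. (\<Sum>k\<in>UNIV. \<Gamma> x k e f * g x $ a $ k) * riemann_up g x f b c d) =
       (\<Sum>f\<in>UNIV. g x $ a $ f * (\<Sum>k\<in>UNIV. \<Gamma> x f e k * riemann_up g x k b c d))"
      by (simp add: sum_distrib_left sum_distrib_right mult_ac) (rule sum.swap)
    ultimately show ?thesis unfolding metric_compat[OF x] by (simp add: distrib_right sum.distrib)
  qed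
  have 3: "(\<Sum>k\<in>UNIV. q k * (\<Sum>f\<in>UNIV. g x $ a $ f * F k f)) = (\<Sum>f\<in>UNIV. g x $ a $ f * (\<Sum>k\<in>UNIV. q k * F k f))"
    for q :: "4 \<Rightarrow> real" and F
    by (simp add: sum_distrib_left mult_ac) (rule sum.swap)
  have "nabla g (riemann g) x [e,a,b,c,d] = 
     (\<Sum>f\<in>UNIV. g x $ a $ f * (\<Sum>k\<in>UNIV. \<Gamma> x f e k * riemann_up g x k b c d))
     + (\<Sum>f\<in>UNIV. g x $ a $ f * partial e (\<lambda>y. riemann_up g y f b c d) x)
     - (\<Sum>f\<in>UNIV. g x $ a $ f * (\<Sum>k\<in>UNIV. \<Gamma> x k e b * riemann_up g x f k c d))
     - (\<Sum>f\<in>UNIV. g x $ a $ f * (\<Sum>k\<in>UNIV. \<Gamma> x k e c * riemann_up g x f b k d))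
     - (\<Sum>f\<in>UNIV. g x $ a $ f * (\<Sum>k\<in>UNIV. \<Gamma> x k e d * riemann_up g x f b c k))"
    unfolding nabla4 1 2 unfolding R 3 by simp
  then show ?thesis unfolding Zb_def
    by (simp add: right_diff_distrib distrib_left sum_subtractf sum.distrib)
qed

lemma bianchi_riemann:
  assumes x: "x \<in> S"
  shows "nabla g (riemann g) x [e,a,b,c,d] + nabla g (riemann g) x [c,a,b,d,e] + nabla g (riemann g) x [d,a,b,e,c] = 0"
proof -
  define W where "W = (\<lambda>f e c d. \<Sum>k\<in>UNIV. \<Gamma> x k e c * riemann_up g x f b k d)"
  have W2: "(\<Sum>k\<in>UNIV. \<Gamma> x k e d * riemann_up g x f b c k) = - W f e d c" for f e c d
    unfolding W_def using riemann_up_antisym[of x f b c] by (simp add: sum_negf)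
  have Ws: "W f e c d = W f c e d" for f e c d
    unfolding W_def using christoffel_sym[OF x, of _ e c] by simp
  have W1: "(\<Sum>k\<in>UNIV. \<Gamma> x k e c * riemann_up g x f b k d) = W f e c d" for f e c d by (simp add: W_def)
  have "(Zb x e f b c d - W f e c d - - W f e d c) + (Zb x c f b d e - W f c d e - - W f c e d)
    + (Zb x d f b e c - W f d e c - - W f d c e) = 0" for f
    using bianchi_up[OF x, of e f b c d] Ws[of f e c d] Ws[of f c d e] Ws[of f d e c] by argo
  then show ?thesis unfolding nabla_riemann[OF x] W2 W1
    by (simp flip: sum.distrib distrib_left)
qed

text \<open>The curvature tensor of constant curvature 1. It is parallel.\<close>

definition gg :: "real^4 \<Rightarrow> tensor" where
  "gg x I = g x $ (I!0) $ (I!2) * g x $ (I!1) $ (I!3) - g x $ (I!0) $ (I!3) * g x $ (I!1) $ (I!2)"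

lemma gg4: "gg x [a,b,c,d] = g x $ a $ c * g x $ b $ d - g x $ a $ d * g x $ b $ c"
  unfolding gg_def by (simp add: numeral_2_eq_2 numeral_3_eq_3)

lemma nabla_gg:
  assumes x: "x \<in> S" shows "nabla g gg x [e,a,b,c,d] = 0"
proof -
  have "partial e (\<lambda>y. gg y [a,b,c,d]) x = 
    partial e (\<lambda>y. g y $ a $ c) x * g x $ b $ d + g x $ a $ c * partial e (\<lambda>y. g y $ b $ d) x
    - (partial e (\<lambda>y. g y $ a $ d) x * g x $ b $ c + g x $ a $ d * partial e (\<lambda>y. g y $ b $ c) x)"
    unfolding gg4
    by (simp add: partial_diff partial_mult sd[OF _ x] smooth_on_mult openS smooth_g)
  then show ?thesis
    unfolding nabla4 metric_compat[OF x] gg4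
    by (simp add: algebra_simps sum.distrib sum_subtractf sum_distrib_left)
qed

lemma scalar_curvature_einstein:
  assumes "\<And>a b. ricci g x $ a $ b = lam * g x $ a $ b" and x: "x \<in> S"
  shows "scalar_curvature g x = 4 * lam"
proof -
  have "scalar_curvature g x = (\<Sum>a\<in>UNIV. lam * (\<Sum>b\<in>UNIV. h x $ a $ b * g x $ b $ a))"
    unfolding scalar_curvature_def assms using g_sym[OF x] by (simp add: sum_distrib_left mult_ac)
  then show ?thesis unfolding hg[OF x] by simp
qed

text \<open>The Ricci terms contribute -lam and the scalar curvature 4 lam contributes 4 lam / 6, in
  total -lam / 3.\<close>

lemma weyl_einstein:
  assumes "\<And>a b. ricci g x $ a $ b = lam * g x $ a $ b" and x: "x \<in> S"
  shows "weyl g x [a,b,c,d] = riemann g x [a,b,c,d] - lam / 3 * gg x [a,b,c,d]"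
  unfolding weyl_def Let_def scalar_curvature_einstein[OF assms] assms(1) gg_def
  by (simp add: numeral_2_eq_2 numeral_3_eq_3 field_simps)

lemma smooth_gg: "smooth_on S (\<lambda>x. gg x I)"
  unfolding gg_def by (intro smooth_on_diff smooth_on_mult openS smooth_g)

text \<open>The two tensors differ by a constant multiple of the parallel tensor \<open>gg\<close>.
  Here the Einstein condition transfers the full Bianchi identity to the Weyl tensor.\<close>

lemma nabla_weyl_einstein:
  assumes ric: "\<And>x a b. x \<in> S \<Longrightarrow> ricci g x $ a $ b = lam * g x $ a $ b" and x: "x \<in> S"
  shows "nabla g (weyl g) x [e,a,b,c,d] = nabla g (riemann g) x [e,a,b,c,d]"
proof -
  have "partial e (\<lambda>y. weyl g y [a,b,c,d]) x = partial e (\<lambda>y. riemann g y [a,b,c,d] - lam / 3 * gg y [a,b,c,d]) x"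
    by (rule partial_cong[OF openS x], rule weyl_einstein[OF ric]) 
  also have "\<dots> = partial e (\<lambda>y. riemann g y [a,b,c,d]) x - lam / 3 * partial e (\<lambda>y. gg y [a,b,c,d]) x"
    by (subst partial_diff) (simp_all add: partial_cmult sd[OF _ x] smooth_gg smooth_riemann smooth_on_mult smooth_on_const openS del: times_divide_eq_left)
  finally have "nabla g (weyl g) x [e,a,b,c,d] = nabla g (riemann g) x [e,a,b,c,d] - lam / 3 * nabla g gg x [e,a,b,c,d]"
    unfolding nabla4 weyl_einstein[OF ric[OF x] x]
    by (simp add: right_diff_distrib sum_subtractf sum_distrib_left mult_ac)
  then show ?thesis using nabla_gg[OF x] by simp
qed

lemma weyl_sym_weyl:
  assumes ric: "\<And>a b. ricci g x $ a $ b = lam * g x $ a $ b" and x: "x \<in> S"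
  shows "weyl_sym (h x) (\<lambda>a b c d. weyl g x [a,b,c,d])"
  unfolding weyl_sym_def
proof (intro allI conjI)
  fix a b c d
  note w = weyl_einstein[OF ric x] and r = riemann_sym[OF x] and gs = g_sym[OF x]
  show "weyl g x [a,b,c,d] = - weyl g x [b,a,c,d]" unfolding w gg4 using r(1)[of a b c d]
    by (simp add: algebra_simps)
  show "weyl g x [a,b,c,d] = weyl g x [c,d,a,b]" unfolding w gg4 using r(2)[of a b c d]
      gs[of c a] gs[of d b] gs[of c b] gs[of d a] by (simp add: algebra_simps)
  show "weyl g x [a,b,c,d] + weyl g x [a,c,d,b] + weyl g x [a,d,b,c] = 0" unfolding w gg4 using r(3)[of a b c d]
      gs[of c b] gs[of d b] gs[of d c] by (simp add: algebra_simps)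
  have "(\<Sum>i\<in>UNIV. \<Sum>j\<in>UNIV. h x $ i $ j * riemann g x [i,b,j,d]) = ricci g x $ b $ d"
  proof -
    have "(\<Sum>i\<in>UNIV. \<Sum>j\<in>UNIV. h x $ i $ j * riemann g x [i,b,j,d]) = 
      (\<Sum>j\<in>UNIV. \<Sum>i\<in>UNIV. h x $ j $ i * (\<Sum>e\<in>UNIV. g x $ i $ e * riemann_up g x e b j d))"
      unfolding riemann_def using h_sym[OF x] by (subst sum.swap) (simp add: numeral_2_eq_2 numeral_3_eq_3)
    also have "\<dots> = (\<Sum>j\<in>UNIV. riemann_up g x j b j d)" by (simp only: raise_lower[OF x])
    finally show ?thesis by (simp add: ricci_def)
  qed
  moreover have "(\<Sum>i\<in>UNIV. \<Sum>j\<in>UNIV. h x $ i $ j * gg x [i,b,j,d]) = 3 * g x $ b $ d"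
  proof -
    have "(\<Sum>i\<in>UNIV. \<Sum>j\<in>UNIV. h x $ i $ j * gg x [i,b,j,d]) =
       (\<Sum>i\<in>UNIV. \<Sum>j\<in>UNIV. h x $ i $ j * g x $ j $ i) * g x $ b $ d
       - (\<Sum>i\<in>UNIV. (\<Sum>j\<in>UNIV. h x $ i $ j * g x $ j $ b) * g x $ i $ d)"
      unfolding gg4 using gs by (simp add: algebra_simps sum_subtractf sum_distrib_left sum_distrib_right)
    also have "\<dots> = 4 * g x $ b $ d - (\<Sum>i\<in>UNIV. if i = b then g x $ i $ d else 0)"
      unfolding hg[OF x] by (intro arg_cong2[where f="(-)"] sum.cong) auto
    finally show ?thesis by simp
  qed
  ultimately show "(\<Sum>i\<in>UNIV. \<Sum>j\<in>UNIV. h x $ i $ j * weyl g x [i,b,j,d]) = 0"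
    unfolding w by (simp add: right_diff_distrib sum_subtractf sum_distrib_left[symmetric] mult.left_commute[of _ lam]
      mult.left_commute[of _ "lam/3"] ric del: times_divide_eq_left)
qed

lemma bianchi_weyl:
  assumes ric: "\<And>x a b. x \<in> S \<Longrightarrow> ricci g x $ a $ b = lam * g x $ a $ b" and x: "x \<in> S"
  shows "nabla g (weyl g) x [e,a,b,c,d] + nabla g (weyl g) x [c,a,b,d,e] + nabla g (weyl g) x [d,a,b,e,c] = 0"
  using bianchi_riemann[OF x] by (simp only: nabla_weyl_einstein[OF ric x])

text \<open>\<open>D\<close> holds the derivative indices already present. The symmetries have
  constant coefficients and so pass to the partial derivative and to the sums of Christoffel
  corrections; the trace passes because the inverse metric is parallel.\<close>

lemma weyl_sym_nabla:
  assumes T: "\<And>I. smooth_on S (\<lambda>x. T x I)"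
    and W: "\<And>x D. x \<in> S \<Longrightarrow> length D = r \<Longrightarrow> weyl_sym (h x) (\<lambda>a b c d. T x (D @ [a,b,c,d]))"
    and x: "x \<in> S" and D: "length D = r"
  shows "weyl_sym (h x) (\<lambda>a b c d. nabla g T x (e # D @ [a,b,c,d]))"
  unfolding weyl_sym_def
proof (intro allI conjI)
  fix a b c d
  have w1: "T y (D @ [a,b,c,d]) = - T y (D @ [b,a,c,d])" if "y \<in> S" "length D = r" for y D a b c d
    using W[OF that] unfolding weyl_sym_def by blast
  have w2: "T y (D @ [a,b,c,d]) = T y (D @ [c,d,a,b])" if "y \<in> S" "length D = r" for y D a b c d
    using W[OF that] unfolding weyl_sym_def by blast
  have w3: "T y (D @ [a,b,c,d]) + T y (D @ [a,c,d,b]) + T y (D @ [a,d,b,c]) = 0" if "y \<in> S" "length D = r" for y D a b c d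
    using W[OF that] unfolding weyl_sym_def by blast
  have w4: "(\<Sum>i\<in>UNIV. \<Sum>j\<in>UNIV. h y $ i $ j * T y (D @ [i,b,j,d])) = 0" if "y \<in> S" "length D = r" for y D b d
    using W[OF that] unfolding weyl_sym_def by blast
  note sT = sd[OF T x]
  define F where "F = (\<lambda>a b c d. (\<Sum>k<length D. \<Sum>i\<in>UNIV. \<Gamma> x i e (D ! k) * T x (D[k := i] @ [a,b,c,d])))"
  have n: "nabla g T x (e # D @ [a,b,c,d]) = partial e (\<lambda>y. T y (D @ [a,b,c,d])) x - F a b c d
   - (\<Sum>k\<in>UNIV. \<Gamma> x k e a * T x (D @ [k,b,c,d])) - (\<Sum>k\<in>UNIV. \<Gamma> x k e b * T x (D @ [a,k,c,d]))
   - (\<Sum>k\<in>UNIV. \<Gamma> x k e c * T x (D @ [a,b,k,d])) - (\<Sum>k\<in>UNIV. \<Gamma> x k e d * T x (D @ [a,b,c,k]))" for a b c d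
    unfolding F_def by (rule nabla_append4)
  have F1: "F a b c d = - F b a c d" for a b c d
  proof -
    have "F a b c d = (\<Sum>k<length D. \<Sum>i\<in>UNIV. \<Gamma> x i e (D ! k) * - T x (D[k := i] @ [b,a,c,d]))"
      unfolding F_def by (intro sum.cong refl arg_cong2[where f="(*)"] w1 x) (simp add: D)
    then show ?thesis unfolding F_def by (simp only: mult_minus_right sum_negf)
  qed
  have F2: "F a b c d = F c d a b" for a b c d
    unfolding F_def by (intro sum.cong refl arg_cong2[where f="(*)"] w2 x) (simp add: D)
  have F3: "F a b c d + F a c d b + F a d b c = 0" for a b c d
    unfolding F_def sum.distrib[symmetric] distrib_left[symmetric] by (simp add: w3 x D)
  have "partial e (\<lambda>y. T y (D @ [a,b,c,d])) x = partial e (\<lambda>y. - T y (D @ [b,a,c,d])) x"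
    by (rule partial_cong[OF openS x], rule w1[OF _ D])
  then have p1: "partial e (\<lambda>y. T y (D @ [a,b,c,d])) x = - partial e (\<lambda>y. T y (D @ [b,a,c,d])) x"
    by (simp add: partial_minus sT)
  show "nabla g T x (e # D @ [a,b,c,d]) = - nabla g T x (e # D @ [b,a,c,d])"
    unfolding n p1 F1[of a b] w1[OF x D, of a] w1[OF x D, of _ b] 
    by (simp add: sum_negf)
  have p2: "partial e (\<lambda>y. T y (D @ [a,b,c,d])) x = partial e (\<lambda>y. T y (D @ [c,d,a,b])) x"
    by (rule partial_cong[OF openS x], rule w2[OF _ D])
  show "nabla g T x (e # D @ [a,b,c,d]) = nabla g T x (e # D @ [c,d,a,b])"
    unfolding n p2 F2[of a b] w2[OF x D, of a b] w2[OF x D, of _ b c d] w2[OF x D, of a _ c d] by simp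
  have "partial e (\<lambda>y. T y (D @ [a,b,c,d]) + T y (D @ [a,c,d,b]) + T y (D @ [a,d,b,c])) x = partial e (\<lambda>y. 0) x"
    by (rule partial_cong[OF openS x], rule w3[OF _ D])
  then have p3: "partial e (\<lambda>y. T y (D @ [a,b,c,d])) x + partial e (\<lambda>y. T y (D @ [a,c,d,b])) x + partial e (\<lambda>y. T y (D @ [a,d,b,c])) x = 0"
    by (simp add: partial_add sT differentiable_add)
  have s3: "(\<Sum>k\<in>UNIV. q k * A k) + (\<Sum>k\<in>UNIV. q k * B k) + (\<Sum>k\<in>UNIV. q k * C k) = 0"
    if "\<And>k. A k + B k + C k = 0" for q A B C :: "4 \<Rightarrow> real"
    using that by (simp flip: sum.distrib distrib_left)
  show "nabla g T x (e # D @ [a,b,c,d]) + nabla g T x (e # D @ [a,c,d,b]) + nabla g T x (e # D @ [a,d,b,c]) = 0"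
    unfolding n using p3 F3[of a b c d]
      s3[of "\<lambda>k. T x (D @ [k,b,c,d])" "\<lambda>k. T x (D @ [k,c,d,b])" "\<lambda>k. T x (D @ [k,d,b,c])" "\<lambda>k. \<Gamma> x k e a", OF w3[OF x D]]
      s3[of "\<lambda>k. T x (D @ [a,k,c,d])" "\<lambda>k. T x (D @ [a,c,d,k])" "\<lambda>k. T x (D @ [a,d,k,c])" "\<lambda>k. \<Gamma> x k e b", OF w3[OF x D]]
      s3[of "\<lambda>k. T x (D @ [a,b,k,d])" "\<lambda>k. T x (D @ [a,k,d,b])" "\<lambda>k. T x (D @ [a,d,b,k])" "\<lambda>k. \<Gamma> x k e c", OF w3[OF x D]]
      s3[of "\<lambda>k. T x (D @ [a,b,c,k])" "\<lambda>k. T x (D @ [a,c,k,b])" "\<lambda>k. T x (D @ [a,k,b,c])" "\<lambda>k. \<Gamma> x k e d", OF w3[OF x D]]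
    by argo
  have "partial e (\<lambda>y. \<Sum>i\<in>UNIV. \<Sum>j\<in>UNIV. h y $ i $ j * T y (D @ [i,b,j,d])) x = partial e (\<lambda>y. 0) x"
    by (rule partial_cong[OF openS x], rule w4[OF _ D])
  then have p4: "(\<Sum>i\<in>UNIV. \<Sum>j\<in>UNIV. h x $ i $ j * (partial e (\<lambda>y. T y (D @ [i,b,j,d])) x
      - (\<Sum>k\<in>UNIV. \<Gamma> x k e i * T x (D @ [k,b,j,d])) - (\<Sum>k\<in>UNIV. \<Gamma> x k e j * T x (D @ [i,b,k,d])))) = 0"
    by (simp add: partial_trace[OF x T])
  have F4: "(\<Sum>i\<in>UNIV. \<Sum>j\<in>UNIV. h x $ i $ j * F i b j d) = 0"
  proof -
    have "(\<Sum>i\<in>UNIV. \<Sum>j\<in>UNIV. h x $ i $ j * (q * T x (D[k := m] @ [i,b,j,d]))) = 0" for q k m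
      using sum_pull[where K="{0::nat}" and q="\<lambda>_. q" and A=UNIV and C=UNIV and h="\<lambda>i j. h x $ i $ j" 
          and F="\<lambda>_ i j. T x (D[k := m] @ [i,b,j,d])"] by (simp add: w4 x D)
    then show ?thesis unfolding F_def sum_pull[where q="\<lambda>k. 1", simplified] by simp
  qed
  have b4: "(\<Sum>i\<in>UNIV. \<Sum>j\<in>UNIV. h x $ i $ j * (\<Sum>k\<in>UNIV. \<Gamma> x k e b * T x (D @ [i,k,j,d]))) = 0"
    unfolding sum_pull by (simp add: w4 x D)
  have d4: "(\<Sum>i\<in>UNIV. \<Sum>j\<in>UNIV. h x $ i $ j * (\<Sum>k\<in>UNIV. \<Gamma> x k e d * T x (D @ [i,b,j,k]))) = 0"
    unfolding sum_pull by (simp add: w4 x D)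
  show "(\<Sum>i\<in>UNIV. \<Sum>j\<in>UNIV. h x $ i $ j * nabla g T x (e # D @ [i,b,j,d])) = 0"
    unfolding n using p4 F4 b4 d4 by (simp add: right_diff_distrib sum_subtractf)
qed

text \<open>The covariant derivative \<open>X\<^sup>i\<^sub>;\<^sub>e\<close> of a vector field.\<close>

definition vd :: "(real^4 \<Rightarrow> real^4) \<Rightarrow> real^4 \<Rightarrow> 4 \<Rightarrow> 4 \<Rightarrow> real" where
  "vd X x i e = partial e (\<lambda>y. X y $ i) x + (\<Sum>k\<in>UNIV. \<Gamma> x i e k * X x $ k)"

lemma smooth_vd: "(\<And>i. smooth_on S (\<lambda>x. X x $ i)) \<Longrightarrow> smooth_on S (\<lambda>x. vd X x i e)"
  unfolding vd_def by (intro smooth_on_add smooth_on_sum smooth_on_mult smooth_on_partial openS smooth_christoffel)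

text \<open>Leibniz rule: the Christoffel term in \<open>vd\<close> cancels the correction of the
  contracted slot.\<close>

lemma nabla_contract0:
  assumes x: "x \<in> S" and X: "\<And>i. smooth_on S (\<lambda>x. X x $ i)" and T: "\<And>I. smooth_on S (\<lambda>x. T x I)"
  shows "nabla g (\<lambda>y I. \<Sum>i\<in>UNIV. X y $ i * T y (i # I)) x (e # I) =
    (\<Sum>i\<in>UNIV. X x $ i * nabla g T x (e # i # I)) + (\<Sum>i\<in>UNIV. vd X x i e * T x (i # I))"
proof -
  have 1: "partial e (\<lambda>y. \<Sum>i\<in>UNIV. X y $ i * T y (i # I)) x =
     (\<Sum>i\<in>UNIV. partial e (\<lambda>y. X y $ i) x * T x (i # I)) + (\<Sum>i\<in>UNIV. X x $ i * partial e (\<lambda>y. T y (i # I)) x)"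
    by (simp add: partial_sum partial_mult sd[OF _ x] smooth_on_mult openS X T sum.distrib)
  have 2: "(\<Sum>i\<in>UNIV. vd X x i e * T x (i # I)) = (\<Sum>i\<in>UNIV. partial e (\<lambda>y. X y $ i) x * T x (i # I))
     + (\<Sum>i\<in>UNIV. X x $ i * (\<Sum>d\<in>UNIV. \<Gamma> x d e i * T x (d # I)))"
  proof -
    have "(\<Sum>i\<in>UNIV. (\<Sum>k\<in>UNIV. \<Gamma> x i e k * X x $ k) * T x (i # I)) = 
      (\<Sum>i\<in>UNIV. X x $ i * (\<Sum>d\<in>UNIV. \<Gamma> x d e i * T x (d # I)))"
      unfolding sum_distrib_right sum_distrib_left by (subst sum.swap) (simp add: mult_ac)
    then show ?thesis unfolding vd_def by (simp add: distrib_right sum.distrib)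
  qed
  have 3: "nabla g T x (e # i # I) = partial e (\<lambda>y. T y (i # I)) x - (\<Sum>d\<in>UNIV. \<Gamma> x d e i * T x (d # I))
     - (\<Sum>k<length I. \<Sum>d\<in>UNIV. \<Gamma> x d e (I ! k) * T x (i # I[k := d]))" for i
    by (simp add: sum.lessThan_Suc_shift del: sum.lessThan_Suc)
  have 4: "(\<Sum>k<length I. \<Sum>d\<in>UNIV. \<Gamma> x d e (I ! k) * (\<Sum>i\<in>UNIV. X x $ i * T x (i # I[k := d]))) =
     (\<Sum>i\<in>UNIV. X x $ i * (\<Sum>k<length I. \<Sum>d\<in>UNIV. \<Gamma> x d e (I ! k) * T x (i # I[k := d])))"
  proof -
    have "(\<Sum>k<length I. \<Sum>d\<in>UNIV. \<Gamma> x d e (I ! k) * (\<Sum>i\<in>UNIV. X x $ i * T x (i # I[k := d]))) =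
      (\<Sum>i\<in>UNIV. X x $ i * (\<Sum>k<length I. \<Sum>d\<in>UNIV. \<Gamma> x d e (I ! k) * T x (i # I[k := d])))"
      by (rule sum_pull)
    then show ?thesis .
  qed
  show ?thesis
    unfolding nabla.simps(2)[of _ _ _ _ I] 1 2 3 4
    by (simp add: right_diff_distrib sum_subtractf del: nabla.simps)
qed

text \<open>Exchanging the first two slots of \<open>T\<close> reduces this to
  \<open>nabla_contract0\<close>.\<close>

lemma nabla_contract1:
  assumes x: "x \<in> S" and X: "\<And>i. smooth_on S (\<lambda>x. X x $ i)" and T: "\<And>I. smooth_on S (\<lambda>x. T x I)"
  shows "nabla g (\<lambda>y I. \<Sum>i\<in>UNIV. X y $ i * T y (hd I # i # tl I)) x (e # a # I) =
    (\<Sum>i\<in>UNIV. X x $ i * nabla g T x (e # a # i # I)) + (\<Sum>i\<in>UNIV. vd X x i e * T x (a # i # I))"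
proof -
  let ?T' = "\<lambda>y J. T y (hd (tl J) # hd J # tl (tl J))"
  have "nabla g ?T' x (e # i # a # I) = nabla g T x (e # a # i # I)" for i
    by (simp add: sum.lessThan_Suc_shift add.commute del: sum.lessThan_Suc)
  then show ?thesis using nabla_contract0[OF x X, of ?T' e "a # I"] T by (simp del: nabla.simps)
qed

lemma nabla_cong:
  assumes x: "x \<in> S" and "\<And>y J. y \<in> S \<Longrightarrow> length J = length I \<Longrightarrow> T y J = T' y J"
  shows "nabla g T x (e # I) = nabla g T' x (e # I)"
proof -
  have "partial e (\<lambda>y. T y I) x = partial e (\<lambda>y. T' y I) x"
    using assms by (intro partial_cong[OF openS x]) auto
  then show ?thesis using assms by simp
qed

end

section \<open>Frame components and complete contractions\<close>

lemma UNIV_4': "(UNIV :: 4 set) = {0, 1, 2, 3}"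
proof -
  have "x \<in> {0,1,2,3}" for x :: 4 using exhaust_4[of x] by auto
  then show ?thesis by blast
qed

lemma sum_4': "(\<Sum>a\<in>(UNIV::4 set). f a) = f 0 + f 1 + f 2 + (f 3 :: real)"
  unfolding UNIV_4' by simp

lemma forall_4': "(\<forall>a::4. P a) \<longleftrightarrow> P 0 \<and> P 1 \<and> P 2 \<and> P 3"
proof -
  have "(\<forall>a::4. P a) \<longleftrightarrow> (\<forall>a\<in>UNIV. P a)" by simp
  then show ?thesis unfolding UNIV_4' by simp
qed

text \<open>Multilinear evaluation on vectors. The recursion on the list makes linearity in every
  argument an induction.\<close>

primrec tev :: "(real^4) list \<Rightarrow> tensor \<Rightarrow> real" where
  "tev [] T = T []"
| "tev (v # vs) T = (\<Sum>i\<in>UNIV. v $ i * tev vs (\<lambda>I. T (i # I)))"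

lemma tev_sum: "tev vs (\<lambda>I. \<Sum>k\<in>K. q k * T k I) = (\<Sum>k\<in>K. q k * tev vs (T k))"
proof (induction vs arbitrary: T)
  case (Cons v vs)
  have "tev (v # vs) (\<lambda>I. \<Sum>k\<in>K. q k * T k I) = (\<Sum>i\<in>UNIV. \<Sum>k\<in>K. v $ i * (q k * tev vs (\<lambda>I. T k (i # I))))"
    by (simp add: Cons.IH[of "\<lambda>k I. T k (_ # I)"] sum_distrib_left)
  also have "\<dots> = (\<Sum>k\<in>K. \<Sum>i\<in>UNIV. v $ i * (q k * tev vs (\<lambda>I. T k (i # I))))" by (rule sum.swap)
  finally show ?case by (simp add: sum_distrib_left mult_ac)
qed simp

lemma tev_scale: "tev vs (\<lambda>I. q * T I) = q * tev vs T"
  using tev_sum[where K="{()}" and q="\<lambda>_. q" and T="\<lambda>_. T"] by simp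

lemma tev_add: "tev vs (\<lambda>I. T I + U I) = tev vs T + tev vs U"
  using tev_sum[where K="UNIV :: bool set" and q="\<lambda>_. 1" and T="\<lambda>b. if b then T else U"] by (simp add: UNIV_bool add.commute)

lemma tev_minus: "tev vs (\<lambda>I. - T I) = - tev vs T"
  using tev_scale[of vs "-1" T] by simp

lemma tev_diff: "tev vs (\<lambda>I. T I - U I) = tev vs T - tev vs U"
  using tev_add[of vs T "\<lambda>I. - U I"] by (simp add: tev_minus)

lemma tev_zero [simp]: "tev vs (\<lambda>I. 0) = 0"
  using tev_scale[of vs 0] by simp

lemma tev_cong: "(\<And>I. length I = length vs \<Longrightarrow> T I = U I) \<Longrightarrow> tev vs T = tev vs U"
proof (induction vs arbitrary: T U)
  case (Cons v vs)
  have "tev vs (\<lambda>I. T (i # I)) = tev vs (\<lambda>I. U (i # I))" for i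
    by (rule Cons.IH) (simp add: Cons.prems)
  then show ?case by simp
qed simp

lemma tev_linear: "tev (us @ (\<Sum>k\<in>K. q k *\<^sub>R w k) # vs) T = (\<Sum>k\<in>K. q k * tev (us @ w k # vs) T)"
proof (induction us arbitrary: T)
  case Nil
  have "tev ((\<Sum>k\<in>K. q k *\<^sub>R w k) # vs) T = (\<Sum>i\<in>UNIV. \<Sum>k\<in>K. q k * (w k $ i * tev vs (\<lambda>I. T (i # I))))"
    by (simp add: sum_distrib_right mult.assoc)
  also have "\<dots> = (\<Sum>k\<in>K. \<Sum>i\<in>UNIV. q k * (w k $ i * tev vs (\<lambda>I. T (i # I))))" by (rule sum.swap)
  finally show ?case by (simp add: sum_distrib_left)
next
  case (Cons u us)
  have "(\<Sum>i\<in>UNIV. u $ i * (\<Sum>k\<in>K. q k * tev (us @ w k # vs) (\<lambda>I. T (i # I)))) =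
     (\<Sum>k\<in>K. q k * (\<Sum>i\<in>UNIV. u $ i * tev (us @ w k # vs) (\<lambda>I. T (i # I))))"
    unfolding sum_distrib_left by (subst sum.swap) (simp add: mult_ac)
  then show ?case by (simp add: Cons.IH)
qed

lemma finite_lists_length: "finite {I :: 4 list. length I = n}"
  using finite_lists_length_eq[of "UNIV :: 4 set" n] by simp

lemma sum_lists_Suc:
  "(\<Sum>I | length I = Suc n. F (I :: 4 list)) = (\<Sum>a\<in>UNIV. \<Sum>I | length I = n. F (a # I) :: real)"
proof -
  have "{I :: 4 list. length I = Suc n} = (\<lambda>(a, I). a # I) ` (UNIV \<times> {I. length I = n})"
    by (auto simp: length_Suc_conv image_iff)
  moreover have inj: "inj_on (\<lambda>(a, I). a # I) (UNIV \<times> {I :: 4 list. length I = n})" by (auto simp: inj_on_def)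
  ultimately show ?thesis
    by (simp only: sum.reindex[OF inj] sum.cartesian_product) (simp add: case_prod_unfold o_def)
qed

lemma sum_lists_0: "(\<Sum>I | length I = 0. F (I :: 4 list)) = (F [] :: real)" by simp

lemma sum_lists_add:
  "(\<Sum>I | length I = m + n. F (I :: 4 list)) = (\<Sum>I | length I = m. \<Sum>J | length J = n. F (I @ J) :: real)"
  by (induction m arbitrary: F) (simp_all add: sum_lists_Suc)

definition evp :: "(4 \<Rightarrow> real^4) \<Rightarrow> 4 list \<Rightarrow> 4 list \<Rightarrow> real" where
  "evp e J I = (\<Prod>k<length J. e (J ! k) $ (I ! k))"

lemma evp_Nil [simp]: "evp e [] I = 1" by (simp add: evp_def)
lemma evp_Cons [simp]: "evp e (j # J) (i # I) = e j $ i * evp e J I"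
  by (simp add: evp_def prod.lessThan_Suc_shift del: prod.lessThan_Suc)
lemma evp_append: "length J = length I \<Longrightarrow> evp e (J @ J') (I @ I') = evp e J I * evp e J' I'"
  by (induction J I rule: list_induct2) auto

lemma frame_component_evp: "frame_component T e J = (\<Sum>I | length I = length J. T I * evp e J I)"
  by (simp add: frame_component_def evp_def)

lemma frame_component_tev: "frame_component T e J = tev (map e J) T"
  unfolding frame_component_evp
proof (induction J arbitrary: T)
  case (Cons j J)
  show ?case by (simp add: Cons.IH[symmetric] sum_lists_Suc sum_distrib_left mult_ac)
qed simp

lemma evp_permute:
  assumes p: "\<pi> permutes {..<n}" and l: "length I = n" "length J = n"
  shows "evp e J (permute_list \<pi> I) = evp e (permute_list (inv \<pi>) J) I"
proof -
  have ip: "inv \<pi> permutes {..<n}" by (rule permutes_inv[OF p])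
  have "evp e J (permute_list \<pi> I) = (\<Prod>k<n. e (J ! k) $ (I ! \<pi> k))"
    unfolding evp_def l(2) by (intro prod.cong refl) (simp add: permute_list_nth[OF p[folded l(1)]] l)
  also have "\<dots> = (\<Prod>k<n. e (J ! inv \<pi> k) $ (I ! k))"
    by (subst prod.permute[OF ip]) (simp add: o_def permutes_inverses[OF p])
  also have "\<dots> = evp e (permute_list (inv \<pi>) J) I"
    unfolding evp_def length_permute_list l(2)
    by (intro prod.cong refl) (simp add: permute_list_nth[OF ip[folded l(2)]] l)
  finally show ?thesis .
qed

text \<open>\<open>e\<close> is a frame in which the inverse metric \<open>H\<close> pairs \<open>a\<close> with \<open>st a\<close>, with sign \<open>s a\<close>.\<close>

definition pairing_frame :: "real^4^4 \<Rightarrow> (4 \<Rightarrow> real^4) \<Rightarrow> (4 \<Rightarrow> real) \<Rightarrow> (4 \<Rightarrow> 4) \<Rightarrow> bool" where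
  "pairing_frame H e s st \<longleftrightarrow> (\<forall>i j. H $ i $ j = (\<Sum>a\<in>UNIV. s a * e a $ i * e (st a) $ j))"

text \<open>The index pattern left when each inverse metric is expanded in a pairing frame: one free
  index per contracted pair.\<close>

definition zz :: "(4 \<Rightarrow> 4) \<Rightarrow> 4 list \<Rightarrow> 4 list" where
  "zz st K = concat (map (\<lambda>a. [a, st a]) K)"

lemma zz_simps [simp]: "zz st [] = []" "zz st (a # K) = a # st a # zz st K"
  by (simp_all add: zz_def)

lemma length_zz [simp]: "length (zz st K) = 2 * length K"
  by (induction K) auto

lemma pair_product_frame:
  assumes H: "pairing_frame H e s st" and "length I = 2 * n"
  shows "pair_product H I = (\<Sum>K | length K = n. (\<Prod>a\<leftarrow>K. s a) * evp e (zz st K) I)"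
  using assms(2)
proof (induction n arbitrary: I)
  case (Suc n)
  then obtain i j I' where I: "I = i # j # I'" "length I' = 2 * n"
    by (auto simp: length_Suc_conv numeral_2_eq_2)
  have "pair_product H I = (\<Sum>a\<in>UNIV. s a * e a $ i * e (st a) $ j) * (\<Sum>K | length K = n. (\<Prod>a\<leftarrow>K. s a) * evp e (zz st K) I')"
    using H Suc.IH[OF I(2)] by (simp add: I(1) pairing_frame_def)
  also have "\<dots> = (\<Sum>a\<in>UNIV. \<Sum>K | length K = n. (s a * e a $ i * e (st a) $ j) * ((\<Prod>a\<leftarrow>K. s a) * evp e (zz st K) I'))"
    by (rule sum_product)
  finally show ?case by (simp add: I(1) sum_lists_Suc mult_ac)
qed simp

lemma tensor_product_frame:
  "length J = sum_list (map fst Ts) \<Longrightarrow>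
   (\<Sum>I | length I = sum_list (map fst Ts). tensor_product Ts I * evp e J I) =
    tensor_product (map (\<lambda>(r, T). (r, frame_component T e)) Ts) J"
proof (induction Ts arbitrary: J)
  case (Cons t Ts)
  obtain r T where t: "t = (r, T)" by fastforce
  let ?n = "sum_list (map fst Ts)"
  obtain J1 J2 where J: "J = J1 @ J2" "length J1 = r" "length J2 = ?n"
    using Cons.prems that[of "take r J" "drop r J"] by (simp add: t)
  have "(\<Sum>I | length I = r + ?n. tensor_product ((r, T) # Ts) I * evp e J I) =
     (\<Sum>I | length I = r. \<Sum>I' | length I' = ?n. (T I * evp e J1 I) * (tensor_product Ts I' * evp e J2 I'))"
    unfolding sum_lists_add by (intro sum.cong refl) (auto simp: J evp_append)
  also have "\<dots> = frame_component T e J1 * (\<Sum>I' | length I' = ?n. tensor_product Ts I' * evp e J2 I')"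
    by (simp add: frame_component_evp J sum_product)
  finally show ?case by (simp add: t Cons.IH[OF J(3)] J)
qed simp

text \<open>Each inverse metric is expanded in the frame, after which the coordinate sums assemble
  into frame components. The permutation moves from the coordinate indices to the frame indices and
  is inverted thereby.\<close>

lemma complete_contraction_frame:
  assumes H: "pairing_frame (matrix_inv G) e s st" and n: "sum_list (map fst Ts) = 2 * n"
    and p: "\<pi> permutes {..<2 * n}"
  shows "complete_contraction G Ts \<pi> = (\<Sum>K | length K = n. (\<Prod>a\<leftarrow>K. s a) *
     tensor_product (map (\<lambda>(r, T). (r, frame_component T e)) Ts) (permute_list (inv \<pi>) (zz st K)))"
proof -
  have "complete_contraction G Ts \<pi> = (\<Sum>I | length I = 2 * n. tensor_product Ts I *
      (\<Sum>K | length K = n. (\<Prod>a\<leftarrow>K. s a) * evp e (permute_list (inv \<pi>) (zz st K)) I))"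
    unfolding complete_contraction_def n
    by (intro sum.cong refl) (auto simp: pair_product_frame[OF H] evp_permute[OF p])
  also have "\<dots> = (\<Sum>I | length I = 2 * n. \<Sum>K | length K = n. (\<Prod>a\<leftarrow>K. s a) *
      (tensor_product Ts I * evp e (permute_list (inv \<pi>) (zz st K)) I))"
    by (simp add: sum_distrib_left mult_ac)
  also have "\<dots> = (\<Sum>K | length K = n. (\<Prod>a\<leftarrow>K. s a) *
      (\<Sum>I | length I = 2 * n. tensor_product Ts I * evp e (permute_list (inv \<pi>) (zz st K)) I))"
    by (subst sum.swap) (simp add: sum_distrib_left)
  also have "\<dots> = (\<Sum>K | length K = n. (\<Prod>a\<leftarrow>K. s a) *
     tensor_product (map (\<lambda>(r, T). (r, frame_component T e)) Ts) (permute_list (inv \<pi>) (zz st K)))"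
    by (intro sum.cong refl arg_cong2[where f="(*)"])
      (rule tensor_product_frame[where e=e and Ts=Ts, unfolded n], simp add: n)
  finally show ?thesis .
qed

text \<open>A permutation written as the list of its values; it is the identity beyond the list, as
  \<open>permutes\<close> demands.\<close>

definition list_perm :: "nat list \<Rightarrow> nat \<Rightarrow> nat" where
  "list_perm p i = (if i < length p then p ! i else i)"

lemma list_perm_permutes:
  assumes "distinct p" "\<forall>i\<in>set p. i < length p" shows "list_perm p permutes {..<length p}"
proof (rule bij_imp_permutes)
  have "set p \<subseteq> {..<length p}" using assms by auto
  then have s: "set p = {..<length p}"
    using assms(1) by (simp add: card_subset_eq distinct_card)
  have "bij_betw ((!) p) {..<length p} (set p)" using assms(1) by (simp add: bij_betw_nth)
  then have "bij_betw ((!) p) {..<length p} {..<length p}" by (simp add: s)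
  then show "bij_betw (list_perm p) {..<length p} {..<length p}"
    by (rule bij_betw_cong[THEN iffD1, rotated]) (simp add: list_perm_def)
qed (auto simp: list_perm_def)

text \<open>The list \<open>p\<close> encodes a contraction scheme: the slots of the tensor product,
  read from left to right, take the entries of \<open>zz st K\<close> at the positions in
  \<open>p\<close>, where position 2i is the summation index number i and position 2i+1 its partner
  under \<open>st\<close>. The invariant is taken with the inverse permutation, which undoes the
  inversion in \<open>complete_contraction_frame\<close>.\<close>

lemma invariant_frame:
  assumes inv: "\<And>f x. f \<in> polynomial_invariants g T r m \<Longrightarrow> x \<in> S \<Longrightarrow> f x = 0" and x: "x \<in> S"
    and H: "pairing_frame (matrix_inv (g x)) e s st"
    and ks: "ks \<noteq> []" "set ks \<subseteq> {..m}" "(\<Sum>k\<leftarrow>ks. r + k) = 2 * n"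
    and p: "distinct p" "\<forall>i\<in>set p. i < length p" "length p = 2 * n"
  shows "(\<Sum>K | length K = n. (\<Prod>a\<leftarrow>K. s a) *
     tensor_product (map (\<lambda>k. (r + k, frame_component ((nabla g ^^ k) T x) e)) ks) (map ((!) (zz st K)) p)) = 0"
proof -
  let ?\<sigma> = "list_perm p"
  have s: "?\<sigma> permutes {..<2 * n}" using list_perm_permutes[OF p(1,2)] p(3) by simp
  have ips: "inv ?\<sigma> permutes {..<2 * n}" by (rule permutes_inv[OF s])
  have "(\<lambda>x. complete_contraction (g x) (map (\<lambda>k. (r + k, (nabla g ^^ k) T x)) ks) (inv ?\<sigma>))
      \<in> polynomial_invariants g T r m"
    using ks ips by (intro polynomial_invariants.contraction) auto
  from inv[OF this x]
  have "complete_contraction (g x) (map (\<lambda>k. (r + k, (nabla g ^^ k) T x)) ks) (inv ?\<sigma>) = 0" .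
  moreover have "sum_list (map fst (map (\<lambda>k. (r + k, (nabla g ^^ k) T x)) ks)) = 2 * n"
    using ks(3) by (simp add: o_def)
  ultimately have 0: "(\<Sum>K | length K = n. (\<Prod>a\<leftarrow>K. s a) *
     tensor_product (map (\<lambda>k. (r + k, frame_component ((nabla g ^^ k) T x) e)) ks) (permute_list ?\<sigma> (zz st K))) = 0"
    using complete_contraction_frame[OF H _ ips] inv_inv_eq[OF permutes_bij[OF s]] by (simp add: o_def)
  have "permute_list ?\<sigma> (zz st K) = map ((!) (zz st K)) p" if "length K = n" for K
    using that p(3) by (intro nth_equalityI) (simp_all add: permute_list_def list_perm_def)
  then have "(\<Sum>K | length K = n. (\<Prod>a\<leftarrow>K. s a) *
     tensor_product (map (\<lambda>k. (r + k, frame_component ((nabla g ^^ k) T x) e)) ks) (permute_list ?\<sigma> (zz st K))) =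
    (\<Sum>K | length K = n. (\<Prod>a\<leftarrow>K. s a) *
     tensor_product (map (\<lambda>k. (r + k, frame_component ((nabla g ^^ k) T x) e)) ks) (map ((!) (zz st K)) p))"
    by (intro sum.cong) auto
  with 0 show ?thesis by simp
qed

definition st01 :: "4 \<Rightarrow> 4" where "st01 a = (if a = 0 then 1 else if a = 1 then 0 else a)"

lemma st01_simps [simp]: "st01 0 = 1" "st01 1 = 0" "st01 2 = 2" "st01 3 = 3"
  by (simp_all add: st01_def)

lemma sum_lists_10: "(\<Sum>I | length I = 10. F (I :: 4 list)) = (\<Sum>a\<in>UNIV. \<Sum>b\<in>UNIV. \<Sum>c\<in>UNIV. \<Sum>d\<in>UNIV. \<Sum>i\<in>UNIV.
  \<Sum>j\<in>UNIV. \<Sum>k\<in>UNIV. \<Sum>l\<in>UNIV. \<Sum>m\<in>UNIV. \<Sum>n\<in>UNIV. F [a,b,c,d,i,j,k,l,m,n] :: real)"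
proof -
  have "(10::nat) = Suc (Suc (Suc (Suc (Suc (Suc (Suc (Suc (Suc (Suc 0)))))))))" by simp
  then show ?thesis by (simp only: sum_lists_Suc sum_lists_0)
qed

lemma sum_lists_12: "(\<Sum>I | length I = 12. F (I :: 4 list)) = (\<Sum>a\<in>UNIV. \<Sum>b\<in>UNIV. \<Sum>c\<in>UNIV. \<Sum>d\<in>UNIV. \<Sum>i\<in>UNIV.
  \<Sum>j\<in>UNIV. \<Sum>k\<in>UNIV. \<Sum>l\<in>UNIV. \<Sum>m\<in>UNIV. \<Sum>n\<in>UNIV. \<Sum>p\<in>UNIV. \<Sum>q\<in>UNIV. F [a,b,c,d,i,j,k,l,m,n,p,q] :: real)"
proof -
  have "(12::nat) = Suc (Suc (Suc (Suc (Suc (Suc (Suc (Suc (Suc (Suc (Suc (Suc 0)))))))))))" by simp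
  then show ?thesis by (simp only: sum_lists_Suc sum_lists_0)
qed

text \<open>The tensor slots are contracted inside each of the two products, the derivative indices
  \<open>d\<close> and \<open>d'\<close> between the products. This crosswise pattern later yields
  squares.\<close>

lemma quartic_sum_1:
  assumes inv: "\<And>f x. f \<in> polynomial_invariants g T 4 m \<Longrightarrow> x \<in> S \<Longrightarrow> f x = 0" and x: "x \<in> S" and m: "1 \<le> m"
    and H: "pairing_frame (matrix_inv (g x)) e (\<lambda>_. 1) st"
    and F: "F = frame_component (nabla g T x) e"
  shows "(\<Sum>d\<in>UNIV. \<Sum>d'\<in>UNIV. 
     (\<Sum>a\<in>UNIV. \<Sum>b\<in>UNIV. \<Sum>c\<in>UNIV. \<Sum>k\<in>UNIV. F [d,a,b,c,k] * F [d', st a, st b, st c, st k]) *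
     (\<Sum>a\<in>UNIV. \<Sum>b\<in>UNIV. \<Sum>c\<in>UNIV. \<Sum>k\<in>UNIV. F [st d,a,b,c,k] * F [st d', st a, st b, st c, st k])) = 0"
proof -
  \<comment> \<open>The summation indices are numbered in the order d, d', a, b, c, k, a', b', c',
    k'; each group of five positions is one factor.\<close>
  define p :: "nat list" where "p = [0,4,6,8,10, 2,5,7,9,11, 1,12,14,16,18, 3,13,15,17,19]"
  have 0: "(\<Sum>K | length K = 10. (\<Prod>a\<leftarrow>K. 1) *
     tensor_product (map (\<lambda>k. (4 + k, frame_component ((nabla g ^^ k) T x) e)) [1,1,1,1]) (map ((!) (zz st K)) p)) = 0"
    using m by (intro invariant_frame[where T=T and r=4 and m=m and g=g and x=x and S=S, OF _ x H] inv) (simp_all add: p_def)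
  have tp: "tensor_product [(5,F),(5,F),(5,F),(5,F)] (map ((!) (zz st [d,d',a,b,c,k,a',b',c',k'])) p) = 
     F [d,a,b,c,k] * (F [d', st a, st b, st c, st k] * (F [st d,a',b',c',k'] * F [st d', st a', st b', st c', st k']))" for d d' a b c k a' b' c' k'
    by (simp add: p_def)
  have "map (\<lambda>k. (4 + k, frame_component ((nabla g ^^ k) T x) e)) [1,1,1,1] = [(5,F),(5,F),(5,F),(5,F)]"
    by (simp add: F)
  from 0[unfolded this sum_lists_10 tp]
  show ?thesis unfolding sum_distrib_right unfolding sum_distrib_left by (simp add: mult.assoc)
qed

text \<open>The same pattern with two derivative indices per factor.\<close>

lemma quartic_sum_2:
  assumes inv: "\<And>f x. f \<in> polynomial_invariants g T 4 m \<Longrightarrow> x \<in> S \<Longrightarrow> f x = 0" and x: "x \<in> S" and m: "2 \<le> m"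
    and H: "pairing_frame (matrix_inv (g x)) e (\<lambda>_. 1) st"
    and F: "F = frame_component (nabla g (nabla g T) x) e"
  shows "(\<Sum>f\<in>UNIV. \<Sum>d\<in>UNIV. \<Sum>f'\<in>UNIV. \<Sum>d'\<in>UNIV. 
     (\<Sum>a\<in>UNIV. \<Sum>b\<in>UNIV. \<Sum>c\<in>UNIV. \<Sum>k\<in>UNIV. F [f,d,a,b,c,k] * F [f',d', st a, st b, st c, st k]) *
     (\<Sum>a\<in>UNIV. \<Sum>b\<in>UNIV. \<Sum>c\<in>UNIV. \<Sum>k\<in>UNIV. F [st f,st d,a,b,c,k] * F [st f',st d', st a, st b, st c, st k])) = 0"
proof -
  \<comment> \<open>Here the order is f, d, f', d', a, b, c, k, a', b', c', k', with six positions
    per factor.\<close>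
  define p :: "nat list" where "p = [0,2,8,10,12,14, 4,6,9,11,13,15, 1,3,16,18,20,22, 5,7,17,19,21,23]"
  have 0: "(\<Sum>K | length K = 12. (\<Prod>a\<leftarrow>K. 1) *
     tensor_product (map (\<lambda>k. (4 + k, frame_component ((nabla g ^^ k) T x) e)) [2,2,2,2]) (map ((!) (zz st K)) p)) = 0"
    using m by (intro invariant_frame[where T=T and r=4 and m=m and g=g and x=x and S=S, OF _ x H] inv) (simp_all add: p_def)
  have tp: "tensor_product [(6,F),(6,F),(6,F),(6,F)] (map ((!) (zz st [f,d,f',d',a,b,c,k,a',b',c',k'])) p) = 
     F [f,d,a,b,c,k] * (F [f',d', st a, st b, st c, st k] * (F [st f,st d,a',b',c',k'] * F [st f',st d', st a', st b', st c', st k']))" 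
     for f f' d d' a b c k a' b' c' k'
    by (simp add: p_def)
  have "map (\<lambda>k. (4 + k, frame_component ((nabla g ^^ k) T x) e)) [2,2,2,2] = [(6,F),(6,F),(6,F),(6,F)]"
    by (simp add: F numeral_2_eq_2)
  from 0[unfolded this sum_lists_12 tp]
  show ?thesis unfolding sum_distrib_right unfolding sum_distrib_left by (simp add: mult.assoc)
qed

section \<open>Null frames\<close>

lemma ip_sum: "ip G u v = (\<Sum>i\<in>UNIV. \<Sum>j\<in>UNIV. u $ i * G $ i $ j * v $ j)"
  unfolding ip_def inner_vec_def matrix_vector_mult_def by (simp add: sum_distrib_left mult.assoc)

lemma ip_commute: "lorentz_form G \<Longrightarrow> ip G u v = ip G v u"
proof -
  assume G: "lorentz_form G"
  have "u $ i * G $ i $ j * v $ j = v $ j * G $ j $ i * u $ i" for i j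
    using lorentz_form_symD[OF G, of i j] by simp
  then show ?thesis unfolding ip_sum by (subst sum.swap) (intro sum.cong refl)
qed

lemma null_frame_ip:
  assumes "null_frame G e" shows "ip G (e a) (e b) = (if b = st01 a then 1 else 0)"
proof -
  have "(if {a, b} = {0, 1} \<or> a = b \<and> a \<in> {2, 3} then 1 else 0) = (if b = st01 a then 1 else (0::real))"
  proof -
    have "\<forall>a b. (if {a, b} = {0, 1} \<or> a = b \<and> a \<in> {2, 3} then 1 else 0) = (if b = st01 a then 1 else (0::real))"
      unfolding forall_4' by (simp add: doubleton_eq_iff)
    then show ?thesis by blast
  qed
  then show ?thesis using assms unfolding null_frame_def by simp
qed

lemma st01_st01 [simp]: "st01 (st01 a) = a" by (simp add: st01_def)

lemma sum_st01: "(\<Sum>a\<in>UNIV. f (st01 a)) = (\<Sum>a\<in>(UNIV::4 set). f a :: real)"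
  unfolding sum_4' by simp

text \<open>The Gram matrix of the frame is the permutation \<open>st01\<close>, so F G E = 1;
  moving the one-sided inverse to the other side gives E F as the inverse metric.\<close>

lemma null_frame_pairing:
  assumes e: "null_frame G e" and G: "invertible G"
  shows "pairing_frame (matrix_inv G) e (\<lambda>_. 1) st01"
proof -
  define E :: "real^4^4" where "E = (\<chi> i a. e a $ i)"
  define F :: "real^4^4" where "F = (\<chi> a j. e (st01 a) $ j)"
  have "(F ** G ** E) $ a $ b = mat 1 $ a $ b" for a b
  proof -
    have "(F ** G ** E) $ a $ b = ip G (e (st01 a)) (e b)"
      unfolding ip_sum matrix_matrix_mult_def F_def E_def
      by (simp add: sum_distrib_right) (rule sum.swap)
    then show ?thesis by (auto simp: null_frame_ip[OF e] mat_def)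
  qed
  then have "(F ** G) ** E = mat 1" by (simp add: vec_eq_iff)
  then have "E ** (F ** G) = mat 1" by (rule matrix_left_right_inverse[THEN iffD1])
  then have "(E ** F) ** (G ** matrix_inv G) = matrix_inv G" by (simp add: matrix_mul_assoc)
  then have "matrix_inv G = E ** F" by (simp add: matrix_inv_mult[OF G])
  then show ?thesis unfolding pairing_frame_def
    by (simp add: matrix_matrix_mult_def E_def F_def)
qed

lemma null_frame_expand:
  assumes e: "null_frame G e" and G: "lorentz_form G"
  shows "v = (\<Sum>a\<in>UNIV. ip G v (e (st01 a)) *\<^sub>R e a)"
proof -
  note inv = lorentz_form_symmetric(2)[OF G]
  have H: "matrix_inv G $ i $ j = (\<Sum>a\<in>UNIV. e a $ i * e (st01 a) $ j)" for i j
    using null_frame_pairing[OF e inv] by (simp add: pairing_frame_def)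
  have "v $ i = (\<Sum>a\<in>UNIV. ip G v (e (st01 a)) *\<^sub>R e a) $ i" for i
  proof -
    have "v = matrix_inv G *v (G *v v)" by (simp add: matrix_vector_mul_assoc matrix_inv_mult[OF inv])
    then have "v $ i = (\<Sum>j\<in>UNIV. (\<Sum>a\<in>UNIV. e a $ i * e (st01 a) $ j) * (\<Sum>k\<in>UNIV. G $ j $ k * v $ k))"
      by (metis (no_types, lifting) H matrix_vector_mult_def sum.cong vec_lambda_beta)
    also have "\<dots> = (\<Sum>a\<in>UNIV. \<Sum>j\<in>UNIV. \<Sum>k\<in>UNIV. e a $ i * (e (st01 a) $ j * G $ j $ k * v $ k))"
      unfolding sum_distrib_right by (subst sum.swap) (simp add: sum_distrib_left mult.assoc)
    also have "\<dots> = (\<Sum>a\<in>UNIV. e a $ i * ip G (e (st01 a)) v)"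
      unfolding ip_sum by (simp add: sum_distrib_left)
    also have "\<dots> = (\<Sum>a\<in>UNIV. e a $ i * ip G v (e (st01 a)))"
      by (simp add: ip_commute[OF G, of v])
    finally show ?thesis by (simp add: mult.commute)
  qed
  then show ?thesis by (simp add: vec_eq_iff)
qed

section \<open>Algebra of Weyl tensors in a null frame\<close>

text \<open>\<open>weyl_sym\<close> for frame components; the last line is the trace with the
  inverse metric of a null frame.\<close>

definition weyl_array :: "(4 \<Rightarrow> 4 \<Rightarrow> 4 \<Rightarrow> 4 \<Rightarrow> real) \<Rightarrow> bool" where
  "weyl_array X \<longleftrightarrow> (\<forall>a b c d. X a b c d = - X b a c d \<and> X a b c d = X c d a b \<and>
      X a b c d + X a c d b + X a d b c = 0 \<and>
      X 0 b 1 d + X 1 b 0 d + X 2 b 2 d + X 3 b 3 d = 0)"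

definition frame_array :: "(4 \<Rightarrow> real^4) \<Rightarrow> tensor \<Rightarrow> 4 \<Rightarrow> 4 \<Rightarrow> 4 \<Rightarrow> 4 \<Rightarrow> real" where
  "frame_array e T a b c d = tev [e a, e b, e c, e d] T"

lemma tev4_swap12: "tev [a,b,c,d] T = tev [b,a,c,d] (\<lambda>I. T [I!1, I!0, I!2, I!3])"
  by (simp add: sum_distrib_left numeral_3_eq_3) (subst sum.swap, simp add: mult_ac)

lemma tev4_swap34: "tev [a,b,c,d] T = tev [a,b,d,c] (\<lambda>I. T [I!0, I!1, I!3, I!2])"
proof -
  have "tev [c,d] U = tev [d,c] (\<lambda>I. U [I!1, I!0])" for U
    by (simp add: sum_distrib_left) (subst sum.swap, simp add: mult_ac)
  from this[of "\<lambda>I. T (_ # _ # I)"] show ?thesis by (simp add: numeral_3_eq_3 numeral_2_eq_2)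
qed

lemma tev4_swap23: "tev [a,b,c,d] T = tev [a,c,b,d] (\<lambda>I. T [I!0, I!2, I!1, I!3])"
proof -
  have "tev [b,c,d] U = tev [c,b,d] (\<lambda>I. U [I!1, I!0, I!2])" for U
    by (simp add: sum_distrib_left numeral_2_eq_2) (subst sum.swap, simp add: mult_ac)
  from this[of "\<lambda>I. T (_ # I)"] show ?thesis by (simp add: numeral_3_eq_3 numeral_2_eq_2)
qed

lemma len4: "length I = 4 \<Longrightarrow> I = [I!0, I!1, I!2, I!3]"
  by (rule nth_equalityI) (auto simp: less_Suc_eq numeral_eq_Suc)

lemma tev4_cong: "(\<And>i j k l. T [i,j,k,l] = U [i,j,k,l]) \<Longrightarrow> tev [a,b,c,d] T = tev [a,b,c,d] U"
  by simp

lemma tev_weyl: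
  assumes W: "weyl_sym H (\<lambda>a b c d. T [a,b,c,d])"
  shows "tev [a,b,c,d] T = - tev [b,a,c,d] T" "tev [a,b,c,d] T = tev [c,d,a,b] T"
    "tev [a,b,c,d] T + tev [a,c,d,b] T + tev [a,d,b,c] T = 0"
proof -
  have w: "T [i,j,k,l] = - T [j,i,k,l]" "T [i,j,k,l] = T [k,l,i,j]" "T [i,j,k,l] + T [i,k,l,j] + T [i,l,j,k] = 0" for i j k l
    using W unfolding weyl_sym_def by blast+
  have "tev [a,b,c,d] T = tev [b,a,c,d] (\<lambda>I. - T I)"
    by (subst tev4_swap12, rule tev4_cong) (simp add: w(1)[symmetric] numeral_3_eq_3 numeral_2_eq_2)
  then show "tev [a,b,c,d] T = - tev [b,a,c,d] T" by (simp only: tev_minus)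
  show "tev [a,b,c,d] T = tev [c,d,a,b] T"
    by (subst tev4_swap23, subst tev4_swap12, subst tev4_swap34, subst tev4_swap23, rule tev4_cong)
      (simp add: w(2)[symmetric] numeral_3_eq_3 numeral_2_eq_2)
  have 1: "tev [a,c,d,b] T = tev [a,b,c,d] (\<lambda>I. T [I!0, I!2, I!3, I!1])"
    by (subst tev4_swap34, subst tev4_swap23, rule tev4_cong) (simp add: numeral_3_eq_3 numeral_2_eq_2)
  have 2: "tev [a,d,b,c] T = tev [a,b,c,d] (\<lambda>I. T [I!0, I!3, I!1, I!2])"
    by (subst tev4_swap23, subst tev4_swap34, rule tev4_cong) (simp add: numeral_3_eq_3 numeral_2_eq_2)
  have "tev [a,b,c,d] (\<lambda>I. T I + T [I!0, I!2, I!3, I!1] + T [I!0, I!3, I!1, I!2]) = tev [a,b,c,d] (\<lambda>I. 0)"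
    by (rule tev4_cong) (simp add: w(3) numeral_3_eq_3 numeral_2_eq_2)
  then show "tev [a,b,c,d] T + tev [a,c,d,b] T + tev [a,d,b,c] T = 0"
    unfolding 1 2 tev_add tev_zero .
qed

lemma tev_trace13:
  assumes H: "pairing_frame H e s st"
  shows "(\<Sum>a\<in>UNIV. s a * tev [e a, v, e (st a), w] T) = tev [v, w] (\<lambda>I. \<Sum>i\<in>UNIV. \<Sum>j\<in>UNIV. H $ i $ j * T [i, I!0, j, I!1])"
proof -
  have "tev [e a, v, e (st a), w] T = tev [v, w] (\<lambda>I. \<Sum>i\<in>UNIV. \<Sum>j\<in>UNIV. e a $ i * e (st a) $ j * T [i, I!0, j, I!1])" for a
  proof -
    have "tev [e a, v, e (st a), w] T = tev [e a, e (st a), v, w] (\<lambda>I. T [I!0, I!2, I!1, I!3])"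
      by (rule tev4_swap23)
    also have "\<dots> = (\<Sum>i\<in>UNIV. e a $ i * tev [v, w] (\<lambda>I. \<Sum>j\<in>UNIV. e (st a) $ j * T [i, I!0, j, I!1]))"
      unfolding tev_sum by (simp add: numeral_3_eq_3 numeral_2_eq_2)
    also have "\<dots> = tev [v, w] (\<lambda>I. \<Sum>i\<in>UNIV. e a $ i * (\<Sum>j\<in>UNIV. e (st a) $ j * T [i, I!0, j, I!1]))"
      unfolding tev_sum ..
    finally show ?thesis by (simp add: sum_distrib_left mult.assoc)
  qed
  then have "(\<Sum>a\<in>UNIV. s a * tev [e a, v, e (st a), w] T) = 
     tev [v, w] (\<lambda>I. \<Sum>a\<in>UNIV. s a * (\<Sum>i\<in>UNIV. \<Sum>j\<in>UNIV. e a $ i * e (st a) $ j * T [i, I!0, j, I!1]))"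
    unfolding tev_sum by simp
  also have "\<dots> = tev [v, w] (\<lambda>I. \<Sum>i\<in>UNIV. \<Sum>j\<in>UNIV. H $ i $ j * T [i, I!0, j, I!1])"
  proof (rule arg_cong[where f="tev [v,w]"], rule ext)
    fix I :: "4 list"
    have "(\<Sum>a\<in>UNIV. s a * (\<Sum>i\<in>UNIV. \<Sum>j\<in>UNIV. e a $ i * e (st a) $ j * T [i, I!0, j, I!1])) =
      (\<Sum>a\<in>UNIV. \<Sum>i\<in>UNIV. \<Sum>j\<in>UNIV. s a * e a $ i * e (st a) $ j * T [i, I!0, j, I!1])"
      by (simp add: sum_distrib_left mult.assoc)
    also have "\<dots> = (\<Sum>i\<in>UNIV. \<Sum>a\<in>UNIV. \<Sum>j\<in>UNIV. s a * e a $ i * e (st a) $ j * T [i, I!0, j, I!1])"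
      by (rule sum.swap)
    also have "\<dots> = (\<Sum>i\<in>UNIV. \<Sum>j\<in>UNIV. \<Sum>a\<in>UNIV. s a * e a $ i * e (st a) $ j * T [i, I!0, j, I!1])"
      by (intro sum.cong refl sum.swap)
    finally show "(\<Sum>a\<in>UNIV. s a * (\<Sum>i\<in>UNIV. \<Sum>j\<in>UNIV. e a $ i * e (st a) $ j * T [i, I!0, j, I!1])) =
       (\<Sum>i\<in>UNIV. \<Sum>j\<in>UNIV. H $ i $ j * T [i, I!0, j, I!1])"
      using H unfolding pairing_frame_def by (simp add: sum_distrib_right)
  qed
  finally show ?thesis .
qed

lemma tev_weyl_trace:
  assumes W: "weyl_sym H (\<lambda>a b c d. T [a,b,c,d])" and H: "pairing_frame H e s st"
  shows "(\<Sum>a\<in>UNIV. s a * tev [e a, v, e (st a), w] T) = 0"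
proof -
  have "(\<Sum>i\<in>UNIV. \<Sum>j\<in>UNIV. H $ i $ j * T [i, b, j, d]) = 0" for b d
    using W unfolding weyl_sym_def by blast
  then show ?thesis unfolding tev_trace13[OF H] by simp
qed

lemma weyl_array_frame:
  assumes W: "weyl_sym H (\<lambda>a b c d. T [a,b,c,d])" and H: "pairing_frame H e (\<lambda>_. 1) st01"
  shows "weyl_array (frame_array e T)"
proof -
  have t: "tev [e 0, v, e 1, w] T + tev [e 1, v, e 0, w] T + tev [e 2, v, e 2, w] T + tev [e 3, v, e 3, w] T = 0" for v w
    using tev_weyl_trace[OF W H, of v w] unfolding sum_4' by (simp del: tev.simps)
  show ?thesis unfolding weyl_array_def frame_array_def
    by (intro allI conjI tev_weyl[OF W] t)
qed

text \<open>Ten real components remain, the real and imaginary parts of the five complex Weyl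
  scalars: (0202, 0203), (0102, 0103), (0101, 0123), (0112, 0113), (1212, 1213), of boost weight 2,
  1, 0, -1, -2.\<close>

lemma weyl_array_comps:
  assumes X: "weyl_array X"
  shows "2 * X 0 2 1 2 = X 0 1 0 1" "2 * X 0 3 1 3 = X 0 1 0 1" "2 * X 0 2 1 3 = X 0 1 2 3" "2 * X 0 3 1 2 = - X 0 1 2 3"
    "X 2 3 2 3 = - X 0 1 0 1" "X 0 2 2 3 = - X 0 1 0 3" "X 0 3 2 3 = X 0 1 0 2" "X 0 3 0 3 = - X 0 2 0 2"
    "X 1 2 2 3 = X 0 1 1 3" "X 1 3 2 3 = - X 0 1 1 2" "X 1 3 1 3 = - X 1 2 1 2"
    "X a a c d = 0" "X a b c c = 0" "X b a c d = - X a b c d" "X a b d c = - X a b c d" "X c d a b = X a b c d"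
proof -
  have s: "X a b c d = - X b a c d" "X a b c d = X c d a b" "X a b c d + X a c d b + X a d b c = 0" 
    and t: "X 0 b 1 d + X 1 b 0 d + X 2 b 2 d + X 3 b 3 d = 0" for a b c d
    using X unfolding weyl_array_def by blast+
  have s': "X a b d c = - X a b c d" for a b c d using s(2)[of a b d c] s(1)[of d c a b] s(2)[of c d a b] by linarith
  have z: "X a a c d = 0" "X a b c c = 0" for a b c d using s(1)[of a a c d] s'[of a b c c] by linarith+
  show "X a a c d = 0" "X a b c c = 0" "X b a c d = - X a b c d" "X a b d c = - X a b c d" "X c d a b = X a b c d"
    by (rule z s(1) s' s(2))+
  have c0212: "2 * X 0 2 1 2 + X 2 3 2 3 = 0" 
    using t[of 2 2, unfolded z] s(2)[of 1 2 0 2] s(1)[of 3 2 3 2] s'[of 2 3 2 3] z by linarith 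
  have c0313: "2 * X 0 3 1 3 + X 2 3 2 3 = 0" 
    using t[of 3 3, unfolded z] s(2)[of 1 3 0 3] by linarith
  have c01: "X 0 1 0 1 = X 0 2 1 2 + X 0 3 1 3"
    using t[of 0 1, unfolded z] s(1)[of 1 0 0 1] s(1)[of 2 0 2 1] s'[of 0 2 1 2] s(1)[of 3 0 3 1] s'[of 0 3 1 3] by linarith
  show a: "2 * X 0 2 1 2 = X 0 1 0 1" "2 * X 0 3 1 3 = X 0 1 0 1" "X 2 3 2 3 = - X 0 1 0 1"
    using c0212 c0313 c01 by linarith+
  have c23: "X 0 2 1 3 + X 0 3 1 2 = 0" using t[of 2 3, unfolded z] s(2)[of 1 2 0 3] by linarith
  have "X 0 1 2 3 + X 0 2 3 1 + X 0 3 1 2 = 0" by (rule s(3))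
  then have "X 0 1 2 3 = X 0 2 1 3 - X 0 3 1 2" using s'[of 0 2 1 3] by simp
  then show "2 * X 0 2 1 3 = X 0 1 2 3" "2 * X 0 3 1 2 = - X 0 1 2 3" using c23 by linarith+
  show "X 0 2 2 3 = - X 0 1 0 3" using t[of 0 3, unfolded z] s(1)[of 1 0 0 3] s(1)[of 2 0 2 3] by linarith
  show "X 0 3 2 3 = X 0 1 0 2" using t[of 0 2, unfolded z] s(1)[of 1 0 0 2] s(1)[of 3 0 3 2] s'[of 0 3 2 3] by linarith
  show "X 0 3 0 3 = - X 0 2 0 2" using t[of 0 0, unfolded z] s(1)[of 2 0 2 0] s'[of 0 2 0 2] s(1)[of 3 0 3 0] s'[of 0 3 0 3] by linarith
  show "X 1 2 2 3 = X 0 1 1 3" using t[of 1 3, unfolded z] s(1)[of 2 1 2 3] by linarith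
  show "X 1 3 2 3 = - X 0 1 1 2" using t[of 1 2, unfolded z] s(1)[of 3 1 3 2] s'[of 1 3 2 3] by linarith
  show "X 1 3 1 3 = - X 1 2 1 2" using t[of 1 1, unfolded z] s(1)[of 2 1 2 1] s'[of 1 2 1 2] s(1)[of 3 1 3 1] s'[of 1 3 1 3] by linarith
qed

definition bw1 :: "4 \<Rightarrow> int" where "bw1 a = (if a = 0 then 1 else if a = 1 then - 1 else 0)"

lemma bw1_simps [simp]: "bw1 0 = 1" "bw1 1 = -1" "bw1 2 = 0" "bw1 3 = 0"
  by (simp_all add: bw1_def)

lemma boost_weight_bw1: "boost_weight J = (\<Sum>a\<leftarrow>J. bw1 a)"
  unfolding boost_weight_def by (induction J) (auto simp: bw1_def)

definition order_le :: "(4 \<Rightarrow> 4 \<Rightarrow> 4 \<Rightarrow> 4 \<Rightarrow> real) \<Rightarrow> int \<Rightarrow> bool" where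
  "order_le X n \<longleftrightarrow> (\<forall>a b c d. X a b c d \<noteq> 0 \<longrightarrow> bw1 a + bw1 b + bw1 c + bw1 d \<le> n)"

text \<open>An antisymmetric pair may be assumed to be one of the six ordered ones.\<close>

definition ordered_pairs :: "(4 \<times> 4) set" where
  "ordered_pairs = {(0,1),(0,2),(0,3),(1,2),(1,3),(2,3)}"

lemma ordered_pairs_cases: "a = b \<or> (a, b) \<in> ordered_pairs \<or> (b, a) \<in> ordered_pairs"
proof -
  have "\<forall>a b. a = b \<or> (a, b) \<in> ordered_pairs \<or> (b, a) \<in> ordered_pairs"
    unfolding forall_4' ordered_pairs_def by simp
  then show ?thesis by blast
qed

lemma weyl_array_cases:
  assumes X: "weyl_array X"
    and P: "\<And>a b c d. (a, b) \<in> ordered_pairs \<Longrightarrow> (c, d) \<in> ordered_pairs \<Longrightarrow> X a b c d \<noteq> 0 \<Longrightarrow>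
      bw1 a + bw1 b + bw1 c + bw1 d \<le> n"
  shows "order_le X n"
  unfolding order_le_def
proof (intro allI impI)
  note w = weyl_array_comps(12-15)[OF X]
  fix a b c d assume ne: "X a b c d \<noteq> 0"
  have ne': "X b a c d \<noteq> 0" "X a b d c \<noteq> 0" "X b a d c \<noteq> 0"
    using ne w(3)[of b a c d] w(4)[of a b d c] w(3)[of b a d c] by simp_all
  have "a \<noteq> b" "c \<noteq> d" using ne w(1,2) by auto
  then consider "(a, b) \<in> ordered_pairs" "(c, d) \<in> ordered_pairs"
    | "(b, a) \<in> ordered_pairs" "(c, d) \<in> ordered_pairs"
    | "(a, b) \<in> ordered_pairs" "(d, c) \<in> ordered_pairs"
    | "(b, a) \<in> ordered_pairs" "(d, c) \<in> ordered_pairs"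
    using ordered_pairs_cases[of a b] ordered_pairs_cases[of c d] by blast
  then show "bw1 a + bw1 b + bw1 c + bw1 d \<le> n"
  proof cases
    case 1 then show ?thesis using P[OF 1 ne] by simp
  next
    case 2 then show ?thesis using P[OF 2 ne'(1)] by simp
  next
    case 3 then show ?thesis using P[OF 3 ne'(2)] by simp
  next
    case 4 then show ?thesis using P[OF 4 ne'(3)] by simp
  qed
qed

text \<open>By \<open>weyl_array_comps\<close> every component of positive boost weight is, up to a
  factor, one of the four listed. The next two lemmas extend the list by the weights 0 and
  -1.\<close>

lemma order_le_0:
  assumes X: "weyl_array X" and "X 0 2 0 2 = 0" "X 0 2 0 3 = 0" "X 0 1 0 2 = 0" "X 0 1 0 3 = 0"
  shows "order_le X 0"
proof -
  note w = weyl_array_comps(16)[OF X]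
  have 0: "X 0 1 0 2 = 0" "X 0 1 0 3 = 0" "X 0 2 0 2 = 0" "X 0 2 0 3 = 0" "X 0 2 2 3 = 0" "X 0 3 0 3 = 0" "X 0 3 2 3 = 0"
    using assms(2-) weyl_array_comps(1-11)[OF X] by simp_all
  have 1: "X 0 2 0 1 = 0" "X 0 3 0 1 = 0" "X 0 3 0 2 = 0" "X 2 3 0 2 = 0" "X 2 3 0 3 = 0"
    using 0 w[of 0 1 0 2] w[of 0 1 0 3] w[of 0 2 0 3] w[of 0 2 2 3] w[of 0 3 2 3] by simp_all
  show ?thesis by (rule weyl_array_cases[OF X]) (auto simp: ordered_pairs_def 0 1)
qed

lemma order_le_m1:
  assumes X: "weyl_array X" and "X 0 2 0 2 = 0" "X 0 2 0 3 = 0" "X 0 1 0 2 = 0" "X 0 1 0 3 = 0" "X 0 1 0 1 = 0" "X 0 1 2 3 = 0"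
  shows "order_le X (-1)"
proof -
  note w = weyl_array_comps(16)[OF X]
  have 0: "X 0 1 0 1 = 0" "X 0 1 0 2 = 0" "X 0 1 0 3 = 0" "X 0 1 2 3 = 0" "X 0 2 0 2 = 0" "X 0 2 0 3 = 0" "X 0 2 1 2 = 0" "X 0 2 1 3 = 0" "X 0 2 2 3 = 0" "X 0 3 0 3 = 0" "X 0 3 1 2 = 0" "X 0 3 1 3 = 0" "X 0 3 2 3 = 0" "X 2 3 2 3 = 0"
    using assms(2-) weyl_array_comps(1-11)[OF X] by simp_all
  have 1: "X 0 2 0 1 = 0" "X 0 3 0 1 = 0" "X 0 3 0 2 = 0" "X 1 2 0 2 = 0" "X 1 2 0 3 = 0" "X 1 3 0 2 = 0" "X 1 3 0 3 = 0" "X 2 3 0 1 = 0" "X 2 3 0 2 = 0" "X 2 3 0 3 = 0"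
    using 0 w[of 0 1 0 2] w[of 0 1 0 3] w[of 0 2 0 3] w[of 0 2 1 2] w[of 0 3 1 2] w[of 0 2 1 3] w[of 0 3 1 3] w[of 0 1 2 3] w[of 0 2 2 3] w[of 0 3 2 3] by simp_all
  show ?thesis by (rule weyl_array_cases[OF X]) (auto simp: ordered_pairs_def 0 1)
qed

lemma order_le_m2:
  assumes X: "weyl_array X" and "X 0 2 0 2 = 0" "X 0 2 0 3 = 0" "X 0 1 0 2 = 0" "X 0 1 0 3 = 0" "X 0 1 0 1 = 0" "X 0 1 2 3 = 0" "X 0 1 1 2 = 0" "X 0 1 1 3 = 0"
  shows "order_le X (-2)"
proof -
  note w = weyl_array_comps(16)[OF X]
  have 0: "X 0 1 0 1 = 0" "X 0 1 0 2 = 0" "X 0 1 0 3 = 0" "X 0 1 1 2 = 0" "X 0 1 1 3 = 0" "X 0 1 2 3 = 0" "X 0 2 0 2 = 0" "X 0 2 0 3 = 0" "X 0 2 1 2 = 0" "X 0 2 1 3 = 0" "X 0 2 2 3 = 0" "X 0 3 0 3 = 0" "X 0 3 1 2 = 0" "X 0 3 1 3 = 0" "X 0 3 2 3 = 0" "X 1 2 2 3 = 0" "X 1 3 2 3 = 0" "X 2 3 2 3 = 0"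
    using assms(2-) weyl_array_comps(1-11)[OF X] by simp_all
  have 1: "X 0 2 0 1 = 0" "X 0 3 0 1 = 0" "X 0 3 0 2 = 0" "X 1 2 0 1 = 0" "X 1 2 0 2 = 0" "X 1 2 0 3 = 0" "X 1 3 0 1 = 0" "X 1 3 0 2 = 0" "X 1 3 0 3 = 0" "X 2 3 0 1 = 0" "X 2 3 0 2 = 0" "X 2 3 0 3 = 0" "X 2 3 1 2 = 0" "X 2 3 1 3 = 0"
    using 0 w[of 0 1 0 2] w[of 0 1 0 3] w[of 0 2 0 3] w[of 0 1 1 2] w[of 0 2 1 2] w[of 0 3 1 2] w[of 0 1 1 3] w[of 0 2 1 3] w[of 0 3 1 3] w[of 0 1 2 3] w[of 0 2 2 3] w[of 0 3 2 3] w[of 1 2 2 3] w[of 1 3 2 3] by simp_all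
  show ?thesis by (rule weyl_array_cases[OF X]) (auto simp: ordered_pairs_def 0 1)
qed

lemma antisym_sum:
  assumes "\<And>a b. A a b = - A b a" "\<And>a b. B a b = - B b a"
  shows "(\<Sum>a\<in>UNIV. \<Sum>b\<in>(UNIV::4 set). A a b * B a b) = 
    2 * (A 0 1 * B 0 1 + A 0 2 * B 0 2 + A 0 3 * B 0 3 + A 1 2 * B 1 2 + A 1 3 * B 1 3 + A 2 3 * (B 2 3 :: real))"
proof -
  have "A a a = 0" for a using assms(1)[of a a] by simp
  moreover have "A 1 0 * B 1 0 = A 0 1 * B 0 1" "A 2 0 * B 2 0 = A 0 2 * B 0 2" "A 3 0 * B 3 0 = A 0 3 * B 0 3"
    "A 2 1 * B 2 1 = A 1 2 * B 1 2" "A 3 1 * B 3 1 = A 1 3 * B 1 3" "A 3 2 * B 3 2 = A 2 3 * B 2 3"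
    by (simp_all add: assms(1)[of 1 0] assms(2)[of 1 0] assms(1)[of 2 0] assms(2)[of 2 0] assms(1)[of 3 0] assms(2)[of 3 0]
        assms(1)[of 2 1] assms(2)[of 2 1] assms(1)[of 3 1] assms(2)[of 3 1] assms(1)[of 3 2] assms(2)[of 3 2])
  ultimately show ?thesis unfolding sum_4' by simp
qed

lemma order_leD: "order_le X n \<Longrightarrow> n < bw1 a + bw1 b + bw1 c + bw1 d \<Longrightarrow> X a b c d = 0"
  unfolding order_le_def by fastforce

text \<open>A full contraction pairs the boost weights w and -w, so for factors of order 0 only
  weight 0 contributes. There each tensor is one complex number X_0101 + i X_0123, and the
  contraction is 12 times the real part of their product.\<close>

lemma weyl_array_product:
  assumes X: "weyl_array X" "order_le X 0" and Y: "weyl_array Y" "order_le Y 0"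
  shows "(\<Sum>a\<in>UNIV. \<Sum>b\<in>UNIV. \<Sum>c\<in>UNIV. \<Sum>d\<in>UNIV. X a b c d * Y (st01 a) (st01 b) (st01 c) (st01 d))
    = 12 * (X 0 1 0 1 * Y 0 1 0 1 - X 0 1 2 3 * Y 0 1 2 3)"
proof -
  note wX = weyl_array_comps[OF X(1)] and wY = weyl_array_comps[OF Y(1)]
  define Z where "Z = (\<lambda>a b c d. Y (st01 a) (st01 b) (st01 c) (st01 d))"
  define W where "W = (\<lambda>a b. 2 * (X a b 0 1 * Z a b 0 1 + X a b 0 2 * Z a b 0 2 + X a b 0 3 * Z a b 0 3
     + X a b 1 2 * Z a b 1 2 + X a b 1 3 * Z a b 1 3 + X a b 2 3 * Z a b 2 3))"
  have 1: "(\<Sum>c\<in>UNIV. \<Sum>d\<in>UNIV. X a b c d * Z a b c d) = W a b" for a b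
    unfolding W_def Z_def by (rule antisym_sum) (rule wX(15) wY(15))+
  have "W a b = W b a" for a b
    unfolding W_def Z_def using wX(14)[of a b] wY(14)[of "st01 a" "st01 b"] by simp
  then have W10: "W 1 0 = W 0 1" "W 2 0 = W 0 2" "W 3 0 = W 0 3" "W 2 1 = W 1 2" "W 3 1 = W 1 3" "W 3 2 = W 2 3" by auto
  have W0: "W a a = 0" for a unfolding W_def by (simp add: wX)
  have "(\<Sum>a\<in>UNIV. \<Sum>b\<in>UNIV. W a b) = 2 * (W 0 1 + W 0 2 + W 0 3 + W 1 2 + W 1 3 + W 2 3)"
    unfolding sum_4' using W0 W10 by simp
  also have "\<dots> = 12 * (X 0 1 0 1 * Y 0 1 0 1 - X 0 1 2 3 * Y 0 1 2 3)"
  proof -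
    have zX: "X 0 2 0 2 = 0" "X 0 2 0 3 = 0" "X 0 3 0 2 = 0" "X 0 3 0 3 = 0" "X 0 1 0 2 = 0" "X 0 1 0 3 = 0" "X 0 2 0 1 = 0" "X 0 3 0 1 = 0"
      "X 0 2 2 3 = 0" "X 0 3 2 3 = 0" "X 2 3 0 2 = 0" "X 2 3 0 3 = 0"
      using X(2) by (auto elim!: order_leD)
    have zY: "Y 0 2 0 2 = 0" "Y 0 2 0 3 = 0" "Y 0 3 0 2 = 0" "Y 0 3 0 3 = 0" "Y 0 1 0 2 = 0" "Y 0 1 0 3 = 0" "Y 1 0 0 2 = 0" "Y 1 0 0 3 = 0" 
      "Y 0 2 1 0 = 0" "Y 0 3 1 0 = 0" "Y 0 2 2 3 = 0" "Y 0 3 2 3 = 0" "Y 2 3 0 2 = 0" "Y 2 3 0 3 = 0"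
      using Y(2) by (auto elim!: order_leD)
    have cX: "X 0 2 1 2 = X 0 1 0 1 / 2" "X 0 3 1 3 = X 0 1 0 1 / 2" "X 0 2 1 3 = X 0 1 2 3 / 2" "X 0 3 1 2 = - X 0 1 2 3 / 2"
      "X 1 2 0 2 = X 0 1 0 1 / 2" "X 1 3 0 3 = X 0 1 0 1 / 2" "X 1 3 0 2 = X 0 1 2 3 / 2" "X 1 2 0 3 = - X 0 1 2 3 / 2"
      "X 2 3 2 3 = - X 0 1 0 1" "X 2 3 0 1 = X 0 1 2 3"
    proof -
      have e: "X 1 2 0 2 = X 0 2 1 2" "X 1 3 0 3 = X 0 3 1 3" "X 1 3 0 2 = X 0 2 1 3" "X 1 2 0 3 = X 0 3 1 2" "X 2 3 0 1 = X 0 1 2 3"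
        by (rule wX(16))+
      show "X 0 2 1 2 = X 0 1 0 1 / 2" "X 0 3 1 3 = X 0 1 0 1 / 2" "X 0 2 1 3 = X 0 1 2 3 / 2" "X 0 3 1 2 = - X 0 1 2 3 / 2"
        "X 1 2 0 2 = X 0 1 0 1 / 2" "X 1 3 0 3 = X 0 1 0 1 / 2" "X 1 3 0 2 = X 0 1 2 3 / 2" "X 1 2 0 3 = - X 0 1 2 3 / 2"
        "X 2 3 2 3 = - X 0 1 0 1" "X 2 3 0 1 = X 0 1 2 3"
        using wX(1-5) e by simp_all
    qed
    have cY: "Y 0 2 1 2 = Y 0 1 0 1 / 2" "Y 0 3 1 3 = Y 0 1 0 1 / 2" "Y 0 2 1 3 = Y 0 1 2 3 / 2" "Y 0 3 1 2 = - Y 0 1 2 3 / 2"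
      "Y 1 2 0 2 = Y 0 1 0 1 / 2" "Y 1 3 0 3 = Y 0 1 0 1 / 2" "Y 1 3 0 2 = Y 0 1 2 3 / 2" "Y 1 2 0 3 = - Y 0 1 2 3 / 2"
      "Y 2 3 2 3 = - Y 0 1 0 1" "Y 2 3 1 0 = - Y 0 1 2 3" "Y 1 0 2 3 = - Y 0 1 2 3" "Y 1 0 1 0 = Y 0 1 0 1"
    proof -
      have e: "Y 1 2 0 2 = Y 0 2 1 2" "Y 1 3 0 3 = Y 0 3 1 3" "Y 1 3 0 2 = Y 0 2 1 3" "Y 1 2 0 3 = Y 0 3 1 2" "Y 2 3 1 0 = Y 1 0 2 3"
        by (rule wY(16))+
      have f: "Y 1 0 2 3 = - Y 0 1 2 3" "Y 1 0 1 0 = - Y 0 1 1 0" by (rule wY(14))+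
      have h: "Y 0 1 1 0 = - Y 0 1 0 1" by (rule wY(15))
      show "Y 0 2 1 2 = Y 0 1 0 1 / 2" "Y 0 3 1 3 = Y 0 1 0 1 / 2" "Y 0 2 1 3 = Y 0 1 2 3 / 2" "Y 0 3 1 2 = - Y 0 1 2 3 / 2"
        "Y 1 2 0 2 = Y 0 1 0 1 / 2" "Y 1 3 0 3 = Y 0 1 0 1 / 2" "Y 1 3 0 2 = Y 0 1 2 3 / 2" "Y 1 2 0 3 = - Y 0 1 2 3 / 2"
        "Y 2 3 2 3 = - Y 0 1 0 1" "Y 2 3 1 0 = - Y 0 1 2 3" "Y 1 0 2 3 = - Y 0 1 2 3" "Y 1 0 1 0 = Y 0 1 0 1"
        using wY(1-5) e f h by simp_all
    qed
    show ?thesis unfolding W_def Z_def by (simp add: zX zY cX cY)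
  qed
  finally show ?thesis unfolding 1[symmetric] Z_def .
qed

section \<open>Quartic invariants of arrays of low boost order\<close>

lemma sum_products_eq_0:
  fixes W :: "'i \<Rightarrow> 'i \<Rightarrow> real"
  assumes fin: "finite A" and "(\<Sum>i\<in>A. \<Sum>j\<in>A. W i j * W (t i) (t j)) = 0"
    and "\<And>i j. i \<in> A \<Longrightarrow> j \<in> A \<Longrightarrow> W i j * W (t i) (t j) \<ge> 0" and "i \<in> A" "j \<in> A"
  shows "W i j * W (t i) (t j) = 0"
proof -
  have "(\<Sum>j\<in>A. W i j * W (t i) (t j)) = 0"
    using assms(2) by (rule sum_nonneg_0[OF fin, rotated]) (intro sum_nonneg assms(3,4); assumption)+
  then show ?thesis
    by (rule sum_nonneg_0[OF fin, rotated]) (intro assms(3,4,5); assumption)+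
qed

definition contr4 :: "(4 \<Rightarrow> 4 \<Rightarrow> 4 \<Rightarrow> 4 \<Rightarrow> real) \<Rightarrow> (4 \<Rightarrow> 4 \<Rightarrow> 4 \<Rightarrow> 4 \<Rightarrow> real) \<Rightarrow> real" where
  "contr4 X Y = (\<Sum>a\<in>UNIV. \<Sum>b\<in>UNIV. \<Sum>c\<in>UNIV. \<Sum>d\<in>UNIV. X a b c d * Y (st01 a) (st01 b) (st01 c) (st01 d))"

lemma bw1_st01: "bw1 (st01 a) = - bw1 a"
  by (simp add: bw1_def st01_def)

text \<open>A component of boost weight w in \<open>X\<close> is multiplied by one of weight -w in
  \<open>Y\<close>.\<close>

lemma contr4_order:
  assumes "order_le X m" "order_le Y n" "m + n < 0" shows "contr4 X Y = 0"
proof -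
  have "X a b c d * Y (st01 a) (st01 b) (st01 c) (st01 d) = 0" for a b c d
  proof (rule ccontr)
    assume "\<not> ?thesis"
    then have "X a b c d \<noteq> 0" "Y (st01 a) (st01 b) (st01 c) (st01 d) \<noteq> 0" by auto
    then have "bw1 a + bw1 b + bw1 c + bw1 d \<le> m" "- bw1 a - bw1 b - bw1 c - bw1 d \<le> n"
      using assms(1,2) unfolding order_le_def bw1_st01[symmetric] by (force simp: bw1_st01)+
    then show False using assms(3) by linarith
  qed
  then show ?thesis unfolding contr4_def by (simp only: sum.neutral_const)
qed

text \<open>If the boost order of \<open>X i\<close> drops with the number \<open>z i\<close> of zero indices in \<open>i\<close>, then in the
  quartic invariant only purely transverse \<open>i\<close> survive, where it is a sum of squares.\<close>

lemma quartic_vanish: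
  fixes X :: "'i::finite \<Rightarrow> 4 \<Rightarrow> 4 \<Rightarrow> 4 \<Rightarrow> 4 \<Rightarrow> real"
  assumes W: "\<And>i. weyl_array (X i)" and ord: "\<And>i. order_le (X i) (- z i)" and z: "\<And>i. z i \<ge> 0"
    and fix0: "\<And>i. z i = 0 \<Longrightarrow> z (t i) = 0 \<Longrightarrow> t i = i"
    and q: "(\<Sum>i\<in>UNIV. \<Sum>j\<in>UNIV. contr4 (X i) (X j) * contr4 (X (t i)) (X (t j))) = 0"
    and i: "z i = 0" "t i = i" and j: "z j = 0" "t j = j"
  shows "X i 0 1 0 1 * X j 0 1 0 1 = X i 0 1 2 3 * X j 0 1 2 3"
proof -
  have nz: "z i = 0 \<and> z j = 0" if "contr4 (X i) (X j) \<noteq> 0" for i j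
    using contr4_order[OF ord ord, of i j] that z[of i] z[of j] by fastforce
  \<comment> \<open>In the applications \<open>t\<close> exchanges the indices 0 and 1, so
    \<open>z (t i)\<close> counts the ones in \<open>i\<close>. A nonvanishing term contains neither
    zeros nor ones, is fixed by \<open>t\<close>, and is therefore a square.\<close>
  have "contr4 (X i) (X j) * contr4 (X (t i)) (X (t j)) \<ge> 0" for i j
  proof (cases "contr4 (X i) (X j) = 0 \<or> contr4 (X (t i)) (X (t j)) = 0")
    case False
    then have "t i = i" "t j = j" using nz fix0 by blast+
    then show ?thesis by simp
  qed auto
  from sum_products_eq_0[of UNIV "\<lambda>i j. contr4 (X i) (X j)" t, OF _ q this, of i j]
  have "contr4 (X i) (X j) = 0" by (simp add: i j)
  moreover have "order_le (X i) 0" "order_le (X j) 0" using ord[of i] ord[of j] i j by auto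
  ultimately show ?thesis
    using weyl_array_product[OF W[of i] _ W[of j]] unfolding contr4_def by simp
qed

lemma sum_sq_zero: "(x::real) * x + y * y = 0 \<Longrightarrow> x = 0 \<and> y = 0"
  by (simp add: sum_squares_eq_zero_iff)

text \<open>Multiplication of complex numbers: if \<open>(a + ib)(p + iq) = 0\<close> and \<open>p + iq\<close> is nonzero.\<close>

lemma complex_zero_divisor:
  fixes a b p q :: real
  assumes "a * p + b * q = 0" "a * q - b * p = 0" "p \<noteq> 0 \<or> q \<noteq> 0" shows "a = 0 \<and> b = 0"
proof -
  have "(a * a + b * b) * (p * p + q * q) = (a * p + b * q) * (a * p + b * q) + (a * q - b * p) * (a * q - b * p)"
    by (simp add: algebra_simps)
  then have "(a * a + b * b) * (p * p + q * q) = 0" using assms by simp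
  moreover have "p * p + q * q \<noteq> 0" using assms(3) by (simp add: sum_squares_eq_zero_iff)
  ultimately have "a * a + b * b = 0" by (metis mult_eq_0_iff)
  then show ?thesis by (rule sum_sq_zero)
qed

text \<open>For z = a + ib the hypotheses say that the real and the imaginary part of z^2
  vanish.\<close>

lemma sq_rotation_zero:
  fixes a b :: real assumes "a * a = b * b" "a * b = - (a * b)" shows "a = 0" "b = 0"
proof -
  have "a * b = 0" using assms(2) by linarith
  then have "a = 0 \<or> b = 0" by simp
  then show "a = 0" "b = 0" using assms(1) by (elim disjE; simp)+
qed

section \<open>Type N\<close>

text \<open>Pointwise data in a null frame with e_0 = l: \<open>C\<close> is the Weyl tensor,
  \<open>P e\<close> its covariant derivative along e_e, and \<open>L k e\<close> the e_k component
  of the derivative of l along e_e. \<open>P0\<close> is the derivative of C(l, ., ., .) = 0 and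
  \<open>L1\<close> that of l.l = 0. \<open>L 2 0\<close> and \<open>L 3 0\<close> vanish iff l is
  geodesic; the block of \<open>L\<close> with indices 2, 3 holds expansion, shear and
  twist.\<close>

locale type_N_point =
  fixes C :: "4 \<Rightarrow> 4 \<Rightarrow> 4 \<Rightarrow> 4 \<Rightarrow> real" and P :: "4 \<Rightarrow> 4 \<Rightarrow> 4 \<Rightarrow> 4 \<Rightarrow> 4 \<Rightarrow> real" and L :: "4 \<Rightarrow> 4 \<Rightarrow> real"
  assumes WC: "weyl_array C" and C0: "\<And>b c d. C 0 b c d = 0"
    and Cnz: "C 1 2 1 2 \<noteq> 0 \<or> C 1 2 1 3 \<noteq> 0"
    and WP: "\<And>e. weyl_array (P e)"
    and P0: "\<And>e b c d. P e 0 b c d = - (\<Sum>k\<in>UNIV. L k e * C k b c d)"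
    and bianchi: "\<And>e a b c d. P e a b c d + P c a b d e + P d a b e c = 0"
    and L1: "\<And>e. L 1 e = 0"
begin

lemmas wC = weyl_array_comps[OF WC] and wP = weyl_array_comps[OF WP]

lemma order_C: "order_le C (-2)"
  by (rule order_le_m2[OF WC]) (rule C0)+

lemma C_zero: "-2 < bw1 a + bw1 b + bw1 c + bw1 d \<Longrightarrow> C a b c d = 0"
  using order_leD[OF order_C] .

lemma P0': "P e 0 b c d = - (L 2 e * C 2 b c d) - L 3 e * C 3 b c d"
  using P0[of e b c d] unfolding sum_4' by (simp add: C0 L1)

lemma P_comps:
  "P e 0 2 0 2 = 0" "P e 0 2 0 3 = 0" "P e 0 1 0 2 = 0" "P e 0 1 0 3 = 0" "P e 0 1 0 1 = 0" "P e 0 1 2 3 = 0"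
  unfolding P0' by (simp_all add: C_zero)

lemma C_values: "C 2 1 1 2 = - C 1 2 1 2" "C 2 1 1 3 = - C 1 2 1 3" "C 3 1 1 2 = - C 1 2 1 3" "C 3 1 1 3 = C 1 2 1 2"
proof -
  have "C 1 3 1 2 = C 1 2 1 3" by (rule wC(16))
  moreover have "C 2 1 1 2 = - C 1 2 1 2" "C 2 1 1 3 = - C 1 2 1 3" "C 3 1 1 2 = - C 1 3 1 2" "C 3 1 1 3 = - C 1 3 1 3"
    by (rule wC(14))+
  ultimately show "C 2 1 1 2 = - C 1 2 1 2" "C 2 1 1 3 = - C 1 2 1 3" "C 3 1 1 2 = - C 1 2 1 3" "C 3 1 1 3 = C 1 2 1 2"
    using wC(11) by simp_all
qed

text \<open>Real and imaginary part of (L_2e - i L_3e)(C_1212 + i C_1213).\<close>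

lemma P_mu: "P e 0 1 1 2 = L 2 e * C 1 2 1 2 + L 3 e * C 1 2 1 3" "P e 0 1 1 3 = L 2 e * C 1 2 1 3 - L 3 e * C 1 2 1 2"
  unfolding P0' C_values by simp_all

lemma order_P: "order_le (P e) (-1)"
  by (rule order_le_m1[OF WP]) (rule P_comps)+

lemma P_zero: "-1 < bw1 a + bw1 b + bw1 c + bw1 d \<Longrightarrow> P e a b c d = 0"
  using order_leD[OF order_P] .

text \<open>In these Bianchi identities the two terms not differentiated along l have boost weight
  0, hence vanish by \<open>order_P\<close>. So the weight -1 part of \<open>P 0\<close> is zero,
  and by \<open>P_mu\<close> it is the acceleration times a nonzero complex number.\<close>

lemma kappa: "L 2 0 = 0" "L 3 0 = 0"
proof -
  have "P 0 1 2 2 3 = 0" using bianchi[of 0 1 2 2 3] by (simp add: P_zero)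
  moreover have "P 0 1 3 2 3 = 0" using bianchi[of 0 1 3 2 3] by (simp add: P_zero)
  ultimately have "P 0 0 1 1 3 = 0" "P 0 0 1 1 2 = 0" using wP(9,10)[of 0] by simp_all
  then have "L 2 0 = 0 \<and> L 3 0 = 0"
    using Cnz unfolding P_mu by (intro complex_zero_divisor) auto
  then show "L 2 0 = 0" "L 3 0 = 0" by auto
qed

lemma P_0_mu: "P 0 0 1 1 2 = 0" "P 0 0 1 1 3 = 0"
  unfolding P_mu by (simp_all add: kappa)

lemma shear: "L 3 3 = L 2 2" "L 2 3 = - L 3 2"
proof -
  have "P 2 0 1 3 1 = - P 2 0 1 1 3" by (rule wP(15))
  then have 1: "P 3 0 1 1 2 - P 2 0 1 1 3 = 0" using bianchi[of 2 0 1 3 1] by (simp add: P_zero)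
  have 2: "P 0 1 2 1 2 + P 2 1 2 0 1 = 0" using bianchi[of 0 1 2 1 2] by (simp add: P_zero)
  have 3: "P 0 1 3 1 3 + P 3 1 3 0 1 = 0" using bianchi[of 0 1 3 1 3] by (simp add: P_zero)
  have "P 2 1 2 0 1 = P 2 0 1 1 2" "P 3 1 3 0 1 = P 3 0 1 1 3" by (rule wP(16))+
  then have 4: "P 2 0 1 1 2 + P 3 0 1 1 3 = 0" using 2 3 wP(11)[of 0] by simp
  have "(L 2 2 - L 3 3) = 0 \<and> (L 3 2 + L 2 3) = 0"
  proof (rule complex_zero_divisor)
    show "C 1 2 1 2 \<noteq> 0 \<or> C 1 2 1 3 \<noteq> 0" by (rule Cnz)
    show "(L 2 2 - L 3 3) * C 1 2 1 2 + (L 3 2 + L 2 3) * C 1 2 1 3 = 0"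
      using 4 unfolding P_mu by (simp add: algebra_simps)
    show "(L 2 2 - L 3 3) * C 1 2 1 3 - (L 3 2 + L 2 3) * C 1 2 1 2 = 0"
      using 1 unfolding P_mu by (simp add: algebra_simps)
  qed
  then show "L 3 3 = L 2 2" "L 2 3 = - L 3 2" by auto
qed

lemma order_P_0: "order_le (P 0) (-2)"
  by (rule order_le_m2[OF WP]) (rule P_comps P_0_mu)+

text \<open>The remaining weight -2 part of \<open>P 0\<close> is expressed by \<open>P_mu\<close>
  through the Bianchi identity. That \<open>C\<close> is parallel along l is what later makes the
  geodesics affine.\<close>

lemma P_0_vanish:
  assumes "L 2 2 = 0" "L 3 2 = 0" shows "P 0 a b c d = 0"
proof -
  have "L 2 3 = 0" "L 3 3 = 0" using shear assms by auto
  then have "P 2 0 1 1 2 = 0" "P 2 0 1 1 3 = 0" unfolding P_mu using assms by auto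
  moreover have "P 2 1 2 0 1 = P 2 0 1 1 2" "P 2 1 3 0 1 = P 2 0 1 1 3" by (rule wP(16))+
  ultimately have "P 0 1 2 1 2 = 0" "P 0 1 3 1 2 = 0"
    using bianchi[of 0 1 2 1 2] bianchi[of 0 1 3 1 2] by (simp_all add: P_zero)
  then have v: "P 0 1 2 1 2 = 0" "P 0 1 2 1 3 = 0" "P 0 1 3 1 2 = 0" "P 0 1 3 1 3 = 0"
    using wP(11)[of 0] wP(16)[of 0 1 2 1 3] by simp_all
  have "order_le (P 0) (-3)"
    by (rule weyl_array_cases[OF WP], rule ccontr)
      (use order_leD[OF order_P_0] v in \<open>fastforce simp: ordered_pairs_def\<close>)
  moreover have "-3 < bw1 a + bw1 b + bw1 c + bw1 d \<or> P 0 a b c d = 0"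
  proof (cases "a = b \<or> c = d")
    case True then show ?thesis using wP(12,13) by auto
  next
    case False
    then have "-1 \<le> bw1 a + bw1 b" "-1 \<le> bw1 c + bw1 d" by (auto simp: bw1_def)
    then show ?thesis by linarith
  qed
  ultimately show ?thesis using order_leD[of "P 0" "-3" a b c d] by auto
qed

end

text \<open>\<open>S f e\<close> is the second covariant derivative of \<open>C\<close>.
  \<open>S0\<close> comes from differentiating C(l, ., ., .) = 0 twice, with an uncontrolled second
  derivative \<open>U\<close> of l. \<open>S00\<close> comes from differentiating the vanishing of
  (nabla_l C)(l, ., ., .) once, which avoids \<open>U\<close>.\<close>

lemma type_N_expansion:
  assumes pt: "type_N_point C P L"
    and WS: "\<And>f e. weyl_array (S f e)"
    and S0: "\<And>f e b c d. S f e 0 b c d = - (\<Sum>k\<in>UNIV. L k f * P e k b c d) - (\<Sum>k\<in>UNIV. L k e * P f k b c d)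
        - (\<Sum>k\<in>UNIV. U f e k * C k b c d)"
    and S00: "\<And>f b c d. S f 0 0 b c d = - (\<Sum>k\<in>UNIV. L k f * P k 0 b c d) - (\<Sum>k\<in>UNIV. L k f * P 0 k b c d)"
    and q: "(\<Sum>f\<in>UNIV. \<Sum>d\<in>UNIV. \<Sum>f'\<in>UNIV. \<Sum>d'\<in>UNIV.
       contr4 (S f d) (S f' d') * contr4 (S (st01 f) (st01 d)) (S (st01 f') (st01 d'))) = 0"
  shows "L 2 2 = 0" "L 3 2 = 0"
proof -
  interpret type_N_point C P L by (rule pt)
  note wS = weyl_array_comps[OF WS]
  have z0: "S f e 0 2 0 2 = 0" "S f e 0 2 0 3 = 0" "S f e 0 1 0 2 = 0" "S f e 0 1 0 3 = 0" for f e
    unfolding S0 sum_4' by (simp_all add: P_zero C_zero C0 L1 wC(12))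
  have m: "P e 2 1 0 1 = - P e 0 1 1 2" "P e 3 1 0 1 = - P e 0 1 1 3" for e
    using wP(16)[of e 2 1 0 1] wP(16)[of e 3 1 0 1] wP(15)[of e 0 1 2 1] wP(15)[of e 0 1 3 1] by simp_all
  have a: "S f e 0 1 0 1 = L 2 f * P e 0 1 1 2 + L 3 f * P e 0 1 1 3 + L 2 e * P f 0 1 1 2 + L 3 e * P f 0 1 1 3" for f e
    unfolding S0 sum_4' by (simp add: P_zero C_zero C0 m L1 wC(12))
  have b': "P e 2 1 2 3 = - P e 0 1 1 3" "P e 3 1 2 3 = P e 0 1 1 2" for e
    using wP(14)[of e 2 1 2 3] wP(14)[of e 3 1 2 3] wP(9,10)[of e] by simp_all
  have b: "S f e 0 1 2 3 = L 2 f * P e 0 1 1 3 - L 3 f * P e 0 1 1 2 + L 2 e * P f 0 1 1 3 - L 3 e * P f 0 1 1 2" for f e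
    unfolding S0 sum_4' by (simp add: b' P_comps C_zero C0 L1 wC(12))
  have s0: "order_le (S f e) 0" for f e by (rule order_le_0[OF WS]) (rule z0)+
  have s1: "order_le (S f e) (-1)" if "f = 0 \<or> e = 0" for f e
  proof (rule order_le_m1[OF WS z0])
    show "S f e 0 1 0 1 = 0" "S f e 0 1 2 3 = 0" unfolding a b using that by (auto simp: kappa P_0_mu)
  qed
  \<comment> \<open>The weight -1 components of \<open>S 0 0\<close> would contain \<open>U\<close>
    if taken from \<open>S0\<close>; \<open>S00\<close> expresses them by known quantities.\<close>
  have s2: "order_le (S 0 0) (-2)"
  proof (rule order_le_m2[OF WS z0])
    show "S 0 0 0 1 0 1 = 0" "S 0 0 0 1 2 3 = 0" unfolding a b by (auto simp: kappa P_0_mu)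
    show "S 0 0 0 1 1 2 = 0" "S 0 0 0 1 1 3 = 0" unfolding S00 sum_4' by (simp_all add: kappa P_0_mu L1)
  qed
  \<comment> \<open>The number of derivative indices equal to 0; by \<open>s0\<close>,
    \<open>s1\<close>, \<open>s2\<close> each of them lowers the boost order by one.\<close>
  define z where "z = (\<lambda>(f, e). (if f = 0 then 1 else 0) + (if e = (0::4) then 1 else (0::int))) \<circ> (\<lambda>p :: 4 \<times> 4. p)"
  define X where "X = (\<lambda>(f, e). S f e)"
  have main: "X i 0 1 0 1 * X j 0 1 0 1 = X i 0 1 2 3 * X j 0 1 2 3"
    if "fst i \<in> {2,3}" "snd i \<in> {2,3}" "fst j \<in> {2,3}" "snd j \<in> {2,3}" for i j
  proof (rule quartic_vanish[of X z "map_prod st01 st01"])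
    show "weyl_array (X i)" for i by (cases i) (simp add: X_def WS)
    show "order_le (X i) (- z i)" for i
      using s0 s1 s2 by (cases i) (auto simp: X_def z_def)
    show "z i \<ge> 0" for i by (cases i) (simp add: z_def)
    show "map_prod st01 st01 i = i" if "z i = 0" "z (map_prod st01 st01 i) = 0" for i
      using that by (cases i) (auto simp: z_def st01_def split: if_splits)
    show "(\<Sum>i\<in>UNIV. \<Sum>j\<in>UNIV. contr4 (X i) (X j) * contr4 (X (map_prod st01 st01 i)) (X (map_prod st01 st01 j))) = 0"
    proof -
      have "(\<Sum>i\<in>UNIV. F i) = (\<Sum>f\<in>UNIV. \<Sum>d\<in>UNIV. F (f, d))" for F :: "4 \<times> 4 \<Rightarrow> real"
        by (simp add: sum.cartesian_product flip: UNIV_Times_UNIV)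
      then show ?thesis using q by (simp add: X_def)
    qed
    show "z i = 0" "map_prod st01 st01 i = i" "z j = 0" "map_prod st01 st01 j = j"
      using that by (cases i; cases j; auto simp: z_def)+
  qed
  define s t p q where "s = L 2 2" "t = L 3 2" "p = P 2 0 1 1 2" "q = P 2 0 1 1 3"
  have p3: "P 3 0 1 1 2 = q" "P 3 0 1 1 3 = - p"
    unfolding s_t_p_q_def P_mu shear by simp_all
  have sh: "L 3 3 = s" "L 2 3 = - t" "L 2 2 = s" "L 3 2 = t" using shear by (simp_all add: s_t_p_q_def)
  \<comment> \<open>With psi = (s - it)(p + iq), the weight 0 parts of \<open>S 2 2\<close> and
    \<open>S 2 3\<close> are 2 psi and -2i psi. The two instances of \<open>main\<close> therefore
    give the real and the imaginary part of psi^2.\<close>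
  have a22: "S 2 2 0 1 0 1 = 2 * (s * p + t * q)" "S 2 2 0 1 2 3 = 2 * (s * q - t * p)"
    "S 2 3 0 1 0 1 = 2 * (s * q - t * p)" "S 2 3 0 1 2 3 = - (2 * (s * p + t * q))"
    unfolding a b p3 sh by (simp_all add: s_t_p_q_def(3,4)[symmetric] algebra_simps)
  have "S 2 2 0 1 0 1 * S 2 2 0 1 0 1 = S 2 2 0 1 2 3 * S 2 2 0 1 2 3"
    "S 2 2 0 1 0 1 * S 2 3 0 1 0 1 = S 2 2 0 1 2 3 * S 2 3 0 1 2 3"
    using main[of "(2,2)" "(2,2)"] main[of "(2,2)" "(2,3)"] by (simp_all add: X_def)
  then have "(2 * (s * p + t * q)) * (2 * (s * p + t * q)) = (2 * (s * q - t * p)) * (2 * (s * q - t * p))"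
    "(2 * (s * p + t * q)) * (2 * (s * q - t * p)) = - ((2 * (s * p + t * q)) * (2 * (s * q - t * p)))"
    unfolding a22 by (simp_all only: mult_minus_right mult.commute)
  then have "2 * (s * p + t * q) = 0" "2 * (s * q - t * p) = 0" using sq_rotation_zero by blast+
  then have 0: "s * p + t * q = 0" "s * q - t * p = 0" by simp_all
  show "L 2 2 = 0" "L 3 2 = 0"
  proof -
    \<comment> \<open>That is, p + iq = (s - it)(C_1212 + i C_1213), so psi = 0 forces s - it =
      0.\<close>
    have pq: "p = s * C 1 2 1 2 + t * C 1 2 1 3" "q = s * C 1 2 1 3 - t * C 1 2 1 2"
      unfolding s_t_p_q_def P_mu by simp_all
    have "s = 0 \<and> t = 0"
    proof (cases "p = 0 \<and> q = 0")
      case True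
      show ?thesis by (rule complex_zero_divisor[OF _ _ Cnz]) (use True pq in auto)
    next
      case False
      show ?thesis by (rule complex_zero_divisor[OF 0]) (use False in auto)
    qed
    then show "L 2 2 = 0" "L 3 2 = 0" using s_t_p_q_def by auto
  qed
qed

section \<open>Type III\<close>

text \<open>As \<open>type_N_point\<close>, now with C(l, b, c, d) = l_b (l_c mu_d - l_d mu_c).
  \<open>l\<close> and \<open>\<mu>\<close> are frame components of covectors,
  \<open>\<nu> d e\<close> those of the derivative of mu along e_e, and \<open>L (st01 b) e\<close>
  those of the lowered derivative of l. \<open>P0\<close> and \<open>nu0\<close> are the Leibniz
  rule for this equation and for mu(l) = 0.\<close>

locale type_III_point =
  fixes C :: "4 \<Rightarrow> 4 \<Rightarrow> 4 \<Rightarrow> 4 \<Rightarrow> real" and P :: "4 \<Rightarrow> 4 \<Rightarrow> 4 \<Rightarrow> 4 \<Rightarrow> 4 \<Rightarrow> real" and L :: "4 \<Rightarrow> 4 \<Rightarrow> real"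
    and l :: "4 \<Rightarrow> real" and \<mu> :: "4 \<Rightarrow> real" and \<nu> :: "4 \<Rightarrow> 4 \<Rightarrow> real"
  assumes WC: "weyl_array C" and C0: "\<And>b c d. C 0 b c d = l b * (l c * \<mu> d - l d * \<mu> c)"
    and l_def: "\<And>b. l b = (if b = 1 then 1 else 0)"
    and mu0: "\<mu> 0 = 0" and mu_nz: "\<mu> 2 \<noteq> 0 \<or> \<mu> 3 \<noteq> 0"
    and WP: "\<And>e. weyl_array (P e)"
    and P0: "\<And>e b c d. P e 0 b c d = - (\<Sum>k\<in>UNIV. L k e * C k b c d)
       + L (st01 b) e * (l c * \<mu> d - l d * \<mu> c) + l b * (L (st01 c) e * \<mu> d - L (st01 d) e * \<mu> c)
       + l b * (l c * \<nu> d e - l d * \<nu> c e)"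
    and nu0: "\<And>e. \<nu> 0 e = - (\<Sum>k\<in>UNIV. L k e * \<mu> k)"
    and bianchi: "\<And>e a b c d. P e a b c d + P c a b d e + P d a b e c = 0"
    and L1: "\<And>e. L 1 e = 0"
    and quartic: "(\<Sum>i\<in>UNIV. \<Sum>j\<in>UNIV. contr4 (P i) (P j) * contr4 (P (st01 i)) (P (st01 j))) = 0"
begin

lemmas wC = weyl_array_comps[OF WC] and wP = weyl_array_comps[OF WP]

lemma l_simps [simp]: "l 0 = 0" "l 1 = 1" "l 2 = 0" "l 3 = 0"
  by (simp_all add: l_def)

lemma order_C: "order_le C (-1)"
  by (rule order_le_m1[OF WC]) (simp_all add: C0 mu0)

lemma C_zero: "-1 < bw1 a + bw1 b + bw1 c + bw1 d \<Longrightarrow> C a b c d = 0"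
  using order_leD[OF order_C] .

lemma C_mu: "C 0 1 1 2 = \<mu> 2" "C 0 1 1 3 = \<mu> 3" "C 2 1 0 1 = - \<mu> 2" "C 3 1 0 1 = - \<mu> 3"
  "C 2 1 2 3 = - \<mu> 3" "C 3 1 2 3 = \<mu> 2"
proof -
  show 1: "C 0 1 1 2 = \<mu> 2" "C 0 1 1 3 = \<mu> 3" by (simp_all add: C0)
  show "C 2 1 0 1 = - \<mu> 2" "C 3 1 0 1 = - \<mu> 3"
    using wC(16)[of 2 1 0 1] wC(16)[of 3 1 0 1] by (simp_all add: C0)
  show "C 2 1 2 3 = - \<mu> 3" "C 3 1 2 3 = \<mu> 2"
    using wC(14)[of 2 1 2 3] wC(14)[of 3 1 2 3] wC(9,10) 1 by simp_all
qed

lemma P_zeros: "P e 0 2 0 2 = 0" "P e 0 2 0 3 = 0" "P e 0 1 0 2 = 0" "P e 0 1 0 3 = 0"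
  unfolding P0 sum_4' by (simp_all add: C_zero L1 mu0)

text \<open>\<open>\<nu>\<close> enters only through \<open>\<nu> 0 e\<close>, which
  \<open>nu0\<close> expresses by \<open>L\<close>. \<open>P_a\<close> and \<open>P_b\<close> form
  the complex number 2 (L_2e - i L_3e)(mu_2 + i mu_3).\<close>

lemma P_a: "P e 0 1 0 1 = 2 * (L 2 e * \<mu> 2 + L 3 e * \<mu> 3)"
  unfolding P0 sum_4' nu0 by (simp add: C_zero L1 mu0 C_mu)

lemma P_b: "P e 0 1 2 3 = 2 * (L 2 e * \<mu> 3 - L 3 e * \<mu> 2)"
  unfolding P0 sum_4' by (simp add: C_zero L1 mu0 C_mu algebra_simps)

lemma order_P: "order_le (P e) 0"
  by (rule order_le_0[OF WP]) (rule P_zeros)+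

lemma P_zero: "0 < bw1 a + bw1 b + bw1 c + bw1 d \<Longrightarrow> P e a b c d = 0"
  using order_leD[OF order_P] .

text \<open>In the Bianchi identities used, the terms not differentiated along l have boost weight 1
  and vanish.\<close>

lemma P_0_ab: "P 0 0 1 0 1 = 0" "P 0 0 1 2 3 = 0"
proof -
  show "P 0 0 1 2 3 = 0" using bianchi[of 0 0 1 2 3] by (simp add: P_zero)
  have "P 0 0 2 1 2 = 0" using bianchi[of 0 0 2 1 2] by (simp add: P_zero)
  then show "P 0 0 1 0 1 = 0" using wP(1)[of 0] by simp
qed

lemma kappa: "L 2 0 = 0" "L 3 0 = 0"
proof -
  have "L 2 0 = 0 \<and> L 3 0 = 0"
    using P_0_ab mu_nz unfolding P_a P_b by (intro complex_zero_divisor) auto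
  then show "L 2 0 = 0" "L 3 0 = 0" by auto
qed

text \<open>The weight -1 components of \<open>P 0\<close> are computed from two different Bianchi
  identities. Comparing the results gives the last two equations, which express the absence of
  shear.\<close>

lemma P_0_mu: "P 0 0 1 1 2 = - P 2 0 1 0 1" "P 0 0 1 1 3 = - P 3 0 1 0 1"
  "P 3 0 1 2 3 = - P 2 0 1 0 1" "P 2 0 1 2 3 = P 3 0 1 0 1"
proof -
  show 1: "P 0 0 1 1 2 = - P 2 0 1 0 1" "P 0 0 1 1 3 = - P 3 0 1 0 1"
    using bianchi[of 0 0 1 1 2] bianchi[of 0 0 1 1 3] by (simp_all add: P_zero)
  have "P 0 2 3 1 2 = - P 2 2 3 0 1" "P 0 2 3 1 3 = - P 3 2 3 0 1"
    using bianchi[of 0 2 3 1 2] bianchi[of 0 2 3 1 3] by (simp_all add: P_zero)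
  moreover have "P 0 2 3 1 2 = P 0 1 2 2 3" "P 0 2 3 1 3 = P 0 1 3 2 3" "P 2 2 3 0 1 = P 2 0 1 2 3" "P 3 2 3 0 1 = P 3 0 1 2 3"
    by (rule wP(16))+
  ultimately show "P 3 0 1 2 3 = - P 2 0 1 0 1" "P 2 0 1 2 3 = P 3 0 1 0 1"
    using wP(9,10)[of 0] 1 by simp_all
qed

lemma shear: "L 3 3 = L 2 2" "L 2 3 = - L 3 2"
proof -
  have "(L 2 2 - L 3 3) = 0 \<and> (L 3 2 + L 2 3) = 0"
  proof (rule complex_zero_divisor)
    show "\<mu> 2 \<noteq> 0 \<or> \<mu> 3 \<noteq> 0" by (rule mu_nz)
    show "(L 2 2 - L 3 3) * \<mu> 2 + (L 3 2 + L 2 3) * \<mu> 3 = 0"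
      using P_0_mu(3) unfolding P_a P_b by (simp add: algebra_simps)
    show "(L 2 2 - L 3 3) * \<mu> 3 - (L 3 2 + L 2 3) * \<mu> 2 = 0"
      using P_0_mu(4) unfolding P_a P_b by (simp add: algebra_simps)
  qed
  then show "L 3 3 = L 2 2" "L 2 3 = - L 3 2" by auto
qed

text \<open>By \<open>P_0_mu\<close> the weight 0 part of \<open>P 3\<close> is -i times that of
  \<open>P 2\<close>, so the quartic invariant yields both parts of the square of one complex
  number.\<close>

lemma P_a_zero: "P 2 0 1 0 1 = 0" "P 3 0 1 0 1 = 0"
proof -
  define z where "z = (\<lambda>e. if e = (0::4) then 1 else (0::int))"
  have main: "P i 0 1 0 1 * P j 0 1 0 1 = P i 0 1 2 3 * P j 0 1 2 3" if "i \<in> {2,3}" "j \<in> {2,3}" for i j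
  proof (rule quartic_vanish[of P z st01])
    show "order_le (P e) (- z e)" for e
      using order_P order_le_m1[OF WP P_zeros, of 0] P_0_ab by (auto simp: z_def)
    show "st01 e = e" if "z e = 0" "z (st01 e) = 0" for e
      using that by (auto simp: z_def st01_def split: if_splits)
  qed (use WP quartic that in \<open>auto simp: z_def\<close>)
  have "P 2 0 1 0 1 * P 2 0 1 0 1 = P 3 0 1 0 1 * P 3 0 1 0 1" 
    using main[of 2 2] P_0_mu(4) by simp
  moreover have "P 2 0 1 0 1 * P 3 0 1 0 1 = - (P 2 0 1 0 1 * P 3 0 1 0 1)"
    using main[of 2 3] unfolding P_0_mu(3,4) by (simp add: mult.commute)
  ultimately show "P 2 0 1 0 1 = 0" "P 3 0 1 0 1 = 0" by (rule sq_rotation_zero)+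
qed

lemma expansion: "L 2 2 = 0" "L 3 2 = 0"
proof -
  have "L 2 2 = 0 \<and> L 3 2 = 0"
    using P_a_zero mu_nz unfolding P_a shear by (intro complex_zero_divisor) auto
  then show "L 2 2 = 0" "L 3 2 = 0" by auto
qed

text \<open>The weight -1 part of \<open>P 0\<close> has become zero, which says that the derivative
  of mu along l is -\<open>L 0 0\<close> times mu in transverse directions. The hypothesis expresses
  that the length of mu is constant along l.\<close>

lemma affine:
  assumes "\<mu> 2 * \<nu> 2 0 + \<mu> 3 * \<nu> 3 0 = 0" shows "L 0 0 = 0"
proof -
  have "P 0 0 1 1 i = L 0 0 * \<mu> i + \<nu> i 0" if "i = 2 \<or> i = 3" for i
    using that unfolding P0 sum_4' by (auto simp: L1 kappa C_mu)
  then have "\<nu> 2 0 = - (L 0 0 * \<mu> 2)" "\<nu> 3 0 = - (L 0 0 * \<mu> 3)"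
    using P_0_mu(1,2) P_a_zero by simp_all
  then have "L 0 0 * (\<mu> 2 * \<mu> 2 + \<mu> 3 * \<mu> 3) = 0" using assms by (simp add: algebra_simps)
  moreover have "\<mu> 2 * \<mu> 2 + \<mu> 3 * \<mu> 3 \<noteq> 0" using mu_nz by (simp add: sum_squares_eq_zero_iff)
  ultimately show ?thesis by (metis mult_eq_0_iff)
qed

end

section \<open>Vanishing zeroth order invariants\<close>

definition sg :: "4 \<Rightarrow> real" where "sg a = (if a = 0 then -1 else 1)"

lemma sg_simps [simp]: "sg 0 = -1" "sg 1 = 1" "sg 2 = 1" "sg 3 = 1" by (simp_all add: sg_def)

lemma orthonormal_frame:
  assumes "lorentz_form G"
  obtains o' where "\<And>a b. ip G (o' a) (o' b) = (if a = b then sg a else 0)" 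
    "pairing_frame (matrix_inv G) o' sg (\<lambda>a. a)"
proof -
  obtain E :: "real^4^4" where E: "transpose E ** G ** E = (\<chi> i j. if i \<noteq> j then 0 else if i = 0 then - 1 else 1)"
    using assms unfolding lorentz_form_def by blast
  define o' where "o' = (\<lambda>a. \<chi> i. E $ i $ a)"
  have ip: "ip G (o' a) (o' b) = (if a = b then sg a else 0)" for a b
  proof -
    have "ip G (o' a) (o' b) = (transpose E ** G ** E) $ a $ b"
      unfolding ip_sum matrix_matrix_mult_def o'_def transpose_def
      by (simp add: sum_distrib_right) (rule sum.swap)
    then show ?thesis unfolding E by (simp add: sg_def)
  qed
  define F :: "real^4^4" where "F = (\<chi> a j. sg a * o' a $ j)"
  have "((F ** G) ** E) $ a $ b = mat 1 $ a $ b" for a b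
  proof -
    have "((F ** G) ** E) $ a $ b = sg a * ip G (o' a) (o' b)"
      unfolding ip_sum matrix_matrix_mult_def F_def o'_def
      by (simp add: sum_distrib_right sum_distrib_left mult.assoc) (rule sum.swap)
    then show ?thesis by (simp add: ip mat_def sg_def)
  qed
  then have "(F ** G) ** E = mat 1" by (simp add: vec_eq_iff)
  then have "E ** (F ** G) = mat 1" by (rule matrix_left_right_inverse[THEN iffD1])
  then have "(E ** F) ** (G ** matrix_inv G) = matrix_inv G" by (simp add: matrix_mul_assoc)
  then have "matrix_inv G = E ** F" by (simp add: matrix_inv_mult[OF lorentz_form_symmetric(2)[OF assms]])
  then have "pairing_frame (matrix_inv G) o' sg (\<lambda>a. a)"
    unfolding pairing_frame_def by (simp add: matrix_matrix_mult_def o'_def F_def mult_ac)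
  with ip show ?thesis using that by blast
qed

text \<open>A tensor commuting with the Hodge dual is represented by the complex matrix of its action
  on self-dual bivectors; \<open>el\<close> and \<open>mg\<close> are the electric and magnetic index pairs.\<close>

definition el :: "3 \<Rightarrow> 4 \<times> 4" where "el i = (0, if i = 1 then 1 else if i = 2 then 2 else 3)"
definition mg :: "3 \<Rightarrow> 4 \<times> 4" where "mg i = (if i = 1 then (2, 3) else if i = 2 then (3, 1) else (1, 2))"

lemma el_mg_simps [simp]: "el 1 = (0,1)" "el 2 = (0,2)" "el 3 = (0,3)" "mg 1 = (2,3)" "mg 2 = (3,1)" "mg 3 = (1,2)"
  by (simp_all add: el_def mg_def)

definition pr :: "(4 \<Rightarrow> 4 \<Rightarrow> 4 \<Rightarrow> 4 \<Rightarrow> real) \<Rightarrow> 4 \<times> 4 \<Rightarrow> 4 \<times> 4 \<Rightarrow> real" where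
  "pr X p q = X (fst p) (snd p) (fst q) (snd q)"

definition rep :: "(4 \<Rightarrow> 4 \<Rightarrow> 4 \<Rightarrow> 4 \<Rightarrow> real) \<Rightarrow> complex^3^3 \<Rightarrow> bool" where
  "rep X Q \<longleftrightarrow> (\<forall>a b c d. X a b c d = - X b a c d \<and> X a b c d = - X a b d c) \<and>
     (\<forall>i j. pr X (el i) (el j) = Re (Q $ i $ j) \<and> pr X (mg i) (mg j) = Re (Q $ i $ j) \<and>
       pr X (el i) (mg j) = Im (Q $ i $ j) \<and> pr X (mg i) (el j) = - Im (Q $ i $ j))"

definition bcomp :: "(4 \<Rightarrow> 4 \<Rightarrow> 4 \<Rightarrow> 4 \<Rightarrow> real) \<Rightarrow> (4 \<Rightarrow> 4 \<Rightarrow> 4 \<Rightarrow> 4 \<Rightarrow> real) \<Rightarrow> 4 \<Rightarrow> 4 \<Rightarrow> 4 \<Rightarrow> 4 \<Rightarrow> real" where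
  "bcomp X Y a b c d = (\<Sum>i\<in>UNIV. \<Sum>j\<in>UNIV. X a b i j * Y i j c d)"

definition btr :: "(4 \<Rightarrow> 4 \<Rightarrow> 4 \<Rightarrow> 4 \<Rightarrow> real) \<Rightarrow> real" where
  "btr X = (\<Sum>a\<in>UNIV. \<Sum>b\<in>UNIV. X a b a b)"

lemma bivector_sum:
  assumes "\<And>a b. A a b = - A b a" "\<And>a b. B a b = - B b a"
  shows "(\<Sum>a\<in>UNIV. \<Sum>b\<in>(UNIV::4 set). A a b * B a b) = 
    (\<Sum>k\<in>UNIV. 2 * (A (fst (el k)) (snd (el k)) * B (fst (el k)) (snd (el k)) + A (fst (mg k)) (snd (mg k)) * (B (fst (mg k)) (snd (mg k)) :: real)))"
  unfolding antisym_sum[of A B, OF assms] sum_3 using assms(1)[of 3 1] assms(2)[of 3 1] by simp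

text \<open>The factor 2 arises because the double sum meets every bivector index pair in both
  orders.\<close>

lemma rep_bcomp:
  assumes X: "rep X Q" and Y: "rep Y R" shows "rep (bcomp X Y) (\<chi> i j. 2 * (Q ** R) $ i $ j)"
proof -
  have aX: "X a b c d = - X b a c d" "X a b c d = - X a b d c" for a b c d using X unfolding rep_def by blast+
  have aY: "Y a b c d = - Y b a c d" "Y a b c d = - Y a b d c" for a b c d using Y unfolding rep_def by blast+
  have X': "pr X (el i) (el j) = Re (Q $ i $ j)" "pr X (mg i) (mg j) = Re (Q $ i $ j)"
       "pr X (el i) (mg j) = Im (Q $ i $ j)" "pr X (mg i) (el j) = - Im (Q $ i $ j)" for i j using X unfolding rep_def by blast+
  have Y': "pr Y (el i) (el j) = Re (R $ i $ j)" "pr Y (mg i) (mg j) = Re (R $ i $ j)"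
       "pr Y (el i) (mg j) = Im (R $ i $ j)" "pr Y (mg i) (el j) = - Im (R $ i $ j)" for i j using Y unfolding rep_def by blast+
  have "pr (bcomp X Y) p q = (\<Sum>k\<in>UNIV. 2 * (pr X p (el k) * pr Y (el k) q + pr X p (mg k) * pr Y (mg k) q))" for p q
    unfolding pr_def bcomp_def by (rule bivector_sum) (rule aX(2), rule aY(1))
  note c = this
  have b1: "bcomp X Y a b c d = - bcomp X Y b a c d" for a b c d
  proof -
    have "bcomp X Y a b c d = (\<Sum>i\<in>UNIV. \<Sum>j\<in>UNIV. - X b a i j * Y i j c d)"
      unfolding bcomp_def by (intro sum.cong refl arg_cong2[where f="(*)"] aX(1))
    then show ?thesis by (simp add: bcomp_def sum_negf)
  qed
  have b2: "bcomp X Y a b c d = - bcomp X Y a b d c" for a b c d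
  proof -
    have "bcomp X Y a b c d = (\<Sum>i\<in>UNIV. \<Sum>j\<in>UNIV. X a b i j * - Y i j d c)"
      unfolding bcomp_def by (intro sum.cong refl arg_cong2[where f="(*)"] aY(2))
    then show ?thesis by (simp add: bcomp_def sum_negf)
  qed
  show ?thesis unfolding rep_def c X' Y'
    by (intro conjI allI; (rule b1 b2 | simp add: matrix_matrix_mult_def sum_3 algebra_simps))
qed

lemma rep_btr:
  assumes X: "rep X Q" shows "btr X = 4 * Re (trace Q)"
proof -
  have aX: "X a b c d = - X b a c d" "X a b c d = - X a b d c" for a b c d using X unfolding rep_def by blast+
  have d: "X a b a b = X b a b a" for a b using aX(1)[of a b a b] aX(2)[of b a a b] by simp
  have z: "X a a a a = 0" for a using aX(1)[of a a a a] by simp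
  have "btr X = 2 * (X 0 1 0 1 + X 0 2 0 2 + X 0 3 0 3 + X 1 2 1 2 + X 3 1 3 1 + X 2 3 2 3)"
    unfolding btr_def sum_4' using d[of 1 0] d[of 2 0] d[of 3 0] d[of 2 1] d[of 1 3] d[of 3 2] by (simp add: z)
  moreover have "pr X (el i) (el j) = Re (Q $ i $ j)" "pr X (mg i) (mg j) = Re (Q $ i $ j)" for i j using X unfolding rep_def by blast+
  from this(1)[of 1 1] this(1)[of 2 2] this(1)[of 3 3] this(2)[of 1 1] this(2)[of 2 2] this(2)[of 3 3]
  have "X 0 1 0 1 = Re (Q$1$1)" "X 0 2 0 2 = Re (Q$2$2)" "X 0 3 0 3 = Re (Q$3$3)"
    "X 2 3 2 3 = Re (Q$1$1)" "X 3 1 3 1 = Re (Q$2$2)" "X 1 2 1 2 = Re (Q$3$3)" unfolding pr_def by simp_all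
  ultimately show ?thesis unfolding trace_def sum_3 by simp
qed

text \<open>The Cayley-Hamilton theorem with det Q = tr Q^3 / 3 for trace 0, verified entrywise
  after eliminating \<open>Q $ 3 $ 3\<close>.\<close>

lemma cayley_hamilton_traceless:
  fixes Q :: "complex^3^3" assumes "trace Q = 0"
  shows "(Q ** (Q ** Q)) $ i $ j = trace (Q ** Q) / 2 * Q $ i $ j + (if i = j then trace (Q ** (Q ** Q)) / 3 else 0)"
proof -
  have q: "Q $ 3 $ 3 = - Q $ 1 $ 1 - Q $ 2 $ 2"
    using assms unfolding trace_def sum_3 by (simp add: algebra_simps eq_neg_iff_add_eq_0)
  have "\<forall>i j. 6 * (Q ** (Q ** Q)) $ i $ j = 3 * trace (Q ** Q) * Q $ i $ j + (if i = j then 2 * trace (Q ** (Q ** Q)) else 0)"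
    unfolding forall_3 trace_def sum_3 matrix_matrix_mult_def vec_lambda_beta q
    by (simp add: algebra_simps)
  then have "6 * (Q ** (Q ** Q)) $ i $ j = 3 * trace (Q ** Q) * Q $ i $ j + (if i = j then 2 * trace (Q ** (Q ** Q)) else 0)"
    by blast
  then show ?thesis by (simp add: field_simps split: if_splits)
qed

text \<open>Cayley-Hamilton gives tr Q^4 = (tr Q^2)^2 / 2 and, once tr Q^2 = 0, tr Q^6 = (tr Q^3)^2
  / 3. A complex number vanishes if it and its square have real part 0, so the imaginary parts of tr
  Q^2 and tr Q^3 are controlled as well.\<close>

lemma nilpotent_of_traces:
  fixes Q :: "complex^3^3"
  assumes t1: "trace Q = 0" and t2: "Re (trace (Q ** Q)) = 0" and t3: "Re (trace (Q ** (Q ** Q))) = 0"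
    and t4: "Re (trace (Q ** (Q ** (Q ** Q)))) = 0"
    and t6: "Re (trace (Q ** (Q ** (Q ** (Q ** (Q ** Q)))))) = 0"
  shows "Q ** (Q ** Q) = 0"
proof -
  let ?a = "trace (Q ** Q)" and ?b = "trace (Q ** (Q ** Q))"
  note ch = cayley_hamilton_traceless[OF t1]
  have gen: "(\<Sum>i\<in>UNIV. \<Sum>k\<in>UNIV. Q $ i $ k * (\<alpha> * Q $ k $ i + (if k = i then \<beta> else 0))) =
     \<alpha> * (\<Sum>i\<in>UNIV. \<Sum>k\<in>UNIV. Q $ i $ k * Q $ k $ i) + \<beta> * (\<Sum>i\<in>UNIV. Q $ i $ i)" for \<alpha> \<beta> :: complex
    by (simp add: sum_3 algebra_simps)
  have "trace (Q ** (Q ** (Q ** Q))) = (\<Sum>i\<in>UNIV. \<Sum>k\<in>UNIV. Q $ i $ k * (Q ** (Q ** Q)) $ k $ i)"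
    unfolding trace_def by (subst matrix_matrix_mult_def) simp
  also have "\<dots> = ?a / 2 * (\<Sum>i\<in>UNIV. \<Sum>k\<in>UNIV. Q $ i $ k * Q $ k $ i) + ?b / 3 * trace Q"
    unfolding ch gen by (simp add: trace_def)
  also have "(\<Sum>i\<in>UNIV. \<Sum>k\<in>UNIV. Q $ i $ k * Q $ k $ i) = ?a"
    unfolding trace_def matrix_matrix_mult_def by simp
  finally have "trace (Q ** (Q ** (Q ** Q))) = ?a * ?a / 2" by (simp add: t1)
  then have "Re (trace (Q ** (Q ** (Q ** Q)))) = Re (?a * ?a / 2)" by (rule arg_cong)
  then have "Re (?a * ?a) = 0" unfolding t4 by simp
  then have a0: "?a = 0" using t2 by (simp add: complex_eq_iff)
  have Q3: "(Q ** (Q ** Q)) $ i $ j = (if i = j then ?b / 3 else 0)" for i j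
    using ch[of i j] a0 by simp
  have "Q ** (Q ** (Q ** (Q ** (Q ** Q)))) = (Q ** (Q ** Q)) ** (Q ** (Q ** Q))" by (simp add: matrix_mul_assoc)
  then have "trace (Q ** (Q ** (Q ** (Q ** (Q ** Q))))) = (\<Sum>i\<in>UNIV. \<Sum>k\<in>UNIV. (Q ** (Q ** Q)) $ i $ k * (Q ** (Q ** Q)) $ k $ i)"
    unfolding trace_def by (simp add: matrix_matrix_mult_def)
  also have "\<dots> = ?b * ?b / 3" unfolding Q3 by (simp add: sum_3)
  finally have "Re (trace (Q ** (Q ** (Q ** (Q ** (Q ** Q)))))) = Re (?b * ?b / 3)" by (rule arg_cong)
  then have "Re (?b * ?b) = 0" unfolding t6 by simp
  then have "?b = 0" using t3 by (simp add: complex_eq_iff)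
  then show ?thesis using Q3 by (simp add: vec_eq_iff)
qed

text \<open>A nonzero column of the highest nonvanishing power of \<open>Q\<close>: by symmetry of
  \<open>Q\<close> its product with itself is an entry of the square of that power, which is 0. For
  Q = 0 the vector (1, i, 0) will do.\<close>

lemma isotropic_kernel:
  fixes Q :: "complex^3^3"
  assumes N: "Q ** (Q ** Q) = 0" and sym: "transpose Q = Q"
  obtains w where "w \<noteq> 0" "Q *v w = 0" "(\<Sum>i\<in>UNIV. w $ i * w $ i) = 0"
proof -
  have sq: "(\<Sum>i\<in>UNIV. column j M $ i * column j M $ i) = (transpose M ** M) $ j $ j" for M :: "complex^3^3" and j
    by (simp add: matrix_matrix_mult_def transpose_def column_def)
  have col: "Q *v column j M = column j (Q ** M)" for M j
    by (simp add: vec_eq_iff column_def matrix_matrix_mult_def matrix_vector_mult_def)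
  have nz: "\<exists>j. column j M \<noteq> 0" if "M \<noteq> 0" for M :: "complex^3^3"
    using that by (auto simp: vec_eq_iff column_def)
  have c0: "column j (0 :: complex^3^3) = 0" for j by (simp add: vec_eq_iff column_def)
  consider "Q ** Q \<noteq> 0" | "Q ** Q = 0" "Q \<noteq> 0" | "Q = 0" by blast
  then show ?thesis
  proof cases
    case 1
    then obtain j where "column j (Q ** Q) \<noteq> 0" using nz by blast
    moreover have "transpose (Q ** Q) ** (Q ** Q) = (Q ** (Q ** Q)) ** Q"
      by (simp add: matrix_transpose_mul sym matrix_mul_assoc)
    then have "transpose (Q ** Q) ** (Q ** Q) = 0" unfolding N by simp
    ultimately show ?thesis by (intro that[of "column j (Q ** Q)"]) (simp_all add: col sq N c0)
  next
    case 2
    then obtain j where "column j Q \<noteq> 0" using nz by blast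
    then show ?thesis by (intro that[of "column j Q"]) (simp_all add: col sq sym 2 c0)
  next
    case 3
    then show ?thesis
      by (intro that[of "\<chi> i. if i = 1 then 1 else if i = 2 then \<i> else 0"])
        (simp_all add: 3 matrix_vector_mult_def vec_eq_iff sum_3 forall_3)
  qed
qed

lemma sum_lists_4: "(\<Sum>I | length I = 4. F (I :: 4 list)) = (\<Sum>a\<in>UNIV. \<Sum>b\<in>UNIV. \<Sum>c\<in>UNIV. \<Sum>d\<in>UNIV. F [a,b,c,d] :: real)"
proof -
  have "(4::nat) = Suc (Suc (Suc (Suc 0)))" by simp
  then show ?thesis by (simp only: sum_lists_Suc sum_lists_0)
qed

lemma sum_lists_6: "(\<Sum>I | length I = 6. F (I :: 4 list)) = (\<Sum>a\<in>UNIV. \<Sum>b\<in>UNIV. \<Sum>c\<in>UNIV. \<Sum>d\<in>UNIV. \<Sum>i\<in>UNIV.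
  \<Sum>j\<in>UNIV. F [a,b,c,d,i,j] :: real)"
proof -
  have "(6::nat) = Suc (Suc (Suc (Suc (Suc (Suc 0)))))" by simp
  then show ?thesis by (simp only: sum_lists_Suc sum_lists_0)
qed

lemma sum_lists_8: "(\<Sum>I | length I = 8. F (I :: 4 list)) = (\<Sum>a\<in>UNIV. \<Sum>b\<in>UNIV. \<Sum>c\<in>UNIV. \<Sum>d\<in>UNIV. \<Sum>i\<in>UNIV.
  \<Sum>j\<in>UNIV. \<Sum>k\<in>UNIV. \<Sum>l\<in>UNIV. F [a,b,c,d,i,j,k,l] :: real)"
proof -
  have "(8::nat) = Suc (Suc (Suc (Suc (Suc (Suc (Suc (Suc 0)))))))" by simp
  then show ?thesis by (simp only: sum_lists_Suc sum_lists_0)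
qed

text \<open>Traces of powers of the Weyl tensor as an operator on bivectors. The signs raise the
  first index pair.\<close>

lemma chain_invariants:
  assumes inv: "\<And>f x. f \<in> polynomial_invariants g T 4 m \<Longrightarrow> x \<in> S \<Longrightarrow> f x = 0" and x: "x \<in> S"
    and H: "pairing_frame (matrix_inv (g x)) e s (\<lambda>a. a)"
    and B: "B = (\<lambda>a b c d. s a * s b * frame_array e (T x) a b c d)"
  shows "btr (bcomp B B) = 0" "btr (bcomp B (bcomp B B)) = 0" "btr (bcomp B (bcomp B (bcomp B B))) = 0"
    "btr (bcomp B (bcomp B (bcomp B (bcomp B (bcomp B B))))) = 0"
proof -
  define F where "F = frame_component (T x) e"
  have FB: "B = (\<lambda>a b c d. s a * s b * F [a,b,c,d])"
    unfolding B F_def frame_component_tev frame_array_def by simp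
  note I = invariant_frame[where T=T and r=4 and m=m and g=g and x=x and S=S, OF _ x H]
  \<comment> \<open>The second index pair of each factor consists of the partners of the first pair
    of the next factor, cyclically; the longer lists below follow the same rule.\<close>
  define p where "p = [0,2,5,7, 4,6,1,3 :: nat]"
  have m1: "map (\<lambda>k. (4 + k, frame_component ((nabla g ^^ k) T x) e)) (replicate n 0) = replicate n (4, F)" for n
    by (simp add: F_def)
  have "(\<Sum>K | length K = 4. (\<Prod>a\<leftarrow>K. s a) *
     tensor_product (map (\<lambda>k. (4 + k, frame_component ((nabla g ^^ k) T x) e)) (replicate 2 0)) (map ((!) (zz (\<lambda>a. a) K)) p)) = 0"
    by (intro I inv) (simp_all add: p_def numeral_2_eq_2)
  moreover have "(\<Prod>a\<leftarrow>[a,b,c,d]. s a) * tensor_product (replicate 2 (4,F)) (map ((!) (zz (\<lambda>a. a) [a,b,c,d])) p)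
     = B a b c d * B c d a b" for a b c d
    by (simp add: p_def FB numeral_2_eq_2 mult_ac)
  ultimately have "(\<Sum>a\<in>UNIV. \<Sum>b\<in>UNIV. \<Sum>c\<in>UNIV. \<Sum>d\<in>UNIV. B a b c d * B c d a b) = 0"
    unfolding m1 sum_lists_4 by (simp only:)
  then show "btr (bcomp B B) = 0" unfolding btr_def bcomp_def .
  define p3 where "p3 = [0,2,5,7, 4,6,9,11, 8,10,1,3 :: nat]"
  have "(\<Sum>K | length K = 6. (\<Prod>a\<leftarrow>K. s a) *
     tensor_product (map (\<lambda>k. (4 + k, frame_component ((nabla g ^^ k) T x) e)) (replicate 3 0)) (map ((!) (zz (\<lambda>a. a) K)) p3)) = 0"
    by (intro I inv) (simp_all add: p3_def numeral_3_eq_3)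
  moreover have "(\<Prod>a\<leftarrow>[a,b,c,d,i,j]. s a) * tensor_product (replicate 3 (4,F)) (map ((!) (zz (\<lambda>a. a) [a,b,c,d,i,j])) p3)
     = B a b c d * (B c d i j * B i j a b)" for a b c d i j
    by (simp add: p3_def FB numeral_3_eq_3 mult_ac)
  ultimately have "(\<Sum>a\<in>UNIV. \<Sum>b\<in>UNIV. \<Sum>c\<in>UNIV. \<Sum>d\<in>UNIV. \<Sum>i\<in>UNIV. \<Sum>j\<in>UNIV. B a b c d * (B c d i j * B i j a b)) = 0"
    unfolding m1 sum_lists_6 by (simp only:)
  then show "btr (bcomp B (bcomp B B)) = 0" unfolding btr_def bcomp_def sum_distrib_left .
  define p4 where "p4 = [0,2,5,7, 4,6,9,11, 8,10,13,15, 12,14,1,3 :: nat]"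
  have r4: "replicate 4 q = [q,q,q,q]" "replicate 6 q = [q,q,q,q,q,q]" for q :: "'q" by (simp_all add: numeral_eq_Suc)
  have r4': "replicate 4 q = [q,q,q,q]" "replicate 6 q = [q,q,q,q,q,q]" for q :: "nat" by (simp_all add: numeral_eq_Suc)
  have r4'': "replicate 4 q = [q,q,q,q]" "replicate 6 q = [q,q,q,q,q,q]" for q :: "nat \<times> tensor" by (simp_all add: numeral_eq_Suc)
  have "(\<Sum>K | length K = 8. (\<Prod>a\<leftarrow>K. s a) *
     tensor_product (map (\<lambda>k. (4 + k, frame_component ((nabla g ^^ k) T x) e)) (replicate 4 0)) (map ((!) (zz (\<lambda>a. a) K)) p4)) = 0"
    by (intro I inv) (simp_all add: p4_def r4')
  moreover have "(\<Prod>a\<leftarrow>[a,b,c,d,i,j,k,l]. s a) * tensor_product (replicate 4 (4,F)) (map ((!) (zz (\<lambda>a. a) [a,b,c,d,i,j,k,l])) p4)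
     = B a b c d * (B c d i j * (B i j k l * B k l a b))" for a b c d i j k l
    by (simp add: p4_def FB r4'' mult_ac)
  ultimately have "(\<Sum>a\<in>UNIV. \<Sum>b\<in>UNIV. \<Sum>c\<in>UNIV. \<Sum>d\<in>UNIV. \<Sum>i\<in>UNIV. \<Sum>j\<in>UNIV. \<Sum>k\<in>UNIV. \<Sum>l\<in>UNIV.
      B a b c d * (B c d i j * (B i j k l * B k l a b))) = 0"
    unfolding m1 sum_lists_8 by (simp only:)
  then show "btr (bcomp B (bcomp B (bcomp B B))) = 0" unfolding btr_def bcomp_def sum_distrib_left .
  define p6 where "p6 = [0,2,5,7, 4,6,9,11, 8,10,13,15, 12,14,17,19, 16,18,21,23, 20,22,1,3 :: nat]"
  have "(\<Sum>K | length K = 12. (\<Prod>a\<leftarrow>K. s a) *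
     tensor_product (map (\<lambda>k. (4 + k, frame_component ((nabla g ^^ k) T x) e)) (replicate 6 0)) (map ((!) (zz (\<lambda>a. a) K)) p6)) = 0"
    by (intro I inv) (simp_all add: p6_def r4')
  moreover have "(\<Prod>a\<leftarrow>[a,b,c,d,i,j,k,l,u,v,w,z]. s a) * tensor_product (replicate 6 (4,F)) (map ((!) (zz (\<lambda>a. a) [a,b,c,d,i,j,k,l,u,v,w,z])) p6)
     = B a b c d * (B c d i j * (B i j k l * (B k l u v * (B u v w z * B w z a b))))" for a b c d i j k l u v w z
    by (simp add: p6_def FB r4'' mult_ac)
  ultimately have "(\<Sum>a\<in>UNIV. \<Sum>b\<in>UNIV. \<Sum>c\<in>UNIV. \<Sum>d\<in>UNIV. \<Sum>i\<in>UNIV. \<Sum>j\<in>UNIV. \<Sum>k\<in>UNIV. \<Sum>l\<in>UNIV.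
     \<Sum>u\<in>UNIV. \<Sum>v\<in>UNIV. \<Sum>w\<in>UNIV. \<Sum>z\<in>UNIV.
      B a b c d * (B c d i j * (B i j k l * (B k l u v * (B u v w z * B w z a b))))) = 0"
    unfolding m1 sum_lists_12 by (simp only:)
  then show "btr (bcomp B (bcomp B (bcomp B (bcomp B (bcomp B B))))) = 0" unfolding btr_def bcomp_def sum_distrib_left .
qed

text \<open>\<open>Q\<close> combines the electric and magnetic parts. Tracelessness makes the
  magnetic-magnetic block the negative of the electric one, which after raising an index pair is
  commutation with duality. The cyclic identity kills the imaginary part of the trace.\<close>

lemma orthonormal_weyl:
  fixes X :: "4 \<Rightarrow> 4 \<Rightarrow> 4 \<Rightarrow> 4 \<Rightarrow> real"
  assumes s: "\<And>a b c d. X a b c d = - X b a c d" "\<And>a b c d. X a b c d = X c d a b"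
      "\<And>a b c d. X a b c d + X a c d b + X a d b c = 0"
    and t: "\<And>b d. - X 0 b 0 d + X 1 b 1 d + X 2 b 2 d + X 3 b 3 d = 0"
  defines "Q \<equiv> (\<chi> i j. Complex (- pr X (el i) (el j)) (- pr X (el i) (mg j)))"
  shows "rep (\<lambda>a b c d. sg a * sg b * X a b c d) Q" "trace Q = 0" "transpose Q = Q"
proof -
  have s': "X a b d c = - X a b c d" for a b c d using s(2)[of a b d c] s(1)[of d c a b] s(2)[of c d a b] by linarith
  have z: "X a a c d = 0" "X a b c c = 0" for a b c d using s(1)[of a a c d] s'[of a b c c] by linarith+
  have tr: "X 0 1 0 1 + X 0 2 0 2 + X 0 3 0 3 = 0"
    using t[of 0 0, unfolded z] s(1)[of 1 0 1 0] s'[of 0 1 0 1] s(1)[of 2 0 2 0] s'[of 0 2 0 2] s(1)[of 3 0 3 0] s'[of 0 3 0 3] by linarith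
  note t1 = t[of 1 1, unfolded z] s(1)[of 2 1 2 1] s'[of 1 2 1 2]
  note t2 = t[of 2 2, unfolded z] s(1)[of 3 2 3 2] s'[of 2 3 2 3]
  note t3 = t[of 3 3, unfolded z] s(1)[of 3 1 3 1] s'[of 1 3 1 3]
  have mm: "X 2 3 2 3 = - X 0 1 0 1" "X 3 1 3 1 = - X 0 2 0 2" "X 1 2 1 2 = - X 0 3 0 3"
    using t1 t2 t3 tr by linarith+
  have mm': "X 2 3 3 1 = - X 0 1 0 2" "X 2 3 1 2 = - X 0 1 0 3" "X 3 1 1 2 = - X 0 2 0 3"
    using t[of 1 2, unfolded z] s(2)[of 2 3 3 1] s'[of 3 1 2 3]
      t[of 1 3, unfolded z] s(2)[of 2 3 1 2] s(1)[of 2 1 2 3]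
      t[of 2 3, unfolded z] s(2)[of 3 1 1 2] s'[of 1 2 1 3] by linarith+
  have em: "X 0 1 3 1 = X 0 2 2 3" "X 0 1 1 2 = X 0 3 2 3" "X 0 2 1 2 = X 0 3 3 1"
    using t[of 0 3, unfolded z] s(1)[of 1 0 1 3] s'[of 0 1 3 1] s(1)[of 2 0 2 3]
      t[of 0 2, unfolded z] s(1)[of 1 0 1 2] s(1)[of 3 0 3 2] s'[of 0 3 2 3]
      t[of 0 1, unfolded z] s(1)[of 2 0 2 1] s'[of 0 2 1 2] s(1)[of 3 0 3 1] by linarith+
  have p: "X 3 1 2 3 = X 2 3 3 1" "X 1 2 2 3 = X 2 3 1 2" "X 1 2 3 1 = X 3 1 1 2"
    "X 0 2 0 1 = X 0 1 0 2" "X 0 3 0 1 = X 0 1 0 3" "X 0 3 0 2 = X 0 2 0 3"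
    "X 2 3 0 1 = X 0 1 2 3" "X 2 3 0 2 = X 0 2 2 3" "X 2 3 0 3 = X 0 3 2 3" 
    "X 3 1 0 1 = X 0 1 3 1" "X 3 1 0 2 = X 0 2 3 1" "X 3 1 0 3 = X 0 3 3 1"
    "X 1 2 0 1 = X 0 1 1 2" "X 1 2 0 2 = X 0 2 1 2" "X 1 2 0 3 = X 0 3 1 2" by (rule s(2))+
  have b0: "\<forall>i j. pr X (mg i) (mg j) = - pr X (el i) (el j) \<and> pr X (mg i) (el j) = pr X (el i) (mg j)"
    unfolding forall_3 pr_def by (simp add: p mm mm' em)
  have b1: "pr (\<lambda>a b c d. sg a * sg b * X a b c d) (el i) q = - pr X (el i) q"
     "pr (\<lambda>a b c d. sg a * sg b * X a b c d) (mg i) q = pr X (mg i) q" for i q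
    by (simp_all add: pr_def el_def mg_def sg_def)
  have b2: "sg a * sg b * X a b c d = - (sg b * sg a * X b a c d)" "sg a * sg b * X a b c d = - (sg a * sg b * X a b d c)" for a b c d
    using s(1)[of a b c d] s'[of a b c d] by simp_all
  show "rep (\<lambda>a b c d. sg a * sg b * X a b c d) Q"
    unfolding rep_def Q_def by (intro conjI allI; (rule b2 | simp add: b0 b1))
  have "X 0 1 2 3 + X 0 2 3 1 + X 0 3 1 2 = 0" by (rule s(3))
  then show "trace Q = 0" using tr unfolding trace_def sum_3 Q_def pr_def by (simp add: complex_eq_iff)
  have "\<forall>i j. Q $ j $ i = Q $ i $ j" unfolding forall_3 Q_def pr_def by (simp add: p em)
  then show "transpose Q = Q" by (simp add: transpose_def vec_eq_iff)
qed

lemma ip_combination: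
  assumes o: "\<And>a b. ip G (o' a) (o' b) = (if a = b then sg a else 0)"
  shows "ip G (\<Sum>a\<in>UNIV. p a *\<^sub>R o' a) (\<Sum>a\<in>UNIV. q a *\<^sub>R o' a) = - p 0 * q 0 + p 1 * q 1 + p 2 * q 2 + p 3 * q 3"
proof -
  have "ip G (\<Sum>a\<in>UNIV. p a *\<^sub>R o' a) w = (\<Sum>a\<in>UNIV. p a * ip G (o' a) w)" for w
    unfolding ip_def by (simp add: inner_sum_left)
  moreover have "ip G v (\<Sum>a\<in>UNIV. q a *\<^sub>R o' a) = (\<Sum>a\<in>UNIV. q a * ip G v (o' a))" for v
    unfolding ip_def by (simp add: linear_sum[OF matrix_vector_mul_linear] matrix_vector_mult_scaleR inner_sum_right)
  ultimately show ?thesis by (simp add: o sum_4')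
qed

text \<open>An isotropic vector in the kernel of \<open>Q\<close> is a null bivector annihilated by
  the Weyl tensor; its null direction becomes e_0 and its real and imaginary parts the transverse
  frame vectors.\<close>

lemma null_frame_of_vanishing_traces:
  assumes inv: "\<And>f x. f \<in> polynomial_invariants g T 4 m \<Longrightarrow> x \<in> S \<Longrightarrow> f x = 0" and x: "x \<in> S"
    and G: "lorentz_form (g x)" and W: "weyl_sym (matrix_inv (g x)) (\<lambda>a b c d. T x [a,b,c,d])"
  obtains e where "null_frame (g x) e" "order_le (frame_array e (T x)) (-1)"
proof -
  obtain o' where o: "\<And>a b. ip (g x) (o' a) (o' b) = (if a = b then sg a else 0)" 
    and H: "pairing_frame (matrix_inv (g x)) o' sg (\<lambda>a. a)"
    using orthonormal_frame[OF G] by blast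
  define X where "X = frame_array o' (T x)"
  define Q :: "complex^3^3" where "Q = (\<chi> i j. Complex (- pr X (el i) (el j)) (- pr X (el i) (mg j)))"
  define B where "B = (\<lambda>a b c d. sg a * sg b * X a b c d)"
  have t: "- X 0 b 0 d + X 1 b 1 d + X 2 b 2 d + X 3 b 3 d = 0" for b d
    using tev_weyl_trace[OF W H, of "o' b" "o' d"] unfolding sum_4' X_def frame_array_def by (simp del: tev.simps)
  have s: "X a b c d = - X b a c d" "X a b c d = X c d a b" "X a b c d + X a c d b + X a d b c = 0" for a b c d
    unfolding X_def frame_array_def by (rule tev_weyl[OF W])+
  have rB: "rep B Q" and tQ: "trace Q = 0" and sQ: "transpose Q = Q"
    unfolding B_def Q_def by (rule orthonormal_weyl[OF s t])+
  have sc: "M ** (\<chi> i j. c * N $ i $ j) = (\<chi> i j. c * (M ** N) $ i $ j)" for c :: complex and M N :: "complex^3^3"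
    by (simp add: vec_eq_iff matrix_matrix_mult_def sum_distrib_left mult_ac)
  have trs: "trace (\<chi> i j. c * M $ i $ j) = c * trace M" for c :: complex and M :: "complex^3^3"
    by (simp add: trace_def sum_distrib_left)
  note r2 = rep_bcomp[OF rB rB]
  note r3 = rep_bcomp[OF rB r2, unfolded sc vec_lambda_beta]
  note r4 = rep_bcomp[OF rB r3, unfolded sc vec_lambda_beta]
  note r5 = rep_bcomp[OF rB r4, unfolded sc vec_lambda_beta]
  note r6 = rep_bcomp[OF rB r5, unfolded sc vec_lambda_beta]
  have ch: "btr (bcomp B B) = 0" "btr (bcomp B (bcomp B B)) = 0" "btr (bcomp B (bcomp B (bcomp B B))) = 0"
    "btr (bcomp B (bcomp B (bcomp B (bcomp B (bcomp B B))))) = 0"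
    by (rule chain_invariants[where g=g and T=T and m=m and x=x and S=S, OF _ x H B_def[unfolded X_def]], rule inv, assumption+)+
  have "Q ** (Q ** Q) = 0"
  proof (rule nilpotent_of_traces[OF tQ])
    show "Re (trace (Q ** Q)) = 0" using ch(1) rep_btr[OF r2] by (simp add: trs sc)
    show "Re (trace (Q ** (Q ** Q))) = 0" using ch(2) rep_btr[OF r3] by (simp add: trs sc)
    show "Re (trace (Q ** (Q ** (Q ** Q)))) = 0" using ch(3) rep_btr[OF r4] by (simp add: trs sc)
    show "Re (trace (Q ** (Q ** (Q ** (Q ** (Q ** Q)))))) = 0" using ch(4) rep_btr[OF r6] by (simp add: trs sc)
  qed
  then obtain w where w: "w \<noteq> 0" "Q *v w = 0" "(\<Sum>i\<in>UNIV. w $ i * w $ i) = 0"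
    using isotropic_kernel[OF _ sQ] by blast
  \<comment> \<open>Isotropy means that the real and imaginary parts of \<open>w\<close> are
    orthogonal and have the same length \<open>N\<close>.\<close>
  define N where "N = sqrt (\<Sum>i\<in>UNIV. Re (w $ i) * Re (w $ i))"
  have uv: "(\<Sum>i\<in>UNIV. Re (w $ i) * Re (w $ i)) = (\<Sum>i\<in>UNIV. Im (w $ i) * Im (w $ i))" "(\<Sum>i\<in>UNIV. Re (w $ i) * Im (w $ i)) = 0"
    using arg_cong[OF w(3), of Re] arg_cong[OF w(3), of Im] unfolding sum_3 by (simp_all add: mult.commute)
  have "(\<Sum>i\<in>UNIV. Re (w $ i) * Re (w $ i)) \<noteq> 0"
  proof
    assume 0: "(\<Sum>i\<in>UNIV. Re (w $ i) * Re (w $ i)) = 0"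
    then have "Re (w $ i) = 0" "Im (w $ i) = 0" for i
      using uv(1) sum_nonneg_eq_0_iff[of "UNIV :: 3 set" "\<lambda>i. Re (w $ i) * Re (w $ i)"]
        sum_nonneg_eq_0_iff[of "UNIV :: 3 set" "\<lambda>i. Im (w $ i) * Im (w $ i)"] by auto
    then show False using w(1) by (auto simp: vec_eq_iff complex_eq_iff)
  qed
  then have Npos: "(\<Sum>i\<in>UNIV. Re (w $ i) * Re (w $ i)) > 0" 
    using sum_nonneg[of "UNIV :: 3 set" "\<lambda>i. Re (w $ i) * Re (w $ i)"] by simp
  then have N2: "N \<noteq> 0" "N * N = (\<Sum>i\<in>UNIV. Re (w $ i) * Re (w $ i))" by (simp_all add: N_def)
  define u1 u2 u3 v1 v2 v3 where uvd: "u1 = Re (w $ 1) / N" "u2 = Re (w $ 2) / N" "u3 = Re (w $ 3) / N"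
    "v1 = Im (w $ 1) / N" "v2 = Im (w $ 2) / N" "v3 = Im (w $ 3) / N"
  have uu: "u1 * u1 + u2 * u2 + u3 * u3 = 1"
  proof -
    have "u1 * u1 + u2 * u2 + u3 * u3 = (\<Sum>i\<in>UNIV. Re (w $ i) * Re (w $ i)) / (N * N)"
      unfolding uvd sum_3 by (simp add: add_divide_distrib)
    then show ?thesis unfolding N2(2)[symmetric] using N2(1) by simp
  qed
  have vv: "v1 * v1 + v2 * v2 + v3 * v3 = 1"
  proof -
    have "v1 * v1 + v2 * v2 + v3 * v3 = (\<Sum>i\<in>UNIV. Im (w $ i) * Im (w $ i)) / (N * N)"
      unfolding uvd sum_3 by (simp add: add_divide_distrib)
    then show ?thesis unfolding uv(1)[symmetric] N2(2)[symmetric] using N2(1) by simp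
  qed
  have uv0: "u1 * v1 + u2 * v2 + u3 * v3 = 0"
  proof -
    have "u1 * v1 + u2 * v2 + u3 * v3 = (\<Sum>i\<in>UNIV. Re (w $ i) * Im (w $ i)) / (N * N)"
      unfolding uvd sum_3 by (simp add: add_divide_distrib)
    then show ?thesis unfolding uv(2) by simp
  qed
  define n1 n2 n3 where nd: "n1 = u2 * v3 - u3 * v2" "n2 = u3 * v1 - u1 * v3" "n3 = u1 * v2 - u2 * v1"
  have nu: "n2 * u3 - n3 * u2 = v1" "n3 * u1 - n1 * u3 = v2" "n1 * u2 - n2 * u1 = v3"
  proof -
    have "n2 * u3 - n3 * u2 = v1 * (u1 * u1 + u2 * u2 + u3 * u3) - u1 * (u1 * v1 + u2 * v2 + u3 * v3)"
      "n3 * u1 - n1 * u3 = v2 * (u1 * u1 + u2 * u2 + u3 * u3) - u2 * (u1 * v1 + u2 * v2 + u3 * v3)"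
      "n1 * u2 - n2 * u1 = v3 * (u1 * u1 + u2 * u2 + u3 * u3) - u3 * (u1 * v1 + u2 * v2 + u3 * v3)"
      unfolding nd by (simp_all add: algebra_simps)
    then show "n2 * u3 - n3 * u2 = v1" "n3 * u1 - n1 * u3 = v2" "n1 * u2 - n2 * u1 = v3" using uu uv0 by simp_all
  qed
  have nv: "n2 * v3 - n3 * v2 = - u1" "n3 * v1 - n1 * v3 = - u2" "n1 * v2 - n2 * v1 = - u3"
  proof -
    have "n2 * v3 - n3 * v2 = v1 * (u1 * v1 + u2 * v2 + u3 * v3) - u1 * (v1 * v1 + v2 * v2 + v3 * v3)"
      "n3 * v1 - n1 * v3 = v2 * (u1 * v1 + u2 * v2 + u3 * v3) - u2 * (v1 * v1 + v2 * v2 + v3 * v3)"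
      "n1 * v2 - n2 * v1 = v3 * (u1 * v1 + u2 * v2 + u3 * v3) - u3 * (v1 * v1 + v2 * v2 + v3 * v3)"
      unfolding nd by (simp_all add: algebra_simps)
    then show "n2 * v3 - n3 * v2 = - u1" "n3 * v1 - n1 * v3 = - u2" "n1 * v2 - n2 * v1 = - u3" using vv uv0 by simp_all
  qed
  have nn: "n1 * n1 + n2 * n2 + n3 * n3 = 1" 
  proof -
    have "n1 * n1 + n2 * n2 + n3 * n3 = (u1 * u1 + u2 * u2 + u3 * u3) * (v1 * v1 + v2 * v2 + v3 * v3) 
       - (u1 * v1 + u2 * v2 + u3 * v3) * (u1 * v1 + u2 * v2 + u3 * v3)" unfolding nd by (simp add: algebra_simps)
    then show ?thesis using uu vv uv0 by simp
  qed
  have nun: "n1 * u1 + n2 * u2 + n3 * u3 = 0" "n1 * v1 + n2 * v2 + n3 * v3 = 0"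
    unfolding nd by (simp_all add: algebra_simps)
  \<comment> \<open>With n = u x v the frame is e_0 = o'_0 - n, e_1 = -(o'_0 + n)/2, e_2 = u, e_3 =
    v.\<close>
  define cf :: "4 \<Rightarrow> 4 \<Rightarrow> real" where "cf = (\<lambda>a k. 
     if a = 0 then (if k = 0 then 1 else if k = 1 then - n1 else if k = 2 then - n2 else - n3)
     else if a = 1 then (if k = 0 then -1/2 else if k = 1 then - n1 / 2 else if k = 2 then - n2 / 2 else - n3 / 2)
     else if a = 2 then (if k = 0 then 0 else if k = 1 then u1 else if k = 2 then u2 else u3)
     else (if k = 0 then 0 else if k = 1 then v1 else if k = 2 then v2 else v3))"
  define e where "e = (\<lambda>a. \<Sum>k\<in>UNIV. cf a k *\<^sub>R o' k)"
  have e: "null_frame (g x) e"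
  proof -
    have "\<forall>a b. - cf a 0 * cf b 0 + cf a 1 * cf b 1 + cf a 2 * cf b 2 + cf a 3 * cf b 3 =
       (if {a, b} = {0, 1} \<or> a = b \<and> a \<in> {2, 3} then 1 else 0)"
      unfolding forall_4' cf_def using uu vv uv0 nn nun by (simp add: field_simps doubleton_eq_iff)
    then show ?thesis unfolding null_frame_def e_def ip_combination[OF o] by blast
  qed
  define A where "A = frame_array e (T x)"
  have WA: "weyl_array A" unfolding A_def
    by (rule weyl_array_frame[OF W null_frame_pairing[OF e lorentz_form_symmetric(2)[OF G]]])
  have lin: "tev (us @ e a # vs) (T x) = (\<Sum>k\<in>UNIV. cf a k * tev (us @ o' k # vs) (T x))" for us a vs
    unfolding e_def by (rule tev_linear)
  define Y where "Y = (\<lambda>i b. tev [o' 0, o' i, e 0, e b] (T x))"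
  have Y: "Y i b = (\<Sum>k\<in>UNIV. cf 0 k * (\<Sum>j\<in>UNIV. cf b j * X 0 i k j))" for i b
    unfolding Y_def using lin[of "[o' 0, o' i]" 0 "[e b]"] lin[of "[o' 0, o' i, o' _]" b "[]"]
    by (simp add: X_def frame_array_def del: tev.simps)
  have Q: "(\<Sum>j\<in>UNIV. Re (Q $ i $ j) * Re (w $ j)) - (\<Sum>j\<in>UNIV. Im (Q $ i $ j) * Im (w $ j)) = 0"
    "(\<Sum>j\<in>UNIV. Re (Q $ i $ j) * Im (w $ j)) + (\<Sum>j\<in>UNIV. Im (Q $ i $ j) * Re (w $ j)) = 0" for i
  proof -
    have "(Q *v w) $ i = 0" using w(2) by simp
    then have "(\<Sum>j\<in>UNIV. Q $ i $ j * w $ j) = 0" by (simp add: matrix_vector_mult_def)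
    from arg_cong[OF this, of Re] arg_cong[OF this, of Im]
    show "(\<Sum>j\<in>UNIV. Re (Q $ i $ j) * Re (w $ j)) - (\<Sum>j\<in>UNIV. Im (Q $ i $ j) * Im (w $ j)) = 0"
    "(\<Sum>j\<in>UNIV. Re (Q $ i $ j) * Im (w $ j)) + (\<Sum>j\<in>UNIV. Im (Q $ i $ j) * Re (w $ j)) = 0"
      by (simp_all add: sum_subtractf sum.distrib)
  qed
  have Rw: "Re (w $ 1) = N * u1" "Re (w $ 2) = N * u2" "Re (w $ 3) = N * u3"
    "Im (w $ 1) = N * v1" "Im (w $ 2) = N * v2" "Im (w $ 3) = N * v3" using N2(1) by (simp_all add: uvd)
  have s': "X a b d c = - X a b c d" for a b c d using s(2)[of a b d c] s(1)[of d c a b] s(2)[of c d a b] by linarith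
  have s'': "X a b c c = 0" for a b c using s'[of a b c c] by linarith
  have K: "X 0 i 0 1 * u1 + X 0 i 0 2 * u2 + X 0 i 0 3 * u3 = X 0 i 2 3 * v1 + X 0 i 3 1 * v2 + X 0 i 1 2 * v3"
     "X 0 i 0 1 * v1 + X 0 i 0 2 * v2 + X 0 i 0 3 * v3 = - (X 0 i 2 3 * u1 + X 0 i 3 1 * u2 + X 0 i 1 2 * u3)" if "i \<noteq> 0" for i
  proof -
    have "\<forall>i. i = 0 \<or> el 1 = (0, i) \<or> el 2 = (0, i) \<or> el 3 = (0, i)" unfolding forall_4' by simp
    then have "i = 0 \<or> el 1 = (0, i) \<or> el 2 = (0, i) \<or> el 3 = (0, i)" by (rule spec)
    then have "\<exists>j. el j = (0, i)" using that by (elim disjE) (erule (1) notE, (rule exI, assumption)+)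
    then obtain j where j: "el j = (0, i)" ..
    have q: "Re (Q $ j $ k) = - pr X (0, i) (el k)" "Im (Q $ j $ k) = - pr X (0, i) (mg k)" for k
      by (simp_all add: Q_def j)
    have "(\<Sum>k\<in>UNIV. Re (Q $ j $ k) * Re (w $ k)) - (\<Sum>k\<in>UNIV. Im (Q $ j $ k) * Im (w $ k)) = 
       N * ((X 0 i 2 3 * v1 + X 0 i 3 1 * v2 + X 0 i 1 2 * v3) - (X 0 i 0 1 * u1 + X 0 i 0 2 * u2 + X 0 i 0 3 * u3))"
      unfolding sum_3 Rw q pr_def el_mg_simps fst_conv snd_conv by (simp add: algebra_simps)
    then show "X 0 i 0 1 * u1 + X 0 i 0 2 * u2 + X 0 i 0 3 * u3 = X 0 i 2 3 * v1 + X 0 i 3 1 * v2 + X 0 i 1 2 * v3"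
      unfolding Q(1) using N2(1) by simp
    have "(\<Sum>k\<in>UNIV. Re (Q $ j $ k) * Im (w $ k)) + (\<Sum>k\<in>UNIV. Im (Q $ j $ k) * Re (w $ k)) = 
       N * (- (X 0 i 2 3 * u1 + X 0 i 3 1 * u2 + X 0 i 1 2 * u3) - (X 0 i 0 1 * v1 + X 0 i 0 2 * v2 + X 0 i 0 3 * v3))"
      unfolding sum_3 Rw q pr_def el_mg_simps fst_conv snd_conv by (simp add: algebra_simps)
    then show "X 0 i 0 1 * v1 + X 0 i 0 2 * v2 + X 0 i 0 3 * v3 = - (X 0 i 2 3 * u1 + X 0 i 3 1 * u2 + X 0 i 1 2 * u3)"
      unfolding Q(2) using N2(1) by simp
  qed
  \<comment> \<open>Since n x u = v and n x v = -u, these components are the real and imaginary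
    parts of Q w = 0.\<close>
  have Y0: "Y i 2 = 0" "Y i 3 = 0" if "i \<noteq> 0" for i
  proof -
    have a: "X 0 i 3 2 = - X 0 i 2 3" "X 0 i 1 3 = - X 0 i 3 1" "X 0 i 2 1 = - X 0 i 1 2" by (rule s')+
    have "Y i 2 = (X 0 i 0 1 * u1 + X 0 i 0 2 * u2 + X 0 i 0 3 * u3) 
      - (X 0 i 2 3 * (n2 * u3 - n3 * u2) + X 0 i 3 1 * (n3 * u1 - n1 * u3) + X 0 i 1 2 * (n1 * u2 - n2 * u1))"
      unfolding Y sum_4' by (simp add: cf_def a s'' algebra_simps)
    then show "Y i 2 = 0" unfolding nu K(1)[OF that] by simp
    have "Y i 3 = (X 0 i 0 1 * v1 + X 0 i 0 2 * v2 + X 0 i 0 3 * v3) 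
      - (X 0 i 2 3 * (n2 * v3 - n3 * v2) + X 0 i 3 1 * (n3 * v1 - n1 * v3) + X 0 i 1 2 * (n1 * v2 - n2 * v1))"
      unfolding Y sum_4' by (simp add: cf_def a s'' algebra_simps)
    then show "Y i 3 = 0" unfolding nv K(2)[OF that] by simp
  qed
  have Z: "tev [o' 0, e a, e 0, e b] (T x) = cf a 0 * Y 0 b + (cf a 1 * Y 1 b + cf a 2 * Y 2 b + cf a 3 * Y 3 b)" for a b
    using lin[of "[o' 0]" a "[e 0, e b]"] unfolding sum_4' Y_def by (simp del: tev.simps)
  have Y00: "Y 0 b = 0" for b
    unfolding Y_def using tev_weyl(1)[OF W, of "o' 0" "o' 0" "e 0" "e b"] by linarith
  have Z0: "tev [o' 0, e a, e 0, e b] (T x) = 0" if "b = 2 \<or> b = 3" for a b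
    unfolding Z Y00 using Y0 that by auto
  \<comment> \<open>Here o'_0 = e_0 / 2 - e_1.\<close>
  have ZA: "tev [o' 0, e a, e 0, e b] (T x) = A 0 a 0 b / 2 - A 1 a 0 b" for a b
  proof -
    have c: "1/2 * cf 0 k - cf 1 k = (if k = 0 then 1 else 0)" for k by (simp add: cf_def)
    have "o' 0 = (\<Sum>k\<in>UNIV. (1/2 * cf 0 k - cf 1 k) *\<^sub>R o' k)"
      unfolding c UNIV_4' by simp
    also have "\<dots> = (1/2) *\<^sub>R e 0 - e 1"
      by (simp only: e_def scaleR_sum_right scaleR_left_diff_distrib sum_subtractf scaleR_scaleR)
    finally have "o' 0 = (\<Sum>k\<in>UNIV. (if k then 1/2 else -1) *\<^sub>R (if k then e 0 else e 1))"
      unfolding UNIV_bool by simp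
    then have "tev ([] @ o' 0 # [e a, e 0, e b]) (T x) =
       (\<Sum>k\<in>UNIV. (if k then 1/2 else -1) * tev ([] @ (if k then e 0 else e 1) # [e a, e 0, e b]) (T x))"
      by (simp only: tev_linear)
    then show ?thesis unfolding A_def frame_array_def UNIV_bool by (simp del: tev.simps)
  qed
  note wA = weyl_array_comps[OF WA]
  have q: "A 0 a 0 2 = 2 * A 1 a 0 2" "A 0 a 0 3 = 2 * A 1 a 0 3" for a
    using Z0[of 2 a] Z0[of 3 a] unfolding ZA by simp_all
  \<comment> \<open>By \<open>q\<close>, A_0202 and A_0303 both equal A_0101, although they are
    opposite; likewise A_0203 equals -A_0123 and A_0302 equals A_0123, although the two are
    equal.\<close>
  have "order_le A (-1)"
  proof (rule order_le_m1[OF WA])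
    have r: "A 1 2 0 2 = A 0 2 1 2" "A 1 3 0 3 = A 0 3 1 3" "A 1 2 0 3 = A 0 3 1 2" "A 1 3 0 2 = A 0 2 1 3" "A 0 3 0 2 = A 0 2 0 3" by (rule wA(16))+
    show "A 0 1 0 1 = 0" "A 0 2 0 2 = 0" using q(1)[of 2] q(2)[of 3] wA(1,2,8) unfolding r by linarith+
    show "A 0 1 2 3 = 0" "A 0 2 0 3 = 0" using q(2)[of 2] q(1)[of 3] wA(3,4) unfolding r by linarith+
    show "A 0 1 0 2 = 0" "A 0 1 0 3 = 0" using q[of 1] wA(12) by simp_all
  qed
  then show ?thesis using that e unfolding A_def by blast
qed

section \<open>Boost orders and Petrov types\<close>

lemma frame_array_component: "frame_array e T a b c d = frame_component T e [a,b,c,d]"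
  unfolding frame_array_def frame_component_tev by simp

lemma boost_weight4: "boost_weight [a,b,c,d] = bw1 a + bw1 b + bw1 c + bw1 d"
  unfolding boost_weight_bw1 by simp

lemma length_4_cases: "length J = 4 \<longleftrightarrow> (\<exists>a b c d. J = [a,b,c,d])"
proof
  assume "length J = 4" then show "\<exists>a b c d. J = [a,b,c,d]" using len4 by blast
qed auto

definition bo_set :: "real^4^4 \<Rightarrow> tensor \<Rightarrow> real^4 \<Rightarrow> int set" where
  "bo_set G T k = {boost_weight J | e J. null_frame G e \<and> e 0 = k \<and> length J = 4 \<and> frame_component T e J \<noteq> 0}"

lemma boost_order_Max: "boost_order G 4 T k = Max (insert (-5) (bo_set G T k))"
  unfolding boost_order_def bo_set_def by simp

lemma finite_bo_set: "finite (bo_set G T k)"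
proof (rule finite_subset)
  show "bo_set G T k \<subseteq> boost_weight ` {J. length J = 4}" unfolding bo_set_def by auto
qed (simp add: finite_lists_length)

lemma boost_order_le:
  assumes "\<And>e. null_frame G e \<Longrightarrow> e 0 = k \<Longrightarrow> order_le (frame_array e T) n" "-5 \<le> n"
  shows "boost_order G 4 T k \<le> n"
proof -
  have "b \<le> n" if b: "b \<in> bo_set G T k" for b
  proof -
    obtain e J where J: "null_frame G e" "e 0 = k" "length J = 4" "frame_component T e J \<noteq> 0" "b = boost_weight J"
      using b unfolding bo_set_def by blast
    obtain a a' c d where Jeq: "J = [a,a',c,d]" using iffD1[OF length_4_cases J(3)] by blast
    show ?thesis using J(4,5) order_leD[OF assms(1)[OF J(1,2)], of a a' c d]
      unfolding Jeq boost_weight4 frame_array_component by linarith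
  qed
  then show ?thesis unfolding boost_order_Max using assms(2) finite_bo_set by (subst Max_le_iff) auto
qed

text \<open>-5 is the default value for the zero tensor of rank 4; above it the maximum is attained
  by a component in an actual frame.\<close>

lemma boost_order_frame:
  assumes "-5 < boost_order G 4 T k"
  obtains e a b c d where "null_frame G e" "e 0 = k" "order_le (frame_array e T) (boost_order G 4 T k)"
    "frame_array e T a b c d \<noteq> 0" "bw1 a + bw1 b + bw1 c + bw1 d = boost_order G 4 T k"
proof -
  let ?A = "insert (-5) (bo_set G T k)"
  have f: "finite ?A" using finite_bo_set by simp
  then have "Max ?A \<in> ?A" by (rule Max_in) simp
  then have "boost_order G 4 T k \<in> bo_set G T k" using assms unfolding boost_order_Max by auto
  then obtain e J where J: "null_frame G e" "e 0 = k" "length J = 4" "frame_component T e J \<noteq> 0" "boost_order G 4 T k = boost_weight J"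
    unfolding bo_set_def by blast
  obtain a b c d where Je: "J = [a,b,c,d]" using iffD1[OF length_4_cases J(3)] by blast
  have "order_le (frame_array e T) (boost_order G 4 T k)"
    unfolding order_le_def
  proof (intro allI impI)
    fix a b c d assume "frame_array e T a b c d \<noteq> 0"
    then have "bw1 a + bw1 b + bw1 c + bw1 d \<in> bo_set G T k"
      unfolding bo_set_def frame_array_component boost_weight4[symmetric] using J(1,2) by force
    then show "bw1 a + bw1 b + bw1 c + bw1 d \<le> boost_order G 4 T k"
      unfolding boost_order_Max using f by (intro Max_ge) auto
  qed
  then show ?thesis using that J Je by (simp add: frame_array_component boost_weight4)
qed

lemma null_frame_null: assumes "null_frame G e" shows "null_vector G (e 0)"
proof -
  have "ip G (e 0) (e 1) = 1" "ip G (e 0) (e 0) = 0" by (simp_all add: null_frame_ip[OF assms])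
  then show ?thesis unfolding null_vector_def by (auto simp: ip_def)
qed

lemma tev_expand:
  assumes "null_frame G e" "lorentz_form G"
  shows "tev (us @ v # vs) T = (\<Sum>a\<in>UNIV. ip G v (e (st01 a)) * tev (us @ e a # vs) T)"
  using tev_linear[of us "\<lambda>a. ip G v (e (st01 a))" e UNIV vs T] null_frame_expand[OF assms, of v] by simp

text \<open>Frames with the same e_0 differ by a change that cannot raise boost weights: e'_2 and
  e'_3 are orthogonal to e_0 and so have no e_1 component. Thanks to \<open>order_le_m1\<close> and
  \<open>order_le_m2\<close> only a few components have to be transformed.\<close>

lemma order_le_frame_indep:
  assumes e: "null_frame G e" and e': "null_frame G e'" and eq: "e' 0 = e 0" and G: "lorentz_form G"
    and W: "weyl_sym (matrix_inv G) (\<lambda>a b c d. T [a,b,c,d])" and ord: "order_le (frame_array e T) n" and n: "n = -1 \<or> n = -2"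
  shows "order_le (frame_array e' T) n"
proof -
  let ?A = "frame_array e T" and ?B = "frame_array e' T"
  note pf = null_frame_pairing[OF _ lorentz_form_symmetric(2)[OF G]]
  have WA: "weyl_array ?A" and WB: "weyl_array ?B" by (rule weyl_array_frame[OF W pf[OF e]] weyl_array_frame[OF W pf[OF e']])+
  note z = order_leD[OF ord]
  note ex = tev_expand[OF e G]
  have e1: "ip G (e' a) (e 0) = (if a = 1 then 1 else 0)" for a
    using null_frame_ip[OF e', of a 0] unfolding eq by (auto simp: st01_def split: if_splits)
  have 1: "?B 0 b 0 d = 0" for b d
  proof -
    have "?A 0 a 0 c = 0" for a c using n by (intro z) (auto simp: bw1_def)
    then have "tev [e 0, e a, e 0, e c] T = 0" for a c unfolding frame_array_def .
    then have "tev [e 0, e a, e 0, e' d] T = 0" for a 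
      using ex[of "[e 0, e a, e 0]" "e' d" "[]" T] by (simp del: tev.simps)
    then show ?thesis unfolding frame_array_def eq
      using ex[of "[e 0]" "e' b" "[e 0, e' d]" T] by (simp del: tev.simps)
  qed
  have 2: "?B 0 b 2 3 = 0" for b
  proof -
    have "tev [e 0, e a, e c, e d] T = 0" if "c \<noteq> 1" "d \<noteq> 1" for a c d
    proof -
      have "?A 0 a c d = 0" using n that by (intro z) (auto simp: bw1_def)
      then show ?thesis unfolding frame_array_def .
    qed
    then have "tev [e 0, e a, e c, e' 3] T = 0" if "c \<noteq> 1" for a c
      using ex[of "[e 0, e a, e c]" "e' 3" "[]" T] that unfolding sum_4' by (simp add: e1 del: tev.simps)
    then have "tev [e 0, e a, e' 2, e' 3] T = 0" for a
      using ex[of "[e 0, e a]" "e' 2" "[e' 3]" T] unfolding sum_4' by (simp add: e1 del: tev.simps)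
    then show ?thesis unfolding frame_array_def eq
      using ex[of "[e 0]" "e' b" "[e' 2, e' 3]" T] by (simp del: tev.simps)
  qed
  have 3: "?B 0 b c d = 0" if "n = -2" for b c d
  proof -
    have "?A 0 a c d = 0" for a c d
    proof (cases "a = 1 \<and> c = 1 \<and> d = 1")
      case True then show ?thesis using weyl_array_comps(13)[OF WA] by simp
    next
      case False then show ?thesis using that by (intro z) (auto simp: bw1_def)
    qed
    then have "tev [e 0, e a, e c, e d] T = 0" for a c d unfolding frame_array_def .
    then have "tev [e 0, e a, e c, e' d] T = 0" for a c
      using ex[of "[e 0, e a, e c]" "e' d" "[]" T] by (simp del: tev.simps)
    then have "tev [e 0, e a, e' c, e' d] T = 0" for a
      using ex[of "[e 0, e a]" "e' c" "[e' d]" T] by (simp del: tev.simps)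
    then show ?thesis unfolding frame_array_def eq
      using ex[of "[e 0]" "e' b" "[e' c, e' d]" T] by (simp del: tev.simps)
  qed
  show ?thesis
  proof (cases "n = -2")
    case True
    then show ?thesis using 3[OF True] by (simp add: order_le_m2[OF WB])
  next
    case False
    then show ?thesis using n 1 2 by (simp add: order_le_m1[OF WB])
  qed
qed

text \<open>A nonvanishing antisymmetric index pair has boost weight at least -1, so -2 is the
  lowest weight possible.\<close>

lemma weyl_array_order_m3:
  assumes W: "weyl_array X" and "order_le X n" "n < -2" shows "X a b c d = 0"
proof (cases "a = b \<or> c = d")
  case True then show ?thesis using weyl_array_comps(12,13)[OF W] by auto
next
  case False
  then have "-1 \<le> bw1 a + bw1 b" "-1 \<le> bw1 c + bw1 d" by (auto simp: bw1_def)
  then show ?thesis using order_leD[OF assms(2)] assms(3) by force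
qed

lemma tensor_zero_of_frame:
  assumes e: "null_frame G e" "lorentz_form G" and z: "\<And>a b c d. frame_array e T a b c d = 0"
  shows "tev [v1,v2,v3,v4] T = 0"
proof -
  note ex = tev_expand[OF e]
  have "tev [e a, e b, e c, e d] T = 0" for a b c d using z unfolding frame_array_def .
  then have "tev [e a, e b, e c, v4] T = 0" for a b c using ex[of "[e a, e b, e c]" v4 "[]" T] by (simp del: tev.simps)
  then have "tev [e a, e b, v3, v4] T = 0" for a b using ex[of "[e a, e b]" v3 "[v4]" T] by (simp del: tev.simps)
  then have "tev [e a, v2, v3, v4] T = 0" for a using ex[of "[e a]" v2 "[v3,v4]" T] by (simp del: tev.simps)
  then show ?thesis using ex[of "[]" v1 "[v2,v3,v4]" T] by (simp del: tev.simps)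
qed

lemma tev_axis: "tev (axis i 1 # vs) T = tev vs (\<lambda>I. T (i # I))"
  by (simp add: axis_def if_distrib[of "\<lambda>x. x * _"] cong: if_cong)

lemma tev_axis4: "tev [axis i 1, axis j 1, axis k 1, axis l 1] T = T [i,j,k,l]"
  by (simp only: tev_axis tev.simps(1))

text \<open>The direction of \<open>e 0\<close> has boost order at most -1, and an order below -2
  would make the tensor zero.\<close>

lemma petrov_type_cases:
  assumes G: "lorentz_form G" and W: "weyl_sym (matrix_inv G) (\<lambda>a b c d. T [a,b,c,d])"
    and e: "null_frame G e" "order_le (frame_array e T) (-1)"
  shows "petrov_type G T \<in> {Petrov_O, Petrov_N, Petrov_III}"
proof -
  have k: "null_vector G (e 0)" by (rule null_frame_null[OF e(1)])
  have le: "boost_order G 4 T (e 0) \<le> -1"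
    by (rule boost_order_le) (auto intro: order_le_frame_indep[OF e(1) _ _ G W e(2)])
  show ?thesis
  proof (cases "\<forall>I. length I = 4 \<longrightarrow> T I = 0")
    case True then show ?thesis unfolding petrov_type_def Let_def by simp
  next
    case False
    then obtain I where I: "length I = 4" "T I \<noteq> 0" by blast
    have "-2 \<le> boost_order G 4 T (e 0)"
    proof (rule ccontr)
      assume lt: "\<not> ?thesis"
      have f: "finite (insert (-5) (bo_set G T (e 0)))" using finite_bo_set by simp
      have "order_le (frame_array e T) (-3)" unfolding order_le_def
      proof (intro allI impI)
        fix a b c d assume "frame_array e T a b c d \<noteq> 0"
        then have "bw1 a + bw1 b + bw1 c + bw1 d \<in> bo_set G T (e 0)"
          unfolding bo_set_def frame_array_component boost_weight4[symmetric] using e(1) by force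
        then have "bw1 a + bw1 b + bw1 c + bw1 d \<le> boost_order G 4 T (e 0)"
          unfolding boost_order_Max using f by (intro Max_ge) auto
        then show "bw1 a + bw1 b + bw1 c + bw1 d \<le> -3" using lt by linarith
      qed
      from weyl_array_order_m3[OF weyl_array_frame[OF W null_frame_pairing[OF e(1) lorentz_form_symmetric(2)[OF G]]] this]
      have "tev [axis (I!0) 1, axis (I!1) 1, axis (I!2) 1, axis (I!3) 1] T = 0"
        by (intro tensor_zero_of_frame[OF e(1) G]) simp
      then show False using I len4[OF I(1)] unfolding tev_axis4 by simp
    qed
    then have "boost_order G 4 T (e 0) = -1 \<or> boost_order G 4 T (e 0) = -2" using le by linarith
    then show ?thesis using k False unfolding petrov_type_def Let_def by auto
  qed
qed

lemma petrov_O: "petrov_type G T = Petrov_O \<Longrightarrow> length I = 4 \<Longrightarrow> T I = 0"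
  unfolding petrov_type_def Let_def by (auto split: if_splits)

lemma petrov_N_frame:
  assumes p: "petrov_type G T = Petrov_N" and G: "lorentz_form G" and W: "weyl_sym (matrix_inv G) (\<lambda>a b c d. T [a,b,c,d])"
  obtains e where "null_frame G e" "order_le (frame_array e T) (-2)" "frame_array e T 1 2 1 2 \<noteq> 0 \<or> frame_array e T 1 2 1 3 \<noteq> 0"
proof -
  obtain k where k: "boost_order G 4 T k = -2"
    using p unfolding petrov_type_def Let_def by (auto split: if_splits)
  have "-5 < boost_order G 4 T k" using k by simp
  then obtain e a b c d where e: "null_frame G e" "order_le (frame_array e T) (-2)" "frame_array e T a b c d \<noteq> 0"
    using boost_order_frame[of G T k] k by metis
  let ?A = "frame_array e T"
  have WA: "weyl_array ?A" by (rule weyl_array_frame[OF W null_frame_pairing[OF e(1) lorentz_form_symmetric(2)[OF G]]])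
  have "?A 1 2 1 2 \<noteq> 0 \<or> ?A 1 2 1 3 \<noteq> 0"
  proof (rule ccontr)
    assume n: "\<not> ?thesis"
    then have v: "?A 1 2 1 2 = 0" "?A 1 2 1 3 = 0" "?A 1 3 1 2 = 0" "?A 1 3 1 3 = 0"
      using weyl_array_comps(11)[OF WA] weyl_array_comps(16)[OF WA, of 1 2 1 3] by simp_all
    have "order_le ?A (-3)"
      by (rule weyl_array_cases[OF WA], rule ccontr)
        (use order_leD[OF e(2)] v in \<open>fastforce simp: ordered_pairs_def\<close>)
    then show False using weyl_array_order_m3[OF WA] e(3) by force
  qed
  then show ?thesis using that e by blast
qed

lemma petrov_III_frame:
  assumes p: "petrov_type G T = Petrov_III" and G: "lorentz_form G" and W: "weyl_sym (matrix_inv G) (\<lambda>a b c d. T [a,b,c,d])"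
  obtains e where "null_frame G e" "order_le (frame_array e T) (-1)" "frame_array e T 0 1 1 2 \<noteq> 0 \<or> frame_array e T 0 1 1 3 \<noteq> 0"
proof -
  obtain k where k: "boost_order G 4 T k = -1" and no2: "\<not> (\<exists>k. null_vector G k \<and> boost_order G 4 T k = -2)"
    using p unfolding petrov_type_def Let_def by (auto split: if_splits)
  have "-5 < boost_order G 4 T k" using k by simp
  then obtain e a b c d where e: "null_frame G e" "e 0 = k" "order_le (frame_array e T) (-1)" "frame_array e T a b c d \<noteq> 0"
    using boost_order_frame[of G T k] k by metis
  let ?A = "frame_array e T"
  have WA: "weyl_array ?A" by (rule weyl_array_frame[OF W null_frame_pairing[OF e(1) lorentz_form_symmetric(2)[OF G]]])
  have "?A 0 1 1 2 \<noteq> 0 \<or> ?A 0 1 1 3 \<noteq> 0"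
  proof (rule ccontr)
    assume n: "\<not> ?thesis"
    have "order_le ?A (-2)" using n order_leD[OF e(3)] by (intro order_le_m2[OF WA]) auto
    then have "boost_order G 4 T k \<le> -2" 
      using order_le_frame_indep[OF e(1) _ _ G W] e(2) by (intro boost_order_le) auto
    then show False using k by simp
  qed
  then show ?thesis using that e by blast
qed

section \<open>Kundt vector fields\<close>

context chart_metric
begin

definition low :: "(real^4 \<Rightarrow> real^4) \<Rightarrow> real^4 \<Rightarrow> 4 \<Rightarrow> real" where
  "low X x a = (\<Sum>k\<in>UNIV. g x $ a $ k * X x $ k)"

lemma cov_low_vd:
  assumes x: "x \<in> S" and X: "\<And>i. smooth_on S (\<lambda>x. X x $ i)"
  shows "cov_low g X x a b = (\<Sum>k\<in>UNIV. g x $ a $ k * vd X x k b)"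
proof -
  have 1: "partial b (\<lambda>y. (g y *v X y) $ a) x = (\<Sum>k\<in>UNIV. partial b (\<lambda>y. g y $ a $ k) x * X x $ k) + (\<Sum>k\<in>UNIV. g x $ a $ k * partial b (\<lambda>y. X y $ k) x)"
    unfolding matrix_vector_mult_def
    by (simp add: partial_sum partial_mult sd[OF _ x] smooth_on_mult openS smooth_g X sum.distrib)
  have 2: "(\<Sum>k\<in>UNIV. (\<Sum>d\<in>UNIV. \<Gamma> x d b a * g x $ d $ k) * X x $ k) = (\<Sum>d\<in>UNIV. \<Gamma> x d b a * (\<Sum>k\<in>UNIV. g x $ d $ k * X x $ k))"
    by (simp add: sum_distrib_left sum_distrib_right mult.assoc) (rule sum.swap)
  have 3: "(\<Sum>k\<in>UNIV. (\<Sum>d\<in>UNIV. \<Gamma> x d b k * g x $ a $ d) * X x $ k) = (\<Sum>k\<in>UNIV. g x $ a $ k * (\<Sum>d\<in>UNIV. \<Gamma> x k b d * X x $ d))"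
    unfolding sum_distrib_left sum_distrib_right by (subst sum.swap) (simp add: mult_ac)
  have "cov_low g X x a b = partial b (\<lambda>y. (g y *v X y) $ a) x - (\<Sum>d\<in>UNIV. \<Gamma> x d b a * (\<Sum>k\<in>UNIV. g x $ d $ k * X x $ k))"
    unfolding cov_low_def by (simp add: matrix_vector_mult_def)
  also have "\<dots> = (\<Sum>k\<in>UNIV. g x $ a $ k * (\<Sum>d\<in>UNIV. \<Gamma> x k b d * X x $ d)) + (\<Sum>k\<in>UNIV. g x $ a $ k * partial b (\<lambda>y. X y $ k) x)"
    unfolding 1 metric_compat[OF x] by (simp add: distrib_right sum.distrib 2 3)
  finally show ?thesis unfolding vd_def by (simp add: distrib_left sum.distrib)
qed

text \<open>In every contraction that defines acceleration, expansion, shear or twist a factor l.l,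
  l.p or l.q appears.\<close>

lemma kundt_vectorI:
  assumes x: "x \<in> S" and null: "null_vector (g x) (l x)"
    and M: "\<And>a b. cov_low g l x a b = low l x a * p b + q a * low l x b"
    and p: "(\<Sum>a\<in>UNIV. l x $ a * p a) = 0" and q: "(\<Sum>a\<in>UNIV. l x $ a * q a) = 0"
  shows "kundt_vector g l x"
proof -
  have raise: "(\<Sum>b\<in>UNIV. h x $ a $ b * low l x b) = l x $ a" for a
    unfolding low_def by (rule raise_lower[OF x])
  have raise': "(\<Sum>a\<in>UNIV. h x $ a $ b * low l x a) = l x $ b" for b
    using raise[of b] h_sym[OF x] by simp
  have ll: "(\<Sum>a\<in>UNIV. l x $ a * low l x a) = 0"
  proof -
    have "ip (g x) (l x) (l x) = (\<Sum>a\<in>UNIV. l x $ a * low l x a)" unfolding ip_sum low_def by (simp add: sum_distrib_left mult.assoc)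
    then show ?thesis using null unfolding null_vector_def by simp
  qed
  define p' where "p' = (\<lambda>a. \<Sum>b\<in>UNIV. h x $ a $ b * p b)"
  define q' where "q' = (\<lambda>a. \<Sum>b\<in>UNIV. h x $ a $ b * q b)"
  have up: "cov_up g l x a b = l x $ a * p' b + q' a * l x $ b" for a b
  proof -
    have "cov_up g l x a b = (\<Sum>c\<in>UNIV. \<Sum>d\<in>UNIV. (h x $ a $ c * low l x c) * (h x $ b $ d * p d))
       + (\<Sum>c\<in>UNIV. \<Sum>d\<in>UNIV. (h x $ a $ c * q c) * (h x $ b $ d * low l x d))"
      unfolding cov_up_def M by (simp add: algebra_simps sum.distrib)
    then show ?thesis unfolding sum_product[symmetric] raise p'_def q'_def .
  qed
  have lp: "(\<Sum>a\<in>UNIV. p' a * low l x a) = 0"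
  proof -
    have "(\<Sum>a\<in>UNIV. p' a * low l x a) = (\<Sum>b\<in>UNIV. (\<Sum>a\<in>UNIV. h x $ a $ b * low l x a) * p b)"
      unfolding p'_def sum_distrib_right by (subst sum.swap) (simp add: mult_ac)
    then show ?thesis unfolding raise' using p by simp
  qed
  have lq: "(\<Sum>a\<in>UNIV. q' a * low l x a) = 0"
  proof -
    have "(\<Sum>a\<in>UNIV. q' a * low l x a) = (\<Sum>b\<in>UNIV. (\<Sum>a\<in>UNIV. h x $ a $ b * low l x a) * q b)"
      unfolding q'_def sum_distrib_right by (subst sum.swap) (simp add: mult_ac)
    then show ?thesis unfolding raise' using q by simp
  qed
  have prod: "(\<Sum>a\<in>UNIV. \<Sum>b\<in>UNIV. F a * G b * (F' a * G' b)) = (\<Sum>a\<in>UNIV. F a * F' a) * (\<Sum>b\<in>UNIV. G b * G' b)" for F G F' G' :: "4 \<Rightarrow> real"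
    by (simp add: sum_product mult_ac)
  have s1: "(\<Sum>a\<in>UNIV. \<Sum>b\<in>UNIV. cov_up g l x a b * cov_low g l x a b) = 0"
  proof -
    have "(\<Sum>a\<in>UNIV. \<Sum>b\<in>UNIV. cov_up g l x a b * cov_low g l x a b) = 
      (\<Sum>a\<in>UNIV. \<Sum>b\<in>UNIV. l x $ a * p' b * (low l x a * p b)) + (\<Sum>a\<in>UNIV. \<Sum>b\<in>UNIV. l x $ a * p' b * (q a * low l x b))
      + (\<Sum>a\<in>UNIV. \<Sum>b\<in>UNIV. q' a * l x $ b * (low l x a * p b)) + (\<Sum>a\<in>UNIV. \<Sum>b\<in>UNIV. q' a * l x $ b * (q a * low l x b))"
      unfolding up M by (simp add: distrib_left distrib_right sum.distrib)
    then show ?thesis unfolding prod by (simp add: ll q lp lq)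
  qed
  have s2: "(\<Sum>a\<in>UNIV. \<Sum>b\<in>UNIV. cov_up g l x b a * cov_low g l x a b) = 0"
  proof -
    have "(\<Sum>a\<in>UNIV. \<Sum>b\<in>UNIV. cov_up g l x b a * cov_low g l x a b) = 
      (\<Sum>a\<in>UNIV. \<Sum>b\<in>UNIV. p' a * l x $ b * (low l x a * p b)) + (\<Sum>a\<in>UNIV. \<Sum>b\<in>UNIV. p' a * l x $ b * (q a * low l x b))
      + (\<Sum>a\<in>UNIV. \<Sum>b\<in>UNIV. l x $ a * q' b * (low l x a * p b)) + (\<Sum>a\<in>UNIV. \<Sum>b\<in>UNIV. l x $ a * q' b * (q a * low l x b))"
      unfolding up M by (simp add: distrib_left distrib_right sum.distrib mult_ac)
    then show ?thesis unfolding prod by (simp add: ll q lp lq)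
  qed
  have geo: "(\<Sum>b\<in>UNIV. l x $ b * cov_low g l x a b) = 0" for a
  proof -
    have "(\<Sum>b\<in>UNIV. l x $ b * cov_low g l x a b) = low l x a * (\<Sum>b\<in>UNIV. l x $ b * p b) + q a * (\<Sum>b\<in>UNIV. l x $ b * low l x b)"
      unfolding M by (simp add: algebra_simps sum.distrib sum_distrib_left)
    then show ?thesis by (simp add: p ll)
  qed
  have tr: "(\<Sum>a\<in>UNIV. \<Sum>b\<in>UNIV. h x $ a $ b * cov_low g l x a b) = 0"
  proof -
    have "(\<Sum>a\<in>UNIV. \<Sum>b\<in>UNIV. h x $ a $ b * cov_low g l x a b) = (\<Sum>a\<in>UNIV. p' a * low l x a) + (\<Sum>a\<in>UNIV. q a * (\<Sum>b\<in>UNIV. h x $ a $ b * low l x b))"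
      unfolding M p'_def by (simp add: algebra_simps sum.distrib sum_distrib_left)
    then show ?thesis unfolding raise lp using q by (simp add: mult.commute)
  qed
  show ?thesis unfolding kundt_vector_def
    using null geo tr s1 s2
    by (simp add: add_divide_distrib diff_divide_distrib distrib_right left_diff_distrib sum.distrib sum_subtractf sum_divide_distrib[symmetric])
qed

end

section \<open>Contracted derivative identities\<close>

definition ctr :: "real^4 \<Rightarrow> tensor \<Rightarrow> tensor" where
  "ctr u T I = (\<Sum>i\<in>UNIV. u $ i * T (i # I))"

lemma tev_ctr: "tev (u # vs) T = tev vs (ctr u T)"
  unfolding ctr_def tev_sum by simp

lemma pairing_frame_sum:
  assumes "pairing_frame H e s st"
  shows "(\<Sum>i\<in>UNIV. \<Sum>j\<in>UNIV. H $ i $ j * (P i * Q j)) = (\<Sum>a\<in>UNIV. s a * (\<Sum>i\<in>UNIV. e a $ i * P i) * (\<Sum>j\<in>UNIV. e (st a) $ j * Q j))"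
proof -
  have "(\<Sum>i\<in>UNIV. \<Sum>j\<in>UNIV. H $ i $ j * (P i * Q j)) = (\<Sum>i\<in>UNIV. \<Sum>j\<in>UNIV. \<Sum>a\<in>UNIV. s a * (e a $ i * P i) * (e (st a) $ j * Q j))"
    using assms unfolding pairing_frame_def by (simp add: sum_distrib_left sum_distrib_right mult_ac)
  also have "\<dots> = (\<Sum>i\<in>UNIV. \<Sum>a\<in>UNIV. \<Sum>j\<in>UNIV. s a * (e a $ i * P i) * (e (st a) $ j * Q j))"
    by (intro sum.cong refl sum.swap)
  also have "\<dots> = (\<Sum>a\<in>UNIV. \<Sum>i\<in>UNIV. \<Sum>j\<in>UNIV. s a * (e a $ i * P i) * (e (st a) $ j * Q j))"
    by (rule sum.swap)
  finally show ?thesis by (simp add: sum_product sum_distrib_left sum_distrib_right mult_ac)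
qed

lemma frame_rescale:
  assumes e: "null_frame G e" "c \<noteq> 0" and G: "lorentz_form G"
  defines "sc \<equiv> (\<lambda>a::4. if a = 0 then c else if a = 1 then 1 / c else 1)"
  shows "null_frame G (\<lambda>a. sc a *\<^sub>R e a)"
    "frame_array (\<lambda>a. sc a *\<^sub>R e a) T i j k l = sc i * sc j * sc k * sc l * frame_array e T i j k l"
proof -
  have "ip G (p *\<^sub>R u) (q *\<^sub>R v) = p * q * ip G u v" for p q u v
    by (simp add: ip_def matrix_vector_mult_scaleR)
  then have "ip G (sc a *\<^sub>R e a) (sc b *\<^sub>R e b) = sc a * sc b * (if b = st01 a then 1 else 0)" for a b
    by (simp add: null_frame_ip[OF e(1)])
  moreover have "\<forall>a b. sc a * sc b * (if b = st01 a then 1 else 0) = (if {a, b} = {0, 1} \<or> a = b \<and> a \<in> {2, 3} then 1 else 0)"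
    unfolding forall_4' sc_def using e(2) by (simp add: doubleton_eq_iff)
  ultimately show "null_frame G (\<lambda>a. sc a *\<^sub>R e a)" unfolding null_frame_def by simp
  show "frame_array (\<lambda>a. sc a *\<^sub>R e a) T i j k l = sc i * sc j * sc k * sc l * frame_array e T i j k l"
    unfolding frame_array_def by (simp add: sum_distrib_left mult_ac)
qed

lemma weyl_sym_ctr:
  assumes "\<And>i. weyl_sym H (\<lambda>a b c d. T (i # D @ [a,b,c,d]))"
  shows "weyl_sym H (\<lambda>a b c d. ctr u T (D @ [a,b,c,d]))"
proof -
  have w: "T (i # D @ [a,b,c,d]) = - T (i # D @ [b,a,c,d])" "T (i # D @ [a,b,c,d]) = T (i # D @ [c,d,a,b])"
    "T (i # D @ [a,b,c,d]) + T (i # D @ [a,c,d,b]) + T (i # D @ [a,d,b,c]) = 0" 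
    "(\<Sum>k\<in>UNIV. \<Sum>j\<in>UNIV. H $ k $ j * T (i # D @ [k,b,j,d])) = 0" for i a b c d
    using assms unfolding weyl_sym_def by blast+
  show ?thesis unfolding weyl_sym_def
  proof (intro allI conjI)
    fix a b c d
    have "(\<Sum>i\<in>UNIV. u $ i * T (i # D @ [a,b,c,d])) = (\<Sum>i\<in>UNIV. u $ i * - T (i # D @ [b,a,c,d]))"
      by (intro sum.cong refl arg_cong2[where f="(*)"] w(1))
    then show "ctr u T (D @ [a,b,c,d]) = - ctr u T (D @ [b,a,c,d])" unfolding ctr_def by (simp add: sum_negf)
    show "ctr u T (D @ [a,b,c,d]) = ctr u T (D @ [c,d,a,b])" unfolding ctr_def
      by (intro sum.cong refl arg_cong2[where f="(*)"] w(2))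
    show "ctr u T (D @ [a,b,c,d]) + ctr u T (D @ [a,c,d,b]) + ctr u T (D @ [a,d,b,c]) = 0"
      unfolding ctr_def sum.distrib[symmetric] distrib_left[symmetric] w(3) by simp
    show "(\<Sum>i\<in>UNIV. \<Sum>j\<in>UNIV. H $ i $ j * ctr u T (D @ [i,b,j,d])) = 0"
      unfolding ctr_def sum_pull w(4) by simp
  qed
qed

context chart_metric
begin

definition Dv :: "(real^4 \<Rightarrow> real^4) \<Rightarrow> real^4 \<Rightarrow> real^4 \<Rightarrow> real^4" where
  "Dv X x u = (\<chi> i. \<Sum>e\<in>UNIV. vd X x i e * u $ e)"

lemma tev_Dv: "(\<Sum>e\<in>UNIV. u $ e * tev vs (\<lambda>I. \<Sum>i\<in>UNIV. vd X x i e * T (i # I))) = tev (Dv X x u # vs) T"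
proof -
  have "(\<Sum>e\<in>UNIV. u $ e * tev vs (\<lambda>I. \<Sum>i\<in>UNIV. vd X x i e * T (i # I))) = 
     (\<Sum>i\<in>UNIV. \<Sum>e\<in>UNIV. u $ e * (vd X x i e * tev vs (\<lambda>I. T (i # I))))"
    unfolding tev_sum sum_distrib_left by (rule sum.swap)
  then show ?thesis unfolding Dv_def by (simp add: sum_distrib_left sum_distrib_right mult_ac)
qed

text \<open>The Leibniz rule for K = T(X, ...), solved for the derivative of \<open>T\<close>. Any
  field \<open>K\<close> that agrees with the contraction on lists of length \<open>n\<close> may be
  used.\<close>

lemma nabla_ctr_tev:
  assumes x: "x \<in> S" and X: "\<And>i. smooth_on S (\<lambda>x. X x $ i)" and T: "\<And>I. smooth_on S (\<lambda>x. T x I)"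
    and K: "\<And>y I. y \<in> S \<Longrightarrow> length I = n \<Longrightarrow> ctr (X y) (T y) I = K y I" and vs: "length vs = n"
  shows "tev (u # X x # vs) (nabla g T x) = tev (u # vs) (nabla g K x) - tev (Dv X x u # vs) (T x)"
proof -
  have "(\<Sum>i\<in>UNIV. X x $ i * nabla g T x (e # i # I)) = nabla g K x (e # I) - (\<Sum>i\<in>UNIV. vd X x i e * T x (i # I))"
    if "length I = n" for e I
    using nabla_contract0[where X=X and T=T and e=e and I=I, OF x X T] nabla_cong[OF x, where I=I and T="\<lambda>y I. \<Sum>i\<in>UNIV. X y $ i * T y (i # I)" and T'=K and e=e] K that
    unfolding ctr_def by simp
  then have "tev vs (\<lambda>I. \<Sum>i\<in>UNIV. X x $ i * nabla g T x (e # i # I)) = 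
     tev vs (\<lambda>I. nabla g K x (e # I) - (\<Sum>i\<in>UNIV. vd X x i e * T x (i # I)))" for e
    by (intro tev_cong) (simp add: vs)
  then have "tev (u # X x # vs) (nabla g T x) = (\<Sum>e\<in>UNIV. u $ e * tev vs (\<lambda>I. nabla g K x (e # I)))
      - (\<Sum>e\<in>UNIV. u $ e * tev vs (\<lambda>I. \<Sum>i\<in>UNIV. vd X x i e * T x (i # I)))"
    by (simp add: tev_sum[symmetric] tev_diff right_diff_distrib sum_subtractf del: nabla.simps)
  then show ?thesis unfolding tev_Dv by simp
qed

lemma nabla_zero: "nabla g (\<lambda>y I. 0) x I = 0"
  by (cases I) simp_all

lemma nabla_ctr_tev_0:
  assumes "x \<in> S" and "\<And>i. smooth_on S (\<lambda>x. X x $ i)" and "\<And>I. smooth_on S (\<lambda>x. T x I)"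
    and "\<And>y I. y \<in> S \<Longrightarrow> length I = n \<Longrightarrow> ctr (X y) (T y) I = 0" and "length vs = n"
  shows "tev (u # X x # vs) (nabla g T x) = - tev (Dv X x u # vs) (T x)"
proof -
  have "tev (u # vs) (nabla g (\<lambda>y I. 0) x) = 0"
    using tev_zero[of "u # vs"] unfolding nabla_zero .
  then show ?thesis using nabla_ctr_tev[where K="\<lambda>y I. 0", OF assms, of u] by simp
qed

text \<open>T(X, ...) = 0 is differentiated twice. \<open>U\<close> collects the second covariant
  derivative of \<open>X\<close> along \<open>u\<close> and \<open>v\<close>; it stays unspecified,
  since it only enters as an argument of \<open>T\<close> itself.\<close>

lemma second_ctr:
  assumes x: "x \<in> S" and X: "\<And>i. smooth_on S (\<lambda>x. X x $ i)" and T: "\<And>I. smooth_on S (\<lambda>x. T x I)"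
    and K: "\<And>y I. y \<in> S \<Longrightarrow> length I = n \<Longrightarrow> ctr (X y) (T y) I = 0"
  obtains U where "\<And>vs. length vs = n \<Longrightarrow> tev (u # v # X x # vs) (nabla g (nabla g T) x) = 
     - tev (v # Dv X x u # vs) (nabla g T x) - tev (u # Dv X x v # vs) (nabla g T x) - tev (U # vs) (T x)"
proof -
  define Z where "Z = (\<lambda>e y. \<chi> i. vd X y i e)"
  have Zs: "smooth_on S (\<lambda>y. Z e y $ i)" for e i unfolding Z_def by (simp add: smooth_vd X)
  define Q where "Q = (\<lambda>y I. \<Sum>i\<in>UNIV. X y $ i * nabla g T y (hd I # i # tl I))"
  have nT: "smooth_on S (\<lambda>x. nabla g T x I)" for I by (rule smooth_nabla[OF T])
  have Qe: "Q y (e # I) = - (\<Sum>i\<in>UNIV. Z e y $ i * T y (i # I))" if "y \<in> S" "length I = n" for y e I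
    using nabla_contract0[where X=X and T=T and e=e and I=I, OF that(1) X T] nabla_cong[OF that(1), where I=I and T="\<lambda>y I. \<Sum>i\<in>UNIV. X y $ i * T y (i # I)" and T'="\<lambda>y I. 0" and e=e] K that(2)
    unfolding ctr_def Q_def Z_def by (simp del: nabla.simps add: nabla_zero)
  \<comment> \<open>The second covariant derivative of \<open>X\<close>. For fixed \<open>e\<close>
    the field \<open>Z e\<close> ignores the tensorial nature of the index \<open>e\<close>, hence
    the correction by \<open>\<Gamma>\<close>.\<close>
  define U1 where "U1 = (\<lambda>i f e. vd (Z e) x i f - (\<Sum>d\<in>UNIV. \<Gamma> x d f e * Z d x $ i))"
  have 1: "nabla g Q x (f # e # I) = - (\<Sum>i\<in>UNIV. Z e x $ i * nabla g T x (f # i # I)) - (\<Sum>i\<in>UNIV. U1 i f e * T x (i # I))"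
    if I: "length I = n" for f e I
  proof -
    define Y where "Y = (\<lambda>e y I. \<Sum>i\<in>UNIV. Z e y $ i * T y (i # I))"
    have Ys: "smooth_on S (\<lambda>y. Y e y I)" for e I unfolding Y_def
      by (intro smooth_on_sum smooth_on_mult openS Zs T)
    have "partial f (\<lambda>y. Q y (e # I)) x = partial f (\<lambda>y. - Y e y I) x"
      by (rule partial_cong[OF openS x]) (simp add: Qe I Y_def)
    then have p: "partial f (\<lambda>y. Q y (e # I)) x = - partial f (\<lambda>y. Y e y I) x"
      by (simp add: partial_minus sd[OF Ys x])
    have "nabla g Q x (f # e # I) = partial f (\<lambda>y. Q y (e # I)) x - (\<Sum>d\<in>UNIV. \<Gamma> x d f e * Q x (d # I))
       - (\<Sum>k<length I. \<Sum>d\<in>UNIV. \<Gamma> x d f (I ! k) * Q x (e # I[k := d]))"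
      by (simp add: sum.lessThan_Suc_shift del: sum.lessThan_Suc)
    also have "\<dots> = - nabla g (Y e) x (f # I) + (\<Sum>d\<in>UNIV. \<Gamma> x d f e * Y d x I)"
      using I unfolding p by (simp add: Qe[OF x] sum_negf Y_def)
    also have "nabla g (Y e) x (f # I) = (\<Sum>i\<in>UNIV. Z e x $ i * nabla g T x (f # i # I)) + (\<Sum>i\<in>UNIV. vd (Z e) x i f * T x (i # I))"
      unfolding Y_def by (rule nabla_contract0[OF x Zs T])
    also have "(\<Sum>d\<in>UNIV. \<Gamma> x d f e * Y d x I) = (\<Sum>i\<in>UNIV. (\<Sum>d\<in>UNIV. \<Gamma> x d f e * Z d x $ i) * T x (i # I))"
      unfolding Y_def by (simp add: sum_distrib_left sum_distrib_right mult.assoc) (rule sum.swap)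
    finally show ?thesis unfolding U1_def by (simp add: left_diff_distrib sum_subtractf)
  qed
  have 2: "(\<Sum>i\<in>UNIV. X x $ i * nabla g (nabla g T) x (f # e # i # I)) = 
     - (\<Sum>i\<in>UNIV. vd X x i f * nabla g T x (e # i # I)) - (\<Sum>i\<in>UNIV. vd X x i e * nabla g T x (f # i # I)) - (\<Sum>i\<in>UNIV. U1 i f e * T x (i # I))"
    if "length I = n" for f e I
    using 1[OF that, of f e] nabla_contract1[where X=X and T="nabla g T" and e=f and a=e and I=I, OF x X nT] unfolding Q_def[symmetric]
    by (simp add: Z_def del: nabla.simps)
  define U where "U = (\<chi> i. \<Sum>f\<in>UNIV. \<Sum>e\<in>UNIV. u $ f * v $ e * U1 i f e)"
  have "tev (u # v # X x # vs) (nabla g (nabla g T) x) = 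
     - tev (v # Dv X x u # vs) (nabla g T x) - tev (u # Dv X x v # vs) (nabla g T x) - tev (U # vs) (T x)" if vs: "length vs = n" for vs
  proof -
    have "tev (u # v # X x # vs) (nabla g (nabla g T) x) = (\<Sum>f\<in>UNIV. u $ f * (\<Sum>e\<in>UNIV. v $ e * tev vs (\<lambda>I. (\<Sum>i\<in>UNIV. X x $ i * nabla g (nabla g T) x (f # e # i # I)))))"
      by (simp add: tev_sum[symmetric] del: nabla.simps)
    also have "\<dots> = (\<Sum>f\<in>UNIV. u $ f * (\<Sum>e\<in>UNIV. v $ e * tev vs (\<lambda>I. - (\<Sum>i\<in>UNIV. vd X x i f * nabla g T x (e # i # I)) - (\<Sum>i\<in>UNIV. vd X x i e * nabla g T x (f # i # I)) - (\<Sum>i\<in>UNIV. U1 i f e * T x (i # I)))))"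
      by (intro sum.cong refl arg_cong2[where f="(*)"] tev_cong 2) (simp add: vs)
    also have "\<dots> = - (\<Sum>f\<in>UNIV. u $ f * (\<Sum>e\<in>UNIV. v $ e * tev vs (\<lambda>I. (\<Sum>i\<in>UNIV. vd X x i f * nabla g T x (e # i # I)))))
       - (\<Sum>f\<in>UNIV. u $ f * (\<Sum>e\<in>UNIV. v $ e * tev vs (\<lambda>I. (\<Sum>i\<in>UNIV. vd X x i e * nabla g T x (f # i # I)))))
       - (\<Sum>f\<in>UNIV. u $ f * (\<Sum>e\<in>UNIV. v $ e * tev vs (\<lambda>I. (\<Sum>i\<in>UNIV. U1 i f e * T x (i # I)))))"
      by (simp add: tev_diff tev_minus right_diff_distrib sum_subtractf sum_negf del: nabla.simps)
    also have "(\<Sum>f\<in>UNIV. u $ f * (\<Sum>e\<in>UNIV. v $ e * tev vs (\<lambda>I. (\<Sum>i\<in>UNIV. vd X x i e * nabla g T x (f # i # I))))) = tev (u # Dv X x v # vs) (nabla g T x)"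
      unfolding tev_Dv[of v vs X x "\<lambda>I. nabla g T x (_ # I)"] by (simp del: nabla.simps)
    also have "(\<Sum>f\<in>UNIV. u $ f * (\<Sum>e\<in>UNIV. v $ e * tev vs (\<lambda>I. (\<Sum>i\<in>UNIV. vd X x i f * nabla g T x (e # i # I))))) = tev (v # Dv X x u # vs) (nabla g T x)"
    proof -
      have "(\<Sum>f\<in>UNIV. u $ f * (\<Sum>e\<in>UNIV. v $ e * tev vs (\<lambda>I. (\<Sum>i\<in>UNIV. vd X x i f * nabla g T x (e # i # I))))) = 
        (\<Sum>e\<in>UNIV. v $ e * (\<Sum>f\<in>UNIV. u $ f * tev vs (\<lambda>I. (\<Sum>i\<in>UNIV. vd X x i f * nabla g T x (e # i # I)))))"
        unfolding sum_distrib_left by (subst sum.swap) (simp add: mult_ac del: nabla.simps)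
      then show ?thesis unfolding tev_Dv[of u vs X x "\<lambda>I. nabla g T x (_ # I)"] by (simp del: nabla.simps)
    qed
    also have "(\<Sum>f\<in>UNIV. u $ f * (\<Sum>e\<in>UNIV. v $ e * tev vs (\<lambda>I. (\<Sum>i\<in>UNIV. U1 i f e * T x (i # I))))) = tev (U # vs) (T x)"
    proof -
      have "(\<Sum>f\<in>UNIV. u $ f * (\<Sum>e\<in>UNIV. v $ e * tev vs (\<lambda>I. (\<Sum>i\<in>UNIV. U1 i f e * T x (i # I))))) = 
         (\<Sum>f\<in>UNIV. \<Sum>e\<in>UNIV. (u $ f * v $ e) * (\<Sum>i\<in>UNIV. 1 * (U1 i f e * tev vs (\<lambda>I. T x (i # I)))))"
        unfolding tev_sum by (simp add: sum_distrib_left mult.assoc)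
      also have "\<dots> = (\<Sum>i\<in>UNIV. 1 * (\<Sum>f\<in>UNIV. \<Sum>e\<in>UNIV. (u $ f * v $ e) * (U1 i f e * tev vs (\<lambda>I. T x (i # I)))))"
        by (rule sum_pull)
      finally show ?thesis unfolding U_def by (simp add: sum_distrib_right mult.assoc)
    qed
    finally show ?thesis .
  qed
  then show ?thesis using that by blast
qed

lemma ip_low: "ip (g x) u (X x) = (\<Sum>a\<in>UNIV. u $ a * low X x a)"
  unfolding ip_sum low_def by (simp add: sum_distrib_left mult.assoc)

lemma smooth_low: "(\<And>i. smooth_on S (\<lambda>x. X x $ i)) \<Longrightarrow> smooth_on S (\<lambda>x. low X x a)"
  unfolding low_def by (intro smooth_on_sum smooth_on_mult openS smooth_g)

lemma nabla_low:
  assumes x: "x \<in> S" and X: "\<And>i. smooth_on S (\<lambda>x. X x $ i)"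
  shows "nabla g (\<lambda>y I. low X y (I ! 0)) x [e, a] = (\<Sum>k\<in>UNIV. g x $ a $ k * vd X x k e)"
  using cov_low_vd[OF x X, of a e] unfolding cov_low_def low_def by (simp add: matrix_vector_mult_def)

text \<open>Differentiating X.X = 0 equates this product with its own negative.\<close>

lemma Dv_null:
  assumes x: "x \<in> S" and X: "\<And>i. smooth_on S (\<lambda>x. X x $ i)" and null: "\<And>y. y \<in> S \<Longrightarrow> ip (g y) (X y) (X y) = 0"
  shows "ip (g x) (Dv X x u) (X x) = 0"
proof -
  have "tev [u, X x] (nabla g (\<lambda>y I. low X y (I ! 0)) x) = - tev [Dv X x u] (\<lambda>I. low X x (I ! 0))"
  proof (rule nabla_ctr_tev_0[where n=0, OF x X])
    show "ctr (X y) (\<lambda>I. low X y (I ! 0)) I = 0" if "y \<in> S" "length I = 0" for y I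
      using null[OF that(1)] unfolding ip_low ctr_def by simp
  qed (use smooth_low[OF X] in auto)
  moreover have "tev [Dv X x u] (\<lambda>I. low X x (I ! 0)) = ip (g x) (Dv X x u) (X x)"
    by (simp add: ip_low)
  moreover have "tev [u, X x] (nabla g (\<lambda>y I. low X y (I ! 0)) x) = ip (g x) (X x) (Dv X x u)"
  proof -
    have "tev [u, X x] (nabla g (\<lambda>y I. low X y (I ! 0)) x) = (\<Sum>e\<in>UNIV. u $ e * (\<Sum>a\<in>UNIV. X x $ a * (\<Sum>k\<in>UNIV. g x $ a $ k * vd X x k e)))"
      unfolding tev.simps nabla_low[OF x X] ..
    also have "\<dots> = (\<Sum>e\<in>UNIV. u $ e * (\<Sum>a\<in>UNIV. \<Sum>k\<in>UNIV. (X x $ a * g x $ a $ k) * vd X x k e))"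
      by (simp add: sum_distrib_left mult.assoc)
    also have "\<dots> = (\<Sum>a\<in>UNIV. \<Sum>k\<in>UNIV. (X x $ a * g x $ a $ k) * (\<Sum>e\<in>UNIV. u $ e * vd X x k e))"
      by (rule sum_pull[symmetric])
    finally show ?thesis unfolding ip_sum Dv_def by (simp add: mult.commute)
  qed
  ultimately show ?thesis using ip_commute[OF lorentz[OF x]] by (metis add.inverse_neutral equal_neg_zero)
qed

lemma Dv_linear: "Dv X x (\<Sum>k\<in>K. q k *\<^sub>R w k) = (\<Sum>k\<in>K. q k *\<^sub>R Dv X x (w k))"
proof -
  have "Dv X x (\<Sum>k\<in>K. q k *\<^sub>R w k) $ i = (\<Sum>k\<in>K. q k *\<^sub>R Dv X x (w k)) $ i" for i
  proof -
    have "Dv X x (\<Sum>k\<in>K. q k *\<^sub>R w k) $ i = (\<Sum>e\<in>UNIV. \<Sum>k\<in>K. q k * (vd X x i e * w k $ e))"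
      unfolding Dv_def by (simp add: sum_distrib_left mult_ac)
    also have "\<dots> = (\<Sum>k\<in>K. \<Sum>e\<in>UNIV. q k * (vd X x i e * w k $ e))" by (rule sum.swap)
    finally show ?thesis unfolding Dv_def by (simp add: sum_distrib_left)
  qed
  then show ?thesis by (simp add: vec_eq_iff)
qed

lemma Dv_axis: "Dv X x (axis b 1) $ k = vd X x k b"
  unfolding Dv_def by (simp add: axis_def if_distrib[of "\<lambda>r. _ * r"] cong: if_cong)

text \<open>The optical scalars and the acceleration of \<open>X\<close> are read off the matrix of \<open>Dv\<close> in a null frame.\<close>

lemma kundt_vector_frame:
  assumes x: "x \<in> S" and X: "\<And>i. smooth_on S (\<lambda>x. X x $ i)" and e: "null_frame (g x) e" "e 0 = X x"
  defines "L \<equiv> (\<lambda>k b. ip (g x) (Dv X x (e b)) (e (st01 k)))"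
  assumes L: "\<And>k. L k 0 = 0" "\<And>b. L 1 b = 0" "L 2 2 = 0" "L 2 3 = 0" "L 3 2 = 0" "L 3 3 = 0"
  shows "kundt_vector g X x"
proof -
  note G = lorentz[OF x]
  have De: "Dv X x (e b) = L 0 b *\<^sub>R X x + L 2 b *\<^sub>R e 2 + L 3 b *\<^sub>R e 3" for b
    using null_frame_expand[OF e(1) G, of "Dv X x (e b)"] L(2) unfolding UNIV_4' by (simp add: L_def e(2) algebra_simps)
  define B where "B = L 2 1 *\<^sub>R e 2 + L 3 1 *\<^sub>R e 3"
  define p where "p = (\<lambda>b. \<Sum>c\<in>UNIV. ip (g x) (axis b 1) (e (st01 c)) * L 0 c)"
  have ax: "ip (g x) (axis b 1) (X x) = low X x b" for b
    unfolding ip_low by (simp add: axis_def if_distrib[of "\<lambda>r. r * _"] cong: if_cong)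
  \<comment> \<open>Expanding the coordinate vectors in the frame brings the derivative of
    \<open>X\<close> into the form required by \<open>kundt_vectorI\<close>.\<close>
  have Da: "Dv X x (axis b 1) = p b *\<^sub>R X x + low X x b *\<^sub>R B" for b
  proof -
    have "Dv X x (axis b 1) = (\<Sum>c\<in>UNIV. ip (g x) (axis b 1) (e (st01 c)) *\<^sub>R Dv X x (e c))"
      using null_frame_expand[OF e(1) G, of "axis b 1"] Dv_linear[where K=UNIV and w=e] by metis
    also have "\<dots> = p b *\<^sub>R X x + ip (g x) (axis b 1) (e 0) *\<^sub>R B"
      unfolding De p_def B_def UNIV_4' using L by (simp add: algebra_simps)
    finally show ?thesis unfolding e(2) ax .
  qed
  define q where "q = (\<lambda>a. \<Sum>k\<in>UNIV. g x $ a $ k * B $ k)"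
  show ?thesis
  proof (rule kundt_vectorI[OF x])
    show "null_vector (g x) (X x)" using null_frame_null[OF e(1)] e(2) by simp
    show "cov_low g X x a b = low X x a * p b + q a * low X x b" for a b
      unfolding cov_low_vd[OF x X] Dv_axis[symmetric] Da low_def[of X x a] q_def
      by (simp add: algebra_simps sum.distrib sum_distrib_left)
    have "(\<Sum>a\<in>UNIV. X x $ a * p a) = (\<Sum>c\<in>UNIV. ip (g x) (X x) (e (st01 c)) * L 0 c)"
    proof -
      have "(\<Sum>a\<in>UNIV. X x $ a * p a) = (\<Sum>c\<in>UNIV. (\<Sum>a\<in>UNIV. X x $ a * ip (g x) (axis a 1) (e (st01 c))) * L 0 c)"
        unfolding p_def by (simp add: sum_distrib_left sum_distrib_right mult.assoc) (rule sum.swap)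
      moreover have "(\<Sum>a\<in>UNIV. X x $ a * ip (g x) (axis a 1) w) = ip (g x) (X x) w" for w
        unfolding ip_def inner_vec_def by (simp add: axis_def if_distrib[of "\<lambda>r. r * _"] cong: if_cong)
      ultimately show ?thesis by simp
    qed
    also have "\<dots> = 0" unfolding e(2)[symmetric] sum_4' using L by (simp add: null_frame_ip[OF e(1)])
    finally show "(\<Sum>a\<in>UNIV. X x $ a * p a) = 0" .
    have "(\<Sum>a\<in>UNIV. X x $ a * q a) = ip (g x) (X x) B"
      unfolding q_def ip_sum by (simp add: sum_distrib_left mult.assoc)
    also have "\<dots> = L 2 1 * ip (g x) (X x) (e 2) + L 3 1 * ip (g x) (X x) (e 3)"
      unfolding B_def ip_def by (simp add: matrix_vector_right_distrib matrix_vector_mult_scaleR inner_add_right)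
    also have "\<dots> = 0" unfolding e(2)[symmetric] by (simp add: null_frame_ip[OF e(1)])
    finally show "(\<Sum>a\<in>UNIV. X x $ a * q a) = 0" .
  qed
qed

end

lemma tev3_cyc: "tev [c,d,e] U = tev [e,c,d] (\<lambda>J. U [J!1, J!2, J!0])"
proof -
  have 1: "tev [d,e] V = tev [e,d] (\<lambda>J. V [J!1, J!0])" for V
    by (simp add: sum_distrib_left) (subst sum.swap, simp add: mult_ac)
  have "tev [c,d,e] U = tev [c,e,d] (\<lambda>J. U [J!0, J!2, J!1])"
    using 1[of "\<lambda>J. U (_ # J)"] by (simp add: numeral_2_eq_2)
  also have "\<dots> = tev [e,c,d] (\<lambda>J. U [J!1, J!2, J!0])"
    by (simp add: sum_distrib_left numeral_2_eq_2) (subst sum.swap, simp add: mult_ac)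
  finally show ?thesis .
qed

lemma tev_basis: "tev (us @ v # vs) T = (\<Sum>i\<in>UNIV. v $ i * tev (us @ axis i 1 # vs) T)"
  using tev_linear[of us "\<lambda>i. v $ i" "\<lambda>i. axis i 1" UNIV vs T] basis_expansion[of v]
  by (simp add: scalar_mult_eq_scaleR)

lemma tev3_zero: "(\<And>i j k. U [i,j,k] = 0) \<Longrightarrow> tev [a,b,c] U = 0"
  by simp

text \<open>Slot permutations let all three terms be evaluated on the same vectors \<open>e\<close>,
  \<open>c\<close>, \<open>d\<close> in the same order; the identity for components then applies
  inside.\<close>

lemma tev5_bianchi:
  assumes "\<And>e a b c d. T [e,a,b,c,d] + T [c,a,b,d,e] + T [d,a,b,e,c] = 0"
  shows "tev [e,a,b,c,d] T + tev [c,a,b,d,e] T + tev [d,a,b,e,c] T = 0"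
proof -
  have 1: "tev [e,a,b,c,d] T = tev [a,b] (\<lambda>I. tev [e,c,d] (\<lambda>J. T [J!0, I!0, I!1, J!1, J!2]))" for e a b c d
  proof -
    have "tev [e,a,b] U = tev [a,b,e] (\<lambda>J. U [J!2, J!0, J!1])" for U
      using tev3_cyc[of a b e "\<lambda>J. U [J!2, J!0, J!1]"] by (simp add: numeral_2_eq_2)
    from this[of "\<lambda>I. tev [c,d] (\<lambda>J. T (I @ J))"] show ?thesis
      by (simp add: numeral_2_eq_2)
  qed
  have "tev [e,a,b,c,d] T + tev [c,a,b,d,e] T + tev [d,a,b,e,c] T = 
    tev [a,b] (\<lambda>I. tev [e,c,d] (\<lambda>J. T [J!0, I!0, I!1, J!1, J!2]) + tev [c,d,e] (\<lambda>J. T [J!0, I!0, I!1, J!1, J!2])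
       + tev [d,e,c] (\<lambda>J. T [J!0, I!0, I!1, J!1, J!2]))"
    unfolding 1 tev_add ..
  also have "\<dots> = tev [a,b] (\<lambda>I. 0)"
  proof (rule tev_cong)
    fix I :: "4 list"
    have cyc: "tev [d,e,c] U = tev [e,c,d] (\<lambda>J. U [J!2, J!0, J!1])" for U
      using tev3_cyc[of e c d "\<lambda>J. U [J!2, J!0, J!1]"] by (simp add: numeral_2_eq_2)
    have "tev [e,c,d] (\<lambda>J. T [J!0, I!0, I!1, J!1, J!2]) + tev [c,d,e] (\<lambda>J. T [J!0, I!0, I!1, J!1, J!2])
       + tev [d,e,c] (\<lambda>J. T [J!0, I!0, I!1, J!1, J!2]) = 
      tev [e,c,d] (\<lambda>J. T [J!0, I!0, I!1, J!1, J!2] + T [J!1, I!0, I!1, J!2, J!0] + T [J!2, I!0, I!1, J!0, J!1])"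
      unfolding tev3_cyc[of c d e] cyc tev_add by (simp add: numeral_2_eq_2)
    also have "\<dots> = 0" by (rule tev3_zero) (simp add: assms numeral_2_eq_2)
    finally show "tev [e,c,d] (\<lambda>J. T [J!0, I!0, I!1, J!1, J!2]) + tev [c,d,e] (\<lambda>J. T [J!0, I!0, I!1, J!1, J!2])
       + tev [d,e,c] (\<lambda>J. T [J!0, I!0, I!1, J!1, J!2]) = 0" .
  qed
  finally show ?thesis by (simp only: tev_zero)
qed

context chart_metric
begin

lemma smooth_tev: "(\<And>I. smooth_on S (\<lambda>x. T x I)) \<Longrightarrow> smooth_on S (\<lambda>x. tev vs (T x))"
  by (induction vs arbitrary: T) (auto intro!: smooth_on_sum smooth_on_mult smooth_on_const openS)

lemma smooth_ip: "(\<And>i. smooth_on S (\<lambda>x. X x $ i)) \<Longrightarrow> smooth_on S (\<lambda>x. ip (g x) v (X x))"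
  unfolding ip_sum by (intro smooth_on_sum smooth_on_mult smooth_on_const openS smooth_g)

lemma open_nonzero: "smooth_on S f \<Longrightarrow> open {x \<in> S. f x \<noteq> (0::real)}"
  using continuous_open_preimage[OF smooth_on_continuous openS, of f "- {0}"]
  by (simp add: vimage_def Int_def open_Compl)

section \<open>The multiple null direction is smooth\<close>

text \<open>A smooth null bivector \<open>B = l \<and> s\<close> with \<open>s\<close> orthogonal to \<open>l\<close> yields a smooth vector field in the direction of \<open>l\<close>:
  contract \<open>B\<close> with \<open>B v\<close>.\<close>

lemma null_bivector_direction:
  assumes B: "\<And>I. smooth_on S (\<lambda>x. B x I)" and pS: "pt \<in> S"
    and E: "\<And>x. x \<in> S \<Longrightarrow> null_frame (g x) (E x)"
    and z: "\<And>x b. x \<in> S \<Longrightarrow> tev [E x 0, E x b] (B x) = 0" "\<And>x b. x \<in> S \<Longrightarrow> tev [E x b, E x 0] (B x) = 0"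
      "\<And>x. x \<in> S \<Longrightarrow> tev [E x 1, E x 1] (B x) = 0"
      "\<And>x a b. x \<in> S \<Longrightarrow> a \<in> {2,3} \<Longrightarrow> b \<in> {2,3} \<Longrightarrow> tev [E x a, E x b] (B x) = 0"
    and nz: "tev [E pt 1, E pt 2] (B pt) \<noteq> 0 \<or> tev [E pt 1, E pt 3] (B pt) \<noteq> 0"
  obtains V w where "open V" "pt \<in> V" "V \<subseteq> S" "\<And>i. smooth_on V (\<lambda>x. w x $ i)"
    "\<And>x. x \<in> V \<Longrightarrow> \<exists>c. c \<noteq> 0 \<and> w x = c *\<^sub>R E x 0"
proof -
  define v where "v = E pt 1"
  define F where "F = (\<lambda>x c d. B x [c, d])"
  define G where "G = (\<lambda>x d. \<Sum>c\<in>UNIV. v $ c * F x c d)"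
  define wl where "wl = (\<lambda>x c. \<Sum>i\<in>UNIV. \<Sum>j\<in>UNIV. h x $ i $ j * (F x c i * G x j))"
  define w where "w = (\<lambda>x. \<chi> k. \<Sum>c\<in>UNIV. h x $ k $ c * wl x c)"
  have Fs: "smooth_on S (\<lambda>x. F x c d)" for c d unfolding F_def by (rule B)
  have Gs: "smooth_on S (\<lambda>x. G x d)" for d unfolding G_def by (intro smooth_on_sum smooth_on_mult smooth_on_const openS Fs)
  have wls: "smooth_on S (\<lambda>x. wl x c)" for c unfolding wl_def by (intro smooth_on_sum smooth_on_mult openS Fs Gs smooth_h)
  have ws: "smooth_on S (\<lambda>x. w x $ k)" for k unfolding w_def vec_lambda_beta by (intro smooth_on_sum smooth_on_mult openS wls smooth_h)
  \<comment> \<open>In the frame only the components of \<open>B\<close> with one index 1 and the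
    other transverse survive. Contracting \<open>B\<close> with \<open>B v\<close> leaves the e_0
    direction, with a factor that is a sum of two squares times v.e_0.\<close>
  have main: "w x = (ip (g x) v (E x 0) * (f1 * f1 + f2 * f2)) *\<^sub>R E x 0"
    if x: "x \<in> S" and f: "f1 = tev [E x 1, E x 2] (B x)" "f2 = tev [E x 1, E x 3] (B x)" for x f1 f2
  proof -
    note e = E[OF x] and Gl = lorentz[OF x]
    note pf = null_frame_pairing[OF e lorentz_form_symmetric(2)[OF Gl]]
    define f where "f = (\<lambda>a b. tev [E x a, E x b] (B x))"
    have f0: "f 0 b = 0" "f b 0 = 0" for b unfolding f_def by (rule z(1,2)[OF x])+
    have f23: "f 2 2 = 0" "f 2 3 = 0" "f 3 2 = 0" "f 3 3 = 0" unfolding f_def by (rule z(4)[OF x]; simp)+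
    have f11: "f 1 1 = 0" unfolding f_def by (rule z(3)[OF x])
    define fv where "fv = (\<lambda>b. tev [v, E x b] (B x))"
    have fv: "fv b = (\<Sum>a\<in>UNIV. ip (g x) v (E x (st01 a)) * f a b)" for b
      unfolding fv_def f_def using tev_expand[OF e Gl, of "[]" v "[E x b]"] by (simp del: tev.simps)
    have fv0: "fv 0 = 0" "fv 2 = ip (g x) v (E x 0) * f 1 2" "fv 3 = ip (g x) v (E x 0) * f 1 3"
      unfolding fv sum_4' by (simp_all add: f0 f23)
    have Fe: "(\<Sum>i\<in>UNIV. E x a $ i * F x c i) = tev [axis c 1, E x a] (B x)" for c a
      unfolding F_def tev_axis unfolding tev.simps ..
    have Fe2: "(\<Sum>c\<in>UNIV. s $ c * (\<Sum>i\<in>UNIV. E x a $ i * F x c i)) = tev [s, E x a] (B x)" for s a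
      unfolding F_def by simp
    have Ge: "(\<Sum>j\<in>UNIV. E x a $ j * G x j) = fv a" for a
    proof -
      have "(\<Sum>j\<in>UNIV. E x a $ j * G x j) = (\<Sum>c\<in>UNIV. v $ c * (\<Sum>i\<in>UNIV. E x a $ i * F x c i))"
        unfolding G_def sum_distrib_left by (subst sum.swap) (simp add: mult_ac)
      then show ?thesis unfolding Fe2 fv_def .
    qed
    have wl: "wl x c = (\<Sum>a\<in>UNIV. (\<Sum>i\<in>UNIV. E x a $ i * F x c i) * fv (st01 a))" for c
      unfolding wl_def using pairing_frame_sum[OF pf, of "F x c" "G x"] by (simp add: Ge)
    have wlE: "(\<Sum>c\<in>UNIV. E x b $ c * wl x c) = (\<Sum>a\<in>UNIV. f b a * fv (st01 a))" for b
    proof -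
      have "(\<Sum>c\<in>UNIV. E x b $ c * wl x c) = (\<Sum>a\<in>UNIV. (\<Sum>c\<in>UNIV. E x b $ c * (\<Sum>i\<in>UNIV. E x a $ i * F x c i)) * fv (st01 a))"
        unfolding wl sum_distrib_left[of "E x b $ _"] sum_distrib_right[of _ _ "fv _"]
        by (subst sum.swap) (simp add: mult.assoc sum_distrib_right)
      then show ?thesis unfolding Fe2 f_def .
    qed
    define WL where "WL = (\<lambda>b. \<Sum>c\<in>UNIV. E x b $ c * wl x c)"
    have wlv: "WL 0 = 0" "WL 2 = 0" "WL 3 = 0" "WL 1 = ip (g x) v (E x 0) * (f 1 2 * f 1 2 + f 1 3 * f 1 3)"
      unfolding WL_def wlE sum_4' by (simp_all add: f0 f23 f11 fv0 algebra_simps)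
    have "w x $ k = (\<Sum>a\<in>UNIV. E x a $ k * WL (st01 a))" for k
    proof -
      have "w x $ k = (\<Sum>c\<in>UNIV. (\<Sum>a\<in>UNIV. E x a $ k * E x (st01 a) $ c) * wl x c)"
        unfolding w_def using pf by (simp add: pairing_frame_def)
      then show ?thesis unfolding WL_def sum_distrib_left sum_distrib_right by (subst sum.swap) (simp add: mult.assoc)
    qed
    then have "w x $ k = E x 0 $ k * (ip (g x) v (E x 0) * (f 1 2 * f 1 2 + f 1 3 * f 1 3))" for k
      unfolding sum_4' by (simp add: wlv)
    then show ?thesis unfolding f[unfolded f_def[symmetric]] vec_eq_iff by (simp add: f_def mult_ac)
  qed
  define V where "V = {x \<in> S. ip (g x) v (w x) \<noteq> 0}"
  have oV: "open V" unfolding V_def by (rule open_nonzero) (rule smooth_ip[OF ws])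
  have pV: "pt \<in> V"
  proof -
    have v1: "ip (g pt) v (E pt 0) = 1" unfolding v_def by (simp add: null_frame_ip[OF E[OF pS]])
    define q where "q = tev [E pt 1, E pt 2] (B pt) * tev [E pt 1, E pt 2] (B pt) + tev [E pt 1, E pt 3] (B pt) * tev [E pt 1, E pt 3] (B pt)"
    have "w pt = (1 * q) *\<^sub>R E pt 0"
      using main[OF pS refl refl] unfolding v1 q_def .
    moreover have "q \<noteq> 0" using nz unfolding q_def sum_squares_eq_zero_iff by blast
    moreover have "ip (g pt) v (q *\<^sub>R E pt 0) = q" for q
      using v1 by (simp add: ip_def matrix_vector_mult_scaleR)
    ultimately show ?thesis using pS unfolding V_def by simp
  qed
  have "\<exists>c. c \<noteq> 0 \<and> w x = c *\<^sub>R E x 0" if "x \<in> V" for x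
  proof -
    have "x \<in> S" "ip (g x) v (w x) \<noteq> 0" using that unfolding V_def by auto
    moreover obtain c where c: "w x = c *\<^sub>R E x 0" using main[OF \<open>x \<in> S\<close> refl refl] by blast
    ultimately have "c \<noteq> 0" by (auto simp: ip_def)
    then show ?thesis using c by blast
  qed
  moreover have "V \<subseteq> S" unfolding V_def by auto
  moreover have "smooth_on V (\<lambda>x. w x $ i)" for i by (rule smooth_on_subset[OF ws oV]) fact
  ultimately show ?thesis using that[OF oV pV] by blast
qed

text \<open>Fixing two slots of \<open>N\<close> by vectors with constant coordinates gives a smooth
  bivector, which is null with direction \<open>E x 0\<close> since the boost order is -2. Taking
  these vectors from the frame at \<open>pt\<close> makes it nonzero there.\<close>

lemma null_direction_field:
  assumes N: "\<And>I. smooth_on S (\<lambda>x. N x I)" and pS: "pt \<in> S"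
    and E: "\<And>x. x \<in> S \<Longrightarrow> null_frame (g x) (E x)"
    and W: "\<And>x. x \<in> S \<Longrightarrow> weyl_array (frame_array (E x) (N x))"
    and ord: "\<And>x. x \<in> S \<Longrightarrow> order_le (frame_array (E x) (N x)) (-2)"
    and nz: "frame_array (E pt) (N pt) 1 2 1 2 \<noteq> 0 \<or> frame_array (E pt) (N pt) 1 2 1 3 \<noteq> 0"
  obtains V w where "open V" "pt \<in> V" "V \<subseteq> S" "\<And>i. smooth_on V (\<lambda>x. w x $ i)"
    "\<And>x. x \<in> V \<Longrightarrow> \<exists>c. c \<noteq> 0 \<and> w x = c *\<^sub>R E x 0"
proof -
  define B where "B x = ctr (E pt 2) (ctr (E pt 1) (N x))" for x
  have t: "tev [a, b] (B x) = tev [E pt 1, E pt 2, a, b] (N x)" for a b x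
    unfolding B_def by (simp only: tev_ctr[of "E pt 1"] tev_ctr[of "E pt 2"])
  have sB: "smooth_on S (\<lambda>x. B x I)" for I
    unfolding B_def ctr_def by (intro smooth_on_sum smooth_on_mult smooth_on_const openS N)
  have Bz: "tev [E x a, E x b] (B x) = 0" if x: "x \<in> S" and ab: "a = 0 \<or> b = 0 \<or> a = b \<or> a \<in> {2,3} \<and> b \<in> {2,3}" for x a b
  proof -
    let ?A = "frame_array (E x) (N x)"
    note wA = weyl_array_comps[OF W[OF x]] and e = E[OF x] and G = lorentz[OF x]
    have "?A c d a b = 0" for c d
    proof (cases "c = d \<or> a = b")
      case True then show ?thesis using wA(12,13) by auto
    next
      case False then show ?thesis using ab by (intro order_leD[OF ord[OF x]]) (auto simp: bw1_def)
    qed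
    then have "tev [E x c, E x d, E x a, E x b] (N x) = 0" for c d unfolding frame_array_def .
    then have "tev [E x c, E pt 2, E x a, E x b] (N x) = 0" for c
      using tev_expand[OF e G, of "[E x c]" "E pt 2" "[E x a, E x b]"] by (simp del: tev.simps)
    then show ?thesis unfolding t using tev_expand[OF e G, of "[]" "E pt 1" "[E pt 2, E x a, E x b]"] by (simp del: tev.simps)
  qed
  show ?thesis
  proof (rule null_bivector_direction[OF sB pS E])
    show "tev [E x 0, E x b] (B x) = 0" "tev [E x b, E x 0] (B x) = 0" if "x \<in> S" for x b
      by (rule Bz[OF that], simp)+
    show "tev [E x 1, E x 1] (B x) = 0" if "x \<in> S" for x by (rule Bz[OF that]) simp
    show "tev [E x a, E x b] (B x) = 0" if "x \<in> S" "a \<in> {2,3}" "b \<in> {2,3}" for x a b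
      by (rule Bz[OF that(1)]) (use that in auto)
    show "tev [E pt 1, E pt 2] (B pt) \<noteq> 0 \<or> tev [E pt 1, E pt 3] (B pt) \<noteq> 0"
      unfolding t using nz unfolding frame_array_def .
  qed (use that in blast)+
qed

end

section \<open>Einstein metrics with vanishing Weyl invariants\<close>

locale einstein_vsi = chart_metric +
  fixes lam :: real
  assumes ric: "\<And>x a b. x \<in> S \<Longrightarrow> ricci g x $ a $ b = lam * g x $ a $ b"
    and inv: "\<And>f x. f \<in> polynomial_invariants g (weyl g) 4 2 \<Longrightarrow> x \<in> S \<Longrightarrow> f x = 0"
begin

abbreviation "Cw \<equiv> weyl g"
abbreviation "C1 \<equiv> nabla g (weyl g)"
abbreviation "C2 \<equiv> nabla g (nabla g (weyl g))"

lemma sC: "smooth_on S (\<lambda>x. Cw x I)" by (rule smooth_weyl)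
lemma sC1: "smooth_on S (\<lambda>x. C1 x I)" by (rule smooth_nabla[OF sC])

lemma wsC: "x \<in> S \<Longrightarrow> weyl_sym (h x) (\<lambda>a b c d. Cw x [a,b,c,d])"
  by (rule weyl_sym_weyl[OF ric])

lemma wsC1: "x \<in> S \<Longrightarrow> weyl_sym (h x) (\<lambda>a b c d. C1 x (e # [a,b,c,d]))"
  using weyl_sym_nabla[where T=Cw and r=0 and D="[]" and e=e and x=x, OF sC] wsC by simp

lemma wsC2: assumes x: "x \<in> S" shows "weyl_sym (h x) (\<lambda>a b c d. C2 x (f # [e] @ [a,b,c,d]))"
proof (rule weyl_sym_nabla[where r=1, OF sC1 _ x])
  show "weyl_sym (h y) (\<lambda>a b c d. C1 y (D @ [a,b,c,d]))" if y: "y \<in> S" and D: "length D = 1" for y D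
  proof -
    obtain e where "D = [e]" using D by (cases D) auto
    then show ?thesis using wsC1[OF y, of e] by simp
  qed
qed simp

lemma null_pairing: "x \<in> S \<Longrightarrow> null_frame (g x) e \<Longrightarrow> pairing_frame (h x) e (\<lambda>_. 1) st01"
  by (rule null_frame_pairing[OF _ lorentz_form_symmetric(2)[OF lorentz]])

text \<open>The derivative index is split off, so that each value, here and in \<open>Sa\<close>, is
  a Weyl array.\<close>

definition Pa :: "real^4 \<Rightarrow> (4 \<Rightarrow> real^4) \<Rightarrow> 4 \<Rightarrow> 4 \<Rightarrow> 4 \<Rightarrow> 4 \<Rightarrow> 4 \<Rightarrow> real" where
  "Pa x E e = frame_array E (ctr (E e) (C1 x))"

definition Sa :: "real^4 \<Rightarrow> (4 \<Rightarrow> real^4) \<Rightarrow> 4 \<Rightarrow> 4 \<Rightarrow> 4 \<Rightarrow> 4 \<Rightarrow> 4 \<Rightarrow> 4 \<Rightarrow> real" where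
  "Sa x E f e = frame_array E (ctr (E e) (ctr (E f) (C2 x)))"

lemma Pa_tev: "Pa x E e a b c d = tev [E e, E a, E b, E c, E d] (C1 x)"
  unfolding Pa_def frame_array_def by (simp only: tev_ctr[of "E e"])

lemma Sa_tev: "Sa x E f e a b c d = tev [E f, E e, E a, E b, E c, E d] (C2 x)"
  unfolding Sa_def frame_array_def by (simp only: tev_ctr[of "E e"] tev_ctr[of "E f"])

lemma weyl_Ca: "x \<in> S \<Longrightarrow> null_frame (g x) E \<Longrightarrow> weyl_array (frame_array E (Cw x))"
  by (rule weyl_array_frame[OF wsC null_pairing])

lemma weyl_Pa: "x \<in> S \<Longrightarrow> null_frame (g x) E \<Longrightarrow> weyl_array (Pa x E e)"
  unfolding Pa_def
  by (rule weyl_array_frame[OF weyl_sym_ctr[where D="[]", simplified] null_pairing]) (use wsC1 in \<open>simp_all del: nabla.simps\<close>)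

lemma weyl_Sa: assumes "x \<in> S" "null_frame (g x) E" shows "weyl_array (Sa x E f e)"
proof -
  have "weyl_sym (h x) (\<lambda>a b c d. ctr (E f) (C2 x) ([i] @ [a,b,c,d]))" for i
    by (rule weyl_sym_ctr) (rule wsC2[OF assms(1)])
  then have "weyl_sym (h x) (\<lambda>a b c d. ctr (E e) (ctr (E f) (C2 x)) ([] @ [a,b,c,d]))"
    by (intro weyl_sym_ctr) simp
  then show ?thesis unfolding Sa_def using weyl_array_frame[OF _ null_pairing[OF assms]] by simp
qed

lemma bianchi_Pa: "x \<in> S \<Longrightarrow> Pa x E e a b c d + Pa x E c a b d e + Pa x E d a b e c = 0"
  unfolding Pa_tev by (rule tev5_bianchi) (rule bianchi_weyl[OF ric])

lemma Dv_components:
  assumes "x \<in> S" "null_frame (g x) E"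
  shows "tev (us @ Dv X x u # vs) T = (\<Sum>k\<in>UNIV. ip (g x) (Dv X x u) (E (st01 k)) * tev (us @ E k # vs) T)"
  by (rule tev_expand[OF assms(2) lorentz[OF assms(1)]])

lemma quartic_Sa:
  assumes x: "x \<in> S" and E: "null_frame (g x) E"
  shows "(\<Sum>f\<in>UNIV. \<Sum>d\<in>UNIV. \<Sum>f'\<in>UNIV. \<Sum>d'\<in>UNIV.
       contr4 (Sa x E f d) (Sa x E f' d') * contr4 (Sa x E (st01 f) (st01 d)) (Sa x E (st01 f') (st01 d'))) = 0"
proof -
  have F: "frame_component (C2 x) E [f,d,a,b,c,k] = Sa x E f d a b c k" for f d a b c k
    unfolding frame_component_tev Sa_tev by simp
  show ?thesis
    unfolding contr4_def F[symmetric]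
    by (rule quartic_sum_2[where g=g and T=Cw and x=x and m=2 and S=S, OF _ x _ null_pairing[OF x E] refl])
      (rule inv, assumption+, simp)
qed

lemma quartic_Pa:
  assumes x: "x \<in> S" and E: "null_frame (g x) E"
  shows "(\<Sum>i\<in>UNIV. \<Sum>j\<in>UNIV. contr4 (Pa x E i) (Pa x E j) * contr4 (Pa x E (st01 i)) (Pa x E (st01 j))) = 0"
proof -
  have F: "frame_component (C1 x) E [d,a,b,c,k] = Pa x E d a b c k" for d a b c k
    unfolding frame_component_tev Pa_tev by simp
  show ?thesis
    unfolding contr4_def F[symmetric]
    by (rule quartic_sum_1[where g=g and T=Cw and x=x and m=2 and S=S, OF _ x _ null_pairing[OF x E] refl])
      (rule inv, assumption+, simp)
qed

text \<open>The inverse metrics are parallel, so the derivative of the squared norm falls on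
  \<open>X\<close> alone.\<close>

lemma partial_norm2:
  assumes x: "x \<in> S" and X: "\<And>I. smooth_on S (\<lambda>x. X x I)"
  shows "partial e (\<lambda>y. \<Sum>i\<in>UNIV. \<Sum>j\<in>UNIV. h y $ i $ j * (\<Sum>k\<in>UNIV. \<Sum>m\<in>UNIV. h y $ k $ m * (X y [i,k] * X y [j,m]))) x =
    (\<Sum>i\<in>UNIV. \<Sum>j\<in>UNIV. h x $ i $ j * (\<Sum>k\<in>UNIV. \<Sum>m\<in>UNIV. h x $ k $ m * (nabla g X x [e,i,k] * X x [j,m] + X x [i,k] * nabla g X x [e,j,m])))"
proof -
  have sX: "smooth_on S (\<lambda>y. X y I * X y J)" for I J by (intro smooth_on_mult openS X)
  have sU: "smooth_on S (\<lambda>y. \<Sum>k\<in>UNIV. \<Sum>m\<in>UNIV. h y $ k $ m * (X y [i,k] * X y [j,m]))" for i j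
    by (intro smooth_on_sum smooth_on_mult openS smooth_h X)
  have p: "partial e (\<lambda>y. X y I * X y J) x = partial e (\<lambda>y. X y I) x * X x J + X x I * partial e (\<lambda>y. X y J) x" for I J
    by (rule partial_mult) (rule sd[OF X x])+
  have pl: "(\<Sum>k\<in>UNIV. q k * (\<Sum>a\<in>UNIV. \<Sum>c\<in>UNIV. h x $ a $ c * F k a c)) = (\<Sum>a\<in>UNIV. \<Sum>c\<in>UNIV. h x $ a $ c * (\<Sum>k\<in>UNIV. q k * F k a c))"
    for q :: "4 \<Rightarrow> real" and F by (rule sum_pull[symmetric])
  show ?thesis
    unfolding partial_trace[OF x sU] partial_trace[OF x sX] p pl sum_subtractf[symmetric] right_diff_distrib[symmetric]
    by (intro sum.cong refl arg_cong2[where f="(*)"])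
      (simp add: algebra_simps sum_distrib_left)
qed

lemma frame_norm2:
  assumes H: "pairing_frame (h x) E (\<lambda>_. 1) st01"
  shows "(\<Sum>i\<in>UNIV. \<Sum>j\<in>UNIV. h x $ i $ j * (\<Sum>k\<in>UNIV. \<Sum>m\<in>UNIV. h x $ k $ m * (X [i,k] * Y [j,m]))) =
    (\<Sum>a\<in>UNIV. \<Sum>b\<in>UNIV. tev [E a, E b] X * tev [E (st01 a), E (st01 b)] Y)"
proof -
  have 1: "(\<Sum>k\<in>UNIV. \<Sum>m\<in>UNIV. h x $ k $ m * (X [i,k] * Y [j,m])) = 
     (\<Sum>b\<in>UNIV. tev [E b] (\<lambda>K. X (i # K)) * tev [E (st01 b)] (\<lambda>K. Y (j # K)))" for i j
    using pairing_frame_sum[OF H, of "\<lambda>k. X [i,k]" "\<lambda>m. Y [j,m]"] by simp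
  have "(\<Sum>i\<in>UNIV. \<Sum>j\<in>UNIV. h x $ i $ j * (\<Sum>b\<in>UNIV. 1 * (tev [E b] (\<lambda>K. X (i # K)) * tev [E (st01 b)] (\<lambda>K. Y (j # K))))) =
     (\<Sum>b\<in>UNIV. 1 * (\<Sum>i\<in>UNIV. \<Sum>j\<in>UNIV. h x $ i $ j * (tev [E b] (\<lambda>K. X (i # K)) * tev [E (st01 b)] (\<lambda>K. Y (j # K)))))"
    by (rule sum_pull)
  also have "\<dots> = (\<Sum>b\<in>UNIV. \<Sum>a\<in>UNIV. tev [E a, E b] X * tev [E (st01 a), E (st01 b)] Y)"
    unfolding pairing_frame_sum[OF H] by simp
  also have "\<dots> = (\<Sum>a\<in>UNIV. \<Sum>b\<in>UNIV. tev [E a, E b] X * tev [E (st01 a), E (st01 b)] Y)" by (rule sum.swap)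
  finally show ?thesis unfolding 1 by simp
qed

text \<open>The tidal tensor C(v, ., v, .) of a vector with constant coordinates. In type N its
  squared norm is (v.l)^4 times the sum of the squares of C_1i1j over transverse i, j: a smooth
  scalar that allows l to be normalised.\<close>

definition vC :: "real^4 \<Rightarrow> real^4 \<Rightarrow> tensor" where
  "vC v x J = (\<Sum>c\<in>UNIV. v $ c * ctr v (Cw x) (hd J # c # tl J))"

lemma vC_tev: "tev [a, b] (vC v x) = tev [v, a, v, b] (Cw x)"
proof -
  have "tev [a, v, b] U = (\<Sum>c\<in>UNIV. v $ c * tev [a, b] (\<lambda>J. U (hd J # c # tl J)))" for U
    by (simp add: sum_distrib_left) (subst sum.swap, simp add: mult_ac)
  from this[of "ctr v (Cw x)"] show ?thesis
    unfolding vC_def tev_sum tev_ctr[of v "[a, v, b]"] by (rule sym)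
qed

lemma smooth_vC: "smooth_on S (\<lambda>x. vC v x J)"
  unfolding vC_def ctr_def by (intro smooth_on_sum smooth_on_mult smooth_on_const openS sC)

definition vnorm :: "real^4 \<Rightarrow> real^4 \<Rightarrow> real" where
  "vnorm v x = (\<Sum>i\<in>UNIV. \<Sum>j\<in>UNIV. h x $ i $ j * (\<Sum>k\<in>UNIV. \<Sum>m\<in>UNIV. h x $ k $ m * (vC v x [i,k] * vC v x [j,m])))"

lemma smooth_vnorm: "smooth_on S (vnorm v)"
  unfolding vnorm_def[abs_def] by (intro smooth_on_sum smooth_on_mult openS smooth_h smooth_vC)

text \<open>At boost order -2, transverse second and fourth slots force the frame index 1 in the
  first and third, which gives the factors u.e_0 and v.e_0. The last branch is a tautology that
  makes this one equation for all \<open>a\<close> and \<open>b\<close>.\<close>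

lemma type_N_component:
  assumes x: "x \<in> S" and E: "null_frame (g x) E" and ord: "order_le (frame_array E (Cw x)) (-2)"
  shows "tev [u, E a, v, E b] (Cw x) = (if a \<in> {2,3} \<and> b \<in> {2,3} then ip (g x) u (E 0) * ip (g x) v (E 0) * frame_array E (Cw x) 1 a 1 b
      else if a = 0 \<or> b = 0 then 0 else tev [u, E a, v, E b] (Cw x))"
proof -
  let ?A = "frame_array E (Cw x)"
  note wA = weyl_array_comps[OF weyl_Ca[OF x E]] and z = order_leD[OF ord]
  note ex = tev_expand[OF E lorentz[OF x]]
  have e: "tev [u, E a, v, E b] (Cw x) = (\<Sum>c\<in>UNIV. ip (g x) u (E (st01 c)) * (\<Sum>d\<in>UNIV. ip (g x) v (E (st01 d)) * ?A c a d b))"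
    using ex[of "[]" u "[E a, v, E b]"] ex[of "[E _, E a]" v "[E b]"] unfolding frame_array_def by (simp del: tev.simps)
  have 1: "?A c a d b = 0" if "a = 0 \<or> b = 0" for c d
  proof (cases "c = 1 \<and> d = 1 \<and> (a = 1 \<or> b = 1)")
    case True then show ?thesis using that wA(12)[of 1 1 0] wA(13)[of 1 0 1] by auto
  next
    case False then show ?thesis using that by (intro z) (auto simp: bw1_def)
  qed
  show ?thesis
  proof (cases "a \<in> {2,3} \<and> b \<in> {2,3}")
    case True
    then have 2: "?A c a d b = 0" if "c \<noteq> 1 \<or> d \<noteq> 1" for c d
      using that by (intro z) (auto simp: bw1_def)
    have "tev [u, E a, v, E b] (Cw x) = ip (g x) u (E 0) * ip (g x) v (E 0) * ?A 1 a 1 b"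
      unfolding e sum_4' by (simp add: 2)
    then show ?thesis using True by simp
  next
    case F: False
    show ?thesis
    proof (cases "a = 0 \<or> b = 0")
      case True
      then have "tev [u, E a, v, E b] (Cw x) = 0" unfolding e by (simp add: 1)
      then show ?thesis using True by auto
    next
      case False then show ?thesis using F by (simp only: if_False)
    qed
  qed
qed

end

lemma tev_frame_0:
  assumes e: "null_frame G e" "lorentz_form G" and z: "\<And>b c d. frame_array e T 0 b c d = 0"
  shows "tev [e 0,v2,v3,v4] T = 0"
proof -
  note ex = tev_expand[OF e]
  have "tev [e 0, e b, e c, e d] T = 0" for b c d using z unfolding frame_array_def .
  then have "tev [e 0, e b, e c, v4] T = 0" for b c using ex[of "[e 0, e b, e c]" v4 "[]" T] by (simp del: tev.simps)
  then have "tev [e 0, e b, v3, v4] T = 0" for b using ex[of "[e 0, e b]" v3 "[v4]" T] by (simp del: tev.simps)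
  then show ?thesis using ex[of "[e 0]" v2 "[v3,v4]" T] by (simp del: tev.simps)
qed

lemma choice2: "\<forall>x y. \<exists>z. P x y z \<Longrightarrow> \<exists>F. \<forall>x y. P x y (F x y)"
  by metis

lemma length_3_cases: "length I = 3 \<Longrightarrow> \<exists>i j k. I = [i,j,k]"
  by (auto simp: numeral_3_eq_3 length_Suc_conv)

lemma ctr_tev3: "ctr u T [i,j,k] = tev [u, axis i 1, axis j 1, axis k 1] T"
  by (simp only: tev_ctr[of u] tev_axis) simp

lemma tev3_prod: "tev [b,c,d] (\<lambda>I. p (I!0) * (q (I!1) * r (I!2))) =
   (\<Sum>i\<in>UNIV. b $ i * p i) * ((\<Sum>i\<in>UNIV. c $ i * q i) * (\<Sum>i\<in>UNIV. d $ i * r i))"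
proof -
  have 1: "(\<Sum>k\<in>UNIV. d $ k * (P * (Q * r k))) = P * (Q * (\<Sum>k\<in>UNIV. d $ k * r k))" for P Q :: real
    by (simp add: sum_distrib_left mult_ac)
  have 2: "(\<Sum>k\<in>UNIV. c $ k * (P * (q k * R))) = P * ((\<Sum>k\<in>UNIV. c $ k * q k) * R)" for P R :: real
    by (simp add: sum_distrib_left sum_distrib_right mult_ac)
  have 3: "(\<Sum>k\<in>UNIV. b $ k * (p k * R)) = (\<Sum>k\<in>UNIV. b $ k * p k) * R" for R :: real
    by (simp add: sum_distrib_right mult.assoc)
  show ?thesis by (simp add: numeral_2_eq_2 1 2 3)
qed

context chart_metric
begin

lemma nabla_ctr1_tev:
  assumes x: "x \<in> S" and X: "\<And>i. smooth_on S (\<lambda>x. X x $ i)" and T: "\<And>I. smooth_on S (\<lambda>x. T x I)"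
  shows "tev (u # a # vs) (nabla g (\<lambda>y J. \<Sum>i\<in>UNIV. X y $ i * T y (hd J # i # tl J)) x) =
    tev (u # a # X x # vs) (nabla g T x) + tev (a # Dv X x u # vs) (T x)"
proof -
  let ?Q = "\<lambda>y J. \<Sum>i\<in>UNIV. X y $ i * T y (hd J # i # tl J)"
  have n: "nabla g ?Q x (e # k # I) = (\<Sum>i\<in>UNIV. X x $ i * nabla g T x (e # k # i # I)) + (\<Sum>i\<in>UNIV. vd X x i e * T x (k # i # I))" for e k I
    by (rule nabla_contract1[OF x X T])
  have "tev (u # a # vs) (nabla g ?Q x) = (\<Sum>e\<in>UNIV. u $ e * (\<Sum>k\<in>UNIV. a $ k * (tev (X x # vs) (\<lambda>I. nabla g T x (e # k # I)) + tev vs (\<lambda>I. \<Sum>i\<in>UNIV. vd X x i e * T x (k # i # I)))))"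
    unfolding tev.simps n tev_add tev_sum ..
  also have "\<dots> = tev (u # a # X x # vs) (nabla g T x) + (\<Sum>e\<in>UNIV. u $ e * (\<Sum>k\<in>UNIV. a $ k * tev vs (\<lambda>I. \<Sum>i\<in>UNIV. vd X x i e * T x (k # i # I))))"
    by (simp add: distrib_left sum.distrib del: nabla.simps)
  also have "(\<Sum>e\<in>UNIV. u $ e * (\<Sum>k\<in>UNIV. a $ k * tev vs (\<lambda>I. \<Sum>i\<in>UNIV. vd X x i e * T x (k # i # I)))) =
    (\<Sum>k\<in>UNIV. a $ k * (\<Sum>e\<in>UNIV. u $ e * tev vs (\<lambda>I. \<Sum>i\<in>UNIV. vd X x i e * T x (k # i # I))))"
    unfolding sum_distrib_left by (subst sum.swap) (simp add: mult_ac)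
  also have "\<dots> = tev (a # Dv X x u # vs) (T x)"
    unfolding tev_Dv[of u vs X x "\<lambda>I. T x (_ # I)"] by simp
  finally show ?thesis .
qed

lemma tev_nabla_low:
  assumes x: "x \<in> S" and X: "\<And>i. smooth_on S (\<lambda>x. X x $ i)"
  shows "tev [u, w] (nabla g (\<lambda>y I. low X y (I ! 0)) x) = ip (g x) w (Dv X x u)"
proof -
  have "tev [u, w] (nabla g (\<lambda>y I. low X y (I ! 0)) x) = (\<Sum>e\<in>UNIV. u $ e * (\<Sum>a\<in>UNIV. w $ a * (\<Sum>k\<in>UNIV. g x $ a $ k * vd X x k e)))"
    unfolding tev.simps nabla_low[OF x X] ..
  also have "\<dots> = (\<Sum>e\<in>UNIV. u $ e * (\<Sum>a\<in>UNIV. \<Sum>k\<in>UNIV. (w $ a * g x $ a $ k) * vd X x k e))"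
    by (simp add: sum_distrib_left mult.assoc)
  also have "\<dots> = (\<Sum>a\<in>UNIV. \<Sum>k\<in>UNIV. (w $ a * g x $ a $ k) * (\<Sum>e\<in>UNIV. u $ e * vd X x k e))"
    by (rule sum_pull[symmetric])
  finally show ?thesis unfolding ip_sum Dv_def by (simp add: mult.commute)
qed

text \<open>A vector with constant coordinates is in general not parallel, so its own covariant
  derivative contributes.\<close>

lemma partial_ip_const:
  assumes x: "x \<in> S" and X: "\<And>i. smooth_on S (\<lambda>x. X x $ i)"
  shows "(\<Sum>e\<in>UNIV. u $ e * partial e (\<lambda>y. ip (g y) v (X y)) x) = ip (g x) v (Dv X x u) + ip (g x) (Dv (\<lambda>_. v) x u) (X x)"
proof -
  have c: "smooth_on S (\<lambda>x. v $ i)" for i by (rule smooth_on_const)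
  have "tev [u, v] (nabla g (\<lambda>y I. low X y (I ! 0)) x) = 
     tev [u] (nabla g (\<lambda>y I. ip (g y) v (X y)) x) - tev [Dv (\<lambda>_. v) x u] (\<lambda>I. low X x (I ! 0))"
    by (rule nabla_ctr_tev[where X="\<lambda>_. v" and n=0, OF x c smooth_low[OF X]]) (simp_all add: ctr_def ip_low)
  moreover have "tev [u] (nabla g (\<lambda>y I. ip (g y) v (X y)) x) = (\<Sum>e\<in>UNIV. u $ e * partial e (\<lambda>y. ip (g y) v (X y)) x)" by simp
  moreover have "tev [Dv (\<lambda>_. v) x u] (\<lambda>I. low X x (I ! 0)) = ip (g x) (Dv (\<lambda>_. v) x u) (X x)" by (simp add: ip_low)
  ultimately show ?thesis unfolding tev_nabla_low[OF x X] by simp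
qed

end

section \<open>Type N: the normalised null field is Kundt\<close>

context einstein_vsi
begin

text \<open>\<open>norm\<close> says that the squares of the components C_1i1j, with i and j
  transverse, add up to 1. Since \<open>C\<close> is parallel along l once expansion and twist
  vanish, this fixes the scale of l along its integral curves and forces \<open>L x 0 0\<close> =
  0.\<close>

lemma type_N_kundt:
  assumes l: "\<And>i. smooth_on S (\<lambda>x. l x $ i)"
    and E: "\<And>x. x \<in> S \<Longrightarrow> null_frame (g x) (E x)" "\<And>x. x \<in> S \<Longrightarrow> E x 0 = l x"
    and ord: "\<And>x. x \<in> S \<Longrightarrow> order_le (frame_array (E x) (Cw x)) (-2)"
    and nz: "\<And>x. x \<in> S \<Longrightarrow> frame_array (E x) (Cw x) 1 2 1 2 \<noteq> 0 \<or> frame_array (E x) (Cw x) 1 2 1 3 \<noteq> 0"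
    and vl: "\<And>x. x \<in> S \<Longrightarrow> ip (g x) v (l x) \<noteq> 0"
    and norm: "\<And>x. x \<in> S \<Longrightarrow> vnorm v x = ip (g x) v (l x) ^ 4"
    and x: "x \<in> S"
  shows "kundt_vector g l x"
proof -
  define L where "L = (\<lambda>x k b. ip (g x) (Dv l x (E x b)) (E x (st01 k)))"
  have null: "ip (g y) (l y) (l y) = 0" if "y \<in> S" for y
    using null_frame_ip[OF E(1)[OF that], of 0 0] E(2)[OF that] by simp
  have A0: "frame_array (E y) (Cw y) 0 b c d = 0" if y: "y \<in> S" for y b c d
  proof (cases "b = 1 \<and> c = 1 \<and> d = 1")
    case True then show ?thesis using weyl_array_comps(13)[OF weyl_Ca[OF y E(1)[OF y]]] by simp
  next
    case False then show ?thesis by (intro order_leD[OF ord[OF y]]) (auto simp: bw1_def)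
  qed
  have tl: "tev [l y, a, b, c] (Cw y) = 0" if y: "y \<in> S" for y a b c
    using tev_frame_0[OF E(1)[OF y] lorentz[OF y] A0[OF y]] E(2)[OF y] by simp
  have cl: "ctr (l y) (Cw y) I = 0" if "y \<in> S" "length I = 3" for y I
    using length_3_cases[OF that(2)] tl[OF that(1)] ctr_tev3 by metis
  have D1: "tev (u # l y # [a,b,c]) (C1 y) = - tev (Dv l y u # [a,b,c]) (Cw y)" if y: "y \<in> S" for u y a b c
    by (rule nabla_ctr_tev_0[where T=Cw and n=3 and X=l, OF y l sC cl]) simp_all
  have pt: "type_N_point (frame_array (E y) (Cw y)) (Pa y (E y)) (L y)" if y: "y \<in> S" for y
  proof
    show "weyl_array (frame_array (E y) (Cw y))" by (rule weyl_Ca[OF y E(1)[OF y]])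
    show "frame_array (E y) (Cw y) 0 b c d = 0" for b c d by (rule A0[OF y])
    show "frame_array (E y) (Cw y) 1 2 1 2 \<noteq> 0 \<or> frame_array (E y) (Cw y) 1 2 1 3 \<noteq> 0" by (rule nz[OF y])
    show "weyl_array (Pa y (E y) e)" for e by (rule weyl_Pa[OF y E(1)[OF y]])
    show "Pa y (E y) e 0 b c d = - (\<Sum>k\<in>UNIV. L y k e * frame_array (E y) (Cw y) k b c d)" for e b c d
      unfolding Pa_tev E(2)[OF y] D1[OF y] L_def frame_array_def
      using Dv_components[OF y E(1)[OF y], where us="[]"] by (simp only: append.simps)
    show "Pa y (E y) e a b c d + Pa y (E y) c a b d e + Pa y (E y) d a b e c = 0" for e a b c d by (rule bianchi_Pa[OF y])
    show "L y 1 e = 0" for e unfolding L_def using Dv_null[OF y l null] E(2)[OF y] by simp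
  qed
  have Dl: "Dv l y (l y) = L y 0 0 *\<^sub>R l y" if y: "y \<in> S" for y
  proof -
    interpret type_N_point "frame_array (E y) (Cw y)" "Pa y (E y)" "L y" by (rule pt[OF y])
    have "Dv l y (E y 0) = (\<Sum>k\<in>UNIV. L y k 0 *\<^sub>R E y k)"
      unfolding L_def by (rule null_frame_expand[OF E(1)[OF y] lorentz[OF y]])
    then show ?thesis unfolding UNIV_4' using kappa L1 E(2)[OF y] by simp
  qed
  have tll: "tev [l y, l y, a, b, c] (C1 y) = 0" if y: "y \<in> S" for y a b c
  proof -
    have "tev [q *\<^sub>R l y, a, b, c] (Cw y) = q * tev [l y, a, b, c] (Cw y)" for q by (simp add: sum_distrib_left mult_ac)
    then show ?thesis unfolding D1[OF y] Dl[OF y] using tl[OF y] by simp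
  qed
  let ?e = "E x"
  note ex = E(1)[OF x] and e0 = E(2)[OF x]
  interpret type_N_point "frame_array (E x) (Cw x)" "Pa x (E x)" "L x" by (rule pt[OF x])
  have "\<forall>f e. \<exists>U. \<forall>b c d. Sa x ?e f e 0 b c d = - (\<Sum>k\<in>UNIV. L x k f * Pa x ?e e k b c d) - (\<Sum>k\<in>UNIV. L x k e * Pa x ?e f k b c d)
      - (\<Sum>k\<in>UNIV. U k * frame_array ?e (Cw x) k b c d)"
  proof (intro allI)
    fix f e
    obtain U where U: "\<And>vs. length vs = 3 \<Longrightarrow> tev (?e f # ?e e # l x # vs) (C2 x) = 
     - tev (?e e # Dv l x (?e f) # vs) (C1 x) - tev (?e f # Dv l x (?e e) # vs) (C1 x) - tev (U # vs) (Cw x)"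
      by (rule second_ctr[where T=Cw and n=3 and X=l and u="?e f" and v="?e e", OF x l sC cl], assumption, assumption, rule that) blast
    show "\<exists>U. \<forall>b c d. Sa x ?e f e 0 b c d = - (\<Sum>k\<in>UNIV. L x k f * Pa x ?e e k b c d) - (\<Sum>k\<in>UNIV. L x k e * Pa x ?e f k b c d)
      - (\<Sum>k\<in>UNIV. U k * frame_array ?e (Cw x) k b c d)"
    proof (intro exI allI)
      fix b c d
      have "Sa x ?e f e 0 b c d = - tev [?e e, Dv l x (?e f), ?e b, ?e c, ?e d] (C1 x) - tev [?e f, Dv l x (?e e), ?e b, ?e c, ?e d] (C1 x)
          - tev [U, ?e b, ?e c, ?e d] (Cw x)"
        unfolding Sa_tev e0 by (rule U) simp
      also have "tev [U, ?e b, ?e c, ?e d] (Cw x) = (\<Sum>k\<in>UNIV. ip (g x) U (?e (st01 k)) * frame_array ?e (Cw x) k b c d)"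
        unfolding frame_array_def using tev_expand[OF ex lorentz[OF x], of "[]" U] by (simp only: append.simps)
      also have "tev [?e e, Dv l x (?e f), ?e b, ?e c, ?e d] (C1 x) = (\<Sum>k\<in>UNIV. L x k f * Pa x ?e e k b c d)"
        unfolding Pa_tev L_def using Dv_components[OF x ex, of "[?e e]"] by (simp only: append.simps)
      also have "tev [?e f, Dv l x (?e e), ?e b, ?e c, ?e d] (C1 x) = (\<Sum>k\<in>UNIV. L x k e * Pa x ?e f k b c d)"
        unfolding Pa_tev L_def using Dv_components[OF x ex, of "[?e f]"] by (simp only: append.simps)
      finally show "Sa x ?e f e 0 b c d = - (\<Sum>k\<in>UNIV. L x k f * Pa x ?e e k b c d) - (\<Sum>k\<in>UNIV. L x k e * Pa x ?e f k b c d)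
        - (\<Sum>k\<in>UNIV. ip (g x) U (?e (st01 k)) * frame_array ?e (Cw x) k b c d)" .
    qed
  qed
  then have "\<exists>U. \<forall>f e b c d. Sa x ?e f e 0 b c d = - (\<Sum>k\<in>UNIV. L x k f * Pa x ?e e k b c d) - (\<Sum>k\<in>UNIV. L x k e * Pa x ?e f k b c d)
      - (\<Sum>k\<in>UNIV. U f e k * frame_array ?e (Cw x) k b c d)"
    by (rule choice2)
  then obtain U where U: "Sa x ?e f e 0 b c d = - (\<Sum>k\<in>UNIV. L x k f * Pa x ?e e k b c d) - (\<Sum>k\<in>UNIV. L x k e * Pa x ?e f k b c d)
      - (\<Sum>k\<in>UNIV. U f e k * frame_array ?e (Cw x) k b c d)" for f e b c d by blast
  \<comment> \<open>R is the derivative of \<open>C\<close> along l. As l is geodesic, R(l, ., ., .)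
    = 0 (\<open>R0\<close>), and differentiating this gives \<open>S00\<close>.\<close>
  define R where "R = (\<lambda>y. ctr (l y) (C1 y))"
  have sR: "smooth_on S (\<lambda>y. R y I)" for I unfolding R_def ctr_def
    by (intro smooth_on_sum smooth_on_mult openS l sC1)
  have R0: "ctr (l y) (R y) I = 0" if y: "y \<in> S" and I: "length I = 3" for y I
  proof -
    obtain i j k where "I = [i,j,k]" using length_3_cases[OF I] by blast
    then show ?thesis using tll[OF y, of "axis i 1" "axis j 1" "axis k 1"]
      by (simp only: ctr_tev3 R_def tev_ctr[of "l y"])
  qed
  have S00: "Sa x ?e f 0 0 b c d = - (\<Sum>k\<in>UNIV. L x k f * Pa x ?e k 0 b c d) - (\<Sum>k\<in>UNIV. L x k f * Pa x ?e 0 k b c d)" for f b c d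
  proof -
    have "Sa x ?e f 0 0 b c d = tev (?e f # l x # [l x, ?e b, ?e c, ?e d]) (C2 x)" unfolding Sa_tev e0 ..
    also have "\<dots> = tev (?e f # [l x, ?e b, ?e c, ?e d]) (nabla g R x) - tev (Dv l x (?e f) # [l x, ?e b, ?e c, ?e d]) (C1 x)"
      by (rule nabla_ctr_tev[where n=4, OF x l sC1]) (simp_all add: R_def)
    also have "tev (?e f # l x # [?e b, ?e c, ?e d]) (nabla g R x) = - tev (Dv l x (?e f) # [?e b, ?e c, ?e d]) (R x)"
      by (rule nabla_ctr_tev_0[where n=3, OF x l sR R0]) simp_all
    also have "tev [Dv l x (?e f), ?e b, ?e c, ?e d] (R x) = tev ([l x] @ Dv l x (?e f) # [?e b, ?e c, ?e d]) (C1 x)"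
      unfolding R_def by (simp only: tev_ctr[of "l x"] append.simps)
    also have "\<dots> = (\<Sum>k\<in>UNIV. L x k f * Pa x ?e 0 k b c d)"
      unfolding Pa_tev L_def Dv_components[OF x ex] by (simp only: append.simps e0)
    also have "tev (Dv l x (?e f) # [l x, ?e b, ?e c, ?e d]) (C1 x) = (\<Sum>k\<in>UNIV. L x k f * Pa x ?e k 0 b c d)"
      unfolding Pa_tev L_def using Dv_components[OF x ex, of "[]"] by (simp only: append.simps e0)
    finally show ?thesis by simp
  qed
  note exp = type_N_expansion[OF pt[OF x] weyl_Sa[OF x ex] U S00 quartic_Sa[OF x ex]]
  have lC1: "tev [l x, a, b, c, d] (C1 x) = 0" for a b c d
  proof -
    have "tev [a, b, c, d] (ctr (l x) (C1 x)) = 0"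
      by (rule tensor_zero_of_frame[OF ex lorentz[OF x]]) (use P_0_vanish[OF exp] in \<open>simp only: Pa_def e0\<close>)
    then show ?thesis by (simp only: tev_ctr[of "l x"])
  qed
  \<comment> \<open>The covariant derivative of the constant vector \<open>v\<close> along l; it
    occurs in the derivatives of both sides of \<open>norm\<close>.\<close>
  define w where "w = Dv (\<lambda>_. v) x (l x)"
  define Y where "Y = ctr (l x) (nabla g (vC v) x)"
  have c: "smooth_on S (\<lambda>x. v $ i)" for i by (rule smooth_on_const)
  have scv: "smooth_on S (\<lambda>y. ctr v (Cw y) I)" for I unfolding ctr_def
    by (intro smooth_on_sum smooth_on_mult smooth_on_const openS sC)
  have Yt: "tev [a, b] Y = tev [w, a, v, b] (Cw x) + tev [v, a, w, b] (Cw x)" for a b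
  proof -
    have "tev [a, b] Y = tev (l x # a # [b]) (nabla g (vC v) x)" unfolding Y_def by (simp only: tev_ctr[of "l x"])
    also have "\<dots> = tev (l x # a # v # [b]) (nabla g (\<lambda>y. ctr v (Cw y)) x) + tev (a # w # [b]) (ctr v (Cw x))"
      unfolding vC_def[abs_def] w_def by (rule nabla_ctr1_tev[OF x c scv])
    also have "tev (a # w # [b]) (ctr v (Cw x)) = tev [v, a, w, b] (Cw x)" by (simp only: tev_ctr[of v])
    also have "tev (l x # [a, v, b]) (nabla g (\<lambda>y. ctr v (Cw y)) x) = tev (l x # v # [a, v, b]) (C1 x) + tev (w # [a, v, b]) (Cw x)"
      using nabla_ctr_tev[where T=Cw and X="\<lambda>_. v" and K="\<lambda>y. ctr v (Cw y)" and n=3 and vs="[a,v,b]" and u="l x", OF x c sC] 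
      unfolding w_def by (simp del: nabla.simps tev.simps)
    finally show ?thesis unfolding lC1 by simp
  qed
  define N where "N X Y = (\<Sum>i\<in>UNIV. \<Sum>j\<in>UNIV. h x $ i $ j * (\<Sum>k\<in>UNIV. \<Sum>m\<in>UNIV. h x $ k $ m * (X [i,k] * Y [j,m] :: real)))" for X Y
  have pn: "(\<Sum>e\<in>UNIV. l x $ e * partial e (vnorm v) x) = N Y (vC v x) + N (vC v x) Y"
  proof -
    have p: "partial e (vnorm v) x = (\<Sum>i\<in>UNIV. \<Sum>j\<in>UNIV. h x $ i $ j * (\<Sum>k\<in>UNIV. \<Sum>m\<in>UNIV. h x $ k $ m * 
         (nabla g (vC v) x [e,i,k] * vC v x [j,m] + vC v x [i,k] * nabla g (vC v) x [e,j,m])))" for e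
      unfolding vnorm_def[abs_def] by (rule partial_norm2[OF x smooth_vC])
    have "(\<Sum>e\<in>UNIV. l x $ e * partial e (vnorm v) x) = (\<Sum>i\<in>UNIV. \<Sum>j\<in>UNIV. h x $ i $ j * (\<Sum>k\<in>UNIV. \<Sum>m\<in>UNIV. h x $ k $ m * 
       (\<Sum>e\<in>UNIV. l x $ e * (nabla g (vC v) x [e,i,k] * vC v x [j,m] + vC v x [i,k] * nabla g (vC v) x [e,j,m]))))"
      unfolding p
      by (rule trans[OF sum_pull[symmetric]]) (intro sum.cong refl arg_cong2[where f="(*)"] sum_pull[symmetric])
    also have "(\<lambda>i j k m. \<Sum>e\<in>UNIV. l x $ e * (nabla g (vC v) x [e,i,k] * vC v x [j,m] + vC v x [i,k] * nabla g (vC v) x [e,j,m])) =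
       (\<lambda>i j k m. Y [i,k] * vC v x [j,m] + vC v x [i,k] * Y [j,m])"
      unfolding Y_def ctr_def by (simp add: sum.distrib sum_distrib_left sum_distrib_right distrib_left mult_ac del: nabla.simps)
    finally show ?thesis unfolding N_def by (simp add: distrib_left sum.distrib)
  qed
  define A where "A = frame_array ?e (Cw x)"
  define q where "q = A 1 2 1 2 * A 1 2 1 2 + A 1 2 1 3 * A 1 2 1 3 + A 1 3 1 2 * A 1 3 1 2 + A 1 3 1 3 * A 1 3 1 3"
  let ?v = "ip (g x) v (l x)" and ?w = "ip (g x) w (l x)"
  note tc = type_N_component[OF x ex ord[OF x], unfolded e0, folded A_def]
  note fn = frame_norm2[OF null_pairing[OF x ex], folded N_def]
  have 0: "tev [u, ?e 0, u', a] (Cw x) = 0" "tev [u, a, u', ?e 0] (Cw x) = 0" if "a \<in> range ?e" for u u' a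
    using tc[of u 0 u'] tc[of u _ u' 0] that by (auto simp del: tev.simps)
  have ii: "tev [u, ?e i, u', ?e j] (Cw x) = ip (g x) u (l x) * ip (g x) u' (l x) * A 1 i 1 j" if "i \<in> {2,3}" "j \<in> {2,3}" for i j u u'
    using tc[of u i u' j] that by (simp del: tev.simps)
  have Nq: "vnorm v x = ?v ^ 4 * q" 
  proof -
    have "vnorm v x = N (vC v x) (vC v x)" unfolding N_def vnorm_def ..
    then show ?thesis unfolding fn vC_tev sum_4' q_def
      by (simp add: 0 ii st01_def power4_eq_xxxx algebra_simps del: tev.simps)
  qed
  have Nd: "N Y (vC v x) + N (vC v x) Y = 4 * (?w * ?v ^ 3 * q)"
    unfolding fn vC_tev Yt sum_4' q_def by (simp add: 0 ii st01_def power3_eq_cube algebra_simps del: tev.simps)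
  have "?v \<noteq> 0" by (rule vl[OF x])
  then have q1: "q = 1" using Nq norm[OF x] by simp
  have "partial e (vnorm v) x = partial e (\<lambda>y. (ip (g y) v (l y) * ip (g y) v (l y)) * (ip (g y) v (l y) * ip (g y) v (l y))) x" for e
    by (rule partial_cong[OF openS x]) (simp add: norm power4_eq_xxxx mult_ac)
  then have pv: "partial e (vnorm v) x = 4 * ?v ^ 3 * partial e (\<lambda>y. ip (g y) v (l y)) x" for e
    by (simp add: partial_mult sd[OF smooth_ip[OF l] x] differentiable_mult power3_eq_cube algebra_simps)
  have "(\<Sum>e\<in>UNIV. l x $ e * partial e (vnorm v) x) = 4 * ?v ^ 3 * (\<Sum>e\<in>UNIV. l x $ e * partial e (\<lambda>y. ip (g y) v (l y)) x)"
    unfolding pv sum_distrib_left by (intro sum.cong refl) (simp add: mult_ac)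
  also have "\<dots> = 4 * ?v ^ 3 * (L x 0 0 * ?v + ?w)"
    unfolding partial_ip_const[OF x l] Dl[OF x] w_def by (simp add: ip_def matrix_vector_mult_scaleR)
  \<comment> \<open>Both sides are the derivative of \<open>vnorm v\<close> along l, computed on the
    left from the parallel transport of \<open>C\<close> and on the right from \<open>norm\<close>.
    The terms with \<open>?w\<close> cancel and leave \<open>L x 0 0\<close>.\<close>
  finally have "4 * (?w * ?v ^ 3) = 4 * ?v ^ 3 * (L x 0 0 * ?v + ?w)" unfolding pn Nd q1 by simp
  then have "4 * ?v ^ 3 * ?v * L x 0 0 = 0" by (simp add: algebra_simps)
  then have L00: "L x 0 0 = 0" using \<open>?v \<noteq> 0\<close> by simp
  show ?thesis
  proof (rule kundt_vector_frame[OF x l ex e0])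
    note LL = L00 L1 kappa exp shear
    have "\<forall>k. L x k 0 = 0" unfolding forall_4' using LL by simp
    then show "ip (g x) (Dv l x (?e 0)) (?e (st01 k)) = 0" for k unfolding L_def by blast
  qed (use L1 exp shear in \<open>simp_all add: L_def\<close>)
qed

end

section \<open>Type III: the covector mu, and the Kundt property\<close>

context chart_metric
begin

text \<open>The Leibniz rule for l_b (l_c mu_d - l_d mu_c), where \<open>p\<close> is l and
  \<open>q\<close> is mu.\<close>

lemma nabla_product3:
  assumes x: "x \<in> S" and s: "\<And>i. smooth_on S (\<lambda>y. p y i)" "\<And>i. smooth_on S (\<lambda>y. q y i)"
  shows "nabla g (\<lambda>y I. p y (I!0) * (p y (I!1) * q y (I!2) - p y (I!2) * q y (I!1))) x [e,b,c,d] =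
    nabla g (\<lambda>y I. p y (I!0)) x [e,b] * (p x c * q x d - p x d * q x c)
    + p x b * (nabla g (\<lambda>y I. p y (I!0)) x [e,c] * q x d + p x c * nabla g (\<lambda>y I. q y (I!0)) x [e,d]
      - nabla g (\<lambda>y I. p y (I!0)) x [e,d] * q x c - p x d * nabla g (\<lambda>y I. q y (I!0)) x [e,c])"
proof -
  have "partial e (\<lambda>y. p y b * (p y c * q y d - p y d * q y c)) x =
    partial e (\<lambda>y. p y b) x * (p x c * q x d - p x d * q x c) 
    + p x b * (partial e (\<lambda>y. p y c) x * q x d + p x c * partial e (\<lambda>y. q y d) x
      - (partial e (\<lambda>y. p y d) x * q x c + p x d * partial e (\<lambda>y. q y c) x))"
    by (simp add: partial_diff partial_mult sd[OF _ x] smooth_on_mult smooth_on_diff openS s)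
  then show ?thesis
    by (simp add: numeral_2_eq_2 algebra_simps sum.distrib sum_subtractf sum_distrib_left)
qed

lemma tev_nabla_product3:
  fixes u :: "real^4"
  assumes x: "x \<in> S" and s: "\<And>i. smooth_on S (\<lambda>y. p y i)" "\<And>i. smooth_on S (\<lambda>y. q y i)"
  defines "P \<equiv> (\<lambda>b. \<Sum>i\<in>UNIV. b $ i * p x i)" and "Q \<equiv> (\<lambda>b. \<Sum>i\<in>UNIV. b $ i * q x i)"
    and "dP \<equiv> (\<lambda>b. tev [u, b] (nabla g (\<lambda>y I. p y (I!0)) x))" and "dQ \<equiv> (\<lambda>b. tev [u, b] (nabla g (\<lambda>y I. q y (I!0)) x))"
  shows "tev [u,b,c,d] (nabla g (\<lambda>y I. p y (I!0) * (p y (I!1) * q y (I!2) - p y (I!2) * q y (I!1))) x) =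
    dP b * (P c * Q d - P d * Q c) + P b * (dP c * Q d + P c * dQ d - dP d * Q c - P d * dQ c)"
proof -
  define np where "np = (\<lambda>i. ctr u (nabla g (\<lambda>y I. p y (I!0)) x) [i])"
  define nq where "nq = (\<lambda>i. ctr u (nabla g (\<lambda>y I. q y (I!0)) x) [i])"
  define K where "K = nabla g (\<lambda>y I. p y (I!0) * (p y (I!1) * q y (I!2) - p y (I!2) * q y (I!1))) x"
  have nP: "dP b = (\<Sum>i\<in>UNIV. b $ i * np i)" "dQ b = (\<Sum>i\<in>UNIV. b $ i * nq i)" for b
    unfolding dP_def dQ_def np_def nq_def tev_ctr[of u] unfolding tev.simps by (rule refl)+
  have K: "ctr u K I = np (I!0) * (p x (I!1) * q x (I!2)) - np (I!0) * (q x (I!1) * p x (I!2))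
      + p x (I!0) * (np (I!1) * q x (I!2)) + p x (I!0) * (p x (I!1) * nq (I!2))
      - p x (I!0) * (q x (I!1) * np (I!2)) - p x (I!0) * (nq (I!1) * p x (I!2))" if I: "length I = 3" for I
  proof -
    obtain i j k where I: "I = [i,j,k]" using length_3_cases[OF I] by blast
    show ?thesis unfolding I K_def np_def nq_def ctr_def nabla_product3[where p=p and q=q, OF x s]
      by (simp add: numeral_2_eq_2 algebra_simps sum.distrib sum_subtractf sum_distrib_left del: nabla.simps)
  qed
  have "tev [u,b,c,d] K = tev [b,c,d] (ctr u K)" by (simp only: tev_ctr[of u])
  also have "\<dots> = tev [b,c,d] (\<lambda>I. np (I!0) * (p x (I!1) * q x (I!2)) - np (I!0) * (q x (I!1) * p x (I!2))
      + p x (I!0) * (np (I!1) * q x (I!2)) + p x (I!0) * (p x (I!1) * nq (I!2))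
      - p x (I!0) * (q x (I!1) * np (I!2)) - p x (I!0) * (nq (I!1) * p x (I!2)))"
    by (rule tev_cong) (simp add: K)
  finally show ?thesis unfolding K_def[symmetric]
    unfolding tev_diff tev_add tev3_prod nP P_def Q_def by (simp add: algebra_simps)
qed

end

context einstein_vsi
begin

text \<open>Setting b = c = z in C(l, b, c, d) = l_b (l_c mu_d - l_d mu_c) and dividing by (z.l)^2
  yields the representative of mu modulo l with mu(z) = 0. It involves no frame and is therefore
  smooth.\<close>

definition muC :: "real^4 \<Rightarrow> (real^4 \<Rightarrow> real^4) \<Rightarrow> real^4 \<Rightarrow> 4 \<Rightarrow> real" where
  "muC z l x d = tev [l x, z, z, axis d 1] (Cw x) / (ip (g x) z (l x))\<^sup>2"

lemma smooth_muC:
  assumes l: "\<And>i. smooth_on S (\<lambda>x. l x $ i)" and zl: "\<And>x. x \<in> S \<Longrightarrow> ip (g x) z (l x) \<noteq> 0"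
  shows "smooth_on S (\<lambda>x. muC z l x d)"
proof -
  have "smooth_on S (\<lambda>x. ctr (l x) (Cw x) I)" for I unfolding ctr_def by (intro smooth_on_sum smooth_on_mult openS l sC)
  then have "smooth_on S (\<lambda>x. tev [z, z, axis d 1] (ctr (l x) (Cw x)))" by (rule smooth_tev)
  then show ?thesis unfolding muC_def power2_eq_square tev_ctr[of "l _"]
    by (intro smooth_on_divide smooth_on_mult openS smooth_ip[OF l]) (use zl in auto)
qed

lemma muC_tev: "(\<Sum>d\<in>UNIV. b $ d * muC z l x d) = tev [l x, z, z, b] (Cw x) / (ip (g x) z (l x))\<^sup>2"
proof -
  have "tev [l x, z, z, b] (Cw x) = (\<Sum>d\<in>UNIV. b $ d * tev [l x, z, z, axis d 1] (Cw x))"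
    using tev_basis[of "[l x, z, z]" b "[]" "Cw x"] by (simp del: tev.simps)
  then show ?thesis unfolding muC_def by (simp add: sum_divide_distrib del: tev.simps)
qed

text \<open>For type III, contracting one slot of the Weyl tensor with the multiple null vector \<open>l\<close> leaves
  \<open>l\<^sub>b (l\<^sub>c \<mu>\<^sub>d - l\<^sub>d \<mu>\<^sub>c)\<close>; the covector \<open>\<mu>\<close> is determined up to a multiple of \<open>l\<close>, which is fixed by \<open>z\<close>.\<close>

lemma type_III_contraction:
  assumes x: "x \<in> S" and E: "null_frame (g x) E" "E 0 = l x"
    and ord: "order_le (frame_array E (Cw x)) (-1)" and zl: "ip (g x) z (l x) \<noteq> 0"
  defines "M \<equiv> (\<lambda>b. \<Sum>i\<in>UNIV. b $ i * muC z l x i)"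
  shows "tev [l x, b, c, d] (Cw x) = ip (g x) b (l x) * (ip (g x) c (l x) * M d - ip (g x) d (l x) * M c)"
    and "M (l x) = 0" "M (E 2) = frame_array E (Cw x) 0 1 1 2" "M (E 3) = frame_array E (Cw x) 0 1 1 3"
proof -
  let ?A = "frame_array E (Cw x)" and ?i = "ip (g x)"
  note wA = weyl_array_comps[OF weyl_Ca[OF x E(1)]] and z = order_leD[OF ord]
  note ex = tev_expand[OF E(1) lorentz[OF x]]
  define m where "m = (\<lambda>d. ?i d (E 2) * ?A 0 1 1 2 + ?i d (E 3) * ?A 0 1 1 3)"
  have A0: "?A 0 b c d = 0" if "b \<noteq> 1 \<or> c = 0 \<or> d = 0 \<or> (c \<noteq> 1 \<and> d \<noteq> 1)" for b c d
  proof (cases "c = 1 \<and> d = 1")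
    case True then show ?thesis using wA(13) by simp
  next
    case False then show ?thesis using that by (intro z) (auto simp: bw1_def)
  qed
  have A1: "?A 0 1 1 1 = 0" "?A 0 1 2 1 = - ?A 0 1 1 2" "?A 0 1 3 1 = - ?A 0 1 1 3"
    by (rule wA(13) wA(15))+
  have T: "tev [l x, b, c, d] (Cw x) = ?i b (l x) * (?i c (l x) * m d - ?i d (l x) * m c)" for b c d
  proof -
    have "tev [l x, b, c, d] (Cw x) = (\<Sum>b'\<in>UNIV. ?i b (E (st01 b')) * (\<Sum>c'\<in>UNIV. ?i c (E (st01 c')) * (\<Sum>d'\<in>UNIV. ?i d (E (st01 d')) * ?A 0 b' c' d')))"
      using ex[of "[E 0]" b "[c, d]"] ex[of "[E 0, E _]" c "[d]"] ex[of "[E 0, E _, E _]" d "[]"] unfolding frame_array_def E(2)[symmetric]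
      by (simp del: tev.simps)
    then show ?thesis unfolding sum_4' by (simp add: A0 A1 m_def st01_def E(2)[symmetric] algebra_simps)
  qed
  have M: "M d = (?i z (l x) * m d - ?i d (l x) * m z) / ?i z (l x)" for d
    unfolding M_def muC_tev T using zl by (simp add: field_simps power2_eq_square)
  show "tev [l x, b, c, d] (Cw x) = ?i b (l x) * (?i c (l x) * M d - ?i d (l x) * M c)"
    unfolding T M using zl by (simp add: field_simps)
  note ii = null_frame_ip[OF E(1)]
  show "M (l x) = 0" "M (E 2) = ?A 0 1 1 2" "M (E 3) = ?A 0 1 1 3"
    unfolding M m_def E(2)[symmetric] using zl by (simp_all add: ii st01_def E(2)[symmetric])
qed

text \<open>\<open>type_III_point\<close> yields all optical conditions except the affine
  parametrisation. For the latter, \<open>norm\<close> is differentiated along l, which gives the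
  hypothesis of \<open>affine\<close>.\<close>

lemma type_III_kundt:
  assumes l: "\<And>i. smooth_on S (\<lambda>x. l x $ i)"
    and E: "\<And>x. x \<in> S \<Longrightarrow> null_frame (g x) (E x)" "\<And>x. x \<in> S \<Longrightarrow> E x 0 = l x"
    and ord: "\<And>x. x \<in> S \<Longrightarrow> order_le (frame_array (E x) (Cw x)) (-1)"
    and nz: "\<And>x. x \<in> S \<Longrightarrow> frame_array (E x) (Cw x) 0 1 1 2 \<noteq> 0 \<or> frame_array (E x) (Cw x) 0 1 1 3 \<noteq> 0"
    and zl: "\<And>x. x \<in> S \<Longrightarrow> ip (g x) z (l x) \<noteq> 0"
    and norm: "\<And>x. x \<in> S \<Longrightarrow> (\<Sum>i\<in>UNIV. \<Sum>j\<in>UNIV. h x $ i $ j * (muC z l x i * muC z l x j)) = 1"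
    and x: "x \<in> S"
  shows "kundt_vector g l x"
proof -
  let ?e = "E x"
  note ex = E(1)[OF x] and e0 = E(2)[OF x]
  define L where "L = (\<lambda>k b. ip (g x) (Dv l x (?e b)) (?e (st01 k)))"
  define Mu where "Mu = (\<lambda>y I. muC z l y (I ! 0))"
  define M where "M y b = (\<Sum>i\<in>UNIV. b $ i * muC z l y i)" for y b
  define mu where "mu = (\<lambda>b. M x (?e b))"
  define nu where "nu = (\<lambda>b e. tev [?e e, ?e b] (nabla g Mu x))"
  define lo where "lo = (\<lambda>b. ip (g x) (?e b) (l x))"
  define K where "K = (\<lambda>y I. low l y (I!0) * (low l y (I!1) * muC z l y (I!2) - low l y (I!2) * muC z l y (I!1)))"
  have sm: "smooth_on S (\<lambda>y. muC z l y d)" for d by (rule smooth_muC[OF l zl])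
  note t3 = type_III_contraction[where l=l, OF _ E(1) E(2) ord zl, folded M_def]
  have null: "ip (g y) (l y) (l y) = 0" if "y \<in> S" for y
    using null_frame_ip[OF E(1)[OF that], of 0 0] E(2)[OF that] by simp
  have cK: "ctr (l y) (Cw y) I = K y I" if y: "y \<in> S" and I: "length I = 3" for y I
  proof -
    obtain i j k where I: "I = [i,j,k]" using length_3_cases[OF I] by blast
    have a: "(\<Sum>a\<in>UNIV. axis i 1 $ a * f a) = f i" for i :: 4 and f :: "4 \<Rightarrow> real"
      by (simp add: axis_def if_distrib[of "\<lambda>x. x * _"] cong: if_cong)
    show ?thesis unfolding I ctr_tev3 t3(1)[OF y y y y y] ip_low M_def a K_def by simp
  qed
  have lL: "ip (g x) (?e b) (Dv l x (?e e)) = L (st01 b) e" for b e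
    unfolding L_def by (simp add: ip_commute[OF lorentz[OF x]] st01_def)
  have C1: "tev [?e e, l x, ?e b, ?e c, ?e d] (C1 x) = - (\<Sum>k\<in>UNIV. L k e * frame_array ?e (Cw x) k b c d)
       + L (st01 b) e * (lo c * mu d - lo d * mu c) + lo b * (L (st01 c) e * mu d - L (st01 d) e * mu c)
       + lo b * (lo c * nu d e - lo d * nu c e)" for e b c d
  proof -
    have "tev (?e e # l x # [?e b, ?e c, ?e d]) (C1 x) = tev (?e e # [?e b, ?e c, ?e d]) (nabla g K x) - tev (Dv l x (?e e) # [?e b, ?e c, ?e d]) (Cw x)"
      by (rule nabla_ctr_tev[OF x l sC cK]) simp_all
    moreover have "tev [?e e, ?e b, ?e c, ?e d] (nabla g K x) = L (st01 b) e * (lo c * mu d - lo d * mu c)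
      + lo b * (L (st01 c) e * mu d + lo c * nu d e - L (st01 d) e * mu c - lo d * nu c e)"
      unfolding K_def tev_nabla_product3[where p="low l" and q="muC z l", OF x smooth_low[OF l] sm] tev_nabla_low[OF x l] lL ip_low[symmetric] M_def[symmetric]
      unfolding lo_def mu_def nu_def Mu_def ..
    moreover have "tev (Dv l x (?e e) # [?e b, ?e c, ?e d]) (Cw x) = (\<Sum>k\<in>UNIV. L k e * frame_array ?e (Cw x) k b c d)"
      unfolding frame_array_def L_def using Dv_components[OF x ex, where us="[]"] by (simp only: append.simps)
    ultimately show ?thesis by (simp add: algebra_simps)
  qed
  have Mt: "tev [b] (Mu y) = M y b" for b y unfolding Mu_def M_def by simp
  have mu23: "mu 0 = 0" "mu 2 = frame_array ?e (Cw x) 0 1 1 2" "mu 3 = frame_array ?e (Cw x) 0 1 1 3"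
    unfolding mu_def using t3(2-4)[OF x x x x x] e0 by simp_all
  interpret type_III_point "frame_array ?e (Cw x)" "Pa x ?e" L lo mu nu
  proof
    show "weyl_array (frame_array ?e (Cw x))" by (rule weyl_Ca[OF x ex])
    show "weyl_array (Pa x ?e e)" for e by (rule weyl_Pa[OF x ex])
    show "frame_array ?e (Cw x) 0 b c d = lo b * (lo c * mu d - lo d * mu c)" for b c d
      using t3(1)[OF x x x x x] unfolding frame_array_def e0 lo_def mu_def .
    show "lo b = (if b = 1 then 1 else 0)" for b
      unfolding lo_def e0[symmetric] null_frame_ip[OF ex] by (auto simp: st01_def split: if_splits)
    show "mu 0 = 0" by (rule mu23)
    show "mu 2 \<noteq> 0 \<or> mu 3 \<noteq> 0" unfolding mu23 by (rule nz[OF x])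
    show "Pa x ?e e 0 b c d = - (\<Sum>k\<in>UNIV. L k e * frame_array ?e (Cw x) k b c d)
       + L (st01 b) e * (lo c * mu d - lo d * mu c) + lo b * (L (st01 c) e * mu d - L (st01 d) e * mu c)
       + lo b * (lo c * nu d e - lo d * nu c e)" for e b c d
      unfolding Pa_tev e0 by (rule C1)
    show "nu 0 e = - (\<Sum>k\<in>UNIV. L k e * mu k)" for e
    proof -
      have "tev (?e e # l x # []) (nabla g Mu x) = - tev (Dv l x (?e e) # []) (Mu x)"
      proof (rule nabla_ctr_tev_0[where n=0, OF x l])
        show "ctr (l y) (Mu y) I = 0" if y: "y \<in> S" and I: "length I = 0" for y I
          using t3(2)[OF y y y y y] I unfolding ctr_def Mu_def M_def by simp
      qed (simp_all add: Mu_def sm)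
      also have "tev [Dv l x (?e e)] (Mu x) = (\<Sum>k\<in>UNIV. L k e * tev [?e k] (Mu x))"
        unfolding L_def using Dv_components[OF x ex, where us="[]" and vs="[]"] by (simp only: append.simps)
      finally show ?thesis unfolding nu_def mu_def e0 Mt .
    qed
    show "Pa x ?e e a b c d + Pa x ?e c a b d e + Pa x ?e d a b e c = 0" for e a b c d by (rule bianchi_Pa[OF x])
    show "L 1 e = 0" for e unfolding L_def using Dv_null[OF x l null] e0 by simp
    show "(\<Sum>i\<in>UNIV. \<Sum>j\<in>UNIV. contr4 (Pa x ?e i) (Pa x ?e j) * contr4 (Pa x ?e (st01 i)) (Pa x ?e (st01 j))) = 0"
      by (rule quartic_Pa[OF x ex])
  qed
  \<comment> \<open>Together with mu_0 = 0 this leaves only the transverse terms in the derivative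
    of the squared length of mu.\<close>
  have nu00: "nu 0 0 = 0" unfolding nu0 sum_4' by (simp add: mu0 L1 kappa)
  define Z where "Z = (\<lambda>i. ctr (l x) (nabla g Mu x) [i])"
  have sMM: "smooth_on S (\<lambda>y. muC z l y i * muC z l y j)" for i j by (intro smooth_on_mult openS sm)
  have pz: "(\<Sum>i\<in>UNIV. \<Sum>j\<in>UNIV. h x $ i $ j * (nabla g Mu x [e,i] * muC z l x j + muC z l x i * nabla g Mu x [e,j])) = 0" for e
  proof -
    have "0 = partial e (\<lambda>y. 1) x" by simp
    also have "\<dots> = partial e (\<lambda>y. \<Sum>i\<in>UNIV. \<Sum>j\<in>UNIV. h y $ i $ j * (muC z l y i * muC z l y j)) x"
      by (rule partial_cong[OF openS x]) (simp add: norm)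
    also have "\<dots> = (\<Sum>i\<in>UNIV. \<Sum>j\<in>UNIV. h x $ i $ j * (nabla g Mu x [e,i] * muC z l x j + muC z l x i * nabla g Mu x [e,j]))"
      unfolding partial_trace[OF x sMM] partial_mult[OF sd[OF sm x] sd[OF sm x]]
      by (intro sum.cong refl arg_cong2[where f="(*)"]) (simp add: Mu_def algebra_simps sum_distrib_left)
    finally show ?thesis by simp
  qed
  have "0 = (\<Sum>e\<in>UNIV. l x $ e * (\<Sum>i\<in>UNIV. \<Sum>j\<in>UNIV. h x $ i $ j * (nabla g Mu x [e,i] * muC z l x j + muC z l x i * nabla g Mu x [e,j])))"
    unfolding pz by simp
  also have "\<dots> = (\<Sum>i\<in>UNIV. \<Sum>j\<in>UNIV. h x $ i $ j * (\<Sum>e\<in>UNIV. l x $ e * (nabla g Mu x [e,i] * muC z l x j + muC z l x i * nabla g Mu x [e,j])))"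
    by (rule sum_pull[symmetric])
  also have "\<dots> = (\<Sum>i\<in>UNIV. \<Sum>j\<in>UNIV. h x $ i $ j * (Z i * muC z l x j + muC z l x i * Z j))"
    unfolding Z_def ctr_def by (intro sum.cong refl arg_cong2[where f="(*)"]) 
      (simp add: sum.distrib sum_distrib_left sum_distrib_right distrib_left mult_ac del: nabla.simps)
  also have "\<dots> = (\<Sum>i\<in>UNIV. \<Sum>j\<in>UNIV. h x $ i $ j * (Z i * muC z l x j)) + (\<Sum>i\<in>UNIV. \<Sum>j\<in>UNIV. h x $ i $ j * (muC z l x i * Z j))"
    by (simp add: distrib_left sum.distrib)
  also have "\<dots> = (\<Sum>a\<in>UNIV. nu a 0 * mu (st01 a)) + (\<Sum>a\<in>UNIV. mu a * nu (st01 a) 0)"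
  proof -
    have Zn: "(\<Sum>i\<in>UNIV. ?e a $ i * Z i) = nu a 0" for a
      unfolding Z_def nu_def e0 tev_ctr[of "l x"] unfolding tev.simps ..
    show ?thesis unfolding pairing_frame_sum[OF null_pairing[OF x ex]] Zn mu_def M_def by simp
  qed
  also have "\<dots> = 2 * (mu 2 * nu 2 0 + mu 3 * nu 3 0)"
    unfolding sum_4' by (simp add: st01_def nu00 mu0)
  finally have L00: "L 0 0 = 0" by (intro affine) simp
  show ?thesis
  proof (rule kundt_vector_frame[OF x l ex e0])
    have "\<forall>k. L k 0 = 0" unfolding forall_4' using L00 L1 kappa by simp
    then show "ip (g x) (Dv l x (?e 0)) (?e (st01 k)) = 0" for k unfolding L_def by blast
  qed (use L1 expansion shear in \<open>simp_all add: L_def\<close>)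
qed

end

section \<open>Integrable linear systems\<close>

text \<open>A partial derivative of the integrand brings out a factor s, so the weight s^k makes the
  family closed under differentiation.\<close>

definition ray_integral :: "real^4 \<Rightarrow> nat \<Rightarrow> (real^4 \<Rightarrow> real) \<Rightarrow> real^4 \<Rightarrow> real" where
  "ray_integral p k F x = integral {0..1} (\<lambda>s. s ^ k * F (p + s *\<^sub>R (x - p)))"

lemma ray_in_ball:
  fixes x :: "'a::real_normed_vector"
  assumes "x \<in> ball p r" "s \<in> {0..1}" shows "p + s *\<^sub>R (x - p) \<in> ball p r"
proof -
  have "norm (s *\<^sub>R (x - p)) \<le> 1 * norm (x - p)"
    using assms(2) unfolding norm_scaleR by (intro mult_right_mono) auto
  then show ?thesis using assms(1) by (simp add: dist_norm norm_minus_commute)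
qed

lemma ray_continuous:
  fixes F :: "real^4 \<Rightarrow> real"
  assumes F: "continuous_on (ball p r) F" and x: "x \<in> ball p r"
  shows "continuous_on {0..1} (\<lambda>s. s ^ k * F (p + s *\<^sub>R (x - p)))"
  by (intro continuous_intros continuous_on_compose2[OF F]) (use ray_in_ball[OF x] in auto)

lemma ray_integrable:
  fixes F :: "real^4 \<Rightarrow> real"
  assumes "continuous_on (ball p r) F" "x \<in> ball p r"
  shows "(\<lambda>s. s ^ k * F (p + s *\<^sub>R (x - p))) integrable_on {0..1}"
  by (rule integrable_continuous_real[OF ray_continuous[OF assms]])

lemma ray_integral_diff:
  assumes "continuous_on (ball p r) F" "continuous_on (ball p r) G" "x \<in> ball p r"
  shows "ray_integral p k F x - ray_integral p k G x = ray_integral p k (\<lambda>y. F y - G y) x"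
  unfolding ray_integral_def right_diff_distrib
  by (rule integral_diff[symmetric]) (rule ray_integrable[OF _ assms(3)], rule assms)+

lemma ray_integral_cong:
  assumes "\<And>y. y \<in> ball p r \<Longrightarrow> F y = G y" "x \<in> ball p r"
  shows "ray_integral p k F x = ray_integral p k G x"
  unfolding ray_integral_def
proof (rule integral_cong)
  show "s ^ k * F (p + s *\<^sub>R (x - p)) = s ^ k * G (p + s *\<^sub>R (x - p))" if "s \<in> {0..1}" for s
    unfolding assms(1)[OF ray_in_ball[OF assms(2) that]] ..
qed

lemma ray_integral_bound:
  assumes F: "continuous_on (ball p r) F" and B: "\<And>y. y \<in> ball p r \<Longrightarrow> \<bar>F y\<bar> \<le> B" and x: "x \<in> ball p r"
  shows "\<bar>ray_integral p k F x\<bar> \<le> B"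
proof -
  have "norm (integral {0..1} (\<lambda>s. s ^ k * F (p + s *\<^sub>R (x - p)))) \<le> B * (1 - 0)"
  proof (rule integral_bound)
    show "norm (s ^ k * F (p + s *\<^sub>R (x - p))) \<le> B" if s: "s \<in> {0..1}" for s
    proof -
      have "\<bar>s ^ k\<bar> * \<bar>F (p + s *\<^sub>R (x - p))\<bar> \<le> 1 * B"
        using s by (intro mult_mono B ray_in_ball[OF x s]) (auto simp: power_le_one)
      then show ?thesis by (simp add: abs_mult)
    qed
  qed (use ray_continuous[OF F x] in auto)
  then show ?thesis unfolding ray_integral_def by simp
qed

lemma ray_integral_derivative:
  assumes F: "smooth_on (ball p r) F" and x: "x \<in> ball p r"
  shows "(ray_integral p k F has_derivative (\<lambda>h. \<Sum>a\<in>UNIV. h $ a * ray_integral p (Suc k) (partial a F) x)) (at x)"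
proof -
  define N where "N = (\<lambda>a::4. Blinfun (\<lambda>h::real^4. h $ a))"
  have N: "blinfun_apply (N a) h = h $ a" for a h
    unfolding N_def by (simp add: bounded_linear_Blinfun_apply bounded_linear_vec_nth)
  define D where "D = (\<lambda>x s. \<Sum>a\<in>UNIV. (s ^ Suc k * partial a F (p + s *\<^sub>R (x - p))) *\<^sub>R N a)"
  have c: "continuous_on (ball p r) (partial a F)" for a
    by (intro smooth_on_continuous smooth_on_partial F)
  have "((\<lambda>x. integral (cbox 0 1) (\<lambda>s. s ^ k * F (p + s *\<^sub>R (x - p)))) has_derivative blinfun_apply (integral (cbox 0 1) (D x))) (at x within ball p r)"
  proof (rule leibniz_rule[OF _ _ _ x])
    show "((\<lambda>x. s ^ k * F (p + s *\<^sub>R (x - p))) has_derivative blinfun_apply (D y s)) (at y within ball p r)"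
      if y: "y \<in> ball p r" and s: "s \<in> cbox 0 1" for y and s :: real
    proof -
      have "(F has_derivative (\<lambda>h. \<Sum>a\<in>UNIV. h $ a * partial a F (p + s *\<^sub>R (y - p)))) (at (p + s *\<^sub>R (y - p)))"
        using s by (intro differentiable_partial smooth_on_D[OF F] ray_in_ball[OF y]) auto
      then have "((\<lambda>x. F (p + s *\<^sub>R (x - p))) has_derivative (\<lambda>h. \<Sum>a\<in>UNIV. (s *\<^sub>R h) $ a * partial a F (p + s *\<^sub>R (y - p)))) (at y)"
        by (rule has_derivative_compose[rotated]) (auto intro!: derivative_eq_intros)
      then have "((\<lambda>x. s ^ k * F (p + s *\<^sub>R (x - p))) has_derivative (\<lambda>h. s ^ k * (\<Sum>a\<in>UNIV. (s *\<^sub>R h) $ a * partial a F (p + s *\<^sub>R (y - p))))) (at y)"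
        by (rule has_derivative_mult_right)
      moreover have "(\<lambda>h. s ^ k * (\<Sum>a\<in>UNIV. (s *\<^sub>R h) $ a * partial a F (p + s *\<^sub>R (y - p)))) = blinfun_apply (D y s)"
        unfolding D_def by (simp add: fun_eq_iff blinfun.sum_left blinfun.scaleR_left N sum_distrib_left mult_ac)
      ultimately show ?thesis by (simp add: has_derivative_at_withinI)
    qed
    show "(\<lambda>s. s ^ k * F (p + s *\<^sub>R (y - p))) integrable_on cbox 0 1" if "y \<in> ball p r" for y
      using ray_integrable[OF smooth_on_continuous[OF F] that] by simp
    show "continuous_on (ball p r \<times> cbox 0 1) (\<lambda>(x, s). D x s)"
      unfolding D_def case_prod_beta
      by (intro continuous_intros continuous_on_compose2[OF c]) (use ray_in_ball[of _ p r] in auto)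
  qed simp
  moreover have "blinfun_apply (integral (cbox 0 1) (D x)) = (\<lambda>h. \<Sum>a\<in>UNIV. h $ a * ray_integral p (Suc k) (partial a F) x)"
  proof
    fix h
    have cD: "continuous_on (cbox 0 1) (D x)" unfolding D_def
      by (intro continuous_intros continuous_on_compose2[OF c]) (use ray_in_ball[OF x] in auto)
    have "blinfun_apply (integral (cbox 0 1) (D x)) h = integral (cbox 0 1) (\<lambda>s. blinfun_apply (D x s) h)"
      by (rule blinfun_apply_integral[OF integrable_continuous[OF cD]])
    also have "\<dots> = integral (cbox 0 1) (\<lambda>s. \<Sum>a\<in>UNIV. h $ a * (s ^ Suc k * partial a F (p + s *\<^sub>R (x - p))))"
      unfolding D_def by (simp add: blinfun.sum_left blinfun.scaleR_left N mult_ac)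
    also have "\<dots> = (\<Sum>a\<in>UNIV. integral (cbox 0 1) (\<lambda>s. h $ a * (s ^ Suc k * partial a F (p + s *\<^sub>R (x - p)))))"
      using ray_integrable[OF c x, of "Suc k"] by (intro integral_sum integrable_on_mult_right) (auto simp del: power_Suc)
    finally show "blinfun_apply (integral (cbox 0 1) (D x)) h = (\<Sum>a\<in>UNIV. h $ a * ray_integral p (Suc k) (partial a F) x)"
      unfolding ray_integral_def by (simp del: power_Suc)
  qed
  ultimately show ?thesis using at_within_open[OF x] unfolding ray_integral_def[abs_def] by simp
qed

lemma partial_ray_integral:
  assumes "smooth_on (ball p r) F" "x \<in> ball p r"
  shows "partial b (ray_integral p k F) x = ray_integral p (Suc k) (partial b F) x"
  using partial_eqI[OF ray_integral_derivative[OF assms], of b k]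
  by (simp add: axis_def if_distrib[of "\<lambda>x. x * _"] cong: if_cong)

lemma smooth_ray_integral:
  assumes F: "smooth_on (ball p r) F" shows "smooth_on (ball p r) (ray_integral p k F)"
proof -
  have d: "ray_integral p k F differentiable_on ball p r" if "smooth_on (ball p r) F" for k F
    unfolding differentiable_on_def differentiable_def
    using ray_integral_derivative[OF that] has_derivative_at_withinI by blast
  have "Ck_on n (ball p r) (ray_integral p k F)" for n
    using F
  proof (induction n arbitrary: k F)
    case 0
    then show ?case using differentiable_imp_continuous_on[OF d] by simp
  next
    case (Suc n)
    have "Ck_on n (ball p r) (partial a (ray_integral p k F))" for a
    proof (rule iffD1[OF Ck_on_cong[OF open_ball]])
      show "Ck_on n (ball p r) (ray_integral p (Suc k) (partial a F))" by (intro Suc.IH smooth_on_partial Suc.prems)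
    qed (simp add: partial_ray_integral[OF Suc.prems])
    then show ?case using d[OF Suc.prems] by simp
  qed
  then show ?thesis unfolding smooth_on_def ..
qed

text \<open>The derivative of s F(p + s(x - p)) is integrated over s from 0 to 1.\<close>

lemma ray_integral_euler:
  assumes F: "smooth_on (ball p r) F" and x: "x \<in> ball p r"
  shows "F x = ray_integral p 0 F x + (\<Sum>a\<in>UNIV. (x - p) $ a * ray_integral p 1 (partial a F) x)"
proof -
  have c: "continuous_on (ball p r) (partial a F)" for a
    by (intro smooth_on_continuous smooth_on_partial F)
  have "((\<lambda>s. F (p + s *\<^sub>R (x - p)) + s * (\<Sum>a\<in>UNIV. (x - p) $ a * partial a F (p + s *\<^sub>R (x - p)))) has_integral
     1 * F (p + 1 *\<^sub>R (x - p)) - 0 * F (p + 0 *\<^sub>R (x - p))) {0..1}"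
  proof (rule fundamental_theorem_of_calculus)
    fix s :: real assume s: "s \<in> {0..1}"
    have "(F has_derivative (\<lambda>h. \<Sum>a\<in>UNIV. h $ a * partial a F (p + s *\<^sub>R (x - p)))) (at (p + s *\<^sub>R (x - p)))"
      using s by (intro differentiable_partial smooth_on_D[OF F] ray_in_ball[OF x]) auto
    then have "((\<lambda>s. F (p + s *\<^sub>R (x - p))) has_derivative (\<lambda>t. \<Sum>a\<in>UNIV. (t *\<^sub>R (x - p)) $ a * partial a F (p + s *\<^sub>R (x - p)))) (at s)"
      by (rule has_derivative_compose[rotated]) (auto intro!: derivative_eq_intros)
    then have "((\<lambda>s. F (p + s *\<^sub>R (x - p))) has_real_derivative (\<Sum>a\<in>UNIV. (x - p) $ a * partial a F (p + s *\<^sub>R (x - p)))) (at s)"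
      unfolding has_field_derivative_def by (rule has_derivative_eq_rhs) (simp add: fun_eq_iff sum_distrib_left mult_ac)
    then have "((\<lambda>s. s * F (p + s *\<^sub>R (x - p))) has_real_derivative
        F (p + s *\<^sub>R (x - p)) + s * (\<Sum>a\<in>UNIV. (x - p) $ a * partial a F (p + s *\<^sub>R (x - p)))) (at s)"
      by (auto intro!: derivative_eq_intros)
    then show "((\<lambda>s. s * F (p + s *\<^sub>R (x - p))) has_vector_derivative
        F (p + s *\<^sub>R (x - p)) + s * (\<Sum>a\<in>UNIV. (x - p) $ a * partial a F (p + s *\<^sub>R (x - p)))) (at s within {0..1})"
      unfolding has_real_derivative_iff_has_vector_derivative by (rule has_vector_derivative_at_within)
  qed simp
  then have "F x = integral {0..1} (\<lambda>s. F (p + s *\<^sub>R (x - p)) + s * (\<Sum>a\<in>UNIV. (x - p) $ a * partial a F (p + s *\<^sub>R (x - p))))"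
    by (simp add: integral_unique)
  also have "\<dots> = integral {0..1} (\<lambda>s. s ^ 0 * F (p + s *\<^sub>R (x - p)) + (\<Sum>a\<in>UNIV. (x - p) $ a * (s ^ 1 * partial a F (p + s *\<^sub>R (x - p)))))"
    by (simp add: sum_distrib_left mult_ac)
  also have "\<dots> = integral {0..1} (\<lambda>s. s ^ 0 * F (p + s *\<^sub>R (x - p))) + integral {0..1} (\<lambda>s. \<Sum>a\<in>UNIV. (x - p) $ a * (s ^ 1 * partial a F (p + s *\<^sub>R (x - p))))"
    by (intro integral_add integrable_sum integrable_on_mult_right ray_integrable[OF c x] ray_integrable[OF smooth_on_continuous[OF F] x]) simp
  also have "integral {0..1} (\<lambda>s. \<Sum>a\<in>UNIV. (x - p) $ a * (s ^ 1 * partial a F (p + s *\<^sub>R (x - p)))) =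
     (\<Sum>a\<in>UNIV. integral {0..1} (\<lambda>s. (x - p) $ a * (s ^ 1 * partial a F (p + s *\<^sub>R (x - p)))))"
    by (intro integral_sum integrable_on_mult_right ray_integrable[OF c x]) simp
  finally show ?thesis unfolding ray_integral_def by simp
qed

lemma sum_abs_le:
  fixes f :: "'a::finite \<Rightarrow> real" and B :: real
  assumes "\<And>i. \<bar>f i\<bar> \<le> B" shows "\<bar>\<Sum>i\<in>UNIV. f i\<bar> \<le> real CARD('a) * B"
  by (rule order_trans[OF sum_abs]) (use sum_bounded_above[of UNIV "\<lambda>i. \<bar>f i\<bar>" B] assms in simp)

text \<open>The total differential system dW = A W with initial value \<open>W0\<close>;
  \<open>integrable\<close> is the flatness of A, and \<open>m\<close> bounds its row sums. The
  constant 32 in \<open>small\<close> is 4 * 2 * 4: four coordinates, two terms in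
  \<open>partial_picard\<close>, and the 4 in \<open>defect_bound\<close>.\<close>

locale linear_system =
  fixes A :: "4 \<Rightarrow> 'n::finite \<Rightarrow> 'n \<Rightarrow> real^4 \<Rightarrow> real" and p :: "real^4" and r M m c :: real and W0 :: "'n \<Rightarrow> real"
  assumes sA: "\<And>a i j. smooth_on (ball p r) (A a i j)"
    and A_bound: "\<And>a i j x. x \<in> ball p r \<Longrightarrow> \<bar>A a i j x\<bar> \<le> M"
    and integrable: "\<And>x a b i j. x \<in> ball p r \<Longrightarrow> partial b (A a i j) x + (\<Sum>k\<in>UNIV. A a i k x * A b k j x) =
       partial a (A b i j) x + (\<Sum>k\<in>UNIV. A b i k x * A a k j x)"
    and m: "m = real CARD('n) * M" and small: "32 * (m * r) \<le> 1" and pos: "0 < r" "0 \<le> M"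
    and W0: "\<And>i. \<bar>W0 i\<bar> \<le> c"
begin

abbreviation V :: "(real^4) set" where "V \<equiv> ball p r"

text \<open>Picard iteration with line integrals along rays from \<open>p\<close>. Its convergence
  alone secures the equation in the radial direction; the other directions are controlled by
  \<open>defect\<close>.\<close>

primrec picard :: "nat \<Rightarrow> real^4 \<Rightarrow> 'n \<Rightarrow> real" where
  "picard 0 x i = W0 i"
| "picard (Suc n) x i = W0 i + (\<Sum>a\<in>UNIV. (x - p) $ a * ray_integral p 0 (\<lambda>y. \<Sum>j\<in>UNIV. A a i j y * picard n y j) x)"

definition rhs :: "nat \<Rightarrow> 4 \<Rightarrow> 'n \<Rightarrow> real^4 \<Rightarrow> real" where
  "rhs n a i y = (\<Sum>j\<in>UNIV. A a i j y * picard n y j)"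

definition defect :: "nat \<Rightarrow> 4 \<Rightarrow> 'n \<Rightarrow> real^4 \<Rightarrow> real" where
  "defect n b i y = partial b (\<lambda>x. picard n x i) y - rhs n b i y"

lemma picard_Suc: "picard (Suc n) x i = W0 i + (\<Sum>a\<in>UNIV. (x - p) $ a * ray_integral p 0 (rhs n a i) x)"
  unfolding rhs_def[abs_def] by simp

declare picard.simps(2) [simp del]

lemma smooth_coord: "smooth_on V (\<lambda>x. (x - p) $ a)"
  unfolding vector_minus_component by (intro smooth_on_diff smooth_on_nth smooth_on_const open_ball)

lemma smooth_picard: "smooth_on V (\<lambda>x. picard n x i)" and smooth_rhs: "smooth_on V (rhs n a i)"
proof -
  have "(\<forall>i. smooth_on V (\<lambda>x. picard n x i)) \<and> (\<forall>a i. smooth_on V (rhs n a i))" for n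
  proof (induction n)
    case 0
    then show ?case unfolding rhs_def[abs_def] by (auto intro!: smooth_on_const smooth_on_sum smooth_on_mult open_ball sA)
  next
    case (Suc n)
    have "smooth_on V (\<lambda>x. picard (Suc n) x i)" for i
      unfolding picard_Suc using Suc
      by (intro smooth_on_add smooth_on_sum smooth_on_mult smooth_on_const smooth_coord smooth_ray_integral open_ball) auto
    then show ?case unfolding rhs_def[abs_def] by (auto intro!: smooth_on_sum smooth_on_mult open_ball sA)
  qed
  then show "smooth_on V (\<lambda>x. picard n x i)" "smooth_on V (rhs n a i)" by auto
qed

lemma coord_bound: "x \<in> V \<Longrightarrow> \<bar>(x - p) $ a\<bar> \<le> r"
  using component_le_norm_cart[of "x - p" a] by (simp add: dist_norm norm_minus_commute)

lemma c_nonneg: "0 \<le> c" using W0[of undefined] by linarith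

lemma m_nonneg: "0 \<le> m" using pos m by simp

lemma A_sum_bound: "x \<in> V \<Longrightarrow> (\<And>j. \<bar>X j\<bar> \<le> B) \<Longrightarrow> \<bar>\<Sum>j\<in>UNIV. A a i j x * X j\<bar> \<le> m * B"
proof -
  assume x: "x \<in> V" and X: "\<And>j. \<bar>X j\<bar> \<le> B"
  have "\<bar>\<Sum>j\<in>UNIV. A a i j x * X j\<bar> \<le> real CARD('n) * (M * B)"
    by (rule sum_abs_le) (simp add: abs_mult, intro mult_mono A_bound x X pos abs_ge_zero)
  then show ?thesis by (simp add: m mult.assoc)
qed

lemma ray_sum_bound:
  assumes x: "x \<in> V" and B: "\<And>a. \<bar>f a\<bar> \<le> B"
  shows "\<bar>\<Sum>a\<in>UNIV. (x - p) $ a * f a\<bar> \<le> 4 * (r * B)"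
  using sum_abs_le[of "\<lambda>a. (x - p) $ a * f a" "r * B"] mult_mono[OF coord_bound[OF x] B] pos
  by (simp add: abs_mult)

lemma picard_step: "x \<in> V \<Longrightarrow> \<bar>picard (Suc n) x i - picard n x i\<bar> \<le> c * (1/2) ^ n"
proof (induction n arbitrary: x i)
  case 0
  have "\<bar>ray_integral p 0 (rhs 0 a i) x\<bar> \<le> m * c" for a
    by (rule ray_integral_bound[OF smooth_on_continuous[OF smooth_rhs] _ 0]) (simp add: rhs_def A_sum_bound W0)
  then have "\<bar>picard (Suc 0) x i - picard 0 x i\<bar> \<le> 4 * (r * (m * c))"
    unfolding picard_Suc using ray_sum_bound[OF 0] by simp
  also have "\<dots> = (4 * (m * r)) * c" by simp
  also have "\<dots> \<le> 1 * c" by (rule mult_right_mono[OF _ c_nonneg]) (use small m_nonneg pos in auto)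
  finally show ?case by simp
next
  case (Suc n)
  let ?B = "c * (1/2) ^ n"
  have "\<bar>ray_integral p 0 (rhs (Suc n) a i) x - ray_integral p 0 (rhs n a i) x\<bar> \<le> m * ?B" for a
  proof -
    have "\<bar>rhs (Suc n) a i y - rhs n a i y\<bar> \<le> m * ?B" if "y \<in> V" for y
      unfolding rhs_def sum_subtractf[symmetric] right_diff_distrib[symmetric] by (rule A_sum_bound[OF that Suc.IH[OF that]])
    then show ?thesis
      unfolding ray_integral_diff[OF smooth_on_continuous[OF smooth_rhs] smooth_on_continuous[OF smooth_rhs] Suc.prems]
      by (intro ray_integral_bound[OF _ _ Suc.prems] continuous_on_diff smooth_on_continuous[OF smooth_rhs])
  qed
  from ray_sum_bound[OF Suc.prems this] have "\<bar>picard (Suc (Suc n)) x i - picard (Suc n) x i\<bar> \<le> 4 * (r * (m * ?B))"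
    unfolding picard_Suc by (simp add: right_diff_distrib sum_subtractf)
  also have "\<dots> = (4 * (m * r)) * ?B" by simp
  also have "\<dots> \<le> (1 / 2) * ?B" by (rule mult_right_mono) (use small c_nonneg in auto)
  finally show ?case by simp
qed

text \<open>\<open>ray_integral_euler\<close>, applied to the right-hand side in direction b,
  reduces the difference to the curl of A W_n. Integrability turns the curl into A applied to the
  defect of the previous step.\<close>

lemma partial_picard:
  assumes x: "x \<in> V"
  shows "partial b (\<lambda>x. picard (Suc n) x i) x - rhs n b i x =
    (\<Sum>a\<in>UNIV. (x - p) $ a * ray_integral p 1 (\<lambda>y. (\<Sum>j\<in>UNIV. A a i j y * defect n b j y) - (\<Sum>j\<in>UNIV. A b i j y * defect n a j y)) x)"
proof -
  note d = smooth_on_D[OF _ open_ball x]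
  have pr: "partial b (rhs n a i) y = (\<Sum>j\<in>UNIV. partial b (A a i j) y * picard n y j + A a i j y * partial b (\<lambda>x. picard n x j) y)"
    if y: "y \<in> V" for a b y
    unfolding rhs_def[abs_def]
    by (simp add: partial_sum partial_mult smooth_on_D[OF _ open_ball y] smooth_on_mult open_ball sA smooth_picard)
  have pd: "partial b (rhs n a i) y - partial a (rhs n b i) y =
     (\<Sum>j\<in>UNIV. A a i j y * defect n b j y) - (\<Sum>j\<in>UNIV. A b i j y * defect n a j y)" if y: "y \<in> V" for a y
  proof -
    have q: "(\<Sum>j\<in>UNIV. A a i j y * rhs n b j y) = (\<Sum>j\<in>UNIV. (\<Sum>k\<in>UNIV. A a i k y * A b k j y) * picard n y j)" for a b
      unfolding rhs_def sum_distrib_left sum_distrib_right by (subst sum.swap) (simp add: mult.assoc)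
    have s: "(\<Sum>k\<in>UNIV. A a i k y * A b k j y) = partial a (A b i j) y - partial b (A a i j) y + (\<Sum>k\<in>UNIV. A b i k y * A a k j y)" for j
      using integrable[OF y, of b a i j] by simp
    show ?thesis unfolding pr[OF y] defect_def right_diff_distrib sum_subtractf q s
      by (simp add: algebra_simps sum.distrib sum_subtractf)
  qed
  have "partial b (\<lambda>x. picard (Suc n) x i) x = (\<Sum>a\<in>UNIV. (if a = b then 1 else 0) * ray_integral p 0 (rhs n a i) x
      + (x - p) $ a * ray_integral p 1 (partial b (rhs n a i)) x)"
  proof -
    have "partial b (\<lambda>x. picard (Suc n) x i) x = (\<Sum>a\<in>UNIV. partial b (\<lambda>x. (x - p) $ a) x * ray_integral p 0 (rhs n a i) x
      + (x - p) $ a * partial b (ray_integral p 0 (rhs n a i)) x)"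
      unfolding picard_Suc
      by (simp only: partial_add partial_sum partial_mult partial_const d smooth_on_mult smooth_on_sum smooth_on_const open_ball smooth_coord smooth_ray_integral smooth_rhs add_0_left)
    moreover have "partial b (\<lambda>x. (x - p) $ a) x = (if a = b then 1 else 0)" for a
      unfolding vector_minus_component
      by (simp only: partial_diff partial_nth partial_const d smooth_on_nth smooth_on_const diff_zero)
    ultimately show ?thesis using partial_ray_integral[OF smooth_rhs x] by simp
  qed
  also have "\<dots> = ray_integral p 0 (rhs n b i) x + (\<Sum>a\<in>UNIV. (x - p) $ a * ray_integral p 1 (partial b (rhs n a i)) x)"
    by (simp add: sum.distrib if_distrib[of "\<lambda>x. x * _"] cong: if_cong)
  finally have "partial b (\<lambda>x. picard (Suc n) x i) x - rhs n b i x = 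
     (\<Sum>a\<in>UNIV. (x - p) $ a * (ray_integral p 1 (partial b (rhs n a i)) x - ray_integral p 1 (partial a (rhs n b i)) x))"
    using ray_integral_euler[OF smooth_rhs x, of n b i] by (simp add: right_diff_distrib sum_subtractf)
  also have "\<dots> = (\<Sum>a\<in>UNIV. (x - p) $ a * ray_integral p 1 (\<lambda>y. partial b (rhs n a i) y - partial a (rhs n b i) y) x)"
    using ray_integral_diff[OF smooth_on_continuous[OF smooth_on_partial[OF smooth_rhs]] smooth_on_continuous[OF smooth_on_partial[OF smooth_rhs]] x]
    by simp
  also have "\<dots> = (\<Sum>a\<in>UNIV. (x - p) $ a * ray_integral p 1 (\<lambda>y. (\<Sum>j\<in>UNIV. A a i j y * defect n b j y) - (\<Sum>j\<in>UNIV. A b i j y * defect n a j y)) x)"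
    by (intro sum.cong refl arg_cong2[where f="(*)"] ray_integral_cong[OF _ x] pd)
  finally show ?thesis .
qed

lemma smooth_defect: "smooth_on V (defect n b i)"
  unfolding defect_def[abs_def] by (intro smooth_on_diff smooth_on_partial smooth_picard smooth_rhs open_ball)

text \<open>One summand m c (1/2)^n comes from the previous defect by \<open>partial_picard\<close>
  and \<open>small\<close>, the other from the change of \<open>rhs\<close> in one step; their sum
  is half of the previous bound.\<close>

lemma defect_bound: "x \<in> V \<Longrightarrow> \<bar>defect n b i x\<bar> \<le> 4 * (m * c) * (1/2) ^ n"
proof (induction n arbitrary: x b i)
  case 0
  have "\<bar>rhs 0 b i x\<bar> \<le> m * c" unfolding rhs_def by (rule A_sum_bound[OF 0]) (simp add: W0)
  moreover have "0 \<le> m * c" by (rule mult_nonneg_nonneg[OF m_nonneg c_nonneg])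
  ultimately show ?case unfolding defect_def by simp
next
  case (Suc n)
  let ?B = "4 * (m * c) * (1/2) ^ n"
  let ?G = "\<lambda>a y. (\<Sum>j\<in>UNIV. A a i j y * defect n b j y) - (\<Sum>j\<in>UNIV. A b i j y * defect n a j y)"
  have G: "\<bar>?G a y\<bar> \<le> 2 * (m * ?B)" if y: "y \<in> V" for a y
    using A_sum_bound[OF y, where X="\<lambda>j. defect n b j y" and a=a and i=i, OF Suc.IH[OF y]]
      A_sum_bound[OF y, where X="\<lambda>j. defect n a j y" and a=b and i=i, OF Suc.IH[OF y]] by linarith
  have cG: "continuous_on V (?G a)" for a
    by (intro smooth_on_continuous smooth_on_diff smooth_on_sum smooth_on_mult open_ball sA smooth_defect)
  have 1: "\<bar>partial b (\<lambda>x. picard (Suc n) x i) x - rhs n b i x\<bar> \<le> 4 * (r * (2 * (m * ?B)))"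
    unfolding partial_picard[OF Suc.prems]
    by (rule ray_sum_bound[OF Suc.prems ray_integral_bound[OF cG G Suc.prems]])
  have 2: "\<bar>rhs (Suc n) b i x - rhs n b i x\<bar> \<le> m * (c * (1/2) ^ n)"
    unfolding rhs_def sum_subtractf[symmetric] right_diff_distrib[symmetric]
    by (rule A_sum_bound[OF Suc.prems picard_step[OF Suc.prems]])
  have "4 * (r * (2 * (m * ?B))) = (32 * (m * r)) * (m * c * (1/2) ^ n)" by simp
  also have "\<dots> \<le> 1 * (m * c * (1/2) ^ n)"
    by (rule mult_right_mono[OF small]) (use m_nonneg c_nonneg in simp)
  finally have "\<bar>defect (Suc n) b i x\<bar> \<le> m * c * (1/2) ^ n + m * (c * (1/2) ^ n)"
    using 1 2 unfolding defect_def by linarith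
  also have "\<dots> = 4 * (m * c) * (1/2) ^ Suc n" by simp
  finally show ?case .
qed

definition sol :: "real^4 \<Rightarrow> 'n \<Rightarrow> real" where
  "sol x i = W0 i + (\<Sum>k. picard (Suc k) x i - picard k x i)"

lemma picard_limit: "uniform_limit V (\<lambda>n x. picard n x i) (\<lambda>x. sol x i) sequentially"
proof -
  have "uniform_limit V (\<lambda>n x. \<Sum>k<n. picard (Suc k) x i - picard k x i) (\<lambda>x. \<Sum>k. picard (Suc k) x i - picard k x i) sequentially"
    by (rule Weierstrass_m_test[where M="\<lambda>n. c * (1/2) ^ n"]) (use picard_step in \<open>auto intro!: summable_mult summable_geometric\<close>)
  then have "uniform_limit V (\<lambda>n x. W0 i + (\<Sum>k<n. picard (Suc k) x i - picard k x i)) (\<lambda>x. W0 i + (\<Sum>k. picard (Suc k) x i - picard k x i)) sequentially"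
    by (intro uniform_limit_intros)
  moreover have "W0 i + (\<Sum>k<n. picard (Suc k) x i - picard k x i) = picard n x i" for n x
    unfolding sum_lessThan_telescope[of "\<lambda>k. picard k x i"] by simp
  ultimately show ?thesis by (simp only: sol_def)
qed

text \<open>The defect tends to 0 uniformly, so the derivatives of the iterates converge uniformly
  to A applied to \<open>sol\<close>, and the limit may be differentiated.\<close>

lemma sol_derivative:
  assumes x: "x \<in> V"
  shows "((\<lambda>x. sol x i) has_derivative (\<lambda>h. \<Sum>b\<in>UNIV. h $ b * (\<Sum>j\<in>UNIV. A b i j x * sol x j))) (at x)"
proof -
  let ?g = "\<lambda>x h. \<Sum>b\<in>UNIV. h $ b * (\<Sum>j\<in>UNIV. A b i j x * sol x j)"
  have "\<exists>g. \<forall>x\<in>V. (\<lambda>n. picard n x i) \<longlonglongrightarrow> g x \<and> (g has_derivative ?g x) (at x within V)"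
  proof (rule has_derivative_sequence[where f="\<lambda>n x. picard n x i" and f'="\<lambda>n y h. \<Sum>b\<in>UNIV. h $ b * partial b (\<lambda>x. picard n x i) y" and g'="?g" and S=V and ?x0.0=x and l="sol x i"])
    show "((\<lambda>x. picard n x i) has_derivative (\<lambda>h. \<Sum>b\<in>UNIV. h $ b * partial b (\<lambda>x. picard n x i) y)) (at y within V)" if "y \<in> V" for n y
      by (rule has_derivative_at_withinI[OF differentiable_partial[OF smooth_on_D[OF smooth_picard open_ball that]]])
    show "(\<lambda>n. picard n x i) \<longlonglongrightarrow> sol x i" by (rule tendsto_uniform_limitI[OF picard_limit x])
    show "\<forall>\<^sub>F n in sequentially. \<forall>x\<in>V. \<forall>h. norm ((\<Sum>b\<in>UNIV. h $ b * partial b (\<lambda>x. picard n x i) x) - ?g x h) \<le> e * norm h"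
      if e: "e > 0" for e :: real
    proof -
      \<comment> \<open>\<open>m\<close> may be 0. The choice of \<open>d\<close> allows an error of
        e/8 from replacing the iterate by \<open>sol\<close> and e/8 from the defect, so e/4 for
        each of the four coordinates.\<close>
      define k where "k = m + 1"
      have k: "k > 0" unfolding k_def using m_nonneg by simp
      define d where "d = e / (8 * k)"
      have d: "d > 0" unfolding d_def using e k by simp
      have "8 * (k * d) = e" unfolding d_def using k by simp
      then have md: "8 * (m * d) \<le> e" using d unfolding k_def by (simp add: algebra_simps)
      have 1: "\<forall>\<^sub>F n in sequentially. \<forall>x\<in>V. \<bar>picard n x j - sol x j\<bar> < d" for j
        using uniform_limitD[OF picard_limit d, of j] by (simp add: dist_real_def)
      then have 1: "\<forall>\<^sub>F n in sequentially. \<forall>j. \<forall>x\<in>V. \<bar>picard n x j - sol x j\<bar> < d"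
        by (rule eventually_all_finite)
      have "(\<lambda>n. 4 * (m * c) * (1/2) ^ n) \<longlonglongrightarrow> 0"
        by (rule tendsto_mult_right_zero[OF LIMSEQ_power_zero]) simp
      then have 2: "\<forall>\<^sub>F n in sequentially. 4 * (m * c) * (1/2) ^ n < e / 8"
        by (rule order_tendstoD(2)) (use e in simp)
      show ?thesis using 1 2
      proof eventually_elim
        case (elim n)
        show ?case
        proof (intro ballI allI)
          fix x h assume x: "x \<in> V"
          have "\<bar>h $ b * (partial b (\<lambda>x. picard n x i) x - (\<Sum>j\<in>UNIV. A b i j x * sol x j))\<bar> \<le> norm h * (e / 4)" for b
          proof -
            have "\<bar>\<Sum>j\<in>UNIV. A b i j x * (picard n x j - sol x j)\<bar> \<le> m * d"
              by (rule A_sum_bound[OF x]) (use elim(1) x in \<open>auto intro: less_imp_le\<close>)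
            then have "\<bar>rhs n b i x - (\<Sum>j\<in>UNIV. A b i j x * sol x j)\<bar> \<le> m * d"
              unfolding rhs_def by (simp add: right_diff_distrib sum_subtractf)
            moreover have "8 * \<bar>defect n b i x\<bar> \<le> e"
              using defect_bound[OF x, of n b i] elim(2) by argo
            ultimately have "4 * \<bar>partial b (\<lambda>x. picard n x i) x - (\<Sum>j\<in>UNIV. A b i j x * sol x j)\<bar> \<le> e"
              using md unfolding defect_def by argo
            then show ?thesis unfolding abs_mult
              by (intro mult_mono component_le_norm_cart) auto
          qed
          then have "\<bar>\<Sum>b\<in>UNIV. h $ b * (partial b (\<lambda>x. picard n x i) x - (\<Sum>j\<in>UNIV. A b i j x * sol x j))\<bar> \<le> real CARD(4) * (norm h * (e / 4))"
            by (rule sum_abs_le)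
          then show "norm ((\<Sum>b\<in>UNIV. h $ b * partial b (\<lambda>x. picard n x i) x) - ?g x h) \<le> e * norm h"
            by (simp add: sum_subtractf[symmetric] right_diff_distrib[symmetric] mult.commute)
        qed
      qed
    qed
  qed (rule convex_ball, rule x)
  then obtain g' where g': "\<And>x. x \<in> V \<Longrightarrow> (\<lambda>n. picard n x i) \<longlonglongrightarrow> g' x" "\<And>x. x \<in> V \<Longrightarrow> (g' has_derivative ?g x) (at x within V)" by blast
  have eq: "g' y = sol y i" if "y \<in> V" for y
    by (rule LIMSEQ_unique[OF g'(1)[OF that] tendsto_uniform_limitI[OF picard_limit that]])
  have "(g' has_derivative ?g x) (at x)" using g'(2)[OF x] at_within_open[OF x open_ball] by simp
  then show ?thesis by (rule has_derivative_transform_within_open[OF _ open_ball x]) (rule eq)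
qed

lemma sol_partial: "x \<in> V \<Longrightarrow> partial b (\<lambda>x. sol x i) x = (\<Sum>j\<in>UNIV. A b i j x * sol x j)"
  using partial_eqI[OF sol_derivative, of x b i]
  by (simp add: axis_def if_distrib[of "\<lambda>x. x * _"] cong: if_cong)

text \<open>Bootstrapping: the equation expresses the first derivatives by \<open>sol\<close> and
  smooth coefficients.\<close>

lemma sol_smooth: "smooth_on V (\<lambda>x. sol x i)"
proof -
  have d: "(\<lambda>x. sol x i) differentiable_on V" for i
    unfolding differentiable_on_def differentiable_def using sol_derivative has_derivative_at_withinI by blast
  have "\<forall>i. Ck_on n V (\<lambda>x. sol x i)" for n
  proof (induction n)
    case 0 then show ?case using differentiable_imp_continuous_on[OF d] by simp
  next
    case (Suc n)
    have "Ck_on n V (partial b (\<lambda>x. sol x i))" for b i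
    proof (rule iffD1[OF Ck_on_cong[OF open_ball]])
      have "Ck_on n V (\<lambda>x. \<Sum>j\<in>J. A b i j x * sol x j)" for J
      proof (induction J rule: infinite_finite_induct)
        case (insert j J)
        have "Ck_on n V (\<lambda>x. A b i j x * sol x j + (\<Sum>j\<in>J. A b i j x * sol x j))"
          using sA[of b i j] Suc unfolding smooth_on_def by (intro Ck_on_add Ck_on_mult insert.IH open_ball) auto
        then show ?case using insert by simp
      qed (simp_all add: Ck_on_const)
      then show "Ck_on n V (\<lambda>x. \<Sum>j\<in>UNIV. A b i j x * sol x j)" .
    qed (simp add: sol_partial)
    then show ?case using d by simp
  qed
  then show ?thesis unfolding smooth_on_def by blast
qed

lemma sol_initial: "sol p i = W0 i"
proof -
  have "picard n p i = W0 i" for n by (cases n) (simp_all add: picard_Suc)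
  then show ?thesis unfolding sol_def by simp
qed

end

text \<open>The radius depends on \<open>A\<close> only, so solutions with different initial values
  live on a common ball.\<close>

lemma linear_system_solvable:
  fixes A :: "4 \<Rightarrow> 'n::finite \<Rightarrow> 'n \<Rightarrow> real^4 \<Rightarrow> real"
  assumes S: "open S" "p \<in> S" and sA: "\<And>a i j. smooth_on S (A a i j)"
    and int: "\<And>x a b i j. x \<in> S \<Longrightarrow> partial b (A a i j) x + (\<Sum>k\<in>UNIV. A a i k x * A b k j x) =
       partial a (A b i j) x + (\<Sum>k\<in>UNIV. A b i k x * A a k j x)"
  obtains r where "r > 0" "ball p r \<subseteq> S"
    "\<forall>W0. \<exists>W. W p = W0 \<and> (\<forall>i. smooth_on (ball p r) (\<lambda>x. W x i)) \<and>
       (\<forall>x\<in>ball p r. \<forall>b i. partial b (\<lambda>x. W x i) x = (\<Sum>j\<in>UNIV. A b i j x * W x j))"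
proof -
  obtain R where R: "R > 0" "cball p R \<subseteq> S" using S open_contains_cball by blast
  have "\<exists>B. \<forall>x\<in>cball p R. \<bar>A a i j x\<bar> \<le> B" for a i j
  proof -
    have "bounded (A a i j ` cball p R)"
      by (intro compact_imp_bounded compact_continuous_image compact_cball continuous_on_subset[OF smooth_on_continuous[OF sA] R(2)])
    then show ?thesis unfolding bounded_iff by auto
  qed
  then obtain B where B: "\<And>a i j x. x \<in> cball p R \<Longrightarrow> \<bar>A a i j x\<bar> \<le> B a i j" by metis
  define M where "M = (\<Sum>a\<in>UNIV. \<Sum>i\<in>UNIV. \<Sum>j\<in>UNIV. \<bar>B a i j\<bar>)"
  have M0: "0 \<le> M" unfolding M_def by (intro sum_nonneg) auto
  have M: "\<bar>A a i j x\<bar> \<le> M" if "x \<in> cball p R" for a i j x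
  proof -
    have "\<bar>B a i j\<bar> \<le> (\<Sum>j\<in>UNIV. \<bar>B a i j\<bar>)" by (rule member_le_sum) auto
    also have "\<dots> \<le> (\<Sum>i\<in>UNIV. \<Sum>j\<in>UNIV. \<bar>B a i j\<bar>)" by (rule member_le_sum) (auto intro!: sum_nonneg)
    also have "\<dots> \<le> M" unfolding M_def by (rule member_le_sum) (auto intro!: sum_nonneg)
    finally show ?thesis using B[OF that, of a i j] by linarith
  qed
  let ?m = "real CARD('n) * M"
  define r where "r = min R (1 / (32 * (?m + 1)))"
  have m0: "0 \<le> ?m" using M0 by simp
  then have r: "r > 0" "r \<le> R" unfolding r_def using R by auto
  have sub: "ball p r \<subseteq> cball p R" using r by auto
  have "?m * r \<le> (?m + 1) * (1 / (32 * (?m + 1)))" using m0 r by (intro mult_mono) (auto simp: r_def)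
  also have "\<dots> = 1 / 32" using m0 by (simp add: add_nonneg_eq_0_iff)
  finally have small: "32 * (?m * r) \<le> 1" by simp
  have "\<exists>W. W p = W0 \<and> (\<forall>i. smooth_on (ball p r) (\<lambda>x. W x i)) \<and>
       (\<forall>x\<in>ball p r. \<forall>b i. partial b (\<lambda>x. W x i) x = (\<Sum>j\<in>UNIV. A b i j x * W x j))" for W0
  proof -
    interpret linear_system A p r M "real CARD('n) * M" "\<Sum>i\<in>UNIV. \<bar>W0 i\<bar>" W0
    proof
      show "smooth_on (ball p r) (A a i j)" for a i j
        by (rule smooth_on_subset[OF sA]) (use sub R in auto)
      show "\<bar>A a i j x\<bar> \<le> M" if "x \<in> ball p r" for a i j x using M that sub by blast
      show "partial b (A a i j) x + (\<Sum>k\<in>UNIV. A a i k x * A b k j x) =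
         partial a (A b i j) x + (\<Sum>k\<in>UNIV. A b i k x * A a k j x)" if "x \<in> ball p r" for x a b i j
        by (rule int) (use that sub R in blast)
      show "\<bar>W0 i\<bar> \<le> (\<Sum>i\<in>UNIV. \<bar>W0 i\<bar>)" for i by (rule member_le_sum) auto
    qed (use small r M0 in auto)
    show ?thesis by (intro exI[of _ sol] conjI allI ballI ext sol_initial sol_smooth sol_partial)
  qed
  from that[OF r(1) order_trans[OF sub R(2)] allI[OF this]] show ?thesis .
qed

section \<open>Spaces of constant curvature\<close>

lemma sum_option: "(\<Sum>i\<in>UNIV. f i) = f None + (\<Sum>a\<in>(UNIV :: 'a::finite set). f (Some a))"
proof -
  have "(\<Sum>i\<in>UNIV. f i) = f None + sum f (range Some)" unfolding UNIV_option_conv by (subst sum.insert) auto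
  then show ?thesis by (simp add: sum.reindex)
qed

lemma open_positive:
  assumes "open S" "smooth_on S f" shows "open {x \<in> S. 0 < f x}"
proof -
  have "open (S \<inter> f -` {0<..})" by (rule continuous_open_preimage[OF smooth_on_continuous[OF assms(2)] assms(1)]) simp
  moreover have "S \<inter> f -` {0<..} = {x \<in> S. 0 < f x}" by auto
  ultimately show ?thesis by simp
qed

context chart_metric
begin

lemma chart_metric_subset: "open V \<Longrightarrow> V \<subseteq> S \<Longrightarrow> chart_metric V g"
  by unfold_locales (use smooth_on_subset[OF smooth_g] lorentz in auto)

definition hpair :: "real^4 \<Rightarrow> (4 \<Rightarrow> real) \<Rightarrow> (4 \<Rightarrow> real) \<Rightarrow> real" where
  "hpair x X Y = (\<Sum>i\<in>UNIV. \<Sum>j\<in>UNIV. h x $ i $ j * (X i * Y j))"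

lemma hpair_sym: "x \<in> S \<Longrightarrow> hpair x X Y = hpair x Y X"
  unfolding hpair_def by (subst sum.swap) (simp add: h_sym mult_ac)

lemma hpair_left: "hpair x (\<lambda>a. X a + s * Y a) Z = hpair x X Z + s * hpair x Y Z"
  unfolding hpair_def by (simp add: algebra_simps sum.distrib sum_distrib_left)

lemma hpair_right: "hpair x Z (\<lambda>a. X a + s * Y a) = hpair x Z X + s * hpair x Z Y"
  unfolding hpair_def by (simp add: algebra_simps sum.distrib sum_distrib_left)

lemma hpair_low: "x \<in> S \<Longrightarrow> hpair x (low X x) (low Y x) = ip (g x) (X x) (Y x)"
proof -
  assume x: "x \<in> S"
  have "hpair x (low X x) (low Y x) = (\<Sum>i\<in>UNIV. low X x i * (\<Sum>j\<in>UNIV. h x $ i $ j * (\<Sum>k\<in>UNIV. g x $ j $ k * Y x $ k)))"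
    unfolding hpair_def low_def[of Y] by (simp add: sum_distrib_left mult_ac)
  then show ?thesis unfolding raise_lower[OF x] using ip_low[of x "Y x" X] ip_commute[OF lorentz[OF x]] by (simp add: mult.commute)
qed

lemma hpair_metric: "x \<in> S \<Longrightarrow> hpair x (\<lambda>i. g x $ i $ e) Y = Y e"
proof -
  assume x: "x \<in> S"
  have "hpair x (\<lambda>i. g x $ i $ e) Y = (\<Sum>j\<in>UNIV. (\<Sum>i\<in>UNIV. h x $ j $ i * g x $ i $ e) * Y j)"
    unfolding hpair_def by (subst sum.swap) (simp add: h_sym[OF x] sum_distrib_right mult.assoc)
  then show ?thesis unfolding hg[OF x] by (simp add: if_distrib[of "\<lambda>x. x * _"] cong: if_cong)
qed

end

text \<open>The system \<open>\<partial>\<^sub>b f = f\<^sub>b\<close>, \<open>\<nabla>\<^sub>b f\<^sub>a = - K f g\<^sub>a\<^sub>b\<close> for a function \<open>f\<close> (index \<open>None\<close>) and its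
  gradient; it is integrable if the curvature is the constant \<open>K\<close>.\<close>

definition hessian_system :: "metric_field \<Rightarrow> real \<Rightarrow> 4 \<Rightarrow> 4 option \<Rightarrow> 4 option \<Rightarrow> real^4 \<Rightarrow> real" where
  "hessian_system g K b i j x = (case i of
      None \<Rightarrow> (case j of None \<Rightarrow> 0 | Some a \<Rightarrow> if a = b then 1 else 0)
    | Some a \<Rightarrow> (case j of None \<Rightarrow> - (K * g x $ a $ b) | Some d \<Rightarrow> christoffel g x d b a))"

context chart_metric
begin

text \<open>The row of the function itself uses the symmetry of the metric and of
  \<open>\<Gamma>\<close>. In the gradient rows, the column of the function is metric compatibility,
  and the gradient columns are the constant curvature equation.\<close>

lemma hessian_system_integrable:
  assumes x: "x \<in> S" and R: "\<And>a b c d. riemann_up g x a b c d = K * ((if a = c then g x $ b $ d else 0) - (if a = d then g x $ b $ c else 0))"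
  shows "partial b (hessian_system g K a i j) x + (\<Sum>k\<in>UNIV. hessian_system g K a i k x * hessian_system g K b k j x) =
       partial a (hessian_system g K b i j) x + (\<Sum>k\<in>UNIV. hessian_system g K b i k x * hessian_system g K a k j x)"
proof (cases i)
  case None
  then show ?thesis
    by (cases j) (simp_all add: sum_option hessian_system_def[abs_def] g_sym[OF x, of a b] christoffel_sym[OF x, of _ a b]
      sum_negf if_distrib[of "\<lambda>x. x * _"] cong: if_cong)
next
  case (Some c)
  note m = metric_compat[OF x]
  show ?thesis
  proof (cases j)
    case None
    have p: "partial b (\<lambda>x. - (K * g x $ c $ a)) x = - (K * partial b (\<lambda>x. g x $ c $ a) x)" for a b
      by (simp add: partial_minus partial_cmult sd[OF smooth_g x] smooth_on_D[OF smooth_on_mult[OF openS smooth_on_const smooth_g] openS x])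
    have "(\<Sum>d\<in>UNIV. \<Gamma> x d a b * g x $ c $ d) = (\<Sum>d\<in>UNIV. \<Gamma> x d b a * g x $ c $ d)"
      using christoffel_sym[OF x, of _ a b] by simp
    moreover have gs: "g x $ d $ a = g x $ a $ d" for d a using g_sym[OF x] .
    ultimately show ?thesis unfolding Some None
      by (simp add: sum_option hessian_system_def[abs_def] p m algebra_simps sum_distrib_left sum_negf)
  next
    case (Some d)
    have r: "partial b (\<lambda>y. \<Gamma> y d a c) x - partial a (\<lambda>y. \<Gamma> y d b c) x
       + (\<Sum>e\<in>UNIV. \<Gamma> x d b e * \<Gamma> x e a c - \<Gamma> x d a e * \<Gamma> x e b c) = K * ((if d = b then g x $ c $ a else 0) - (if d = a then g x $ c $ b else 0))"
      using R[of d c b a] unfolding riemann_up_def .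
    show ?thesis unfolding \<open>i = Some c\<close> Some
      using r by (simp add: sum_option hessian_system_def[abs_def] sum_subtractf mult.commute algebra_simps split: if_splits)
  qed
qed

lemma smooth_hessian_system: "smooth_on S (hessian_system g K b i j)"
proof -
  have "smooth_on S (\<lambda>x. - (K * g x $ a $ b))" for a by (intro smooth_on_minus smooth_on_mult smooth_on_const smooth_g openS)
  then show ?thesis
    by (cases i; cases j) (auto simp: hessian_system_def[abs_def] intro: smooth_on_const smooth_christoffel)
qed

definition hessian_solution :: "(real^4) set \<Rightarrow> real \<Rightarrow> (real^4 \<Rightarrow> real) \<Rightarrow> (real^4 \<Rightarrow> 4 \<Rightarrow> real) \<Rightarrow> bool" where
  "hessian_solution B K f p \<longleftrightarrow> smooth_on B f \<and> (\<forall>a. smooth_on B (\<lambda>x. p x a)) \<and> (\<forall>x\<in>B. \<forall>b. partial b f x = p x b) \<and>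
     (\<forall>x\<in>B. \<forall>a b. partial b (\<lambda>x. p x a) x = (\<Sum>d\<in>UNIV. \<Gamma> x d b a * p x d) - K * f x * g x $ a $ b)"

lemma hpair_scale: "hpair x Z (\<lambda>a. s * Y a) = s * hpair x Z Y" "hpair x (\<lambda>a. s * Y a) Z = s * hpair x Y Z"
  unfolding hpair_def by (simp_all add: sum_distrib_left mult_ac)

lemma hpair_zero: "hpair x Z (\<lambda>_. 0) = 0" "hpair x (\<lambda>_. 0) Z = 0"
  unfolding hpair_def by simp_all

text \<open>The Hessian equation gives d<df, dk> = -K (f dk + k df), which is minus the differential
  of K f k.\<close>

lemma hessian_first_integral:
  assumes B: "open B" "convex B" "B \<subseteq> S" and F: "hessian_solution B K f p" and G: "hessian_solution B K k q" and x: "x \<in> B" and y: "y \<in> B"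
  shows "hpair x (p x) (q x) + K * (f x * k x) = hpair y (p y) (q y) + K * (f y * k y)"
proof -
  interpret B: chart_metric B g by (rule chart_metric_subset[OF B(1,3)])
  have sF: "smooth_on B f" "smooth_on B (\<lambda>x. p x a)" and sG: "smooth_on B k" "smooth_on B (\<lambda>x. q x a)" for a
    using F G unfolding hessian_solution_def by auto
  have dF: "partial b f x = p x b" "partial b (\<lambda>x. p x a) x = (\<Sum>d\<in>UNIV. \<Gamma> x d b a * p x d) - K * f x * g x $ a $ b"
    and dG: "partial b k x = q x b" "partial b (\<lambda>x. q x a) x = (\<Sum>d\<in>UNIV. \<Gamma> x d b a * q x d) - K * k x * g x $ a $ b"
    if "x \<in> B" for x a b using F G that unfolding hessian_solution_def by auto
  have s: "smooth_on B (\<lambda>x. p x i * q x j)" for i j by (intro smooth_on_mult B(1) sF sG)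
  have sh: "smooth_on B (\<lambda>x. hpair x (p x) (q x))" unfolding hpair_def by (intro smooth_on_sum smooth_on_mult B(1) B.smooth_h sF sG)
  define Q where "Q = (\<lambda>x. hpair x (p x) (q x) + K * (f x * k x))"
  have sQ: "smooth_on B Q" unfolding Q_def by (intro smooth_on_add smooth_on_mult smooth_on_const B(1) sh sF sG)
  have "partial b Q x = 0" if x: "x \<in> B" for b x
  proof -
    have xS: "x \<in> S" using x B by auto
    note d = smooth_on_D[OF _ B(1) x]
    have "partial b (\<lambda>x. hpair x (p x) (q x)) x = (\<Sum>i\<in>UNIV. \<Sum>j\<in>UNIV. h x $ i $ j * (partial b (\<lambda>y. p y i * q y j) x
       - (\<Sum>k\<in>UNIV. \<Gamma> x k b i * (p x k * q x j)) - (\<Sum>k\<in>UNIV. \<Gamma> x k b j * (p x i * q x k))))"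
      unfolding hpair_def by (rule B.partial_trace[OF x s])
    also have "\<dots> = (\<Sum>i\<in>UNIV. \<Sum>j\<in>UNIV. h x $ i $ j * (- (K * f x) * (g x $ i $ b * q x j) - (K * k x) * (p x i * g x $ j $ b)))"
      by (intro sum.cong refl arg_cong2[where f="(*)"])
        (simp add: partial_mult d sF sG dF[OF x] dG[OF x] algebra_simps sum_distrib_left)
    also have "\<dots> = - (K * f x) * hpair x (\<lambda>i. g x $ i $ b) (q x) - (K * k x) * hpair x (p x) (\<lambda>j. g x $ j $ b)"
      unfolding hpair_def sum_distrib_left sum_subtractf[symmetric] by (simp add: algebra_simps)
    also have "\<dots> = - (K * f x) * q x b - (K * k x) * p x b"
      unfolding hpair_sym[OF xS, of "p x"] hpair_metric[OF xS] ..
    finally have 1: "partial b (\<lambda>x. hpair x (p x) (q x)) x = - (K * f x) * q x b - (K * k x) * p x b" .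
    have 2: "partial b (\<lambda>x. K * (f x * k x)) x = K * (p x b * k x + f x * q x b)"
      using dF(1)[OF x] dG(1)[OF x] by (simp add: partial_cmult partial_mult d sF sG smooth_on_mult B(1))
    have "partial b Q x = partial b (\<lambda>x. hpair x (p x) (q x)) x + partial b (\<lambda>x. K * (f x * k x)) x"
      unfolding Q_def by (rule partial_add; rule d) (intro sh smooth_on_mult smooth_on_const B(1) sF sG)+
    then show ?thesis unfolding 1 2 by (simp add: algebra_simps)
  qed
  then have "(Q has_derivative (\<lambda>h. 0)) (at x within B)" if "x \<in> B" for x
    using has_derivative_at_withinI[OF differentiable_partial[OF smooth_on_D[OF sQ B(1) that]]] that by simp
  from has_derivative_zero_constant[OF B(2) this] obtain c where "\<forall>x\<in>B. Q x = c" by (rule exE)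
  then have "Q x = Q y" using x y by simp
  then show ?thesis unfolding Q_def .
qed

text \<open>In flat space the null hyperplanes \<open>F = const\<close> give a Kundt vector.  In general let \<open>F\<^sub>u = f\<^sub>0 + u f\<^sub>1 + u\<^sup>2 f\<^sub>2\<close>, where the
  solutions of the Hessian system are chosen so that the gradient of \<open>F\<^sub>u\<close> is null on \<open>F\<^sub>u = 0\<close>; the null hypersurfaces
  \<open>F\<^sub>u = 0\<close> foliate a neighbourhood, and \<open>l\<close> is the gradient of \<open>F\<^sub>u\<close> on them.\<close>

lemma constant_curvature_kundt:
  assumes pS: "pt \<in> S" and e: "null_frame (g pt) e"
    and R: "\<And>x a b c d. x \<in> S \<Longrightarrow> riemann_up g x a b c d = K * ((if a = c then g x $ b $ d else 0) - (if a = d then g x $ b $ c else 0))"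
  obtains V l where "open V" "pt \<in> V" "V \<subseteq> S" "\<And>i. smooth_on V (\<lambda>x. l x $ i)" "\<And>x. x \<in> V \<Longrightarrow> kundt_vector g l x"
proof -
  have int: "partial b (hessian_system g K a i j) x + (\<Sum>k\<in>UNIV. hessian_system g K a i k x * hessian_system g K b k j x) =
       partial a (hessian_system g K b i j) x + (\<Sum>k\<in>UNIV. hessian_system g K b i k x * hessian_system g K a k j x)"
    if "x \<in> S" for x a b i j by (rule hessian_system_integrable[OF that R[OF that]])
  obtain r where r: "r > 0" "ball pt r \<subseteq> S"
    and sol: "\<forall>W0. \<exists>W. W pt = W0 \<and> (\<forall>i. smooth_on (ball pt r) (\<lambda>x. W x i)) \<and>
       (\<forall>x\<in>ball pt r. \<forall>b i. partial b (\<lambda>x. W x i) x = (\<Sum>j\<in>UNIV. hessian_system g K b i j x * W x j))"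
    by (rule linear_system_solvable[where A="hessian_system g K", OF openS pS smooth_hessian_system int])
  let ?B = "ball pt r"
  have pB: "pt \<in> ?B" using r by simp
  \<comment> \<open>In the squared gradient of F_u the solution f1 contributes K u^2 and the mixed
    term of f0 and f2 contributes -2 \<open>\<kappa>\<close> u^2. With \<open>\<kappa>\<close> = K/2
    they cancel, so that |dF_u|^2 = -K F_u^2.\<close>
  define \<kappa> where "\<kappa> = K / 2"
  have K: "K = 2 * \<kappa>" unfolding \<kappa>_def by simp
  define l0 where "l0 = low (\<lambda>_. e 0) pt"
  define n0 where "n0 = low (\<lambda>_. e 1) pt"
  have S2: "\<exists>f p. f pt = c \<and> p pt = X \<and> hessian_solution ?B K f p" for c :: real and X :: "4 \<Rightarrow> real"
  proof -
    define ini where "ini i = (case i of None \<Rightarrow> c | Some a \<Rightarrow> X a)" for i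
    obtain W where W: "W pt = ini" "\<And>i. smooth_on ?B (\<lambda>x. W x i)"
       "\<And>x b i. x \<in> ?B \<Longrightarrow> partial b (\<lambda>x. W x i) x = (\<Sum>j\<in>UNIV. hessian_system g K b i j x * W x j)"
      using spec[OF sol, of ini] by blast
    have d: "partial b (\<lambda>x. W x None) x = W x (Some b)" 
      "partial b (\<lambda>x. W x (Some a)) x = (\<Sum>d\<in>UNIV. \<Gamma> x d b a * W x (Some d)) - K * W x None * g x $ a $ b" if "x \<in> ?B" for x a b
      by (simp_all only: W(3)[OF that] sum_option) (simp_all add: hessian_system_def if_distrib[of "\<lambda>x. x * _"] cong: if_cong)
    have "hessian_solution ?B K (\<lambda>x. W x None) (\<lambda>x a. W x (Some a))"
      unfolding hessian_solution_def by (intro conjI ballI allI W(2) d)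
    moreover have "W pt None = c" "(\<lambda>a. W pt (Some a)) = X" unfolding W(1) ini_def by simp_all
    ultimately show ?thesis by (intro exI[of _ "\<lambda>x. W x None"] exI[of _ "\<lambda>x a. W x (Some a)"]) simp
  qed
  obtain f0 p0 where A0: "f0 pt = 0" "p0 pt = l0" "hessian_solution ?B K f0 p0" using S2[of 0 l0] by blast
  obtain f1 p1 where A1: "f1 pt = 1" "p1 pt = (\<lambda>_. 0)" "hessian_solution ?B K f1 p1" using S2[of 1 "\<lambda>_. 0"] by blast
  obtain f2 p2 where A2: "f2 pt = 0" "p2 pt = (\<lambda>a. - \<kappa> * n0 a)" "hessian_solution ?B K f2 p2" using S2[of 0 "\<lambda>a. - \<kappa> * n0 a"] by blast
  note fi = hessian_first_integral[OF open_ball convex_ball r(2) _ _ _ pB]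
  have ll: "hpair pt l0 l0 = 0" "hpair pt l0 n0 = 1" "hpair pt n0 n0 = 0"
    unfolding l0_def n0_def hpair_low[OF pS] by (simp_all add: null_frame_ip[OF e] st01_def)
  have H: "hpair x (p0 x) (p0 x) = - K * (f0 x * f0 x)" "hpair x (p0 x) (p1 x) = - K * (f0 x * f1 x)"
    "hpair x (p0 x) (p2 x) = - \<kappa> - K * (f0 x * f2 x)" "hpair x (p1 x) (p1 x) = K - K * (f1 x * f1 x)"
    "hpair x (p1 x) (p2 x) = - K * (f1 x * f2 x)" "hpair x (p2 x) (p2 x) = - K * (f2 x * f2 x)" if x: "x \<in> ?B" for x
  proof -
    note z = A0(1,2) A1(1,2) A2(1,2) hpair_scale hpair_zero ll
    show "hpair x (p0 x) (p0 x) = - K * (f0 x * f0 x)" using fi[OF A0(3) A0(3) x] unfolding z by linarith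
    show "hpair x (p0 x) (p1 x) = - K * (f0 x * f1 x)" using fi[OF A0(3) A1(3) x] unfolding z by linarith
    show "hpair x (p0 x) (p2 x) = - \<kappa> - K * (f0 x * f2 x)" using fi[OF A0(3) A2(3) x] unfolding z by linarith
    show "hpair x (p1 x) (p1 x) = K - K * (f1 x * f1 x)" using fi[OF A1(3) A1(3) x] unfolding z by linarith
    show "hpair x (p1 x) (p2 x) = - K * (f1 x * f2 x)" using fi[OF A1(3) A2(3) x] unfolding z by linarith
    show "hpair x (p2 x) (p2 x) = - K * (f2 x * f2 x)" using fi[OF A2(3) A2(3) x] unfolding z by linarith
  qed
  have H': "hpair x (p1 x) (p0 x) = - K * (f0 x * f1 x)" "hpair x (p2 x) (p0 x) = - \<kappa> - K * (f0 x * f2 x)"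
    "hpair x (p2 x) (p1 x) = - K * (f1 x * f2 x)" if x: "x \<in> ?B" for x
    using H(2,3,5)[OF x] hpair_sym[OF subsetD[OF r(2) x], of "p1 x" "p0 x"] hpair_sym[OF subsetD[OF r(2) x], of "p2 x" "p0 x"]
      hpair_sym[OF subsetD[OF r(2) x], of "p2 x" "p1 x"] by (simp_all only:)
  have sm: "smooth_on ?B f0" "smooth_on ?B f1" "smooth_on ?B f2" "smooth_on ?B (\<lambda>x. p0 x a)" "smooth_on ?B (\<lambda>x. p1 x a)" "smooth_on ?B (\<lambda>x. p2 x a)" for a
    using A0(3) A1(3) A2(3) unfolding hessian_solution_def by auto
  define D where "D = (\<lambda>x. f1 x * f1 x - 4 * (f0 x * f2 x))"
  have sD: "smooth_on ?B D" unfolding D_def by (intro smooth_on_diff smooth_on_mult smooth_on_const open_ball sm)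
  define V2 where "V2 = {x \<in> ?B. 0 < f1 x}"
  have o2: "open V2" "V2 \<subseteq> ?B" unfolding V2_def using open_positive[OF open_ball sm(2)] by auto
  define V1 where "V1 = {x \<in> V2. 0 < D x}"
  have o1: "open V1" "V1 \<subseteq> ?B" unfolding V1_def using open_positive[OF o2(1) smooth_on_subset[OF sD o2]] o2(2) by auto
  have pos: "f1 x > 0" "D x > 0" if "x \<in> V1" for x using that unfolding V1_def V2_def by auto
  define t where "t = (\<lambda>x. f1 x + sqrt (D x))"
  have tp: "t x > 0" if "x \<in> V1" for x unfolding t_def using pos[OF that] by (simp add: add_pos_pos)
  note sm1 = sm[THEN smooth_on_subset[OF _ o1]]
  have st: "smooth_on V1 t" unfolding t_def by (intro smooth_on_add smooth_on_sqrt o1(1) sm1 pos smooth_on_subset[OF sD o1])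
  \<comment> \<open>The root of F_u(x) = 0 that vanishes together with f0, written without division
    by f2, which is 0 at \<open>pt\<close>.\<close>
  define u where "u = (\<lambda>x. (- 2 * f0 x) / t x)"
  have su: "smooth_on V1 u" unfolding u_def
    by (intro smooth_on_divide smooth_on_mult smooth_on_const o1(1) sm1 st) (use tp in force)
  have F0: "f0 x + u x * f1 x + u x * u x * f2 x = 0" if x: "x \<in> V1" for x
  proof -
    have ut: "u x * t x = - 2 * f0 x" unfolding u_def using tp[OF x] by simp
    have "(t x - f1 x) * (t x - f1 x) = D x" unfolding t_def using pos[OF x] by simp
    then have "f0 x * t x * t x + (u x * t x) * f1 x * t x + (u x * t x) * (u x * t x) * f2 x = 0"
      unfolding ut D_def by algebra
    then have "(f0 x + u x * f1 x + u x * u x * f2 x) * (t x * t x) = 0" by (simp add: algebra_simps)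
    then show ?thesis using tp[OF x] by simp
  qed
  \<comment> \<open>The derivative of F_u with respect to u; at the root its square is the
    discriminant \<open>D\<close>.\<close>
  define qq where "qq = (\<lambda>x. f1 x + 2 * u x * f2 x)"
  have qq0: "qq x \<noteq> 0" if x: "x \<in> V1" for x
  proof
    assume "qq x = 0"
    then have "D x = 0" unfolding D_def qq_def using F0[OF x] by algebra
    then show False using pos[OF x] by simp
  qed
  \<comment> \<open>\<open>cov\<close> is the gradient of F_u for fixed u, taken at the root, and
    \<open>hh\<close> is its derivative with respect to u.\<close>
  define cov where "cov = (\<lambda>x a. (p0 x a + u x * p1 x a) + (u x * u x) * p2 x a)"
  define hh where "hh = (\<lambda>x a. p1 x a + (2 * u x) * p2 x a)"
  have sc: "smooth_on V1 (\<lambda>x. cov x a)" for a unfolding cov_def by (intro smooth_on_add smooth_on_mult o1(1) sm1 su)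
  have "f0 pt = 0" by (rule A0(1))
  then have up: "u pt = 0" unfolding u_def by simp
  have cp: "cov pt = l0" unfolding cov_def up A0(2) by simp
  have "\<exists>a0. l0 a0 \<noteq> 0"
  proof (rule ccontr)
    assume "\<not> ?thesis"
    then have "l0 = (\<lambda>_. 0)" by auto
    then show False using ll(2) hpair_zero by simp
  qed
  then obtain a0 where a0: "l0 a0 \<noteq> 0" by blast
  \<comment> \<open>The condition on the component \<open>a0\<close> keeps \<open>cov\<close>, and
    with it \<open>l\<close>, from vanishing.\<close>
  define V where "V = {x \<in> V1. 0 < cov x a0 * cov x a0}"
  have oV: "open V" "V \<subseteq> V1" unfolding V_def using open_positive[OF o1(1) smooth_on_mult[OF o1(1) sc sc]] by auto
  have VS: "V \<subseteq> S" using oV o1 r by blast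
  have pV: "pt \<in> V" unfolding V_def V1_def V2_def using a0 pB A1(1) A0(1)
    by (simp add: cp D_def not_sum_squares_lt_zero zero_less_mult_iff linorder_neq_iff) auto
  define l where "l = (\<lambda>x. \<chi> k. \<Sum>c\<in>UNIV. h x $ k $ c * cov x c)"
  interpret V: chart_metric V g by (rule chart_metric_subset[OF oV(1) VS])
  have sl: "smooth_on V (\<lambda>x. l x $ i)" for i unfolding l_def vec_lambda_beta
    by (intro smooth_on_sum smooth_on_mult oV(1) V.smooth_h smooth_on_subset[OF sc oV])
  have low_l: "low l x = cov x" if "x \<in> S" for x
    unfolding low_def l_def fun_eq_iff vec_lambda_beta using lower_raise[OF that] by blast
  have "kundt_vector g l x" if x: "x \<in> V" for x
  proof -
    have x1: "x \<in> V1" and xB: "x \<in> ?B" and xS: "x \<in> S" using x oV o1 VS by auto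
    have F: "f0 x + u x * f1 x + u x * u x * f2 x = 0" by (rule F0[OF x1])
    note d = smooth_on_D[OF _ o1(1) x1]
    note dd = d[OF sm1(1)] d[OF sm1(2)] d[OF sm1(3)] d[OF sm1(4)] d[OF sm1(5)] d[OF sm1(6)] d[OF su]
    note E0 = A0(3)[unfolded hessian_solution_def] and E1 = A1(3)[unfolded hessian_solution_def] and E2 = A2(3)[unfolded hessian_solution_def]
    have df: "partial b f0 x = p0 x b" "partial b f1 x = p1 x b" "partial b f2 x = p2 x b" for b
      by (rule E0[THEN conjunct2, THEN conjunct2, THEN conjunct1, THEN bspec[OF _ xB], THEN spec]
        E1[THEN conjunct2, THEN conjunct2, THEN conjunct1, THEN bspec[OF _ xB], THEN spec]
        E2[THEN conjunct2, THEN conjunct2, THEN conjunct1, THEN bspec[OF _ xB], THEN spec])+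
    have dp: "partial b (\<lambda>x. p0 x a) x = (\<Sum>d\<in>UNIV. \<Gamma> x d b a * p0 x d) - K * f0 x * g x $ a $ b"
      "partial b (\<lambda>x. p1 x a) x = (\<Sum>d\<in>UNIV. \<Gamma> x d b a * p1 x d) - K * f1 x * g x $ a $ b"
      "partial b (\<lambda>x. p2 x a) x = (\<Sum>d\<in>UNIV. \<Gamma> x d b a * p2 x d) - K * f2 x * g x $ a $ b" for a b
      by (rule E0[THEN conjunct2, THEN conjunct2, THEN conjunct2, THEN bspec[OF _ xB], THEN spec, THEN spec]
        E1[THEN conjunct2, THEN conjunct2, THEN conjunct2, THEN bspec[OF _ xB], THEN spec, THEN spec]
        E2[THEN conjunct2, THEN conjunct2, THEN conjunct2, THEN bspec[OF _ xB], THEN spec, THEN spec])+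
    \<comment> \<open>Implicit differentiation of F_u(x) = 0.\<close>
    have du: "partial b u x = - cov x b / qq x" for b
    proof -
      have "0 = partial b (\<lambda>y. 0) x" by simp
      also have "\<dots> = partial b (\<lambda>y. (f0 y + u y * f1 y) + (u y * u y) * f2 y) x"
        by (rule partial_cong[OF o1(1) x1]) (simp add: F0)
      also have "\<dots> = (p0 x b + (partial b u x * f1 x + u x * p1 x b)) + ((partial b u x * u x + u x * partial b u x) * f2 x + (u x * u x) * p2 x b)"
        by (simp add: partial_add partial_mult differentiable_mult differentiable_add dd df)
      also have "\<dots> = cov x b + partial b u x * qq x" unfolding cov_def qq_def by (simp add: algebra_simps)
      finally show ?thesis using qq0[OF x1] by (simp add: field_simps)
    qed
    \<comment> \<open>The Hessians add up to -K F_u g, which is 0 at the root. What remains is the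
      variation of u, whose gradient is a multiple of \<open>cov\<close>.\<close>
    have "cov_low g l x a b = low l x a * 0 + (- hh x a / qq x) * low l x b" for a b
    proof -
      have gl: "(g y *v l y) $ c = low l y c" for y c unfolding low_def by (simp add: matrix_vector_mult_def)
      have "partial b (\<lambda>y. low l y a) x = partial b (\<lambda>y. cov y a) x"
        by (rule partial_cong[OF oV(1) x]) (use low_l VS in auto)
      also have "\<dots> = (partial b (\<lambda>x. p0 x a) x + (partial b u x * p1 x a + u x * partial b (\<lambda>x. p1 x a) x))
          + ((partial b u x * u x + u x * partial b u x) * p2 x a + (u x * u x) * partial b (\<lambda>x. p2 x a) x)"
        unfolding cov_def by (simp add: partial_add partial_mult differentiable_mult differentiable_add dd)
      finally have pc: "partial b (\<lambda>y. low l y a) x = \<dots>" .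
      have "cov_low g l x a b = partial b (\<lambda>y. low l y a) x - (\<Sum>d\<in>UNIV. \<Gamma> x d b a * low l x d)"
        unfolding cov_low_def gl by simp
      also have "(\<Sum>d\<in>UNIV. \<Gamma> x d b a * low l x d) = (\<Sum>d\<in>UNIV. \<Gamma> x d b a * p0 x d) + u x * (\<Sum>d\<in>UNIV. \<Gamma> x d b a * p1 x d) + (u x * u x) * (\<Sum>d\<in>UNIV. \<Gamma> x d b a * p2 x d)"
        unfolding low_l[OF xS] cov_def by (simp add: distrib_left sum.distrib sum_distrib_left mult_ac)
      also have "partial b (\<lambda>y. low l y a) x - \<dots> = partial b u x * hh x a - K * g x $ a $ b * (f0 x + u x * f1 x + u x * u x * f2 x)"
        unfolding pc dp hh_def by (simp add: algebra_simps)
      finally show ?thesis unfolding F du low_l[OF xS] by simp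
    qed
    note M = this
    \<comment> \<open>This is |dF_u|^2 = -K F_u^2; \<open>lh\<close> is half of its derivative with
      respect to u.\<close>
    have nn: "hpair x (cov x) (cov x) = 0"
    proof -
      have "hpair x (cov x) (cov x) = - K * ((f0 x + u x * f1 x + u x * u x * f2 x) * (f0 x + u x * f1 x + u x * u x * f2 x))"
        unfolding cov_def hpair_left hpair_right H[OF xB] H'[OF xB] K by (simp add: algebra_simps)
      then show ?thesis unfolding F by simp
    qed
    have lh: "hpair x (hh x) (cov x) = 0"
    proof -
      have "hpair x (hh x) (cov x) = - K * ((f0 x + u x * f1 x + u x * u x * f2 x) * qq x)"
        unfolding cov_def hh_def qq_def hpair_left hpair_right H[OF xB] H'[OF xB] K by (simp add: algebra_simps)
      then show ?thesis unfolding F by simp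
    qed
    have "cov x a0 \<noteq> 0" using x unfolding V_def by auto
    then have "l x \<noteq> 0" using fun_cong[OF low_l[OF xS], of a0] unfolding low_def by auto
    moreover have "ip (g x) (l x) (l x) = 0" unfolding hpair_low[OF xS, symmetric] low_l[OF xS] by (rule nn)
    ultimately have "null_vector (g x) (l x)" unfolding null_vector_def by simp
    moreover have "(\<Sum>a\<in>UNIV. l x $ a * (- hh x a / qq x)) = - hpair x (hh x) (cov x) / qq x"
    proof -
      have "hpair x (hh x) (cov x) = (\<Sum>a\<in>UNIV. l x $ a * hh x a)"
        unfolding hpair_def l_def by (simp add: sum_distrib_left sum_distrib_right mult_ac)
      then show ?thesis by (simp add: sum_divide_distrib sum_negf)
    qed
    ultimately show ?thesis unfolding lh by (intro kundt_vectorI[OF xS _ M]) simp_all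
  qed
  from that[OF oV(1) pV VS sl this] show ?thesis .
qed

end

section \<open>Local Kundt fields for the types N, III and O\<close>

lemma tev_sum1: "tev vs (\<lambda>I. \<Sum>k\<in>K. T k I) = (\<Sum>k\<in>K. tev vs (T k))"
  using tev_sum[where q="\<lambda>_. 1" and T=T and K=K and vs=vs] by simp

context einstein_vsi
begin

lemma einstein_vsi_subset: assumes "open V" "V \<subseteq> S" shows "einstein_vsi V g lam"
proof -
  interpret V: chart_metric V g by (rule chart_metric_subset[OF assms])
  show ?thesis by unfold_locales (use ric inv assms(2) in auto)
qed

lemma rescaled_frame:
  assumes x: "x \<in> S" and E: "null_frame (g x) E" and c: "c \<noteq> 0"
  obtains E' s where "null_frame (g x) E'" "E' 0 = c *\<^sub>R E 0"
    "\<And>i j k l. frame_array E' (Cw x) i j k l = s i * s j * s k * s l * frame_array E (Cw x) i j k l"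
    "\<And>i::4. s i \<noteq> (0::real)"
  using that[OF frame_rescale(1)[OF E c lorentz[OF x]] _ frame_rescale(2)[OF E c lorentz[OF x]]] c by simp

lemma rescaled_order_le: "(\<And>i j k l. X i j k l = s i * s j * s k * s l * Y i j k l) \<Longrightarrow> order_le Y n \<Longrightarrow> order_le X n"
  unfolding order_le_def by auto

lemma vnorm_type_N:
  assumes x: "x \<in> S" and E: "null_frame (g x) E" and ord: "order_le (frame_array E (Cw x)) (-2)"
  defines "A \<equiv> frame_array E (Cw x)"
  shows "vnorm v x = ip (g x) v (E 0) ^ 4 *
    (A 1 2 1 2 * A 1 2 1 2 + A 1 2 1 3 * A 1 2 1 3 + A 1 3 1 2 * A 1 3 1 2 + A 1 3 1 3 * A 1 3 1 3)"
proof -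
  note tc = type_N_component[OF x E ord, folded A_def]
  have 0: "tev [v, E 0, v, a] (Cw x) = 0" "tev [v, a, v, E 0] (Cw x) = 0" if "a \<in> range E" for a
    using tc[of v 0 v] tc[of v _ v 0] that by (auto simp del: tev.simps)
  have ii: "tev [v, E i, v, E j] (Cw x) = ip (g x) v (E 0) * ip (g x) v (E 0) * A 1 i 1 j" if "i \<in> {2,3}" "j \<in> {2,3}" for i j
    using tc[of v i v j] that by (simp del: tev.simps)
  have "vnorm v x = (\<Sum>a\<in>UNIV. \<Sum>b\<in>UNIV. tev [E a, E b] (vC v x) * tev [E (st01 a), E (st01 b)] (vC v x))"
    unfolding vnorm_def by (rule frame_norm2[OF null_pairing[OF x E]])
  then show ?thesis unfolding vC_tev sum_4'
    by (simp add: 0 ii st01_def power4_eq_xxxx algebra_simps del: tev.simps)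
qed

text \<open>The frames \<open>E\<close> are mere choices; only their null direction is made smooth,
  as \<open>w\<close>, and \<open>w\<close> is then rescaled to meet \<open>norm\<close> of
  \<open>type_N_kundt\<close>.\<close>

lemma type_N_local:
  assumes pS: "pt \<in> S" and N: "\<And>x. x \<in> S \<Longrightarrow> petrov_type (g x) (Cw x) = Petrov_N"
  obtains V l where "open V" "pt \<in> V" "V \<subseteq> S" "\<And>i. smooth_on V (\<lambda>x. l x $ i)" "\<And>x. x \<in> V \<Longrightarrow> kundt_vector g l x"
proof -
  have "\<exists>e. null_frame (g x) e \<and> order_le (frame_array e (Cw x)) (-2) \<and> (frame_array e (Cw x) 1 2 1 2 \<noteq> 0 \<or> frame_array e (Cw x) 1 2 1 3 \<noteq> 0)"
    if "x \<in> S" for x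
    using petrov_N_frame[OF N[OF that] lorentz[OF that] wsC[OF that]] by metis
  then obtain E where E: "\<And>x. x \<in> S \<Longrightarrow> null_frame (g x) (E x)" "\<And>x. x \<in> S \<Longrightarrow> order_le (frame_array (E x) (Cw x)) (-2)"
    "\<And>x. x \<in> S \<Longrightarrow> frame_array (E x) (Cw x) 1 2 1 2 \<noteq> 0 \<or> frame_array (E x) (Cw x) 1 2 1 3 \<noteq> 0" by metis
  obtain V0 w where V0: "open V0" "pt \<in> V0" "V0 \<subseteq> S" and w: "\<And>i. smooth_on V0 (\<lambda>x. w x $ i)"
    "\<And>x. x \<in> V0 \<Longrightarrow> \<exists>c. c \<noteq> 0 \<and> w x = c *\<^sub>R E x 0"
    by (rule null_direction_field[where N=Cw, OF sC pS E(1) weyl_Ca[OF _ E(1)] E(2) E(3)[OF pS]]) blast+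
  interpret V0: einstein_vsi V0 g lam by (rule einstein_vsi_subset[OF V0(1,3)])
  have ipc: "ip G (a *\<^sub>R u) (b *\<^sub>R u') = a * b * ip G u u'" "ip G u (b *\<^sub>R u') = b * ip G u u'" for G a b u u'
    by (simp_all add: ip_def matrix_vector_mult_scaleR)
  obtain c0 where c0: "c0 \<noteq> 0" "w pt = c0 *\<^sub>R E pt 0" using w(2)[OF V0(2)] by blast
  \<comment> \<open>The factor \<open>c0\<close> makes v.w equal to c0^2 at \<open>pt\<close>, hence
    positive nearby.\<close>
  define v where "v = c0 *\<^sub>R E pt 1"
  define X where "X = (\<lambda>x. ip (g x) v (w x))"
  have sX: "smooth_on V0 X" unfolding X_def[abs_def] by (rule V0.smooth_ip[OF w(1)])
  define V where "V = {x \<in> V0. 0 < X x}"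
  have oV: "open V" unfolding V_def by (rule open_positive[OF V0(1) sX])
  have "X pt = c0 * c0" unfolding X_def v_def c0(2) ipc(1) by (simp add: null_frame_ip[OF E(1)[OF pS]] st01_def)
  then have pV: "pt \<in> V" unfolding V_def using V0(2) c0(1) by (simp add: not_sum_squares_lt_zero zero_less_mult_iff) (metis linorder_neqE_linordered_idom)
  have VV0: "V \<subseteq> V0" unfolding V_def by auto
  then have VS: "V \<subseteq> S" using V0(3) by auto
  interpret V: einstein_vsi V g lam by (rule einstein_vsi_subset[OF oV VS])
  have Xp: "X x > 0" if "x \<in> V" for x using that unfolding V_def by simp
  have vn: "vnorm v x > 0" if x: "x \<in> V" for x
  proof -
    have xS: "x \<in> S" using x VS by auto
    obtain c where c: "c \<noteq> 0" "w x = c *\<^sub>R E x 0" using w(2) x VV0 by blast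
    have "ip (g x) v (E x 0) \<noteq> 0" using Xp[OF x] unfolding X_def c(2) ipc by auto
    then have "ip (g x) v (E x 0) ^ 4 > 0" by (simp add: zero_less_power_eq)
    moreover have "p * p + q * q + r + s * s > 0" if "p \<noteq> 0 \<or> q \<noteq> 0" "r \<ge> 0" for p q r s :: real
      using that sum_squares_gt_zero_iff[of p q] zero_le_square[of s] by linarith
    ultimately show ?thesis unfolding vnorm_type_N[OF xS E(1,2)[OF xS]]
      by (intro mult_pos_pos) (use E(3)[OF xS] in auto)
  qed
  \<comment> \<open>\<open>vnorm v\<close> does not depend on l, while v.l scales linearly; this
    factor achieves (v.l)^4 = \<open>vnorm v\<close>.\<close>
  define k where "k = (\<lambda>x. sqrt (sqrt (vnorm v x)) / X x)"
  define l where "l = (\<lambda>x. k x *\<^sub>R w x)"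
  have sk: "smooth_on V k" unfolding k_def[abs_def]
    by (intro smooth_on_divide smooth_on_sqrt oV smooth_on_subset[OF smooth_vnorm oV VS] smooth_on_subset[OF sX oV VV0])
      (use vn Xp in \<open>auto simp: less_imp_neq[symmetric]\<close>)
  have sl: "smooth_on V (\<lambda>x. l x $ i)" for i
    unfolding l_def vector_scaleR_component real_scaleR_def by (intro smooth_on_mult oV sk) (simp add: smooth_on_subset[OF w(1) oV VV0])
  have kp: "k x > 0" if "x \<in> V" for x unfolding k_def using vn[OF that] Xp[OF that] by simp
  have vl: "ip (g x) v (l x) = sqrt (sqrt (vnorm v x))" if "x \<in> V" for x
    unfolding l_def ipc using Xp[OF that] by (simp add: k_def X_def)
  have "\<exists>E'. null_frame (g x) E' \<and> E' 0 = l x \<and> order_le (frame_array E' (Cw x)) (-2) \<and> (frame_array E' (Cw x) 1 2 1 2 \<noteq> 0 \<or> frame_array E' (Cw x) 1 2 1 3 \<noteq> 0)"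
    if x: "x \<in> V" for x
  proof -
    have xS: "x \<in> S" using x VS by auto
    obtain c where c: "c \<noteq> 0" "w x = c *\<^sub>R E x 0" using w(2) x VV0 by blast
    have kc: "k x * c \<noteq> 0" using c kp[OF x] by simp
    obtain E' s where E': "null_frame (g x) E'" "E' 0 = (k x * c) *\<^sub>R E x 0"
      "\<And>i j k l. frame_array E' (Cw x) i j k l = s i * s j * s k * s l * frame_array (E x) (Cw x) i j k l" "\<And>i::4. s i \<noteq> (0::real)"
      by (rule rescaled_frame[OF xS E(1)[OF xS] kc]) blast
    have o: "order_le (frame_array E' (Cw x)) (-2)" by (rule rescaled_order_le[OF E'(3) E(2)[OF xS]])
    show ?thesis by (intro exI[of _ E'] conjI E'(1) o) (use E(3)[OF xS] in \<open>auto simp: E'(2-4) l_def c(2)\<close>)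
  qed
  then obtain E' where E': "\<And>x. x \<in> V \<Longrightarrow> null_frame (g x) (E' x)" "\<And>x. x \<in> V \<Longrightarrow> E' x 0 = l x" "\<And>x. x \<in> V \<Longrightarrow> order_le (frame_array (E' x) (Cw x)) (-2)"
    "\<And>x. x \<in> V \<Longrightarrow> frame_array (E' x) (Cw x) 1 2 1 2 \<noteq> 0 \<or> frame_array (E' x) (Cw x) 1 2 1 3 \<noteq> 0" by metis
  have "kundt_vector g l x" if x: "x \<in> V" for x
  proof (rule V.type_N_kundt[where E=E' and v=v, OF sl E' _ _ x])
    show "ip (g y) v (l y) \<noteq> 0" if "y \<in> V" for y unfolding vl[OF that] using vn[OF that] by simp
    show "vnorm v y = ip (g y) v (l y) ^ 4" if "y \<in> V" for y
    proof -
      have "sqrt (sqrt (vnorm v y)) ^ 4 = (sqrt (sqrt (vnorm v y)) ^ 2) ^ 2" by simp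
      also have "\<dots> = vnorm v y" using vn[OF that] by simp
      finally show ?thesis unfolding vl[OF that] by simp
    qed
  qed
  from that[OF oV pV VS sl this] show ?thesis .
qed

text \<open>In type III the Weyl tensor does not map bivectors to null bivectors, but its square
  does: \<open>Q\<close> is nilpotent of index 3, so Q^2 has rank one, and its image is the null
  bivector of the multiple direction.\<close>

lemma type_III_local:
  assumes pS: "pt \<in> S" and III: "\<And>x. x \<in> S \<Longrightarrow> petrov_type (g x) (Cw x) = Petrov_III"
  obtains V l where "open V" "pt \<in> V" "V \<subseteq> S" "\<And>i. smooth_on V (\<lambda>x. l x $ i)" "\<And>x. x \<in> V \<Longrightarrow> kundt_vector g l x"
proof -
  have "\<exists>e. null_frame (g x) e \<and> order_le (frame_array e (Cw x)) (-1) \<and> (frame_array e (Cw x) 0 1 1 2 \<noteq> 0 \<or> frame_array e (Cw x) 0 1 1 3 \<noteq> 0)"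
    if "x \<in> S" for x
    using petrov_III_frame[OF III[OF that] lorentz[OF that] wsC[OF that]] by metis
  then obtain E where E: "\<And>x. x \<in> S \<Longrightarrow> null_frame (g x) (E x)" "\<And>x. x \<in> S \<Longrightarrow> order_le (frame_array (E x) (Cw x)) (-1)"
    "\<And>x. x \<in> S \<Longrightarrow> frame_array (E x) (Cw x) 0 1 1 2 \<noteq> 0 \<or> frame_array (E x) (Cw x) 0 1 1 3 \<noteq> 0" by metis
  define v where "v = E pt 1"
  define u where "u = E pt 2"
  \<comment> \<open>The square of the Weyl tensor with one index pair filled by the constant vectors
    \<open>v\<close> and \<open>u\<close>.\<close>
  define B where "B = (\<lambda>x I. \<Sum>i\<in>UNIV. \<Sum>j\<in>UNIV. h x $ i $ j * (\<Sum>k\<in>UNIV. \<Sum>m\<in>UNIV. h x $ k $ m * (ctr u (ctr v (Cw x)) [i,k] * Cw x (I @ [j,m]))))"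
  have sB: "smooth_on S (\<lambda>x. B x I)" for I
    unfolding B_def ctr_def by (intro smooth_on_sum smooth_on_mult smooth_on_const openS smooth_h sC)
  define f where "f = (\<lambda>x a b. tev [E x a, E x b] (B x))"
  define P where "P = (\<lambda>x i j. tev [v, u, E x i, E x j] (Cw x))"
  define A where "A x = frame_array (E x) (Cw x)" for x
  note AD = order_leD[OF E(2), folded A_def]
  note wA = weyl_array_comps[OF weyl_Ca[OF _ E(1)], folded A_def]
  have Pz: "P x i j = 0" if x: "x \<in> S" and ij: "bw1 i + bw1 j > 0" for x i j
  proof -
    have z: "A x c d i j = 0" for c d
    proof (cases "c = 1 \<and> d = 1")
      case True then show ?thesis using wA(12)[OF x x] by simp
    next
      case False then show ?thesis using ij by (intro AD[OF x]) (auto simp: bw1_def split: if_splits)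
    qed
    have "tev [E x c, E x d, E x i, E x j] (Cw x) = 0" for c d using z unfolding A_def frame_array_def .
    then have "tev [E x c, u, E x i, E x j] (Cw x) = 0" for c
      using tev_expand[OF E(1)[OF x] lorentz[OF x], of "[E x c]" u "[E x i, E x j]"] by (simp del: tev.simps)
    then show ?thesis unfolding P_def using tev_expand[OF E(1)[OF x] lorentz[OF x], of "[]" v "[u, E x i, E x j]"] by (simp del: tev.simps)
  qed
  have f: "f x a b = (\<Sum>i\<in>UNIV. \<Sum>j\<in>UNIV. P x i j * A x a b (st01 i) (st01 j))" if x: "x \<in> S" for x a b
  proof -
    have "B x = (\<lambda>I. \<Sum>i\<in>UNIV. \<Sum>j\<in>UNIV. P x i j * tev [E x (st01 i), E x (st01 j)] (\<lambda>J. Cw x (I @ J)))"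
      unfolding B_def frame_norm2[OF null_pairing[OF x E(1)[OF x]], where Y="\<lambda>J. Cw x (_ @ J)"] P_def
      by (simp only: tev_ctr[of v] tev_ctr[of u])
    then have "f x a b = (\<Sum>i\<in>UNIV. \<Sum>j\<in>UNIV. P x i j * tev [E x a, E x b] (\<lambda>I. tev [E x (st01 i), E x (st01 j)] (\<lambda>J. Cw x (I @ J))))"
      unfolding f_def by (simp only: tev_sum1 tev_scale)
    then show ?thesis unfolding A_def frame_array_def by simp
  qed
  have Pii: "P x i i = 0" if x: "x \<in> S" for x i
  proof -
    have "tev [E x c, E x d, E x i, E x i] (Cw x) = 0" for c d using wA(13)[OF x x] unfolding A_def frame_array_def .
    then have "tev [E x c, u, E x i, E x i] (Cw x) = 0" for c
      using tev_expand[OF E(1)[OF x] lorentz[OF x], of "[E x c]" u "[E x i, E x i]"] by (simp del: tev.simps)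
    then show ?thesis unfolding P_def using tev_expand[OF E(1)[OF x] lorentz[OF x], of "[]" v "[u, E x i, E x i]"] by (simp del: tev.simps)
  qed
  have Az: "A x a b 0 i = 0" "A x a b i 0 = 0" if x: "x \<in> S" and i: "i \<in> {2,3}" for x a b i
  proof -
    show "A x a b 0 i = 0"
    proof (cases "a = 1 \<and> b = 1")
      case True then show ?thesis using wA(12)[OF x x] by simp
    next
      case False then show ?thesis using i by (intro AD[OF x]) (auto simp: bw1_def split: if_splits)
    qed
    then show "A x a b i 0 = 0" using wA(15)[OF x x, of a b 0 i] by simp
  qed
  have f': "f x a b = P x 0 1 * A x a b 1 0 + P x 1 0 * A x a b 0 1 + P x 2 3 * A x a b 2 3 + P x 3 2 * A x a b 3 2" if x: "x \<in> S" for x a b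
    unfolding f[OF x] sum_4' by (simp add: Pz[OF x] Pii[OF x] Az[OF x] st01_def bw1_def)
  have fz: "f x a b = 0" if x: "x \<in> S" and ab: "bw1 a + bw1 b \<ge> 0" for x a b
    unfolding f'[OF x] using ab by (simp add: AD[OF x] bw1_def)
  \<comment> \<open>Here f_12 + i f_13 = 2 (m3 - i m2)^2.\<close>
  have fpt: "f pt 1 2 \<noteq> 0 \<or> f pt 1 3 \<noteq> 0"
  proof -
    define m2 m3 where "m2 = A pt 0 1 1 2" and "m3 = A pt 0 1 1 3"
    have PA: "P pt i j = A pt 1 2 i j" for i j unfolding P_def A_def frame_array_def v_def u_def ..
    note w = wA[OF pS pS]
    have v: "A pt 1 2 0 1 = m2" "A pt 1 3 0 1 = m3" "A pt 1 2 2 3 = m3" "A pt 1 3 2 3 = - m2"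
      using w(16)[of 1 2 0 1] w(16)[of 1 3 0 1] w(9,10) by (simp_all add: m2_def m3_def)
    have v': "A pt 1 2 1 0 = - m2" "A pt 1 3 1 0 = - m3" "A pt 1 2 3 2 = - m3" "A pt 1 3 3 2 = m2"
      using w(15)[of 1 2 0 1] w(15)[of 1 3 0 1] w(15)[of 1 2 2 3] w(15)[of 1 3 2 3] v by simp_all
    have "f pt 1 2 = 2 * (m3 * m3 - m2 * m2)" "f pt 1 3 = - 4 * (m2 * m3)"
      unfolding f'[OF pS] PA v v' by simp_all
    moreover have "m2 \<noteq> 0 \<or> m3 \<noteq> 0" using E(3)[OF pS] unfolding m2_def m3_def A_def .
    ultimately show ?thesis by auto
  qed
  obtain V0 w where V0: "open V0" "pt \<in> V0" "V0 \<subseteq> S" and w: "\<And>i. smooth_on V0 (\<lambda>x. w x $ i)"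
    "\<And>x. x \<in> V0 \<Longrightarrow> \<exists>c. c \<noteq> 0 \<and> w x = c *\<^sub>R E x 0"
  proof (rule null_bivector_direction[OF sB pS E(1)])
    show "tev [E x 0, E x b] (B x) = 0" "tev [E x b, E x 0] (B x) = 0" if "x \<in> S" for x b
      using fz[OF that, of 0 b] fz[OF that, of b 0] unfolding f_def by (auto simp: bw1_def simp del: tev.simps)
    show "tev [E x 1, E x 1] (B x) = 0" if "x \<in> S" for x
      using f'[OF that, of 1 1] wA(12)[OF that that] unfolding f_def by (simp del: tev.simps)
    show "tev [E x a, E x b] (B x) = 0" if "x \<in> S" "a \<in> {2,3}" "b \<in> {2,3}" for x a b
      using fz[OF that(1), of a b] that(2,3) unfolding f_def by (auto simp: bw1_def simp del: tev.simps)
    show "tev [E pt 1, E pt 2] (B pt) \<noteq> 0 \<or> tev [E pt 1, E pt 3] (B pt) \<noteq> 0" using fpt unfolding f_def .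
  qed blast+
  interpret V0: einstein_vsi V0 g lam by (rule einstein_vsi_subset[OF V0(1,3)])
  have ipc: "ip G u (b *\<^sub>R u') = b * ip G u u'" for G b u u'
    by (simp add: ip_def matrix_vector_mult_scaleR)
  obtain c0 where c0: "c0 \<noteq> 0" "w pt = c0 *\<^sub>R E pt 0" using w(2)[OF V0(2)] by blast
  define z where "z = E pt 1"
  define V where "V = {x \<in> V0. ip (g x) z (w x) \<noteq> 0}"
  have oV: "open V" unfolding V_def by (rule V0.open_nonzero[OF V0.smooth_ip[OF w(1)]])
  have pV: "pt \<in> V" using V0(2) c0(1) by (simp add: V_def z_def c0(2) ipc null_frame_ip[OF E(1)[OF pS]] st01_def)
  have VV0: "V \<subseteq> V0" unfolding V_def by auto
  then have VS: "V \<subseteq> S" using V0(3) by auto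
  interpret V: einstein_vsi V g lam by (rule einstein_vsi_subset[OF oV VS])
  have zw: "ip (g x) z (w x) \<noteq> 0" if "x \<in> V" for x using that unfolding V_def by simp
  have sw: "smooth_on V (\<lambda>x. w x $ i)" for i by (rule smooth_on_subset[OF w(1) oV VV0])
  have frame: "\<exists>E'. null_frame (g x) E' \<and> E' 0 = k *\<^sub>R w x \<and> order_le (frame_array E' (Cw x)) (-1) \<and> (frame_array E' (Cw x) 0 1 1 2 \<noteq> 0 \<or> frame_array E' (Cw x) 0 1 1 3 \<noteq> 0)"
    if x: "x \<in> V" and k: "k \<noteq> 0" for x k
  proof -
    have xS: "x \<in> S" using x VS by auto
    obtain c where c: "c \<noteq> 0" "w x = c *\<^sub>R E x 0" using w(2) x VV0 by blast
    have kc: "k * c \<noteq> 0" using c k by simp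
    obtain E' s where E': "null_frame (g x) E'" "E' 0 = (k * c) *\<^sub>R E x 0"
      "\<And>i j k l. frame_array E' (Cw x) i j k l = s i * s j * s k * s l * frame_array (E x) (Cw x) i j k l" "\<And>i::4. s i \<noteq> (0::real)"
      by (rule rescaled_frame[OF xS E(1)[OF xS] kc]) blast
    have o: "order_le (frame_array E' (Cw x)) (-1)" by (rule rescaled_order_le[OF E'(3) E(2)[OF xS]])
    show ?thesis by (intro exI[of _ E'] conjI E'(1) o) (use E(3)[OF xS] in \<open>auto simp: E'(2-4) c(2)\<close>)
  qed
  define n where "n = (\<lambda>x. \<Sum>i\<in>UNIV. \<Sum>j\<in>UNIV. h x $ i $ j * (muC z w x i * muC z w x j))"
  have smu: "smooth_on V (\<lambda>x. muC z w x d)" for d by (rule V.smooth_muC[OF sw zw])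
  have sn: "smooth_on V n" unfolding n_def[abs_def] by (intro smooth_on_sum smooth_on_mult oV V.smooth_h smu)
  have np: "n x > 0" if x: "x \<in> V" for x
  proof -
    obtain E' where E': "null_frame (g x) E'" "E' 0 = w x" "order_le (frame_array E' (Cw x)) (-1)"
      "frame_array E' (Cw x) 0 1 1 2 \<noteq> 0 \<or> frame_array E' (Cw x) 0 1 1 3 \<noteq> 0" using frame[OF x, of 1] by auto
    define M where "M b = (\<Sum>i\<in>UNIV. b $ i * muC z w x i)" for b
    note c = V.type_III_contraction[where l=w and x=x and E=E' and z=z, OF x E'(1,2,3) zw[OF x], folded M_def]
    have "n x = (\<Sum>a\<in>UNIV. 1 * M (E' a) * M (E' (st01 a)))"
      unfolding n_def M_def by (rule pairing_frame_sum[OF V.null_pairing[OF x E'(1)]])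
    then have "n x = frame_array E' (Cw x) 0 1 1 2 * frame_array E' (Cw x) 0 1 1 2 + frame_array E' (Cw x) 0 1 1 3 * frame_array E' (Cw x) 0 1 1 3"
      unfolding sum_4' by (simp add: st01_def E'(2) c(2-4))
    then show ?thesis using E'(4) by (simp add: sum_squares_gt_zero_iff)
  qed
  \<comment> \<open>mu scales inversely to l, so the factor sqrt(n) gives mu unit length.\<close>
  define l where "l = (\<lambda>x. sqrt (n x) *\<^sub>R w x)"
  have sq0: "sqrt (n x) \<noteq> 0" if "x \<in> V" for x using np[OF that] by simp
  have sl: "smooth_on V (\<lambda>x. l x $ i)" for i
    unfolding l_def vector_scaleR_component real_scaleR_def by (intro smooth_on_mult oV smooth_on_sqrt sn np) (simp_all add: sw)
  have "\<exists>E'. null_frame (g x) E' \<and> E' 0 = l x \<and> order_le (frame_array E' (Cw x)) (-1) \<and> (frame_array E' (Cw x) 0 1 1 2 \<noteq> 0 \<or> frame_array E' (Cw x) 0 1 1 3 \<noteq> 0)"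
    if "x \<in> V" for x unfolding l_def by (rule frame[OF that sq0[OF that]])
  then obtain E' where E': "\<And>x. x \<in> V \<Longrightarrow> null_frame (g x) (E' x)" "\<And>x. x \<in> V \<Longrightarrow> E' x 0 = l x" "\<And>x. x \<in> V \<Longrightarrow> order_le (frame_array (E' x) (Cw x)) (-1)"
    "\<And>x. x \<in> V \<Longrightarrow> frame_array (E' x) (Cw x) 0 1 1 2 \<noteq> 0 \<or> frame_array (E' x) (Cw x) 0 1 1 3 \<noteq> 0" by metis
  have "kundt_vector g l x" if x: "x \<in> V" for x
  proof (rule V.type_III_kundt[where E=E' and z=z, OF sl E' _ _ x])
    show "ip (g y) z (l y) \<noteq> 0" if "y \<in> V" for y unfolding l_def ipc using zw[OF that] sq0[OF that] by simp
    show "(\<Sum>i\<in>UNIV. \<Sum>j\<in>UNIV. h y $ i $ j * (muC z l y i * muC z l y j)) = 1" if y: "y \<in> V" for y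
    proof -
      have m: "muC z l y i = inverse (sqrt (n y)) * muC z w y i" for i
      proof -
        have "tev [q *\<^sub>R w y, z, z, b] (Cw y) = q * tev [w y, z, z, b] (Cw y)" for q b by (simp add: sum_distrib_left mult_ac)
        then show ?thesis unfolding muC_def l_def ipc using sq0[OF y] by (simp add: field_simps power2_eq_square del: tev.simps)
      qed
      have pull: "(\<Sum>i\<in>UNIV. \<Sum>j\<in>UNIV. h y $ i $ j * (q * X i * (q * X j))) = (q * q) * (\<Sum>i\<in>UNIV. \<Sum>j\<in>UNIV. h y $ i $ j * (X i * X j))" for q and X :: "4 \<Rightarrow> real"
        by (simp add: sum_distrib_left mult_ac)
      have "(\<Sum>i\<in>UNIV. \<Sum>j\<in>UNIV. h y $ i $ j * (muC z l y i * muC z l y j)) = (inverse (sqrt (n y)) * inverse (sqrt (n y))) * n y"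
        unfolding m pull n_def ..
      also have "\<dots> = 1" using np[OF y] by (simp add: field_simps)
      finally show ?thesis .
    qed
  qed
  from that[OF oV pV VS sl this] show ?thesis .
qed

text \<open>With vanishing Weyl tensor an Einstein metric has constant curvature K = lam /
  3.\<close>

lemma type_O_local:
  assumes pS: "pt \<in> S" and O: "\<And>x. x \<in> S \<Longrightarrow> petrov_type (g x) (Cw x) = Petrov_O" and e: "null_frame (g pt) e"
  obtains V l where "open V" "pt \<in> V" "V \<subseteq> S" "\<And>i. smooth_on V (\<lambda>x. l x $ i)" "\<And>x. x \<in> V \<Longrightarrow> kundt_vector g l x"
proof (rule constant_curvature_kundt[OF pS e])
  fix x a b c d assume x: "x \<in> S"
  have r: "riemann g x [e,b,c,d] = lam / 3 * (g x $ e $ c * g x $ b $ d - g x $ e $ d * g x $ b $ c)" for e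
    using weyl_einstein[OF ric[OF x] x, of e b c d] petrov_O[OF O[OF x], of "[e,b,c,d]"] by (simp add: gg4)
  have "riemann g x [e,b,c,d] = (\<Sum>k\<in>UNIV. g x $ e $ k * riemann_up g x k b c d)" for e
    unfolding riemann_def by (simp add: numeral_2_eq_2 numeral_3_eq_3)
  then have "riemann_up g x a b c d = (\<Sum>e\<in>UNIV. h x $ a $ e * riemann g x [e,b,c,d])"
    using raise_lower[OF x, of a "\<lambda>k. riemann_up g x k b c d"] by simp
  also have "\<dots> = lam / 3 * ((\<Sum>e\<in>UNIV. h x $ a $ e * g x $ e $ c) * g x $ b $ d - (\<Sum>e\<in>UNIV. h x $ a $ e * g x $ e $ d) * g x $ b $ c)"
    unfolding r by (simp add: sum_distrib_left sum_distrib_right sum_subtractf algebra_simps)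
  finally show "riemann_up g x a b c d = lam / 3 * ((if a = c then g x $ b $ d else 0) - (if a = d then g x $ b $ c else 0))"
    unfolding hg[OF x] by simp
qed (rule that)

end

theorem proposition6p4:
  fixes A :: "'m::{t2_space, second_countable_topology} chart set"
    and g :: "'m chart \<Rightarrow> real^4 \<Rightarrow> real^4^4"
    and lam :: real
  assumes "smooth_atlas A"
    and "lorentzian_metric A g"
    and "constant_algebraic_types A g"
    and "einstein A g lam"
    and "VSI_W 2 A g"
  shows "kundt A g"
  unfolding kundt_def
proof
  fix p
  obtain c where c: "c \<in> A" "p \<in> fst c" using assms(1) unfolding smooth_atlas_def by blast
  define S where "S = snd c ` fst c"
  define x0 where "x0 = snd c p"
  have x0: "x0 \<in> S" using c unfolding S_def x0_def by auto
  interpret einstein_vsi S "g c" lam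
  proof
    show "open S" using assms(1) c(1) unfolding smooth_atlas_def is_chart_def S_def by blast
    show "smooth_on S (\<lambda>x. g c x $ i $ j)" for i j using assms(2) c(1) unfolding lorentzian_metric_def S_def by blast
    show "lorentz_form (g c x)" if "x \<in> S" for x using assms(2) c(1) that unfolding lorentzian_metric_def S_def by blast
    show "ricci (g c) x $ a $ b = lam * g c x $ a $ b" if "x \<in> S" for x a b using assms(4) c(1) that unfolding einstein_def S_def by blast
    show "f x = 0" if "f \<in> polynomial_invariants (g c) (weyl (g c)) 4 2" "x \<in> S" for f x
      using assms(5) c(1) that unfolding VSI_W_def S_def by blast
  qed
  obtain e where e: "null_frame (g c x0) e" "order_le (frame_array e (Cw x0)) (-1)"
    by (rule null_frame_of_vanishing_traces[where g="g c" and T=Cw and m=2 and S=S and x=x0, OF _ x0 lorentz[OF x0] wsC[OF x0]], erule (1) inv, rule that)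
  \<comment> \<open>The local lemmas require the Petrov type at every point of the chart domain, not
    only at \<open>x0\<close>.\<close>
  have const: "petrov_type (g c x) (Cw x) = petrov_type (g c x0) (Cw x0)" if "x \<in> S" for x
    using assms(3) c(1) that x0 unfolding constant_algebraic_types_def S_def by blast
  have "petrov_type (g c x0) (Cw x0) \<in> {Petrov_O, Petrov_N, Petrov_III}"
    by (rule petrov_type_cases[OF lorentz[OF x0] wsC[OF x0] e])
  then have "\<exists>V l. open V \<and> x0 \<in> V \<and> V \<subseteq> S \<and> (\<forall>i. smooth_on V (\<lambda>x. l x $ i)) \<and> (\<forall>x\<in>V. kundt_vector (g c) l x)"
  proof (elim insertE)
    assume "petrov_type (g c x0) (Cw x0) = Petrov_O"
    then show ?thesis using type_O_local[OF x0 _ e(1)] const by metis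
  next
    assume "petrov_type (g c x0) (Cw x0) = Petrov_N"
    then show ?thesis using type_N_local[OF x0] const by metis
  next
    assume "petrov_type (g c x0) (Cw x0) = Petrov_III"
    then show ?thesis using type_III_local[OF x0] const by metis
  qed simp
  then show "\<exists>c\<in>A. \<exists>V l. p \<in> fst c \<and> open V \<and> snd c p \<in> V \<and> V \<subseteq> snd c ` fst c \<and>
     (\<forall>i. smooth_on V (\<lambda>x. l x $ i)) \<and> (\<forall>x\<in>V. kundt_vector (g c) l x)"
    using c unfolding x0_def S_def by blast
qed

end
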